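(* Let $A$, $\psi$, $y_0$ and the time steps $\tau_j$ satisfy assumptions (A) and (B) listed in the context. For $u_\tau\in U_\tau$ let $y_\tau=S_\tau(u_\tau)\in Y_\tau$ be the solution of the time discrete state equation $$\tfrac{\varepsilon}{\tau_j}(y_j,\varphi)+\varepsilon(A'(\nabla y_j),\nabla\varphi)+\tfrac1\varepsilon(\psi'(y_j),\varphi)=(u_j,\varphi)+\tfrac{\varepsilon}{\tau_j}(y_{j-1},\varphi)\qquad\forall\varphi\in H^1(\Omega),\ j=1,\dots,N,$$ started from the given $y_0$, and let $$j_\tau(u_\tau):=\tfrac12\|y_N-y_\Omega\|_{L^2(\Omega)}^2+\tfrac{\lambda}{2\varepsilon}\sum_{j=1}^N\tau_j\|u_j\|_{L^2(\Omega)}^2 .$$ Then the reduced cost functional $j_\tau:U_\tau\to\mathbb{R}$ is Fréchet differentiable and its derivative can be represented (as gradient with respect to the $L^2(Q)$ inner product) as $$\nabla j_\tau(u_\tau)=\tfrac1\varepsilon(\lambda u_\tau+p_\tau),$$ where $p_\tau$, given by its values $p_1,\dots,p_N\in H^1(\Omega)$ on the time intervals, is the solution of the discrete adjoint equation $$(\varepsilon A''(\nabla y_j)\nabla\varphi,\nabla p_j)+\big(\tfrac1\varepsilon\psi''(y_j)\varphi+\tfrac{\varepsilon}{\tau_j}\varphi,p_j\big)=\tfrac{\varepsilon}{\tau_j}(\varphi,p_{j+1})\qquad\forall\varphi\in H^1(\Omega),\ j=N,\dots,1,$$ starting with $p_{N+1}:=y_N-y_\Omega$.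
   Context: $\Omega\subset\mathbb{R}^d$ is a bounded Lipschitz domain, $T>0$, $Q=[0,T]\times\Omega$, $\varepsilon>0$, $\lambda>0$, $y_\Omega\in L^2(\Omega)$, and $(\cdot,\cdot)$ is the $L^2(\Omega)$ inner product. Let $0=t_0<t_1<\dots<t_N=T$, $\tau_j:=t_j-t_{j-1}$, $I_j:=(t_{j-1},t_j]$. $Y_\tau$ (resp. $U_\tau$) is the space of functions $Q\to\mathbb{R}$ that are constant in time on each $I_j$ with values in $H^1(\Omega)$ (resp. $L^2(\Omega)$); the constant value on $I_j$ is denoted by a subscript, e.g. $y_j:=y_\tau|_{I_j}$. $U_\tau$ is normed as a subspace of $L^2(Q)$, so $(u_\tau,v_\tau)_{L^2(Q)}=\sum_j\tau_j(u_j,v_j)$. The adjoint $p_\tau$ is piecewise constant in time with value $p_j$ on $[t_{j-1},t_j)$; as an element of $L^2(Q)$ it is identified with the function having value $p_j$ on $I_j$. Assumptions (A): (i) $A\in C^1(\mathbb{R}^d)$, its gradient $A'$ is strongly monotone, i.e. $(A'(p)-A'(q))\cdot(p-q)\ge C_A|p-q|^2$ for some $C_A>0$ and all $p,q\in\mathbb{R}^d$, and $|A'(p)|\le C|p|$ for all $p$. (ii) $\psi\in C^1(\mathbb{R})$ is bounded from below and can be approximated by functions $f_n\in C^2(\mathbb{R})$ with $f_n\to\psi$ in $C^1_{\rm loc}$, $-c\le f_n\le c(\psi+1)$, $f_n''\ge -C_\psi$ and $|f_n''|\le C_n$, where $c,C_\psi,C_n\ge0$ are constants. (iii) $y_0\in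 H^1(\Omega)$ with $\psi(y_0)\in L^1(\Omega)$ is given. (iv) $\max_j\tau_j<\varepsilon^2/C_\psi$ (no restriction if $C_\psi=0$). Assumptions (B): in addition $A\in C^2(\mathbb{R}^d)$ with bounded Hessian $A''$, and $\psi\in C^2(\mathbb{R})$ is such that the Nemytskii (superposition) operator $y\mapsto\psi''(y)$ is continuous from $H^1(\Omega)$ to $L^q(\Omega)$ for some $q>\max\{d/2,1\}$. It is known that under (A) the time discrete state equation has a unique solution $y_\tau\in Y_\tau$ for each $u_\tau\in U_\tau$. *)

theory Defs
  imports "HOL-Analysis.Analysis"
begin

subsection \<open>Lipschitz domains\<close>

text \<open>
  Near every boundary point, \<open>\<Omega>\<close> is the strict epigraph, in some unit direction \<open>e\<close>, of a Lipschitz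
  function \<open>\<gamma>\<close> on the hyperplane orthogonal to \<open>e\<close>.
\<close>

definition lipschitz_domain :: "'a::euclidean_space set \<Rightarrow> bool" where
  "lipschitz_domain \<Omega> \<longleftrightarrow> open \<Omega> \<and> connected \<Omega> \<and> \<Omega> \<noteq> {} \<and>
     (\<forall>z\<in>frontier \<Omega>. \<exists>e \<gamma> L V. norm e = 1 \<and> open V \<and> z \<in> V \<and>
        L-lipschitz_on {x. x \<bullet> e = 0} \<gamma> \<and>
        \<Omega> \<inter> V = {x \<in> V. \<gamma> (x - (x \<bullet> e) *\<^sub>R e) < x \<bullet> e})"


subsection \<open>Lebesgue and Sobolev spaces\<close>

text \<open>
  Elements of the function spaces are represented by functions on the whole type; only their values
  on \<open>\<Omega>\<close>, up to null sets, matter. The norms are therefore seminorms on representatives.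
\<close>

definition L2 :: "'a::euclidean_space set \<Rightarrow> ('a \<Rightarrow> 'b::euclidean_space) set" where
  "L2 \<Omega> = {f \<in> borel_measurable (lebesgue_on \<Omega>). integrable (lebesgue_on \<Omega>) (\<lambda>x. (norm (f x))\<^sup>2)}"

definition inner_L2 ::
  "'a::euclidean_space set \<Rightarrow> ('a \<Rightarrow> 'b::euclidean_space) \<Rightarrow> ('a \<Rightarrow> 'b) \<Rightarrow> real" where
  "inner_L2 \<Omega> f g = (\<integral>x. f x \<bullet> g x \<partial>lebesgue_on \<Omega>)"

definition norm_L2 :: "'a::euclidean_space set \<Rightarrow> ('a \<Rightarrow> 'b::euclidean_space) \<Rightarrow> real" where
  "norm_L2 \<Omega> f = sqrt (inner_L2 \<Omega> f f)"

definition Lq :: "real \<Rightarrow> 'a::euclidean_space set \<Rightarrow> ('a \<Rightarrow> real) set" where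
  "Lq q \<Omega> = {f \<in> borel_measurable (lebesgue_on \<Omega>). integrable (lebesgue_on \<Omega>) (\<lambda>x. \<bar>f x\<bar> powr q)}"

definition norm_Lq :: "real \<Rightarrow> 'a::euclidean_space set \<Rightarrow> ('a \<Rightarrow> real) \<Rightarrow> real" where
  "norm_Lq q \<Omega> f = (\<integral>x. \<bar>f x\<bar> powr q \<partial>lebesgue_on \<Omega>) powr (1 / q)"

primrec C_k :: "nat \<Rightarrow> ('a::euclidean_space \<Rightarrow> real) \<Rightarrow> bool" where
  "C_k 0 f \<longleftrightarrow> continuous_on UNIV f"
| "C_k (Suc k) f \<longleftrightarrow> f differentiable_on UNIV \<and>
     (\<forall>i\<in>Basis. C_k k (\<lambda>x. frechet_derivative f (at x) i))"

definition test_functions :: "'a::euclidean_space set \<Rightarrow> ('a \<Rightarrow> real) set" where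
  "test_functions \<Omega> = {\<phi>. (\<forall>k. C_k k \<phi>) \<and> compact (closure {x. \<phi> x \<noteq> 0}) \<and>
     closure {x. \<phi> x \<noteq> 0} \<subseteq> \<Omega>}"

definition weak_gradient :: "'a::euclidean_space set \<Rightarrow> ('a \<Rightarrow> real) \<Rightarrow> ('a \<Rightarrow> 'a) \<Rightarrow> bool" where
  "weak_gradient \<Omega> y g \<longleftrightarrow> g \<in> L2 \<Omega> \<and>
     (\<forall>\<phi>\<in>test_functions \<Omega>. \<forall>i\<in>Basis.
        (\<integral>x. y x * frechet_derivative \<phi> (at x) i \<partial>lebesgue_on \<Omega>) =
        - (\<integral>x. (g x \<bullet> i) * \<phi> x \<partial>lebesgue_on \<Omega>))"

definition H1 :: "'a::euclidean_space set \<Rightarrow> ('a \<Rightarrow> real) set" where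
  "H1 \<Omega> = {y \<in> L2 \<Omega>. \<exists>g. weak_gradient \<Omega> y g}"

text \<open>Only meaningful for \<open>y \<in> H1 \<Omega>\<close>; the choice is unique up to null sets.\<close>

definition wgrad :: "'a::euclidean_space set \<Rightarrow> ('a \<Rightarrow> real) \<Rightarrow> 'a \<Rightarrow> 'a" where
  "wgrad \<Omega> y = (SOME g. weak_gradient \<Omega> y g)"

definition norm_H1 :: "'a::euclidean_space set \<Rightarrow> ('a \<Rightarrow> real) \<Rightarrow> real" where
  "norm_H1 \<Omega> y = sqrt ((norm_L2 \<Omega> y)\<^sup>2 + (norm_L2 \<Omega> (wgrad \<Omega> y))\<^sup>2)"

definition nemytskii_H1_Lq_continuous ::
  "'a::euclidean_space set \<Rightarrow> real \<Rightarrow> (real \<Rightarrow> real) \<Rightarrow> bool" where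
  "nemytskii_H1_Lq_continuous \<Omega> q h \<longleftrightarrow>
     (\<forall>y\<in>H1 \<Omega>. (\<lambda>x. h (y x)) \<in> Lq q \<Omega>) \<and>
     (\<forall>y\<in>H1 \<Omega>. \<forall>e>0. \<exists>\<delta>>0. \<forall>z\<in>H1 \<Omega>.
        norm_H1 \<Omega> (\<lambda>x. z x - y x) < \<delta> \<longrightarrow> norm_Lq q \<Omega> (\<lambda>x. h (z x) - h (y x)) < e)"


subsection \<open>Assumptions on the nonlinearities\<close>

definition is_C1_with :: "(real \<Rightarrow> real) \<Rightarrow> (real \<Rightarrow> real) \<Rightarrow> bool" where
  "is_C1_with f f' \<longleftrightarrow> (\<forall>x. (f has_real_derivative f' x) (at x)) \<and> continuous_on UNIV f'"

definition assumption_A_grad ::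
  "('a::euclidean_space \<Rightarrow> real) \<Rightarrow> ('a \<Rightarrow> 'a) \<Rightarrow> bool" where
  "assumption_A_grad A A' \<longleftrightarrow>
     (\<forall>p. GDERIV A p :> A' p) \<and> continuous_on UNIV A' \<and>
     (\<exists>C\<^sub>A>0. \<forall>p q. (A' p - A' q) \<bullet> (p - q) \<ge> C\<^sub>A * (norm (p - q))\<^sup>2) \<and>
     (\<exists>C. \<forall>p. norm (A' p) \<le> C * norm p)"

text \<open>The parameter \<open>C\<^sub>\<psi>\<close> is the semiconvexity constant entering the time step restriction.\<close>

definition assumption_A_psi :: "(real \<Rightarrow> real) \<Rightarrow> (real \<Rightarrow> real) \<Rightarrow> real \<Rightarrow> bool" where
  "assumption_A_psi \<psi> \<psi>' C\<^sub>\<psi> \<longleftrightarrow>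
     is_C1_with \<psi> \<psi>' \<and> (\<exists>m. \<forall>x. m \<le> \<psi> x) \<and> C\<^sub>\<psi> \<ge> 0 \<and>
     (\<exists>(f :: nat \<Rightarrow> real \<Rightarrow> real) f' f'' c C.
        c \<ge> 0 \<and>
        (\<forall>n. is_C1_with (f n) (f' n) \<and> is_C1_with (f' n) (f'' n)) \<and>
        (\<forall>K. compact K \<longrightarrow> uniform_limit K f \<psi> sequentially \<and> uniform_limit K f' \<psi>' sequentially) \<and>
        (\<forall>n x. - c \<le> f n x \<and> f n x \<le> c * (\<psi> x + 1)) \<and>
        (\<forall>n x. f'' n x \<ge> - C\<^sub>\<psi>) \<and>
        (\<forall>n. C n \<ge> 0 \<and> (\<forall>x. \<bar>f'' n x\<bar> \<le> C n)))"

definition assumption_B_hessian ::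
  "('a::euclidean_space \<Rightarrow> 'a) \<Rightarrow> ('a \<Rightarrow> 'a \<Rightarrow>\<^sub>L 'a) \<Rightarrow> bool" where
  "assumption_B_hessian A' A'' \<longleftrightarrow>
     (\<forall>p. (A' has_derivative blinfun_apply (A'' p)) (at p)) \<and> continuous_on UNIV A'' \<and>
     bounded (range A'')"

definition assumption_B_psi ::
  "'a::euclidean_space set \<Rightarrow> (real \<Rightarrow> real) \<Rightarrow> (real \<Rightarrow> real) \<Rightarrow> bool" where
  "assumption_B_psi \<Omega> \<psi>' \<psi>'' \<longleftrightarrow>
     is_C1_with \<psi>' \<psi>'' \<and>
     (\<exists>q. q > max (real DIM('a) / 2) 1 \<and> nemytskii_H1_Lq_continuous \<Omega> q \<psi>'')"


subsection \<open>Time discretization\<close>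

definition time_grid :: "nat \<Rightarrow> real \<Rightarrow> (nat \<Rightarrow> real) \<Rightarrow> bool" where
  "time_grid N T t \<longleftrightarrow> t 0 = 0 \<and> t N = T \<and> (\<forall>j\<in>{1..N}. t (j - 1) < t j)"

definition tau :: "(nat \<Rightarrow> real) \<Rightarrow> nat \<Rightarrow> real" where
  "tau t j = t j - t (j - 1)"

text \<open>The constant value on \<open>(t\<^sub>j\<^sub>-\<^sub>1, t\<^sub>j]\<close> of a function on \<open>[0,T] \<times> \<Omega>\<close>, read off at the right end point.\<close>

definition val :: "(nat \<Rightarrow> real) \<Rightarrow> (real \<times> 'a \<Rightarrow> real) \<Rightarrow> nat \<Rightarrow> 'a \<Rightarrow> real" where
  "val t u j = (\<lambda>x. u (t j, x))"

text \<open>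
  For \<open>X = H1 \<Omega>\<close> this is the space \<open>Y\<^sub>\<tau>\<close>, for \<open>X = L2 \<Omega>\<close> the space \<open>U\<^sub>\<tau>\<close>. No condition is imposed on
  the null set \<open>{0} \<times> \<Omega>\<close>, which lies in no interval \<open>(t\<^sub>j\<^sub>-\<^sub>1, t\<^sub>j]\<close>.
\<close>

definition pw_const ::
  "nat \<Rightarrow> (nat \<Rightarrow> real) \<Rightarrow> 'a set \<Rightarrow> ('a \<Rightarrow> real) set \<Rightarrow> (real \<times> 'a \<Rightarrow> real) set" where
  "pw_const N t \<Omega> X =
     {u. \<forall>j\<in>{1..N}. val t u j \<in> X \<and> (\<forall>s\<in>{t (j - 1)<..t j}. \<forall>x\<in>\<Omega>. u (s, x) = val t u j x)}"

text \<open>The function on \<open>[0,T] \<times> \<Omega>\<close> with value \<open>p j\<close> on \<open>(t\<^sub>j\<^sub>-\<^sub>1, t\<^sub>j]\<close>.\<close>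

definition pw_const_of ::
  "nat \<Rightarrow> (nat \<Rightarrow> real) \<Rightarrow> (nat \<Rightarrow> 'a \<Rightarrow> real) \<Rightarrow> real \<times> 'a \<Rightarrow> real" where
  "pw_const_of N t p = (\<lambda>(s, x). \<Sum>j=1..N. indicator {t (j - 1)<..t j} s * p j x)"

text \<open>
  The integrability requirements in the next two definitions say that the pairings
  \<open>(\<psi>'(y\<^sub>j), \<phi>)\<close> and \<open>(\<psi>''(y\<^sub>j) \<phi>, p\<^sub>j)\<close> are meaningful; the Bochner integral of a non-integrable function
  would silently be \<open>0\<close>. All other pairings are between elements of \<open>L\<^sup>2\<close>.
\<close>

definition state_solution ::
  "'a::euclidean_space set \<Rightarrow> nat \<Rightarrow> (nat \<Rightarrow> real) \<Rightarrow> real \<Rightarrow> ('a \<Rightarrow> 'a) \<Rightarrow> (real \<Rightarrow> real) \<Rightarrow>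
   ('a \<Rightarrow> real) \<Rightarrow> (real \<times> 'a \<Rightarrow> real) \<Rightarrow> (real \<times> 'a \<Rightarrow> real) \<Rightarrow> bool" where
  "state_solution \<Omega> N t \<epsilon> A' \<psi>' y\<^sub>0 u y \<longleftrightarrow>
     y \<in> pw_const N t \<Omega> (H1 \<Omega>) \<and>
     (\<forall>j\<in>{1..N}. \<forall>\<phi>\<in>H1 \<Omega>.
        integrable (lebesgue_on \<Omega>) (\<lambda>x. \<psi>' (val t y j x) * \<phi> x) \<and>
        \<epsilon> / tau t j * inner_L2 \<Omega> (val t y j) \<phi>
          + \<epsilon> * inner_L2 \<Omega> (\<lambda>x. A' (wgrad \<Omega> (val t y j) x)) (wgrad \<Omega> \<phi>)
          + 1 / \<epsilon> * inner_L2 \<Omega> (\<lambda>x. \<psi>' (val t y j x)) \<phi>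
        = inner_L2 \<Omega> (val t u j) \<phi>
          + \<epsilon> / tau t j * inner_L2 \<Omega> (if j = 1 then y\<^sub>0 else val t y (j - 1)) \<phi>)"

definition adjoint_solution ::
  "'a::euclidean_space set \<Rightarrow> nat \<Rightarrow> (nat \<Rightarrow> real) \<Rightarrow> real \<Rightarrow> ('a \<Rightarrow> 'a \<Rightarrow>\<^sub>L 'a) \<Rightarrow> (real \<Rightarrow> real) \<Rightarrow>
   ('a \<Rightarrow> real) \<Rightarrow> (real \<times> 'a \<Rightarrow> real) \<Rightarrow> (nat \<Rightarrow> 'a \<Rightarrow> real) \<Rightarrow> bool" where
  "adjoint_solution \<Omega> N t \<epsilon> A'' \<psi>'' y\<^sub>\<Omega> y p \<longleftrightarrow>
     p (N + 1) = (\<lambda>x. val t y N x - y\<^sub>\<Omega> x) \<and>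
     (\<forall>j\<in>{1..N}. p j \<in> H1 \<Omega> \<and>
       (\<forall>\<phi>\<in>H1 \<Omega>.
          integrable (lebesgue_on \<Omega>) (\<lambda>x. \<psi>'' (val t y j x) * \<phi> x * p j x) \<and>
          inner_L2 \<Omega> (\<lambda>x. \<epsilon> *\<^sub>R blinfun_apply (A'' (wgrad \<Omega> (val t y j) x)) (wgrad \<Omega> \<phi> x))
              (wgrad \<Omega> (p j))
            + inner_L2 \<Omega> (\<lambda>x. 1 / \<epsilon> * \<psi>'' (val t y j x) * \<phi> x + \<epsilon> / tau t j * \<phi> x) (p j)
          = \<epsilon> / tau t j * inner_L2 \<Omega> \<phi> (p (j + 1))))"


subsection \<open>The reduced cost functional and Frechet differentiability\<close>

definition reduced_cost ::
  "'a::euclidean_space set \<Rightarrow> nat \<Rightarrow> (nat \<Rightarrow> real) \<Rightarrow> real \<Rightarrow> real \<Rightarrow> ('a \<Rightarrow> real) \<Rightarrow>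
   ((real \<times> 'a \<Rightarrow> real) \<Rightarrow> (real \<times> 'a \<Rightarrow> real)) \<Rightarrow> (real \<times> 'a \<Rightarrow> real) \<Rightarrow> real" where
  "reduced_cost \<Omega> N t \<epsilon> lam y\<^sub>\<Omega> S u =
     1 / 2 * (norm_L2 \<Omega> (\<lambda>x. val t (S u) N x - y\<^sub>\<Omega> x))\<^sup>2
     + lam / (2 * \<epsilon>) * (\<Sum>j=1..N. tau t j * (norm_L2 \<Omega> (val t u j))\<^sup>2)"

text \<open>
  \<open>D\<close> is the Frechet derivative at \<open>u\<close> of \<open>J : V \<rightarrow> \<real>\<close>, where \<open>V\<close> is a linear subspace of \<open>L\<^sup>2(Q)\<close> with
  the \<open>L\<^sup>2(Q)\<close> norm. Spelled out because \<open>has_derivative\<close> requires a normed space type.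
\<close>

definition has_L2_frechet_derivative ::
  "'q::euclidean_space set \<Rightarrow> ('q \<Rightarrow> real) set \<Rightarrow> (('q \<Rightarrow> real) \<Rightarrow> real) \<Rightarrow>
   (('q \<Rightarrow> real) \<Rightarrow> real) \<Rightarrow> ('q \<Rightarrow> real) \<Rightarrow> bool" where
  "has_L2_frechet_derivative Q V J D u \<longleftrightarrow>
     (\<forall>v\<in>V. \<forall>w\<in>V. D (\<lambda>z. v z + w z) = D v + D w) \<and>
     (\<forall>c. \<forall>v\<in>V. D (\<lambda>z. c * v z) = c * D v) \<and>
     (\<exists>K. \<forall>v\<in>V. \<bar>D v\<bar> \<le> K * norm_L2 Q v) \<and>
     (\<forall>e>0. \<exists>\<delta>>0. \<forall>v\<in>V. norm_L2 Q v < \<delta> \<longrightarrow>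
        \<bar>J (\<lambda>z. u z + v z) - J u - D v\<bar> \<le> e * norm_L2 Q v)"

definition has_L2_gradient ::
  "'q::euclidean_space set \<Rightarrow> ('q \<Rightarrow> real) set \<Rightarrow> (('q \<Rightarrow> real) \<Rightarrow> real) \<Rightarrow>
   ('q \<Rightarrow> real) \<Rightarrow> ('q \<Rightarrow> real) \<Rightarrow> bool" where
  "has_L2_gradient Q V J g u \<longleftrightarrow>
     g \<in> V \<and> has_L2_frechet_derivative Q V J (\<lambda>v. inner_L2 Q g v) u"

end

theory Submission
  imports Defs "HOL-Computational_Algebra.Polynomial"
begin

text \<open>
  Testing the linearisation of the state equation with the adjoint state gives, after summation over
  the time steps, \<open>\<epsilon> (\<delta>\<^sub>N, y\<^sub>N - y\<^sub>\<Omega>) = \<Sum>\<^sub>j \<tau>\<^sub>j (v\<^sub>j, p\<^sub>j)\<close> up to remainders, where \<open>\<delta> = S(u + v) - S(u)\<close>. By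
  semiconvexity of \<open>\<psi>\<close> and the time step restriction, \<open>S\<close> is Lipschitz from \<open>L\<^sup>2\<close> to \<open>H\<^sup>1\<close>, so it suffices that
  the remainders, tested with the fixed \<open>p\<^sub>j\<close>, are \<open>o(\<delta>)\<close> in \<open>H\<^sup>1\<close>. No differentiability of \<open>S\<close> is needed.

  The terms with \<open>\<psi>''\<close> require that \<open>L\<^sup>q\<close>, \<open>q > max (d/2) 1\<close>, multiplies \<open>H\<^sup>1\<close> into its dual. This replaces
  the Sobolev embedding and is shown directly: on a cone patch, \<open>f\<close> is the sum of differences of
  averages of \<open>f\<close> over dyadic cones; the difference at scale \<open>1/c\<close> is bounded by \<open>c\<^sup>-\<^sup>1\<close> times a local mean
  of the gradient, and splitting the weight at the height \<open>c\<^sup>d\<^sup>/\<^sup>q\<close> makes the series summable.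
\<close>

subsection \<open>Square integrable functions\<close>

text \<open>The remainder of \<open>A'\<close> is controlled only weakly: \<open>A'\<close> is
  merely \<open>C1\<close> with bounded derivative, and smallness in \<open>H1\<close> does not make
  the gradient increments uniformly small. It must be tested with an element fixed before the
  perturbation, and the adjoint state, which depends on \<open>u\<close> alone, is such an element.
  Balls around points near the boundary leave \<Omega>, and extension by zero destroys weak
  differentiability. A cone with its vertex at the point stays inside \<Omega> at every small scale,
  and the derivative of its scaled kernel in the scale is the divergence of a field with compact
  support in \<Omega>; so the weak gradient appears without a boundary term. The threshold
  \<open>q > d/2\<close> comes from counting powers: the squared difference of averages costs
  \<open>c^(d-2)\<close> times a local energy, weighting and integrating turn this into
  \<open>c^(d/q-2)\<close>, and the sum over \<open>c = c0 * 2^k\<close> is geometric. Since the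
  Hessian of \<open>A\<close> is symmetric, each adjoint step is a symmetric coercive problem and is
  solved by minimising a quadratic functional. Spaces are sets of representatives with seminorms, so
  identities between gradients hold almost everywhere only.\<close>

lemma L2I:
  "f \<in> borel_measurable (lebesgue_on \<Omega>) \<Longrightarrow> integrable (lebesgue_on \<Omega>) (\<lambda>x. (norm (f x))\<^sup>2) \<Longrightarrow> f \<in> L2 \<Omega>"
  by (simp add: L2_def)

lemma L2_measurable: "f \<in> L2 \<Omega> \<Longrightarrow> f \<in> borel_measurable (lebesgue_on \<Omega>)"
  by (simp add: L2_def)

lemma L2_integrable_sq: "f \<in> L2 \<Omega> \<Longrightarrow> integrable (lebesgue_on \<Omega>) (\<lambda>x. (norm (f x))\<^sup>2)"
  by (simp add: L2_def)

lemma L2_bound: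
  assumes "f \<in> L2 \<Omega>" "g \<in> borel_measurable (lebesgue_on \<Omega>)"
    and "AE x in lebesgue_on \<Omega>. norm (g x) \<le> K * norm (f x)"
  shows "g \<in> L2 \<Omega>"
proof (rule L2I)
  have "AE x in lebesgue_on \<Omega>. norm ((norm (g x))\<^sup>2) \<le> norm (K\<^sup>2 * (norm (f x))\<^sup>2)"
    using assms(3)
  proof eventually_elim
    case (elim x)
    then have "(norm (g x))\<^sup>2 \<le> (K * norm (f x))\<^sup>2" by (intro power_mono) auto
    then show ?case by (simp add: power_mult_distrib)
  qed
  then show "integrable (lebesgue_on \<Omega>) (\<lambda>x. (norm (g x))\<^sup>2)"
    using assms by (intro Bochner_Integration.integrable_bound
        [OF integrable_mult_right[OF L2_integrable_sq[OF assms(1)], of "K\<^sup>2"]]) auto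
qed (use assms in auto)

lemma L2_norm_mult_integrable:
  assumes "f \<in> L2 \<Omega>" "g \<in> L2 \<Omega>"
  shows "integrable (lebesgue_on \<Omega>) (\<lambda>x. norm (f x) * norm (g x))"
proof (rule Bochner_Integration.integrable_bound)
  show "integrable (lebesgue_on \<Omega>) (\<lambda>x. (norm (f x))\<^sup>2 + (norm (g x))\<^sup>2)"
    using assms by (simp add: L2_integrable_sq)
  have "norm (norm (f x) * norm (g x)) \<le> norm ((norm (f x))\<^sup>2 + (norm (g x))\<^sup>2)" for x
  proof -
    have "0 \<le> norm (f x) * norm (g x)" "0 \<le> (norm (f x))\<^sup>2 + (norm (g x))\<^sup>2" by simp_all
    then show ?thesis
      using sum_squares_bound[of "norm (f x)" "norm (g x)"] unfolding real_norm_def by linarith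
  qed
  then show "AE x in lebesgue_on \<Omega>. norm (norm (f x) * norm (g x)) \<le> norm ((norm (f x))\<^sup>2 + (norm (g x))\<^sup>2)"
    by simp
  show "(\<lambda>x. norm (f x) * norm (g x)) \<in> borel_measurable (lebesgue_on \<Omega>)"
    using assms[THEN L2_measurable] by measurable
qed

lemma L2_inner_integrable:
  assumes "f \<in> L2 \<Omega>" "g \<in> L2 \<Omega>"
  shows "integrable (lebesgue_on \<Omega>) (\<lambda>x. f x \<bullet> g x)"
proof (rule Bochner_Integration.integrable_bound[OF L2_norm_mult_integrable[OF assms]])
  show "(\<lambda>x. f x \<bullet> g x) \<in> borel_measurable (lebesgue_on \<Omega>)"
    using assms[THEN L2_measurable] by measurable
qed (auto simp: abs_mult Cauchy_Schwarz_ineq2)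

lemma L2_mult_integrable:
  fixes f g :: "'a::euclidean_space \<Rightarrow> real"
  shows "f \<in> L2 \<Omega> \<Longrightarrow> g \<in> L2 \<Omega> \<Longrightarrow> integrable (lebesgue_on \<Omega>) (\<lambda>x. f x * g x)"
  using L2_inner_integrable[of f \<Omega> g] by simp

lemma L2_zero [simp]: "(\<lambda>x. 0) \<in> L2 \<Omega>"
  by (rule L2I) auto

lemma L2_add:
  assumes "f \<in> L2 \<Omega>" "g \<in> L2 \<Omega>"
  shows "(\<lambda>x. f x + g x) \<in> L2 \<Omega>"
proof (rule L2I)
  have "(norm (f x + g x))\<^sup>2 = (norm (f x))\<^sup>2 + 2 * (f x \<bullet> g x) + (norm (g x))\<^sup>2" for x
    by (simp add: power2_norm_eq_inner algebra_simps inner_commute)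
  then show "integrable (lebesgue_on \<Omega>) (\<lambda>x. (norm (f x + g x))\<^sup>2)"
    using assms by (simp add: L2_integrable_sq L2_inner_integrable)
  show "(\<lambda>x. f x + g x) \<in> borel_measurable (lebesgue_on \<Omega>)"
    using assms[THEN L2_measurable] by measurable
qed

lemma L2_scaleR:
  assumes "f \<in> L2 \<Omega>"
  shows "(\<lambda>x. c *\<^sub>R f x) \<in> L2 \<Omega>"
  by (rule L2_bound[OF assms, of _ "\<bar>c\<bar>"]) (use L2_measurable[OF assms] in auto)

lemma L2_mult_left:
  fixes f :: "'a::euclidean_space \<Rightarrow> real"
  shows "f \<in> L2 \<Omega> \<Longrightarrow> (\<lambda>x. c * f x) \<in> L2 \<Omega>"
  using L2_scaleR[of f \<Omega> c] by simp

lemma L2_diff: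
  assumes "f \<in> L2 \<Omega>" "g \<in> L2 \<Omega>"
  shows "(\<lambda>x. f x - g x) \<in> L2 \<Omega>"
  using L2_add[OF assms(1) L2_scaleR[OF assms(2), of "-1"]] by simp

lemma inner_L2_commute: "inner_L2 \<Omega> f g = inner_L2 \<Omega> g f"
  by (simp add: inner_L2_def inner_commute)

lemma inner_L2_cong_AE:
  assumes "f \<in> L2 \<Omega>" "g \<in> L2 \<Omega>" "f' \<in> L2 \<Omega>" "g' \<in> L2 \<Omega>"
    and "AE x in lebesgue_on \<Omega>. f x = f' x" "AE x in lebesgue_on \<Omega>. g x = g' x"
  shows "inner_L2 \<Omega> f g = inner_L2 \<Omega> f' g'"
  unfolding inner_L2_def
proof (rule integral_cong_AE)
  show "AE x in lebesgue_on \<Omega>. f x \<bullet> g x = f' x \<bullet> g' x"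
    using assms(5,6) by eventually_elim simp
qed (use assms(1-4)[THEN L2_measurable] in auto)

lemma inner_L2_add_left:
  "f \<in> L2 \<Omega> \<Longrightarrow> g \<in> L2 \<Omega> \<Longrightarrow> h \<in> L2 \<Omega> \<Longrightarrow>
    inner_L2 \<Omega> (\<lambda>x. f x + g x) h = inner_L2 \<Omega> f h + inner_L2 \<Omega> g h"
  by (simp add: inner_L2_def inner_add_left L2_inner_integrable)

lemma inner_L2_diff_left:
  "f \<in> L2 \<Omega> \<Longrightarrow> g \<in> L2 \<Omega> \<Longrightarrow> h \<in> L2 \<Omega> \<Longrightarrow>
    inner_L2 \<Omega> (\<lambda>x. f x - g x) h = inner_L2 \<Omega> f h - inner_L2 \<Omega> g h"
  by (simp add: inner_L2_def inner_diff_left L2_inner_integrable)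

lemma inner_L2_add_right:
  "f \<in> L2 \<Omega> \<Longrightarrow> g \<in> L2 \<Omega> \<Longrightarrow> h \<in> L2 \<Omega> \<Longrightarrow>
    inner_L2 \<Omega> h (\<lambda>x. f x + g x) = inner_L2 \<Omega> h f + inner_L2 \<Omega> h g"
  by (simp add: inner_L2_def inner_add_right L2_inner_integrable)

lemma inner_L2_scaleR_left: "inner_L2 \<Omega> (\<lambda>x. c *\<^sub>R f x) h = c * inner_L2 \<Omega> f h"
  by (simp add: inner_L2_def)

lemma inner_L2_scaleR_right: "inner_L2 \<Omega> h (\<lambda>x. c *\<^sub>R f x) = c * inner_L2 \<Omega> h f"
  by (simp add: inner_L2_def)

lemma inner_L2_mult_left: "inner_L2 \<Omega> (\<lambda>x. c * f x) h = c * inner_L2 \<Omega> f h"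
  using inner_L2_scaleR_left[of \<Omega> c f h] by simp

lemma inner_L2_mult_right: "inner_L2 \<Omega> h (\<lambda>x. c * f x) = c * inner_L2 \<Omega> h f"
  using inner_L2_scaleR_right[of \<Omega> h c f] by simp

lemma inner_L2_self_nonneg [simp]: "0 \<le> inner_L2 \<Omega> f f"
  by (simp add: inner_L2_def)

lemma norm_L2_nonneg [simp]: "0 \<le> norm_L2 \<Omega> f"
  by (simp add: norm_L2_def)

lemma norm_L2_power2: "(norm_L2 \<Omega> f)\<^sup>2 = inner_L2 \<Omega> f f"
  by (simp add: norm_L2_def)

lemma norm_L2_power2_integral: "(norm_L2 \<Omega> f)\<^sup>2 = (\<integral>x. (norm (f x))\<^sup>2 \<partial>lebesgue_on \<Omega>)"
  by (simp add: norm_L2_power2 inner_L2_def power2_norm_eq_inner)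

lemma norm_L2_scaleR: "norm_L2 \<Omega> (\<lambda>x. c *\<^sub>R f x) = \<bar>c\<bar> * norm_L2 \<Omega> f"
  by (simp add: norm_L2_def inner_L2_scaleR_left inner_L2_scaleR_right real_sqrt_mult flip: mult.assoc)

lemma norm_L2_mult_left: "norm_L2 \<Omega> (\<lambda>x. c * f x) = \<bar>c\<bar> * norm_L2 \<Omega> f"
  using norm_L2_scaleR[of \<Omega> c f] by simp

lemma norm_L2_cong_AE:
  assumes "f \<in> L2 \<Omega>" "g \<in> L2 \<Omega>" "AE x in lebesgue_on \<Omega>. f x = g x"
  shows "norm_L2 \<Omega> f = norm_L2 \<Omega> g"
  unfolding norm_L2_def using inner_L2_cong_AE[OF assms(1,1,2,2,3,3)] by simp

lemma norm_L2_eq_0_imp_AE: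
  assumes "f \<in> L2 \<Omega>" "norm_L2 \<Omega> f = 0"
  shows "AE x in lebesgue_on \<Omega>. f x = 0"
proof -
  have "(\<integral>x. (norm (f x))\<^sup>2 \<partial>lebesgue_on \<Omega>) = 0"
    using assms(2) norm_L2_power2_integral[of \<Omega> f] by simp
  then have "AE x in lebesgue_on \<Omega>. (norm (f x))\<^sup>2 = 0"
    using integral_nonneg_eq_0_iff_AE[OF L2_integrable_sq[OF assms(1)]] by simp
  then show ?thesis by simp
qed

text \<open>The infimum of \<open>t * a^2 + b^2 / t\<close> over \<open>t > 0\<close> is
  \<open>2 * a * b\<close>. This turns a pointwise Young inequality with a free weight, integrated,
  into a Cauchy-Schwarz inequality; it serves for integrals, for weighted integrals and for abstract
  forms alike.\<close>

lemma le_mult_if_weighted: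
  fixes x a b :: real
  assumes "a \<ge> 0" "b \<ge> 0" "\<And>t. t > 0 \<Longrightarrow> 2 * x \<le> t * a\<^sup>2 + b\<^sup>2 / t"
  shows "x \<le> a * b"
proof -
  \<comment> \<open>The optimal weight is \<open>b / a\<close>. Shifting both numbers by
    \<open>e\<close> keeps it positive and finite when \<open>a\<close> or \<open>b\<close>
    vanishes.\<close>
  have "x \<le> (a + e) * (b + e)" if "e > 0" for e
  proof -
    have "2 * x \<le> (b + e) / (a + e) * a\<^sup>2 + b\<^sup>2 / ((b + e) / (a + e))"
      using assms(1,2) that by (intro assms(3)) auto
    also have "\<dots> \<le> (b + e) / (a + e) * (a + e)\<^sup>2 + (b + e)\<^sup>2 / ((b + e) / (a + e))"
      using assms(1,2) that by (intro add_mono mult_left_mono divide_right_mono power_mono) auto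
    also have "\<dots> = 2 * ((a + e) * (b + e))"
    proof -
      have "q / p * p\<^sup>2 + q\<^sup>2 / (q / p) = 2 * (p * q)" if "p > 0" "q > 0" for p q :: real
        using that by (simp add: power2_eq_square)
      then show ?thesis using assms(1,2) that by simp
    qed
    finally show ?thesis by simp
  qed
  moreover have "((\<lambda>e. (a + e) * (b + e)) \<longlongrightarrow> (a + 0) * (b + 0)) (at_right 0)"
    by (intro tendsto_intros)
  ultimately have "x \<le> (a + 0) * (b + 0)"
    by (intro tendsto_lowerbound) (auto simp: eventually_at_filter)
  then show ?thesis by simp
qed

lemma integral_norm_mult_le_L2:
  assumes "f \<in> L2 \<Omega>" "g \<in> L2 \<Omega>"
  shows "(\<integral>x. norm (f x) * norm (g x) \<partial>lebesgue_on \<Omega>) \<le> norm_L2 \<Omega> f * norm_L2 \<Omega> g"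
proof (rule le_mult_if_weighted)
  fix t :: real assume t: "t > 0"
  have "2 * (\<integral>x. norm (f x) * norm (g x) \<partial>lebesgue_on \<Omega>)
      = (\<integral>x. 2 * (norm (f x) * norm (g x)) \<partial>lebesgue_on \<Omega>)" by simp
  also have "\<dots> \<le> (\<integral>x. t * (norm (f x))\<^sup>2 + (norm (g x))\<^sup>2 / t \<partial>lebesgue_on \<Omega>)"
  proof (rule integral_mono)
    fix x
    have "0 \<le> (t * norm (f x) - norm (g x))\<^sup>2 / t" using t by simp
    also have "\<dots> = t * (norm (f x))\<^sup>2 + (norm (g x))\<^sup>2 / t - 2 * (norm (f x) * norm (g x))"
      using t by (simp add: power2_eq_square field_simps)
    finally show "2 * (norm (f x) * norm (g x)) \<le> t * (norm (f x))\<^sup>2 + (norm (g x))\<^sup>2 / t" by simp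
  qed (use assms in \<open>simp_all add: L2_norm_mult_integrable L2_integrable_sq\<close>)
  also have "\<dots> = t * (norm_L2 \<Omega> f)\<^sup>2 + (norm_L2 \<Omega> g)\<^sup>2 / t"
    using assms by (simp add: norm_L2_power2_integral L2_integrable_sq)
  finally show "2 * (\<integral>x. norm (f x) * norm (g x) \<partial>lebesgue_on \<Omega>)
    \<le> t * (norm_L2 \<Omega> f)\<^sup>2 + (norm_L2 \<Omega> g)\<^sup>2 / t" .
qed auto

lemma abs_inner_L2_le:
  assumes "f \<in> L2 \<Omega>" "g \<in> L2 \<Omega>"
  shows "\<bar>inner_L2 \<Omega> f g\<bar> \<le> norm_L2 \<Omega> f * norm_L2 \<Omega> g"
proof -
  have "\<bar>inner_L2 \<Omega> f g\<bar> \<le> (\<integral>x. norm (f x) * norm (g x) \<partial>lebesgue_on \<Omega>)"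
    unfolding inner_L2_def
    by (rule order_trans[OF integral_abs_bound integral_mono])
      (use assms in \<open>auto simp: L2_norm_mult_integrable L2_inner_integrable Cauchy_Schwarz_ineq2\<close>)
  also note integral_norm_mult_le_L2[OF assms]
  finally show ?thesis .
qed

section \<open>Almost everywhere convergence and completeness in L2\<close>

lemma nn_integral_L2:
  assumes "f \<in> L2 \<Omega>"
  shows "(\<integral>\<^sup>+x. ennreal ((norm (f x))\<^sup>2) \<partial>lebesgue_on \<Omega>) = ennreal ((norm_L2 \<Omega> f)\<^sup>2)"
  unfolding norm_L2_power2_integral
  by (rule nn_integral_eq_integral) (auto simp: L2_integrable_sq assms)

text \<open>The squared norms decay like \<open>4^(-n)\<close>, so the weight \<open>2^n\<close>
  still leaves a summable series; by monotone convergence its sum is finite almost everywhere. The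
  spare weight gives both the pointwise limit and the pointwise summability below, without passing
  to subsequences.\<close>

lemma L2_AE_convergent:
  assumes f: "\<And>n. f n \<in> L2 \<Omega>"
    and b: "\<And>n. norm_L2 \<Omega> (f n) \<le> (1/2)^n"
  shows "AE x in lebesgue_on \<Omega>. summable (\<lambda>n. 2^n * (norm (f n x))\<^sup>2)"
proof -
  have "(\<integral>\<^sup>+x. (\<Sum>n. ennreal (2^n * (norm (f n x))\<^sup>2)) \<partial>lebesgue_on \<Omega>)
      = (\<Sum>n. \<integral>\<^sup>+x. ennreal (2^n * (norm (f n x))\<^sup>2) \<partial>lebesgue_on \<Omega>)"
    using L2_measurable[OF f] by (intro nn_integral_suminf) auto
  also have "\<dots> \<le> (\<Sum>n. ennreal ((1/2)^n))"
  proof (intro suminf_le summableI)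
    fix n
    have "(\<integral>\<^sup>+x. ennreal (2^n * (norm (f n x))\<^sup>2) \<partial>lebesgue_on \<Omega>) = ennreal (2^n * (norm_L2 \<Omega> (f n))\<^sup>2)"
      using L2_measurable[OF f[of n]] by (simp add: ennreal_mult nn_integral_cmult nn_integral_L2[OF f])
    also have "\<dots> \<le> ennreal (2^n * ((1/2)^n)\<^sup>2)"
      using b[of n] by (intro ennreal_leI mult_left_mono power_mono) auto
    also have "2^n * ((1/2)^n)\<^sup>2 = ((1/2)^n :: real)"
      by (simp add: power2_eq_square field_simps power_mult_distrib)
    finally show "(\<integral>\<^sup>+x. ennreal (2^n * (norm (f n x))\<^sup>2) \<partial>lebesgue_on \<Omega>) \<le> ennreal ((1/2)^n)" .
  qed
  also have "\<dots> < \<infinity>"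
    by (subst suminf_ennreal2) (auto simp: less_top intro!: summable_geometric)
  finally have "(\<integral>\<^sup>+x. (\<Sum>n. ennreal (2^n * (norm (f n x))\<^sup>2)) \<partial>lebesgue_on \<Omega>) \<noteq> \<infinity>" by simp
  then have "AE x in lebesgue_on \<Omega>. (\<Sum>n. ennreal (2^n * (norm (f n x))\<^sup>2)) \<noteq> \<infinity>"
    by (intro nn_integral_PInf_AE borel_measurable_suminf_order measurable_compose[OF _ measurable_ennreal]
      borel_measurable_times borel_measurable_const borel_measurable_power measurable_compose[OF L2_measurable[OF f] borel_measurable_norm])
  then show ?thesis
  proof eventually_elim
    case (elim x)
    then show ?case unfolding infinity_ennreal_def by (rule summable_suminf_not_top[rotated]) simp
  qed
qed

lemma L2_AE_tendsto_0:
  assumes f: "\<And>n. f n \<in> L2 \<Omega>"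
    and b: "\<And>n. norm_L2 \<Omega> (f n) \<le> (1/2)^n"
  shows "AE x in lebesgue_on \<Omega>. (\<lambda>n. f n x) \<longlonglongrightarrow> 0"
  using L2_AE_convergent[OF assms]
proof eventually_elim
  case (elim x)
  then have lim: "(\<lambda>n. 2^n * (norm (f n x))\<^sup>2) \<longlonglongrightarrow> 0" by (rule summable_LIMSEQ_zero)
  have "(\<lambda>n. (norm (f n x))\<^sup>2) \<longlonglongrightarrow> 0"
  proof (rule tendsto_sandwich[OF _ _ tendsto_const lim])
    show "\<forall>\<^sub>F n in sequentially. (norm (f n x))\<^sup>2 \<le> 2^n * (norm (f n x))\<^sup>2"
      using mult_right_mono[of 1 "2^_" "(norm (f _ x))\<^sup>2"] by (intro always_eventually allI) simp
  qed auto
  then have "(\<lambda>n. sqrt ((norm (f n x))\<^sup>2)) \<longlonglongrightarrow> sqrt 0" by (intro tendsto_intros)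
  then show ?case by (simp add: tendsto_norm_zero_iff)
qed

lemma L2_AE_summable:
  assumes f: "\<And>n. f n \<in> L2 \<Omega>"
    and b: "\<And>n. norm_L2 \<Omega> (f n) \<le> (1/2)^n"
  shows "AE x in lebesgue_on \<Omega>. summable (\<lambda>n. f n x)"
  using L2_AE_convergent[OF assms]
proof eventually_elim
  case (elim x)
  \<comment> \<open>Young's inequality with weight \<open>2^n\<close> trades the square for a first
    power at the price of a geometric term.\<close>
  have "norm (f n x) \<le> (1/2)^n + 2^n * (norm (f n x))\<^sup>2" for n
  proof -
    have "2 * norm (f n x) = 2 * (1/2)^n * (2^n * norm (f n x))"
      by (simp add: field_simps)
    also have "\<dots> = (1/2)^n * (2 * (2^n * norm (f n x)) * 1)" by simp
    also have "\<dots> \<le> (1/2)^n * ((2^n * norm (f n x))\<^sup>2 + 1\<^sup>2)"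
      by (intro mult_left_mono sum_squares_bound) auto
    also have "\<dots> = (1/2)^n + 2^n * (norm (f n x))\<^sup>2"
      by (simp add: field_simps power2_eq_square)
    finally show ?thesis
      by (smt (verit) norm_ge_zero)
  qed
  then show ?case
    by (intro summable_comparison_test'[OF summable_add[OF summable_geometric elim]]) auto
qed

lemma nn_integral_L2_finite_imp:
  assumes "f \<in> borel_measurable (lebesgue_on \<Omega>)"
    and "(\<integral>\<^sup>+x. ennreal ((norm (f x))\<^sup>2) \<partial>lebesgue_on \<Omega>) \<le> ennreal (c\<^sup>2)" "c \<ge> 0"
  shows "f \<in> L2 \<Omega>" "norm_L2 \<Omega> f \<le> c"
proof -
  have "integrable (lebesgue_on \<Omega>) (\<lambda>x. (norm (f x))\<^sup>2)"
    using assms(1) le_less_trans[OF assms(2)] by (intro integrableI_bounded) auto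
  then show "f \<in> L2 \<Omega>" using assms(1) by (intro L2I)
  then have "ennreal ((norm_L2 \<Omega> f)\<^sup>2) \<le> ennreal (c\<^sup>2)" using nn_integral_L2 assms(2) by metis
  then have "(norm_L2 \<Omega> f)\<^sup>2 \<le> c\<^sup>2" by (simp add: ennreal_le_iff)
  then show "norm_L2 \<Omega> f \<le> c" using assms(3) by (rule power2_le_imp_le)
qed

text \<open>Consecutive differences are absolutely summable almost everywhere, so the telescoped
  sequence converges pointwise; Fatou's lemma transfers the Cauchy bound to the limit. With a
  geometric rate as hypothesis no subsequence has to be chosen.\<close>

lemma L2_fast_Cauchy_convergent:
  fixes f :: "nat \<Rightarrow> 'a::euclidean_space \<Rightarrow> 'b::euclidean_space"
  assumes f: "\<And>n. f n \<in> L2 \<Omega>"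
    and c: "\<And>n k. n \<le> k \<Longrightarrow> norm_L2 \<Omega> (\<lambda>x. f k x - f n x) \<le> (1/2)^n"
  shows "\<exists>g\<in>L2 \<Omega>. \<forall>n. norm_L2 \<Omega> (\<lambda>x. g x - f n x) \<le> (1/2)^n"
proof -
  define g where "g x = lim (\<lambda>n. f n x)" for x
  have gm: "g \<in> borel_measurable (lebesgue_on \<Omega>)"
    unfolding g_def using L2_measurable[OF f] by (intro borel_measurable_lim_metric)
  have "AE x in lebesgue_on \<Omega>. summable (\<lambda>n. f (Suc n) x - f n x)"
    using L2_diff[OF f f] by (intro L2_AE_summable c) auto
  then have lim: "AE x in lebesgue_on \<Omega>. (\<lambda>n. f n x) \<longlonglongrightarrow> g x"
  proof eventually_elim
    case (elim x)
    then have "convergent (\<lambda>n. \<Sum>i<n. f (Suc i) x - f i x)"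
      by (simp add: summable_iff_convergent)
    then have "convergent (\<lambda>n. f n x - f 0 x)" by (simp add: sum_lessThan_telescope[of "\<lambda>n. f n x"])
    then have "convergent (\<lambda>n. f 0 x + (f n x - f 0 x))" by (intro convergent_add convergent_const)
    then show ?case by (simp add: g_def convergent_LIMSEQ_iff)
  qed
  have "(\<integral>\<^sup>+x. ennreal ((norm (g x - f n x))\<^sup>2) \<partial>lebesgue_on \<Omega>) \<le> ennreal (((1/2)^n)\<^sup>2)" for n
  proof -
    have "(\<integral>\<^sup>+x. ennreal ((norm (g x - f n x))\<^sup>2) \<partial>lebesgue_on \<Omega>)
        = (\<integral>\<^sup>+x. liminf (\<lambda>k. ennreal ((norm (f k x - f n x))\<^sup>2)) \<partial>lebesgue_on \<Omega>)"
    proof (rule nn_integral_cong_AE)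
      show "AE x in lebesgue_on \<Omega>. ennreal ((norm (g x - f n x))\<^sup>2)
          = liminf (\<lambda>k. ennreal ((norm (f k x - f n x))\<^sup>2))"
        using lim
      proof eventually_elim
        case (elim x)
        then have "(\<lambda>k. ennreal ((norm (f k x - f n x))\<^sup>2)) \<longlonglongrightarrow> ennreal ((norm (g x - f n x))\<^sup>2)"
          by (intro tendsto_intros)
        from lim_imp_Liminf[OF sequentially_bot this] show ?case by (rule sym)
      qed
    qed
    also have "\<dots> \<le> liminf (\<lambda>k. \<integral>\<^sup>+x. ennreal ((norm (f k x - f n x))\<^sup>2) \<partial>lebesgue_on \<Omega>)"
      using L2_measurable[OF f] by (intro nn_integral_liminf) auto
    also have "\<dots> \<le> liminf (\<lambda>k. ennreal (((1/2)^n)\<^sup>2))"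
    proof (rule Liminf_mono)
      show "\<forall>\<^sub>F k in sequentially. (\<integral>\<^sup>+x. ennreal ((norm (f k x - f n x))\<^sup>2) \<partial>lebesgue_on \<Omega>)
          \<le> ennreal (((1/2)^n)\<^sup>2)"
        using eventually_ge_at_top[of n]
      proof eventually_elim
        case (elim k)
        then show ?case
          by (simp only: nn_integral_L2[OF L2_diff[OF f f]]) (intro ennreal_leI power_mono c, auto)
      qed
    qed
    finally show ?thesis by (simp only: Liminf_const[OF sequentially_bot])
  qed
  note * = nn_integral_L2_finite_imp[OF _ this]
  have d: "(\<lambda>x. g x - f n x) \<in> L2 \<Omega>" "norm_L2 \<Omega> (\<lambda>x. g x - f n x) \<le> (1/2)^n" for n
    using gm L2_measurable[OF f] by (intro *; simp)+
  have "(\<lambda>x. (g x - f 0 x) + f 0 x) \<in> L2 \<Omega>" by (intro L2_add d f)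
  then show ?thesis using d(2) by auto
qed

subsection \<open>Smooth functions and the fundamental lemma of the calculus of variations\<close>

text \<open>Allows any known derivative in place of the chosen \<open>frechet_derivative\<close>,
  which makes the inductions over \<open>k\<close> work.\<close>

lemma C_k_SucI:
  assumes "\<And>x. (f has_derivative f' x) (at x)" "\<And>i. i \<in> Basis \<Longrightarrow> C_k k (\<lambda>x. f' x i)"
  shows "C_k (Suc k) f"
proof -
  have "frechet_derivative f (at x) = f' x" for x
    using frechet_derivative_at[OF assms(1)] by simp
  then show ?thesis
    using assms by (auto simp: differentiable_on_def intro: differentiableI has_derivative_at_withinI)
qed

lemma C_k_SucD:
  assumes "C_k (Suc k) f"
  shows "(f has_derivative frechet_derivative f (at x)) (at x)"
    and "i \<in> Basis \<Longrightarrow> C_k k (\<lambda>x. frechet_derivative f (at x) i)"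
  using assms by (auto simp: differentiable_on_def frechet_derivative_works)

lemma C_k_Suc_imp: "C_k (Suc k) f \<Longrightarrow> C_k k f"
proof (induction k arbitrary: f)
  case 0
  then show ?case by (auto intro: differentiable_imp_continuous_on)
next
  case (Suc k)
  then show ?case using C_k_SucD[OF Suc.prems] by (intro C_k_SucI) auto
qed

lemma C_k_const [simp]: "C_k k (\<lambda>x. c)"
proof (induction k arbitrary: c)
  case (Suc k)
  then show ?case by (intro C_k_SucI[where f' = "\<lambda>x h. 0"]) auto
qed simp

lemma C_k_add: "C_k k f \<Longrightarrow> C_k k g \<Longrightarrow> C_k k (\<lambda>x. f x + g x)"
proof (induction k arbitrary: f g)
  case (Suc k)
  show ?case
    by (rule C_k_SucI[OF has_derivative_add[OF C_k_SucD(1)[OF Suc.prems(1)] C_k_SucD(1)[OF Suc.prems(2)]]])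
      (intro Suc.IH C_k_SucD(2) Suc.prems)
qed (auto intro: continuous_intros)

lemma C_k_mult: "C_k k f \<Longrightarrow> C_k k g \<Longrightarrow> C_k k (\<lambda>x. f x * g x)"
proof (induction k arbitrary: f g)
  case (Suc k)
  show ?case
    by (rule C_k_SucI[OF has_derivative_mult[OF C_k_SucD(1)[OF Suc.prems(1)] C_k_SucD(1)[OF Suc.prems(2)]]])
      (intro C_k_add Suc.IH C_k_SucD(2) Suc.prems C_k_Suc_imp)
qed (auto intro: continuous_intros)

lemma C_k_diff: "C_k k f \<Longrightarrow> C_k k g \<Longrightarrow> C_k k (\<lambda>x. f x - g x)"
  using C_k_add[OF _ C_k_mult[OF C_k_const[of k "-1"]], of f g] by simp

lemma C_k_inner: "C_k k (\<lambda>x. x \<bullet> v)"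
proof (cases k)
  case (Suc m)
  then show ?thesis
    by (simp only:) (rule C_k_SucI[where f' = "\<lambda>x h. h \<bullet> v"], auto intro!: derivative_eq_intros)
qed (auto intro: continuous_intros)

lemma C_k_sum: "(\<And>a. a \<in> S \<Longrightarrow> C_k k (f a)) \<Longrightarrow> C_k k (\<lambda>x. \<Sum>a\<in>S. f a x)"
  by (induction S rule: infinite_finite_induct) (auto intro: C_k_add)

lemma C_k_prod: "(\<And>a. a \<in> S \<Longrightarrow> C_k k (f a)) \<Longrightarrow> C_k k (\<lambda>x. \<Prod>a\<in>S. f a x)"
  by (induction S rule: infinite_finite_induct) (auto intro: C_k_mult)

lemma C_k_norm_sq: "C_k k (\<lambda>x. (norm (x - c))\<^sup>2)"
proof -
  have "(norm (x - c))\<^sup>2 = (\<Sum>i\<in>Basis. (x \<bullet> i - c \<bullet> i) * (x \<bullet> i - c \<bullet> i))" for x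
    unfolding power2_norm_eq_inner by (subst euclidean_inner) (simp add: inner_diff_left)
  then show ?thesis
    by (simp only:) (intro C_k_sum C_k_mult C_k_diff C_k_inner C_k_const)
qed

text \<open>The outer function is given with all its derivatives as a sequence \<open>G\<close>, and
  the statement is for every \<open>n\<close>: the chain rule produces \<open>G (Suc n)\<close>,
  which the induction hypothesis must cover.\<close>

lemma C_k_compose_real:
  assumes "\<And>n x. (G n has_real_derivative G (Suc n) x) (at x)" "C_k k f"
  shows "C_k k (\<lambda>x. G n (f x))"
  using assms(2)
proof (induction k arbitrary: n)
  case 0
  have "continuous_on UNIV (G n)"
    using assms(1) by (meson DERIV_isCont continuous_at_imp_continuous_on)
  then show ?case using 0 by (auto intro: continuous_on_compose2)
next
  case (Suc k)
  have "((\<lambda>x. G n (f x)) has_derivative (\<lambda>h. G (Suc n) (f x) * frechet_derivative f (at x) h)) (at x)" for x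
    using has_derivative_compose[OF C_k_SucD(1)[OF Suc.prems] has_field_derivative_imp_has_derivative[OF assms(1)]]
    by simp
  then show ?case
    by (rule C_k_SucI) (intro C_k_mult Suc.IH C_k_SucD(2)[OF Suc.prems] C_k_Suc_imp[OF Suc.prems])
qed

lemma C_k_scale_shift:
  assumes "C_k k f"
  shows "C_k k (\<lambda>y. f (c *\<^sub>R (y - a)))"
  using assms
proof (induction k arbitrary: f)
  case 0
  then show ?case by (auto intro!: continuous_intros intro: continuous_on_compose2)
next
  case (Suc k)
  have "((\<lambda>y. c *\<^sub>R (y - a)) has_derivative (\<lambda>h. c *\<^sub>R h)) (at y)" for y
    by (auto intro!: derivative_eq_intros)
  note * = has_derivative_compose[OF this C_k_SucD(1)[OF Suc.prems]]
  have "frechet_derivative f (at z) (c *\<^sub>R h) = c * frechet_derivative f (at z) h" for z h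
    using linear_cmul[OF has_derivative_linear[OF C_k_SucD(1)[OF Suc.prems, of z]], of c h] by simp
  then have d: "((\<lambda>y. f (c *\<^sub>R (y - a))) has_derivative (\<lambda>h. c * frechet_derivative f (at (c *\<^sub>R (y - a))) h)) (at y)" for y
    using *[of y] by simp
  show ?case
    by (rule C_k_SucI[OF d]) (intro C_k_mult C_k_const Suc.IH C_k_SucD(2)[OF Suc.prems])
qed

section \<open>The flat exponential and smooth steps\<close>

lemma poly_times_exp_minus_tendsto_0:
  fixes p :: "real poly"
  shows "((\<lambda>t. poly p t * exp (- t)) \<longlongrightarrow> 0) at_top"
proof -
  have "((\<lambda>t. \<Sum>i\<le>degree p. coeff p i * (t ^ i / exp t)) \<longlongrightarrow> (\<Sum>i\<le>degree p. coeff p i * 0)) at_top"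
    by (intro tendsto_sum tendsto_mult tendsto_const tendsto_power_div_exp_0)
  then show ?thesis
    by (simp add: poly_altdef sum_distrib_right exp_minus divide_inverse mult.assoc)
qed

text \<open>The family \<open>p(1/x) * exp(-1/x)\<close> with a polynomial prefactor is the smallest
  natural class that contains the classical flat function and is closed under
  differentiation.\<close>

definition flat :: "real poly \<Rightarrow> real \<Rightarrow> real" where
  "flat p x = (if x > 0 then poly p (1 / x) * exp (- (1 / x)) else 0)"

text \<open>With \<open>s = 1/x\<close> one has \<open>ds/dx = -s^2\<close>, so the derivative of
  \<open>p(s) * exp(-s)\<close> is \<open>s^2 * (p(s) - p'(s)) * exp(-s)\<close>, again in the
  family.\<close>

lemma flat_has_derivative:
  "(flat p has_real_derivative flat ([:0, 0, 1:] * (p - pderiv p)) x) (at x)"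
proof (cases "x = 0")
  case True
  \<comment> \<open>The substitution \<open>s = 1/h\<close> turns the right-hand difference quotient
    into the polynomial \<open>s * p(s)\<close> times \<open>exp(-s)\<close>, which vanishes at
    infinity; the left-hand quotient is identically zero.\<close>
  have "((\<lambda>h. flat p h / h) \<longlongrightarrow> 0) (at_right 0)"
  proof (rule Lim_transform_eventually)
    have "((\<lambda>h. poly ([:0, 1:] * p) (inverse h) * exp (- inverse h)) \<longlongrightarrow> 0) (at_right (0::real))"
      by (rule filterlim_compose[OF poly_times_exp_minus_tendsto_0 filterlim_inverse_at_top_right])
    then show "((\<lambda>h. poly ([:0, 1:] * p) (inverse h) * exp (- inverse h)) \<longlongrightarrow> 0) (at_right (0::real))" .
    show "\<forall>\<^sub>F h in at_right 0. poly ([:0, 1:] * p) (inverse h) * exp (- inverse h) = flat p h / h"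
      by (auto simp: eventually_at_filter flat_def field_simps)
  qed
  moreover have "((\<lambda>h. flat p h / h) \<longlongrightarrow> 0) (at_left 0)"
    by (rule Lim_transform_eventually[OF tendsto_const]) (auto simp: eventually_at_filter flat_def)
  ultimately have "((\<lambda>h. flat p h / h) \<longlongrightarrow> 0) (at 0)"
    by (simp add: filterlim_split_at)
  then show ?thesis using True by (simp add: has_field_derivative_iff flat_def)
next
  case False
  show ?thesis
  proof (cases "x > 0")
    case True
    have "((\<lambda>x. poly p (1 / x) * exp (- (1 / x))) has_real_derivative
        flat ([:0, 0, 1:] * (p - pderiv p)) x) (at x)"
      using True by (auto intro!: derivative_eq_intros DERIV_chain2[OF poly_DERIV]
          simp: flat_def field_simps power2_eq_square)
    moreover have "\<forall>\<^sub>F x in nhds x. flat p x = poly p (1 / x) * exp (- (1 / x))"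
      using eventually_nhds_in_open[OF open_greaterThan, of x 0] True
      by (auto elim!: eventually_mono simp: flat_def)
    ultimately show ?thesis by (subst DERIV_cong_ev[OF refl _ refl]) auto
  next
    case neg: False
    then have "\<forall>\<^sub>F x in nhds x. flat p x = 0"
      using eventually_nhds_in_open[OF open_lessThan, of x 0] False
      by (auto elim!: eventually_mono simp: flat_def)
    then show ?thesis using neg by (subst DERIV_cong_ev[OF refl _ refl]) (auto simp: flat_def)
  qed
qed

definition smooth_step :: "real \<Rightarrow> real" where "smooth_step = flat 1"

lemma smooth_step_eq: "smooth_step x = (if x > 0 then exp (- (1 / x)) else 0)"
  by (simp add: smooth_step_def flat_def)

lemma smooth_step_bounds: "0 \<le> smooth_step x" "smooth_step x \<le> 1"
  by (auto simp: smooth_step_eq)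

lemma smooth_step_pos_iff: "smooth_step x > 0 \<longleftrightarrow> x > 0"
  by (auto simp: smooth_step_eq)

lemma smooth_step_nonpos: "x \<le> 0 \<Longrightarrow> smooth_step x = 0"
  by (auto simp: smooth_step_eq)

text \<open>Together with \<open>smooth_step_nonpos\<close> this shows that the rescaled steps
  converge pointwise to the indicator of the positive half line.\<close>

lemma smooth_step_scaled_tendsto:
  assumes "x > 0"
  shows "(\<lambda>n. smooth_step (real (Suc n) * x)) \<longlonglongrightarrow> 1"
proof -
  have "(\<lambda>n. exp (- (inverse (real (Suc n)) * (1 / x)))) \<longlonglongrightarrow> exp (- (0 * (1 / x)))"
    by (intro tendsto_intros LIMSEQ_inverse_real_of_nat)
  then show ?thesis using assms by (simp add: smooth_step_eq divide_inverse)
qed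

lemma C_k_smooth_step:
  assumes "C_k k f"
  shows "C_k k (\<lambda>x. smooth_step (f x))"
proof -
  define G where "G n = flat (((\<lambda>p. [:0, 0, 1:] * (p - pderiv p)) ^^ n) 1)" for n
  have "(G n has_real_derivative G (Suc n) x) (at x)" for n x
    unfolding G_def funpow.simps o_apply by (rule flat_has_derivative)
  from C_k_compose_real[of G, OF this assms, of 0] show ?thesis
    by (simp add: G_def smooth_step_def)
qed

section \<open>Test functions\<close>

lemma test_functionsI:
  assumes "\<And>k. C_k k \<phi>" "compact K" "K \<subseteq> \<Omega>" "\<And>x. x \<notin> K \<Longrightarrow> \<phi> x = 0"
  shows "\<phi> \<in> test_functions \<Omega>"
proof -
  have "closure {x. \<phi> x \<noteq> 0} \<subseteq> K"
    using assms(2,4) by (intro closure_minimal) (auto intro: compact_imp_closed)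
  moreover from this have "compact (closure {x. \<phi> x \<noteq> 0})"
    using compact_Int_closed[OF assms(2), of "closure {x. \<phi> x \<noteq> 0}"] by (simp add: Int_absorb1)
  ultimately show ?thesis using assms by (auto simp: test_functions_def)
qed

lemma test_functions_continuous: "\<phi> \<in> test_functions \<Omega> \<Longrightarrow> continuous_on UNIV \<phi>"
  unfolding test_functions_def by (auto dest: spec[of _ 0])

lemma test_functions_frechet_continuous:
  "\<phi> \<in> test_functions \<Omega> \<Longrightarrow> i \<in> Basis \<Longrightarrow> continuous_on UNIV (\<lambda>x. frechet_derivative \<phi> (at x) i)"
  unfolding test_functions_def using C_k_SucD(2)[of 0] by fastforce

lemma test_functions_frechet_eq_0:
  assumes "\<phi> \<in> test_functions \<Omega>" "x \<notin> closure {x. \<phi> x \<noteq> 0}"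
  shows "frechet_derivative \<phi> (at x) i = 0"
proof -
  have "(\<phi> has_derivative (\<lambda>h. 0)) (at x)"
    by (rule has_derivative_transform_within_open[of "\<lambda>x. 0" _ _ _ "- closure {x. \<phi> x \<noteq> 0}"])
      (use assms(2) closure_subset[of "{x. \<phi> x \<noteq> 0}"] in \<open>auto simp: open_Compl\<close>)
  from frechet_derivative_at[OF this] show ?thesis by (simp add: fun_eq_iff)
qed

lemma continuous_compact_support_bounded:
  fixes f :: "'a::euclidean_space \<Rightarrow> real"
  assumes "continuous_on UNIV f" "compact K" "\<And>x. x \<notin> K \<Longrightarrow> f x = 0"
  obtains B where "B > 0" "\<And>x. \<bar>f x\<bar> \<le> B"
proof -
  have "bounded (f ` K)"
    using assms by (intro compact_imp_bounded compact_continuous_image) (auto intro: continuous_on_subset)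
  then obtain B where "B > 0" "\<And>x. x \<in> K \<Longrightarrow> \<bar>f x\<bar> \<le> B" by (auto simp: bounded_pos)
  then have "\<bar>f x\<bar> \<le> B" for x using assms(3)[of x] by (cases "x \<in> K") auto
  then show thesis using \<open>B > 0\<close> that by blast
qed


lemma continuous_compact_support_L2:
  fixes f :: "'a::euclidean_space \<Rightarrow> real"
  assumes "\<Omega> \<in> sets lebesgue" "continuous_on UNIV f" "compact K" "\<And>x. x \<notin> K \<Longrightarrow> f x = 0"
  shows "f \<in> L2 \<Omega>"
proof (rule L2I)
  have fm: "f \<in> borel_measurable borel" using assms(2) by (rule borel_measurable_continuous_onI)
  have "integrable lborel (\<lambda>x. indicator K x *\<^sub>R (f x)\<^sup>2)"
    using assms(2,3) by (intro borel_integrable_compact) (auto intro!: continuous_intros intro: continuous_on_subset)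
  moreover have "(\<lambda>x. indicator K x *\<^sub>R (f x)\<^sup>2) = (\<lambda>x. (f x)\<^sup>2)"
    using assms(4) by (auto simp: indicator_def fun_eq_iff)
  ultimately have "integrable lebesgue (\<lambda>x. (f x)\<^sup>2)" using fm by (simp add: integrable_completion)
  then have "integrable lebesgue (\<lambda>x. indicator \<Omega> x *\<^sub>R (f x)\<^sup>2)"
    using assms(1) by (intro integrable_mult_indicator)
  then show "integrable (lebesgue_on \<Omega>) (\<lambda>x. (norm (f x))\<^sup>2)"
    using assms(1) by (simp add: integrable_restrict_space)
  show "f \<in> borel_measurable (lebesgue_on \<Omega>)"
    using fm by (intro measurable_restrict_space1 measurable_completion) simp
qed

lemma test_functions_L2:
  assumes "\<Omega> \<in> sets lebesgue" "\<phi> \<in> test_functions \<Omega>'"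
  shows "\<phi> \<in> L2 \<Omega>" and "i \<in> Basis \<Longrightarrow> (\<lambda>x. frechet_derivative \<phi> (at x) i) \<in> L2 \<Omega>"
proof -
  have K: "compact (closure {x. \<phi> x \<noteq> 0})" using assms(2) by (simp add: test_functions_def)
  show "\<phi> \<in> L2 \<Omega>"
    using closure_subset[of "{x. \<phi> x \<noteq> 0}"]
    by (intro continuous_compact_support_L2[OF assms(1) test_functions_continuous[OF assms(2)] K]) auto
  show "i \<in> Basis \<Longrightarrow> (\<lambda>x. frechet_derivative \<phi> (at x) i) \<in> L2 \<Omega>"
    using test_functions_frechet_continuous[OF assms(2)] test_functions_frechet_eq_0[OF assms(2)]
    by (intro continuous_compact_support_L2[OF assms(1) _ K]) auto
qed

section \<open>The fundamental lemma of the calculus of variations\<close>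

lemma open_eq_UN_ball:
  fixes V :: "'a::euclidean_space set"
  assumes "open V"
  obtains c r where "V = (\<Union>k::nat. ball (c k) (r k))" "\<And>k. cball (c k) (r k) \<subseteq> V"
proof -
  define F where "F = {B. \<exists>c r. B = ball c r \<and> cball c r \<subseteq> V}"
  have "\<Union>F = V"
  proof (intro equalityI subsetI)
    fix x assume "x \<in> V"
    then obtain e where e: "e > 0" "cball x e \<subseteq> V" using assms open_contains_cball by blast
    then show "x \<in> \<Union>F" unfolding F_def by (auto intro!: exI[of _ "ball x e"])
  qed (auto simp: F_def)
  have "\<And>S. S \<in> F \<Longrightarrow> open S" by (auto simp: F_def)
  then obtain F' where F': "F' \<subseteq> F" "countable F'" "\<Union>F' = \<Union>F" by (rule Lindelof)
  \<comment> \<open>A negative radius gives the empty ball. Adding it makes the countable family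
    nonempty, so it can be enumerated by the naturals even if \<open>V\<close> is empty.\<close>
  have "ball (0::'a) (-1) = {}" "cball (0::'a) (-1) = {}" by simp_all
  then have "{} \<in> F" unfolding F_def by blast
  then have G: "countable (insert {} F')" "insert {} F' \<subseteq> F" using F' by auto
  define B where "B = from_nat_into (insert {} F')"
  have "range B = insert {} F'" unfolding B_def using G by (intro range_from_nat_into) auto
  then have "V = (\<Union>k. B k)" using F' \<open>\<Union>F = V\<close> by auto
  have "\<forall>k. \<exists>c r. B k = ball c r \<and> cball c r \<subseteq> V"
  proof
    fix k
    have "B k \<in> insert {} F'" using \<open>range B = _\<close> rangeI[of B k] by metis
    then have "B k \<in> F" using G(2) by (rule subsetD[rotated])
    then show "\<exists>c r. B k = ball c r \<and> cball c r \<subseteq> V" by (simp add: F_def)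
  qed
  then obtain c r where cr: "\<And>k. B k = ball (c k) (r k) \<and> cball (c k) (r k) \<subseteq> V" by metis
  show thesis
  proof (rule that)
    show "V = (\<Union>k. ball (c k) (r k))" using \<open>V = (\<Union>k. B k)\<close> cr by simp
    show "cball (c k) (r k) \<subseteq> V" for k using cr by blast
  qed
qed

text \<open>A union of balls is encoded as one minus a product of complements: the values stay in
  the unit interval, only finitely many closed balls carry the support, and at each point of
  \<open>V\<close> a single factor already forces the limit \<open>1\<close>.\<close>

lemma indicator_open_limit_test_functions:
  fixes V :: "'a::euclidean_space set"
  assumes "open V"
  obtains \<phi> :: "nat \<Rightarrow> 'a \<Rightarrow> real" where "\<And>n. \<phi> n \<in> test_functions V"
    "\<And>n x. 0 \<le> \<phi> n x \<and> \<phi> n x \<le> 1" "\<And>x. (\<lambda>n. \<phi> n x) \<longlonglongrightarrow> indicator V x"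
proof -
  obtain c r where V: "V = (\<Union>k::nat. ball (c k) (r k))" and sub: "\<And>k. cball (c k) (r k) \<subseteq> V"
    using open_eq_UN_ball[OF assms] by blast
  \<comment> \<open>Radii are compared through their squares, which is only monotone for nonnegative
    radii; truncation at \<open>0\<close> changes none of the balls.\<close>
  define r' where "r' k = max 0 (r k)" for k
  have V': "V = (\<Union>k. ball (c k) (r' k))"
  proof -
    have "ball (c k) (r' k) = ball (c k) (r k)" for k 
    proof (cases "r k \<ge> 0")
      case False
      then have "ball (c k) (r k) = {}" by simp
      then show ?thesis using False by (simp only:) (simp add: r'_def)
    qed (simp add: r'_def)
    then show ?thesis using V by simp
  qed
  define s where "s n k x = smooth_step (real (Suc n) * ((r' k)\<^sup>2 - (norm (x - c k))\<^sup>2))" for n k x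
  have s01: "0 \<le> s n k x" "s n k x \<le> 1" for n k x by (auto simp: s_def smooth_step_bounds)
  have s0: "s n k x = 0" if "x \<notin> ball (c k) (r' k)" for n k x
  proof -
    have "(r' k)\<^sup>2 \<le> (norm (x - c k))\<^sup>2"
      using that by (intro power_mono) (auto simp: r'_def dist_norm norm_minus_commute)
    then show ?thesis unfolding s_def by (intro smooth_step_nonpos) (simp add: mult_le_0_iff)
  qed
  define \<phi> where "\<phi> n x = 1 - (\<Prod>k\<le>n. 1 - s n k x)" for n x
  have "\<phi> n \<in> test_functions V" for n
  proof (rule test_functionsI)
    show "C_k k (\<phi> n)" for k unfolding \<phi>_def s_def
      by (intro C_k_diff C_k_prod C_k_const C_k_smooth_step C_k_mult C_k_norm_sq)
    show "compact (\<Union>k\<in>{k\<in>{..n}. r k \<ge> 0}. cball (c k) (r k))" by (intro compact_UN) auto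
    show "(\<Union>k\<in>{k\<in>{..n}. r k \<ge> 0}. cball (c k) (r k)) \<subseteq> V" using sub by blast
    show "\<phi> n x = 0" if "x \<notin> (\<Union>k\<in>{k\<in>{..n}. r k \<ge> 0}. cball (c k) (r k))" for x
    proof -
      have "x \<notin> ball (c k) (r' k)" if "k \<le> n" for k
        using \<open>x \<notin> _\<close> that by (cases "r k \<ge> 0") (auto simp: r'_def max_def)
      then show ?thesis by (simp add: \<phi>_def s0)
    qed
  qed
  moreover have "0 \<le> (\<Prod>k\<le>n. 1 - s n k x) \<and> (\<Prod>k\<le>n. 1 - s n k x) \<le> 1" for n x
    using s01 by (auto intro!: prod_nonneg prod_le_1)
  then have "0 \<le> \<phi> n x \<and> \<phi> n x \<le> 1" for n x by (simp add: \<phi>_def)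
  moreover have "(\<lambda>n. \<phi> n x) \<longlonglongrightarrow> indicator V x" for x
  proof (cases "x \<in> V")
    case False
    then have "\<phi> n x = 0" for n using V' by (auto simp: \<phi>_def s0)
    then show ?thesis using False by simp
  next
    case True
    then obtain j where j: "x \<in> ball (c j) (r' j)" using V' by auto
    have "(norm (x - c j))\<^sup>2 < (r' j)\<^sup>2"
      using j by (intro power_strict_mono) (auto simp: dist_norm norm_minus_commute)
    then have lim: "(\<lambda>n. s n j x) \<longlonglongrightarrow> 1"
      unfolding s_def by (intro smooth_step_scaled_tendsto) simp
    have "(\<lambda>n. \<phi> n x) \<longlonglongrightarrow> 1"
    proof (rule tendsto_sandwich[OF _ _ lim tendsto_const])
      show "\<forall>\<^sub>F n in sequentially. s n j x \<le> \<phi> n x"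
        using eventually_ge_at_top[of j]
      proof eventually_elim
        case (elim n)
        have "(\<Prod>k\<le>n. 1 - s n k x) = (1 - s n j x) * (\<Prod>k\<in>{..n} - {j}. 1 - s n k x)"
          using elim by (intro prod.remove) auto
        also have "\<dots> \<le> (1 - s n j x) * 1"
          using s01 by (intro mult_left_mono prod_le_1) auto
        finally show ?case by (simp add: \<phi>_def)
      qed
      show "\<forall>\<^sub>F n in sequentially. \<phi> n x \<le> 1"
        using \<open>\<And>n x. 0 \<le> \<phi> n x \<and> \<phi> n x \<le> 1\<close> by simp
    qed
    then show ?thesis using True by simp
  qed
  ultimately show thesis using that by blast
qed

lemma test_functions_mono: "\<phi> \<in> test_functions V \<Longrightarrow> V \<subseteq> U \<Longrightarrow> \<phi> \<in> test_functions U"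
  by (auto simp: test_functions_def)

lemma integral_open_eq_0_if_test_functions:
  fixes h :: "'a::euclidean_space \<Rightarrow> real"
  assumes h: "integrable (lebesgue_on U) h"
    and 0: "\<And>\<phi>. \<phi> \<in> test_functions U \<Longrightarrow> (\<integral>x. h x * \<phi> x \<partial>lebesgue_on U) = 0"
    and V: "open V" "V \<subseteq> U"
  shows "(\<integral>x. indicator V x *\<^sub>R h x \<partial>lebesgue_on U) = 0"
proof -
  obtain \<phi> where \<phi>: "\<And>n. \<phi> n \<in> test_functions V"
    "\<And>n x. 0 \<le> \<phi> n x \<and> \<phi> n x \<le> 1" "\<And>x. (\<lambda>n. \<phi> n x) \<longlonglongrightarrow> indicator V x"
    using indicator_open_limit_test_functions[OF V(1)] by blast
  have \<phi>m: "\<phi> n \<in> borel_measurable (lebesgue_on U)" for n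
    using borel_measurable_continuous_onI[OF test_functions_continuous[OF \<phi>(1)]]
    by (intro measurable_restrict_space1 measurable_completion) simp
  have "(\<lambda>n. \<integral>x. h x * \<phi> n x \<partial>lebesgue_on U) \<longlonglongrightarrow> (\<integral>x. h x * indicator V x \<partial>lebesgue_on U)"
  proof (rule integral_dominated_convergence)
    have "indicat_real V \<in> borel_measurable (lebesgue_on U)"
      using V(1) by (intro measurable_restrict_space1 borel_measurable_indicator) auto
    then show "(\<lambda>x. h x * indicator V x) \<in> borel_measurable (lebesgue_on U)"
      by (rule borel_measurable_times[OF borel_measurable_integrable[OF h]])
    show "(\<lambda>x. h x * \<phi> n x) \<in> borel_measurable (lebesgue_on U)" for n
      by (rule borel_measurable_times[OF borel_measurable_integrable[OF h] \<phi>m])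
    show "integrable (lebesgue_on U) (\<lambda>x. \<bar>h x\<bar>)" using h by simp
    show "AE x in lebesgue_on U. (\<lambda>n. h x * \<phi> n x) \<longlonglongrightarrow> h x * indicator V x"
      by (intro AE_I2 tendsto_intros \<phi>)
    show "AE x in lebesgue_on U. norm (h x * \<phi> n x) \<le> \<bar>h x\<bar>" for n
      using \<phi>(2) by (auto simp: abs_mult intro!: mult_left_le)
  qed
  moreover have "(\<integral>x. h x * \<phi> n x \<partial>lebesgue_on U) = 0" for n
    using 0[OF test_functions_mono[OF \<phi>(1) V(2)]] .
  ultimately show ?thesis by (simp add: LIMSEQ_const_iff mult.commute)
qed

text \<open>The signed measure with density \<open>h\<close> vanishes on open sets because their
  indicators are bounded limits of test functions. A generator argument extends this to Borel sets,
  null sets to Lebesgue sets, and a density is determined by its integrals over sets.\<close>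

lemma AE_eq_0_if_test_functions:
  fixes h :: "'a::euclidean_space \<Rightarrow> real"
  assumes U: "open U" and h: "integrable (lebesgue_on U) h"
    and 0: "\<And>\<phi>. \<phi> \<in> test_functions U \<Longrightarrow> (\<integral>x. h x * \<phi> x \<partial>lebesgue_on U) = 0"
  shows "AE x in lebesgue_on U. h x = 0"
proof -
  let ?M = "lebesgue_on U"
  have Um: "U \<in> sets lebesgue" using U by simp
  have inM: "B \<in> sets lebesgue \<Longrightarrow> B \<inter> U \<in> sets ?M" for B
    using Um by (simp add: sets_restrict_space_iff)
  have cut: "(\<integral>x. indicator B x *\<^sub>R h x \<partial>?M) = (\<integral>x. indicator (B \<inter> U) x *\<^sub>R h x \<partial>?M)" for B
    by (intro Bochner_Integration.integral_cong) (auto simp: indicator_def)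
  have int: "integrable ?M (\<lambda>x. indicator B x *\<^sub>R h x)" if "B \<in> sets lebesgue" for B
  proof -
    have "integrable ?M (\<lambda>x. indicator (B \<inter> U) x *\<^sub>R h x)"
      using h inM[OF that] by (intro integrable_mult_indicator)
    then show ?thesis
      by (rule Bochner_Integration.integrable_cong[THEN iffD1, rotated 2]) (auto simp: indicator_def)
  qed
  have open0: "(\<integral>x. indicator V x *\<^sub>R h x \<partial>?M) = 0" if "open V" for V
    using integral_open_eq_0_if_test_functions[OF h 0, of "V \<inter> U"] that U cut[of V] by (simp add: open_Int)
  have tot: "(\<integral>x. h x \<partial>?M) = 0" using open0[of UNIV] by simp
  \<comment> \<open>The open sets are stable under intersection and generate the Borel sets.
    Complements are handled by the vanishing total integral, disjoint unions by countable
    additivity.\<close>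
  have borel0: "(\<integral>x. indicator B x *\<^sub>R h x \<partial>?M) = 0" if "B \<in> sets borel" for B
  proof -
    have Bs: "B \<in> sigma_sets UNIV {S. open S}" using that by (simp add: borel_def)
    have bl: "D \<in> sets lebesgue" if "D \<in> sigma_sets UNIV {S. open S}" for D
    proof -
      have "D \<in> sets borel" using that by (simp add: borel_def)
      then show ?thesis by simp
    qed
    have st: "Int_stable {S::'a set. open S}" by (auto simp: Int_stable_def open_Int)
    have pw: "{S::'a set. open S} \<subseteq> Pow UNIV" by simp
    show ?thesis
      using st pw Bs
    proof (induction rule: sigma_sets_induct_disjoint)
      case (basic A)
      then show ?case by (intro open0) simp
    next
      case empty
      then show ?case by simp
    next
      case (compl A)
      have "(\<integral>x. indicator (UNIV - A) x *\<^sub>R h x \<partial>?M) = (\<integral>x. h x - indicator A x *\<^sub>R h x \<partial>?M)"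
        by (intro Bochner_Integration.integral_cong) (auto simp: indicator_def)
      also have "\<dots> = 0"
        using h int[OF bl[OF compl(1)]] compl(2) tot by (subst Bochner_Integration.integral_diff) auto
      finally show ?case .
    next
      case (union A)
      have Al: "\<And>i. A i \<in> sets lebesgue" using union(2) bl by blast
      have "(LINT x:(\<Union>i. A i \<inter> U)|?M. h x) = (\<Sum>i. (LINT x:(A i \<inter> U)|?M. h x))"
      proof (rule lebesgue_integral_countable_add)
        show "\<And>i. A i \<inter> U \<in> sets ?M" using Al inM by blast
        show "\<And>i j. i \<noteq> j \<Longrightarrow> (A i \<inter> U) \<inter> (A j \<inter> U) = {}"
          using union(1) by (auto simp: disjoint_family_on_def)
        have "(\<Union>i. A i \<inter> U) \<in> sets ?M" using Al inM by blast
        then show "set_integrable ?M (\<Union>i. A i \<inter> U) h"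
          unfolding set_integrable_def using h by (intro integrable_mult_indicator)
      qed
      also have "\<dots> = 0" using union(3) cut[of "A _"] by (simp add: set_lebesgue_integral_def)
      finally show ?case using cut[of "\<Union>i. A i"] by (simp add: set_lebesgue_integral_def)
    qed
  qed
  show ?thesis
  proof (rule density_unique_real[OF h, of "\<lambda>x. 0"])
    fix B assume "B \<in> sets ?M"
    then have BL: "B \<in> sets lebesgue" using Um by (simp add: sets_restrict_space_iff)
    \<comment> \<open>A Lebesgue set differs from a Borel set by a null set, so the integral of
      \<open>h\<close> over it is already known.\<close>
    then obtain S N N' where SN: "B = S \<union> N" "N \<subseteq> N'" "N' \<in> null_sets lborel" "S \<in> sets lborel"
      by (rule sets_completionE)
    have "N' \<in> null_sets lebesgue" using SN(3) by (rule null_sets_completionI)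
    then have "AE x in lebesgue. x \<notin> N'" by (rule AE_not_in)
    then have "AE x in ?M. x \<notin> N'" using Um by (simp add: AE_restrict_space_iff) (auto elim: eventually_mono)
    then have "AE x in ?M. indicator B x *\<^sub>R h x = indicator S x *\<^sub>R h x"
      using SN(1,2) by (auto elim!: eventually_mono simp: indicator_def)
    then have "(\<integral>x. indicator B x *\<^sub>R h x \<partial>?M) = (\<integral>x. indicator S x *\<^sub>R h x \<partial>?M)"
      using int[OF BL] int[of S] SN(4) by (intro integral_cong_AE) auto
    then show "set_lebesgue_integral ?M B h = set_lebesgue_integral ?M B (\<lambda>x. 0)"
      using borel0[of S] SN(4) by (simp add: set_lebesgue_integral_def)
  qed simp
qed

subsection \<open>The Sobolev space H1 and the Riesz representation of symmetric forms\<close>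

lemma weak_gradient_L2: "weak_gradient \<Omega> y g \<Longrightarrow> g \<in> L2 \<Omega>"
  by (simp add: weak_gradient_def)

lemma L2_inner_const: "f \<in> L2 \<Omega> \<Longrightarrow> (\<lambda>x. f x \<bullet> v) \<in> L2 \<Omega>"
  by (rule L2_bound[where K = "norm v"])
    (auto dest: L2_measurable simp: mult.commute[of "norm v"] Cauchy_Schwarz_ineq2)

lemma weak_gradient_unique:
  assumes "open \<Omega>" "weak_gradient \<Omega> y g" "weak_gradient \<Omega> y g'"
  shows "AE x in lebesgue_on \<Omega>. g x = g' x"
proof -
  have gL: "g \<in> L2 \<Omega>" "g' \<in> L2 \<Omega>" using assms by (auto simp: weak_gradient_def)
  have "AE x in lebesgue_on \<Omega>. g x \<bullet> i - g' x \<bullet> i = 0" if i: "i \<in> Basis" for i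
  proof -
    have test: "(\<integral>x. (g x \<bullet> i - g' x \<bullet> i) * \<phi> x \<partial>lebesgue_on \<Omega>) = 0" if \<phi>: "\<phi> \<in> test_functions \<Omega>" for \<phi>
    proof -
      have \<phi>L: "\<phi> \<in> L2 \<Omega>" using assms(1) \<phi> by (intro test_functions_L2) auto
      have "(\<integral>x. (g x \<bullet> i - g' x \<bullet> i) * \<phi> x \<partial>lebesgue_on \<Omega>)
          = (\<integral>x. (g x \<bullet> i) * \<phi> x \<partial>lebesgue_on \<Omega>) - (\<integral>x. (g' x \<bullet> i) * \<phi> x \<partial>lebesgue_on \<Omega>)"
        using gL \<phi>L by (simp add: left_diff_distrib L2_mult_integrable L2_inner_const)
      also have "\<dots> = 0" using assms(2,3) \<phi> i unfolding weak_gradient_def by fastforce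
      finally show ?thesis .
    qed
    show ?thesis
    proof (cases "\<Omega> = {}")
      case False
      \<comment> \<open>\<Omega> may have infinite measure here, so an \<open>L\<^sup>2\<close>
        function need not be integrable on it. The fundamental lemma is therefore applied on each
        ball of a countable cover.\<close>
      obtain c r where V: "\<Omega> = (\<Union>k::nat. ball (c k) (r k))" "\<And>k. cball (c k) (r k) \<subseteq> \<Omega>"
        using open_eq_UN_ball[OF assms(1)] by blast
      let ?h = "\<lambda>x. g x \<bullet> i - g' x \<bullet> i"
      have hL: "?h \<in> L2 \<Omega>" using gL by (intro L2_diff L2_inner_const)
      have om: "\<Omega> \<in> sets lebesgue" using assms(1) by simp
      have "AE x in lebesgue. x \<in> ball (c k) (r k) \<longrightarrow> ?h x = 0" for k
      proof -
        let ?B = "ball (c k) (r k)"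
        have sub: "?B \<subseteq> \<Omega>" using V(2)[of k] ball_subset_cball by blast
        have h1: "?h \<in> borel_measurable (lebesgue_on ?B)"
          using L2_measurable[OF hL] sub by (rule measurable_restrict_mono)
        have ind: "indicat_real ?B \<in> L2 \<Omega>"
        proof (rule L2I)
          have "integrable lebesgue (\<lambda>x. indicator ?B x *\<^sub>R (1::real))"
            by (simp add: integrable_indicator_iff emeasure_bounded_finite[OF bounded_ball, unfolded infinity_ennreal_def])
          then have "integrable lebesgue (\<lambda>x. indicator \<Omega> x *\<^sub>R (indicator ?B x *\<^sub>R (1::real)))"
            by (rule integrable_mult_indicator[OF om])
          moreover have "(\<lambda>x. indicator \<Omega> x *\<^sub>R (indicator ?B x *\<^sub>R (1::real)))
              = (\<lambda>x. indicator \<Omega> x *\<^sub>R (norm (indicator ?B x :: real))\<^sup>2)"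
            by (auto simp: indicator_def fun_eq_iff)
          ultimately show "integrable (lebesgue_on \<Omega>) (\<lambda>x. (norm (indicator ?B x :: real))\<^sup>2)"
            using om by (subst integrable_restrict_space) simp_all
          show "indicat_real ?B \<in> borel_measurable (lebesgue_on \<Omega>)"
            by (intro measurable_restrict_space1 borel_measurable_indicator) auto
        qed
        have "integrable (lebesgue_on \<Omega>) (\<lambda>x. ?h x * indicator ?B x)"
          by (rule L2_mult_integrable[OF hL ind])
        then have "integrable lebesgue (\<lambda>x. indicator \<Omega> x *\<^sub>R (?h x * indicator ?B x))"
          using om by (simp add: integrable_restrict_space)
        moreover have "(\<lambda>x. indicator \<Omega> x *\<^sub>R (?h x * indicator ?B x)) = (\<lambda>x. indicator ?B x *\<^sub>R ?h x)"
          using sub by (auto simp: indicator_def fun_eq_iff)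
        ultimately have hint: "integrable (lebesgue_on ?B) ?h"
          by (simp add: integrable_restrict_space)
        have "AE x in lebesgue_on ?B. ?h x = 0"
        proof (rule AE_eq_0_if_test_functions[OF _ hint])
          fix \<phi> assume \<phi>: "\<phi> \<in> test_functions ?B"
          have z: "\<phi> x = 0" if "x \<notin> ?B" for x
            using that \<phi> closure_subset[of "{x. \<phi> x \<noteq> 0}"] by (auto simp: test_functions_def)
          have "(\<integral>x. ?h x * \<phi> x \<partial>lebesgue_on ?B) = (\<integral>x. indicator ?B x *\<^sub>R (?h x * \<phi> x) \<partial>lebesgue)"
            by (intro integral_restrict_space) auto
          also have "\<dots> = (\<integral>x. indicator \<Omega> x *\<^sub>R (?h x * \<phi> x) \<partial>lebesgue)"
            using z sub by (intro Bochner_Integration.integral_cong) (auto simp: indicator_def)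
          also have "\<dots> = (\<integral>x. ?h x * \<phi> x \<partial>lebesgue_on \<Omega>)"
            using om by (intro integral_restrict_space[symmetric]) auto
          also have "\<dots> = 0" by (rule test[OF test_functions_mono[OF \<phi> sub]])
          finally show "(\<integral>x. ?h x * \<phi> x \<partial>lebesgue_on ?B) = 0" .
        qed auto
        then show ?thesis by (simp add: AE_restrict_space_iff)
      qed
      then have "AE x in lebesgue. \<forall>k. x \<in> ball (c k) (r k) \<longrightarrow> ?h x = 0"
        unfolding AE_all_countable by (rule allI)
      then have "AE x in lebesgue. x \<in> \<Omega> \<longrightarrow> ?h x = 0"
        by eventually_elim (use V(1) in auto)
      then show ?thesis using om by (simp add: AE_restrict_space_iff)
    qed (simp add: AE_restrict_space_iff)
  qed
  then have "AE x in lebesgue_on \<Omega>. \<forall>i\<in>Basis. g x \<bullet> i - g' x \<bullet> i = 0"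
    by (intro AE_finite_allI) auto
  then show ?thesis by eventually_elim (auto intro: euclidean_eqI)
qed

lemma weak_gradient_add:
  assumes "open \<Omega>" "y \<in> L2 \<Omega>" "z \<in> L2 \<Omega>" "weak_gradient \<Omega> y g" "weak_gradient \<Omega> z h"
  shows "weak_gradient \<Omega> (\<lambda>x. y x + z x) (\<lambda>x. g x + h x)"
  unfolding weak_gradient_def
proof (intro conjI ballI)
  show gh: "(\<lambda>x. g x + h x) \<in> L2 \<Omega>" using assms by (intro L2_add weak_gradient_L2)
  fix \<phi> and i :: 'a assume \<phi>: "\<phi> \<in> test_functions \<Omega>" and i: "i \<in> Basis"
  have om: "\<Omega> \<in> sets lebesgue" using assms(1) by simp
  note \<phi>L = test_functions_L2(1)[OF om \<phi>] test_functions_L2(2)[OF om \<phi> i]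
  show "(\<integral>x. (y x + z x) * frechet_derivative \<phi> (at x) i \<partial>lebesgue_on \<Omega>) =
        - (\<integral>x. ((g x + h x) \<bullet> i) * \<phi> x \<partial>lebesgue_on \<Omega>)"
    using assms(2-5) \<phi>L \<phi> i unfolding weak_gradient_def
    by (simp add: distrib_right inner_add_left L2_mult_integrable L2_inner_const)
qed

lemma weak_gradient_mult_left:
  assumes "weak_gradient \<Omega> y g"
  shows "weak_gradient \<Omega> (\<lambda>x. c * y x) (\<lambda>x. c *\<^sub>R g x)"
  using assms by (auto simp: weak_gradient_def L2_scaleR mult.assoc)

lemma H1_L2: "y \<in> H1 \<Omega> \<Longrightarrow> y \<in> L2 \<Omega>"
  by (simp add: H1_def)

lemma weak_gradient_wgrad: "y \<in> H1 \<Omega> \<Longrightarrow> weak_gradient \<Omega> y (wgrad \<Omega> y)"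
  by (simp add: H1_def wgrad_def someI_ex)

lemma wgrad_L2: "y \<in> H1 \<Omega> \<Longrightarrow> wgrad \<Omega> y \<in> L2 \<Omega>"
  by (rule weak_gradient_L2[OF weak_gradient_wgrad])

lemma H1_I: "y \<in> L2 \<Omega> \<Longrightarrow> weak_gradient \<Omega> y g \<Longrightarrow> y \<in> H1 \<Omega>"
  by (auto simp: H1_def)

lemma H1_zero [simp]: "(\<lambda>x. 0) \<in> H1 \<Omega>"
  by (rule H1_I[where g = "\<lambda>x. 0"]) (auto simp: weak_gradient_def)

lemma H1_mult_left: "y \<in> H1 \<Omega> \<Longrightarrow> (\<lambda>x. c * y x) \<in> H1 \<Omega>"
  by (rule H1_I[OF L2_mult_left[OF H1_L2] weak_gradient_mult_left[OF weak_gradient_wgrad]])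

context
  fixes \<Omega> :: "'a::euclidean_space set"
  assumes open_dom: "open \<Omega>"
begin

text \<open>\<open>wgrad\<close> is an arbitrary choice, so even its linearity holds only almost
  everywhere, and uniqueness of the weak gradient is what provides it.\<close>

lemma wgrad_AE_eqI:
  assumes "y \<in> L2 \<Omega>" "weak_gradient \<Omega> y g"
  shows "AE x in lebesgue_on \<Omega>. wgrad \<Omega> y x = g x"
  by (rule weak_gradient_unique[OF open_dom weak_gradient_wgrad[OF H1_I[OF assms]] assms(2)])

lemma H1_add: "y \<in> H1 \<Omega> \<Longrightarrow> z \<in> H1 \<Omega> \<Longrightarrow> (\<lambda>x. y x + z x) \<in> H1 \<Omega>"
  by (rule H1_I[OF L2_add[OF H1_L2 H1_L2] weak_gradient_add[OF open_dom H1_L2 H1_L2]])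
    (auto intro: weak_gradient_wgrad)

lemma H1_diff: "y \<in> H1 \<Omega> \<Longrightarrow> z \<in> H1 \<Omega> \<Longrightarrow> (\<lambda>x. y x - z x) \<in> H1 \<Omega>"
  using H1_add[OF _ H1_mult_left[of z \<Omega> "-1"], of y] by simp

lemma wgrad_add: "y \<in> H1 \<Omega> \<Longrightarrow> z \<in> H1 \<Omega> \<Longrightarrow>
    AE x in lebesgue_on \<Omega>. wgrad \<Omega> (\<lambda>x. y x + z x) x = wgrad \<Omega> y x + wgrad \<Omega> z x"
  by (intro wgrad_AE_eqI L2_add H1_L2 weak_gradient_add open_dom weak_gradient_wgrad)

lemma wgrad_mult_left: "y \<in> H1 \<Omega> \<Longrightarrow>
    AE x in lebesgue_on \<Omega>. wgrad \<Omega> (\<lambda>x. c * y x) x = c *\<^sub>R wgrad \<Omega> y x"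
  by (intro wgrad_AE_eqI L2_mult_left H1_L2 weak_gradient_mult_left weak_gradient_wgrad)

lemma wgrad_diff:
  assumes "y \<in> H1 \<Omega>" "z \<in> H1 \<Omega>"
  shows "AE x in lebesgue_on \<Omega>. wgrad \<Omega> (\<lambda>x. y x - z x) x = wgrad \<Omega> y x - wgrad \<Omega> z x"
proof -
  have "AE x in lebesgue_on \<Omega>. wgrad \<Omega> (\<lambda>x. y x + -1 * z x) x = wgrad \<Omega> y x - wgrad \<Omega> z x"
    using wgrad_add[OF assms(1) H1_mult_left[OF assms(2), of "-1"]] wgrad_mult_left[OF assms(2), of "-1"]
    by eventually_elim simp
  then show ?thesis by simp
qed

lemma norm_H1_power2: "(norm_H1 \<Omega> y)\<^sup>2 = (norm_L2 \<Omega> y)\<^sup>2 + (norm_L2 \<Omega> (wgrad \<Omega> y))\<^sup>2"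
  by (simp add: norm_H1_def)

lemma norm_H1_nonneg [simp]: "0 \<le> norm_H1 \<Omega> y"
  by (simp add: norm_H1_def)

lemma norm_L2_le_H1: "norm_L2 \<Omega> y \<le> norm_H1 \<Omega> y"
  by (rule power2_le_imp_le) (auto simp: norm_H1_power2)

lemma norm_L2_wgrad_le_H1: "norm_L2 \<Omega> (wgrad \<Omega> y) \<le> norm_H1 \<Omega> y"
  by (rule power2_le_imp_le) (auto simp: norm_H1_power2)

lemma norm_H1_mult_left:
  assumes "y \<in> H1 \<Omega>"
  shows "norm_H1 \<Omega> (\<lambda>x. c * y x) = \<bar>c\<bar> * norm_H1 \<Omega> y"
proof -
  have "norm_L2 \<Omega> (wgrad \<Omega> (\<lambda>x. c * y x)) = norm_L2 \<Omega> (\<lambda>x. c *\<^sub>R wgrad \<Omega> y x)"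
    using assms by (intro norm_L2_cong_AE wgrad_L2 H1_mult_left L2_scaleR wgrad_mult_left)
  then have "(norm_H1 \<Omega> (\<lambda>x. c * y x))\<^sup>2 = (\<bar>c\<bar> * norm_H1 \<Omega> y)\<^sup>2"
    by (simp add: norm_H1_power2 norm_L2_scaleR norm_L2_mult_left power_mult_distrib distrib_left)
  then show ?thesis by (simp add: power2_eq_iff_nonneg)
qed

lemma norm_L2_wgrad_diff:
  assumes "y \<in> H1 \<Omega>" "z \<in> H1 \<Omega>"
  shows "norm_L2 \<Omega> (wgrad \<Omega> (\<lambda>x. y x - z x)) = norm_L2 \<Omega> (\<lambda>x. wgrad \<Omega> y x - wgrad \<Omega> z x)"
  using assms by (intro norm_L2_cong_AE wgrad_L2 H1_diff L2_diff wgrad_diff)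

text \<open>The weak gradient is a closed operator: the functions and their gradients converge
  separately in \<open>L\<^sup>2\<close>, and the defining identity, which pairs with fixed
  \<open>L\<^sup>2\<close> functions, survives the limit. The factor \<open>2\<close> generously
  bounds the square root of two from the two parts of the norm.\<close>

lemma H1_fast_Cauchy_convergent:
  fixes f :: "nat \<Rightarrow> 'a \<Rightarrow> real"
  assumes f: "\<And>n. f n \<in> H1 \<Omega>"
    and c: "\<And>n k. n \<le> k \<Longrightarrow> norm_H1 \<Omega> (\<lambda>x. f k x - f n x) \<le> (1/2)^n"
  shows "\<exists>g\<in>H1 \<Omega>. \<forall>n. norm_H1 \<Omega> (\<lambda>x. g x - f n x) \<le> 2 * (1/2)^n"
proof -
  have fL: "f n \<in> L2 \<Omega>" "wgrad \<Omega> (f n) \<in> L2 \<Omega>" for n using f by (auto intro: H1_L2 wgrad_L2)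
  have c1: "norm_L2 \<Omega> (\<lambda>x. f k x - f n x) \<le> (1/2)^n" if "n \<le> k" for n k
    using norm_L2_le_H1 c[OF that] by (rule order_trans)
  have c2: "norm_L2 \<Omega> (\<lambda>x. wgrad \<Omega> (f k) x - wgrad \<Omega> (f n) x) \<le> (1/2)^n" if "n \<le> k" for n k
    using norm_L2_wgrad_le_H1[of "\<lambda>x. f k x - f n x"] c[OF that] norm_L2_wgrad_diff[OF f f, of k n] by simp
  obtain g where g: "g \<in> L2 \<Omega>" "\<And>n. norm_L2 \<Omega> (\<lambda>x. g x - f n x) \<le> (1/2)^n"
    using L2_fast_Cauchy_convergent[of f, OF fL(1) c1] by blast
  obtain G where G: "G \<in> L2 \<Omega>" "\<And>n. norm_L2 \<Omega> (\<lambda>x. G x - wgrad \<Omega> (f n) x) \<le> (1/2)^n"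
    using L2_fast_Cauchy_convergent[of "\<lambda>n. wgrad \<Omega> (f n)", OF fL(2) c2] by blast
  have lim: "(\<lambda>n. inner_L2 \<Omega> (F n) \<theta>) \<longlonglongrightarrow> inner_L2 \<Omega> F0 \<theta>"
    if "\<And>n. F n \<in> L2 \<Omega>" "F0 \<in> L2 \<Omega>" "\<theta> \<in> L2 \<Omega>" "\<And>n. norm_L2 \<Omega> (\<lambda>x. F0 x - F n x) \<le> (1/2)^n"
    for F :: "nat \<Rightarrow> 'a \<Rightarrow> real" and F0 \<theta>
  proof -
    have "(\<lambda>n. (1/2)^n * norm_L2 \<Omega> \<theta>) \<longlonglongrightarrow> 0 * norm_L2 \<Omega> \<theta>"
      by (intro tendsto_intros LIMSEQ_power_zero) auto
    then have z: "(\<lambda>n. (1/2)^n * norm_L2 \<Omega> \<theta>) \<longlonglongrightarrow> 0" by simp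
    have "norm (inner_L2 \<Omega> (F n) \<theta> - inner_L2 \<Omega> F0 \<theta>) \<le> (1/2)^n * norm_L2 \<Omega> \<theta>" for n
    proof -
      have "norm (inner_L2 \<Omega> (F n) \<theta> - inner_L2 \<Omega> F0 \<theta>) = \<bar>inner_L2 \<Omega> (\<lambda>x. F0 x - F n x) \<theta>\<bar>"
        using that(1-3) by (simp add: inner_L2_diff_left)
      also have "\<dots> \<le> norm_L2 \<Omega> (\<lambda>x. F0 x - F n x) * norm_L2 \<Omega> \<theta>"
        using that(1-3) by (intro abs_inner_L2_le L2_diff)
      also have "\<dots> \<le> (1/2)^n * norm_L2 \<Omega> \<theta>" using that(4) by (intro mult_right_mono) auto
      finally show ?thesis .
    qed
    then have "(\<lambda>n. inner_L2 \<Omega> (F n) \<theta> - inner_L2 \<Omega> F0 \<theta>) \<longlonglongrightarrow> 0"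
      by (intro Lim_null_comparison[OF _ z]) auto
    then show ?thesis by (rule LIM_zero_cancel)
  qed
  have wg: "weak_gradient \<Omega> g G"
    unfolding weak_gradient_def
  proof (intro conjI ballI)
    fix \<phi> and i :: 'a assume \<phi>: "\<phi> \<in> test_functions \<Omega>" and i: "i \<in> Basis"
    have om: "\<Omega> \<in> sets lebesgue" using open_dom by simp
    note \<phi>L = test_functions_L2(1)[OF om \<phi>] test_functions_L2(2)[OF om \<phi> i]
    have "(\<lambda>n. inner_L2 \<Omega> (f n) (\<lambda>x. frechet_derivative \<phi> (at x) i)) \<longlonglongrightarrow>
        inner_L2 \<Omega> g (\<lambda>x. frechet_derivative \<phi> (at x) i)"
      using fL g \<phi>L by (intro lim) auto
    moreover have "(\<lambda>n. inner_L2 \<Omega> (\<lambda>x. wgrad \<Omega> (f n) x \<bullet> i) \<phi>) \<longlonglongrightarrow> inner_L2 \<Omega> (\<lambda>x. G x \<bullet> i) \<phi>"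
    proof (rule lim)
      fix n
      have L: "(\<lambda>x. G x - wgrad \<Omega> (f n) x) \<in> L2 \<Omega>" using G fL by (intro L2_diff)
      have "norm_L2 \<Omega> (\<lambda>x. G x \<bullet> i - wgrad \<Omega> (f n) x \<bullet> i) \<le> norm_L2 \<Omega> (\<lambda>x. G x - wgrad \<Omega> (f n) x)"
      proof (rule power2_le_imp_le)
        show "(norm_L2 \<Omega> (\<lambda>x. G x \<bullet> i - wgrad \<Omega> (f n) x \<bullet> i))\<^sup>2
            \<le> (norm_L2 \<Omega> (\<lambda>x. G x - wgrad \<Omega> (f n) x))\<^sup>2"
          unfolding norm_L2_power2_integral
        proof (rule integral_mono)
          show "integrable (lebesgue_on \<Omega>) (\<lambda>x. (norm (G x \<bullet> i - wgrad \<Omega> (f n) x \<bullet> i))\<^sup>2)"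
            using L2_integrable_sq[OF L2_inner_const[OF L, of i]] by (simp add: inner_diff_left)
          show "integrable (lebesgue_on \<Omega>) (\<lambda>x. (norm (G x - wgrad \<Omega> (f n) x))\<^sup>2)"
            by (rule L2_integrable_sq[OF L])
          show "(norm (G x \<bullet> i - wgrad \<Omega> (f n) x \<bullet> i))\<^sup>2 \<le> (norm (G x - wgrad \<Omega> (f n) x))\<^sup>2" for x
            using Basis_le_norm[OF i, of "G x - wgrad \<Omega> (f n) x"]
            by (intro power_mono) (auto simp: inner_diff_left)
        qed
      qed simp
      then show "norm_L2 \<Omega> (\<lambda>x. G x \<bullet> i - wgrad \<Omega> (f n) x \<bullet> i) \<le> (1/2)^n"
        using G(2)[of n] by linarith
    qed (use fL G \<phi>L in \<open>auto intro: L2_inner_const\<close>)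
    moreover have "inner_L2 \<Omega> (f n) (\<lambda>x. frechet_derivative \<phi> (at x) i)
        = - inner_L2 \<Omega> (\<lambda>x. wgrad \<Omega> (f n) x \<bullet> i) \<phi>" for n
      using weak_gradient_wgrad[OF f[of n]] \<phi> i by (auto simp: weak_gradient_def inner_L2_def)
    ultimately have "inner_L2 \<Omega> g (\<lambda>x. frechet_derivative \<phi> (at x) i) = - inner_L2 \<Omega> (\<lambda>x. G x \<bullet> i) \<phi>"
      by (auto intro: LIMSEQ_unique tendsto_minus)
    then show "(\<integral>x. g x * frechet_derivative \<phi> (at x) i \<partial>lebesgue_on \<Omega>) =
        - (\<integral>x. (G x \<bullet> i) * \<phi> x \<partial>lebesgue_on \<Omega>)" by (simp add: inner_L2_def)
  qed (rule G)
  have gH: "g \<in> H1 \<Omega>" using g(1) wg by (rule H1_I)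
  have "norm_H1 \<Omega> (\<lambda>x. g x - f n x) \<le> 2 * (1/2)^n" for n
  proof -
    have "norm_L2 \<Omega> (wgrad \<Omega> (\<lambda>x. g x - f n x)) = norm_L2 \<Omega> (\<lambda>x. G x - wgrad \<Omega> (f n) x)"
    proof (rule norm_L2_cong_AE)
      show "AE x in lebesgue_on \<Omega>. wgrad \<Omega> (\<lambda>x. g x - f n x) x = G x - wgrad \<Omega> (f n) x"
        using wgrad_diff[OF gH f[of n]] wgrad_AE_eqI[OF g(1) wg] by eventually_elim simp
    qed (use gH f G fL in \<open>auto intro: wgrad_L2 H1_diff L2_diff\<close>)
    then have "(norm_H1 \<Omega> (\<lambda>x. g x - f n x))\<^sup>2 \<le> ((1/2)^n)\<^sup>2 + ((1/2)^n)\<^sup>2"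
      unfolding norm_H1_power2 using g(2) G(2) by (intro add_mono power_mono) auto
    also have "\<dots> \<le> (2 * (1/2)^n)\<^sup>2" by (simp add: power2_eq_square)
    finally show ?thesis by (rule power2_le_imp_le) simp
  qed
  then show ?thesis using gH by blast
qed

end

text \<open>The representing element minimises \<open>a f f - 2 l f\<close>.\<close>

lemma symmetric_form_represents:
  fixes a :: "('x \<Rightarrow> real) \<Rightarrow> ('x \<Rightarrow> real) \<Rightarrow> real"
  assumes V0: "(\<lambda>x. 0) \<in> V"
    and V_add: "\<And>f g. f \<in> V \<Longrightarrow> g \<in> V \<Longrightarrow> (\<lambda>x. f x + g x) \<in> V"
    and V_mult: "\<And>f c. f \<in> V \<Longrightarrow> (\<lambda>x. c * f x) \<in> V"
    and a_add: "\<And>f g h. f \<in> V \<Longrightarrow> g \<in> V \<Longrightarrow> h \<in> V \<Longrightarrow> a (\<lambda>x. f x + g x) h = a f h + a g h"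
    and a_mult: "\<And>f h c. f \<in> V \<Longrightarrow> h \<in> V \<Longrightarrow> a (\<lambda>x. c * f x) h = c * a f h"
    and a_sym: "\<And>f g. f \<in> V \<Longrightarrow> g \<in> V \<Longrightarrow> a f g = a g f"
    and a_nonneg: "\<And>f. f \<in> V \<Longrightarrow> 0 \<le> a f f"
    and l_add: "\<And>f g. f \<in> V \<Longrightarrow> g \<in> V \<Longrightarrow> l (\<lambda>x. f x + g x) = l f + l g"
    and l_mult: "\<And>f c. f \<in> V \<Longrightarrow> l (\<lambda>x. c * f x) = c * l f"
    and l_bound: "\<And>f. f \<in> V \<Longrightarrow> l f \<le> K * sqrt (a f f)"
    and complete: "\<And>f :: nat \<Rightarrow> 'x \<Rightarrow> real. (\<And>n. f n \<in> V) \<Longrightarrow>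
      (\<And>n k. n \<le> k \<Longrightarrow> a (\<lambda>x. f k x - f n x) (\<lambda>x. f k x - f n x) \<le> (1/4)^n) \<Longrightarrow>
      \<exists>g\<in>V. (\<lambda>n. a (\<lambda>x. g x - f n x) (\<lambda>x. g x - f n x)) \<longlonglongrightarrow> 0"
  shows "\<exists>p\<in>V. \<forall>\<phi>\<in>V. a \<phi> p = l \<phi>"
proof -
  define J where "J f = a f f - 2 * l f" for f
  have a_add_r: "a h (\<lambda>x. f x + g x) = a h f + a h g" if "f \<in> V" "g \<in> V" "h \<in> V" for f g h
    using that by (simp add: a_sym[of h] V_add a_add)
  have a_mult_r: "a h (\<lambda>x. c * f x) = c * a h f" if "f \<in> V" "h \<in> V" for f h c
    using that by (simp add: a_sym[of h] V_mult a_mult)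
  have quad: "a (\<lambda>x. f x + s * g x) (\<lambda>x. f x + s * g x) = a f f + 2 * s * a f g + s\<^sup>2 * a g g"
    if "f \<in> V" "g \<in> V" for f g s
    using that by (simp add: a_add a_add_r a_mult a_mult_r V_add V_mult a_sym[of g f] power2_eq_square algebra_simps)
  have CS: "\<bar>a f g\<bar> \<le> sqrt (a f f) * sqrt (a g g)" if fg: "f \<in> V" "g \<in> V" for f g
  proof -
    have "s * a f g \<le> sqrt (a f f) * sqrt (a g g)" if s: "s = 1 \<or> s = -1" for s
    proof (rule le_mult_if_weighted)
      fix t :: real assume t: "t > 0"
      have "0 \<le> a (\<lambda>x. f x + (- s / t) * g x) (\<lambda>x. f x + (- s / t) * g x)"
        using fg by (intro a_nonneg V_add V_mult)
      also have "\<dots> = a f f - 2 * (s / t) * a f g + (s / t)\<^sup>2 * a g g"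
        using quad[OF fg, of "- s / t"] by simp
      finally have "0 \<le> t * (a f f - 2 * (s / t) * a f g + (s / t)\<^sup>2 * a g g)" using t by simp
      also have "\<dots> = t * a f f - 2 * (s * a f g) + a g g / t"
        using t s by (auto simp: field_simps power2_eq_square)
      finally show "2 * (s * a f g) \<le> t * (sqrt (a f f))\<^sup>2 + (sqrt (a g g))\<^sup>2 / t"
        using a_nonneg fg by simp
    qed (auto simp: a_nonneg fg)
    from this[of 1] this[of "-1"] show ?thesis by (simp add: abs_le_iff)
  qed
  have J_ge: "- K\<^sup>2 \<le> J f" if "f \<in> V" for f
  proof -
    have "0 \<le> (sqrt (a f f) - K)\<^sup>2" by simp
    also have "\<dots> = a f f - 2 * (K * sqrt (a f f)) + K\<^sup>2"
      using a_nonneg[OF that] by (simp add: power2_diff)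
    finally show ?thesis using l_bound[OF that] by (simp add: J_def)
  qed
  define d where "d = (INF f\<in>V. J f)"
  have bdd: "bdd_below (J ` V)" using J_ge by (intro bdd_belowI2)
  have d_le: "d \<le> J f" if "f \<in> V" for f unfolding d_def using bdd that by (rule cINF_lower)
  \<comment> \<open>This tolerance is tuned to the parallelogram estimate: the form of
    \<open>f k - f n\<close> is at most four times the larger tolerance, that is
    \<open>(1/4)^n\<close>.\<close>
  have "\<exists>f\<in>V. J f < d + (1/4)^n / 4" for n :: nat
  proof (rule ccontr)
    assume "\<not> ?thesis"
    then have "d + (1/4)^n / 4 \<le> d" unfolding d_def using V0 by (intro cINF_greatest) (auto simp: not_less)
    moreover have "(1/4::real)^n > 0" by simp
    ultimately show False by linarith
  qed
  then obtain f where f: "\<And>n::nat. f n \<in> V" "\<And>n. J (f n) < d + (1/4)^n / 4" by metis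
  have cauchy: "a (\<lambda>x. f k x - f n x) (\<lambda>x. f k x - f n x) \<le> (1/4)^n" if "n \<le> k" for n k
  proof -
    \<comment> \<open>The midpoint of two almost minimisers cannot lie below the infimum, and the
      parallelogram identity turns this into a bound on the form of their difference. The factor
      \<open>1\<close> matches \<open>quad\<close> with \<open>s = 1\<close>.\<close>
    let ?m = "\<lambda>x. (1/2) * (f k x + 1 * f n x)"
    have mV: "(\<lambda>x. f k x + 1 * f n x) \<in> V" using f(1) V_add[of "f k" "f n"] by simp
    have "d \<le> J ?m" using mV by (intro d_le V_mult)
    also have "J ?m = (1/4) * (a (f k) (f k) + 2 * a (f k) (f n) + a (f n) (f n)) - l (f k) - l (f n)"
      using quad[OF f(1) f(1), of k 1 n] l_add[OF f(1) f(1), of k n] mV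
      by (simp only: J_def l_mult a_mult a_mult_r V_mult) (simp add: add_divide_distrib)
    finally have "a (f k) (f k) - 2 * a (f k) (f n) + a (f n) (f n) \<le> 2 * (J (f k) - d) + 2 * (J (f n) - d)"
      unfolding J_def by (simp add: field_simps)
    also have "\<dots> \<le> 2 * ((1/4)^k / 4) + 2 * ((1/4)^n / 4)" using f(2)[of k] f(2)[of n] by simp
    also have "(1/4::real)^k \<le> (1/4)^n" using that by (intro power_decreasing) auto
    finally show ?thesis using quad[OF f(1) f(1), of k "-1" n] by simp
  qed
  obtain g where g: "g \<in> V" "(\<lambda>n. a (\<lambda>x. g x - f n x) (\<lambda>x. g x - f n x)) \<longlonglongrightarrow> 0"
    using complete[of f, OF f(1) cauchy] by blast
  have "a \<phi> g = l \<phi>" if \<phi>: "\<phi> \<in> V" for \<phi>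
  proof -
    have lim: "(\<lambda>n. a (f n) \<phi>) \<longlonglongrightarrow> a g \<phi>"
    proof -
      have "(\<lambda>n. sqrt (a (\<lambda>x. g x - f n x) (\<lambda>x. g x - f n x)) * sqrt (a \<phi> \<phi>)) \<longlonglongrightarrow> sqrt 0 * sqrt (a \<phi> \<phi>)"
        by (intro tendsto_intros g)
      moreover have "norm (a g \<phi> - a (f n) \<phi>) \<le> sqrt (a (\<lambda>x. g x - f n x) (\<lambda>x. g x - f n x)) * sqrt (a \<phi> \<phi>)" for n
      proof -
        have mV: "(\<lambda>x. (-1) * f n x) \<in> V" using f(1) by (rule V_mult)
        have "a (\<lambda>x. g x + (-1) * f n x) \<phi> = a g \<phi> - a (f n) \<phi>"
          using a_add[OF g(1) mV \<phi>] a_mult[OF f(1) \<phi>, of "-1" n] by simp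
        moreover have "(\<lambda>x. g x + (-1) * f n x) \<in> V" by (rule V_add[OF g(1) mV])
        ultimately show ?thesis using CS[OF _ \<phi>, of "\<lambda>x. g x + (-1) * f n x"] by simp
      qed
      ultimately have "(\<lambda>n. a g \<phi> - a (f n) \<phi>) \<longlonglongrightarrow> 0"
        by (intro Lim_null_comparison[of "\<lambda>n. a g \<phi> - a (f n) \<phi>"]) auto
      then have "(\<lambda>n. a g \<phi> - (a g \<phi> - a (f n) \<phi>)) \<longlonglongrightarrow> a g \<phi> - 0" by (intro tendsto_intros)
      then show ?thesis by simp
    qed
    \<comment> \<open>Almost minimality of \<open>f n\<close> against the perturbation
      \<open>s * \<phi>\<close>, passed to the limit; only the linear term depends on
      \<open>n\<close>, so \<open>J g\<close> never has to be computed.\<close>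
    have ineq: "0 \<le> 2 * s * (a g \<phi> - l \<phi>) + s\<^sup>2 * a \<phi> \<phi>" for s
    proof (rule tendsto_lowerbound)
      have "(\<lambda>n::nat. (1/4::real)^n / 4) \<longlonglongrightarrow> 0 / 4" by (intro tendsto_divide LIMSEQ_power_zero) auto
      then have "(\<lambda>n::nat. (1/4)^n / 4 + 2 * s * (a (f n) \<phi> - l \<phi>) + s\<^sup>2 * a \<phi> \<phi>) \<longlonglongrightarrow>
          0 / 4 + 2 * s * (a g \<phi> - l \<phi>) + s\<^sup>2 * a \<phi> \<phi>"
        by (intro tendsto_add tendsto_mult tendsto_diff tendsto_const lim)
      then show "(\<lambda>n::nat. (1/4)^n / 4 + 2 * s * (a (f n) \<phi> - l \<phi>) + s\<^sup>2 * a \<phi> \<phi>) \<longlonglongrightarrow>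
          2 * s * (a g \<phi> - l \<phi>) + s\<^sup>2 * a \<phi> \<phi>" by simp
      have "0 \<le> (1/4)^n / 4 + 2 * s * (a (f n) \<phi> - l \<phi>) + s\<^sup>2 * a \<phi> \<phi>" for n
      proof -
        have "d \<le> J (\<lambda>x. f n x + s * \<phi> x)" using f(1) \<phi> by (intro d_le V_add V_mult)
        also have "\<dots> = J (f n) + 2 * s * (a (f n) \<phi> - l \<phi>) + s\<^sup>2 * a \<phi> \<phi>"
          using quad[OF f(1) \<phi>, of n s] f(1) \<phi> by (simp add: J_def l_add l_mult V_mult algebra_simps)
        finally show ?thesis using f(2)[of n] by simp
      qed
      then show "\<forall>\<^sub>F n in sequentially. 0 \<le> (1/4)^n / 4 + 2 * s * (a (f n) \<phi> - l \<phi>) + s\<^sup>2 * a \<phi> \<phi>" by simp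
    qed simp
    \<comment> \<open>Up to the added \<open>1\<close>, the choice \<open>s = - X / A\<close>
      minimises the quadratic. The \<open>1\<close> keeps the quotient meaningful when the form
      vanishes at \<open>\<phi>\<close>.\<close>
    define X where "X = a g \<phi> - l \<phi>"
    define A where "A = a \<phi> \<phi> + 1"
    have "A > 0" using a_nonneg[OF \<phi>] by (simp add: A_def)
    have "0 \<le> 2 * (- X / A) * X + (- X / A)\<^sup>2 * a \<phi> \<phi>" using ineq[of "- X / A"] by (simp add: X_def)
    also have "\<dots> \<le> 2 * (- X / A) * X + (- X / A)\<^sup>2 * A" by (intro add_left_mono mult_left_mono) (auto simp: A_def)
    also have "\<dots> = - X\<^sup>2 / A" using \<open>A > 0\<close> by (simp add: power2_eq_square field_simps)
    finally have "X = 0" using \<open>A > 0\<close> by (simp add: divide_le_0_iff)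
    then show ?thesis using a_sym[OF \<phi> g(1)] by (simp add: X_def)
  qed
  then show ?thesis using g(1) by blast
qed

section \<open>Symmetry of the Hessian\<close>

lemma second_difference_eq:
  fixes A :: "'a::euclidean_space \<Rightarrow> real"
  assumes A: "\<And>p. GDERIV A p :> A' p" and A': "\<And>p. (A' has_derivative blinfun_apply (A'' p)) (at p)" and h: "h > 0"
  shows "\<exists>s t. s \<in> {0..h} \<and> t \<in> {0..h} \<and>
    A (p + h *\<^sub>R v + h *\<^sub>R w) - A (p + h *\<^sub>R v) - A (p + h *\<^sub>R w) + A p
      = h * h * (A'' (p + s *\<^sub>R v + t *\<^sub>R w) w \<bullet> v)"
proof -
  have dA: "((\<lambda>s. A (q + s *\<^sub>R v)) has_real_derivative (A' (q + s *\<^sub>R v) \<bullet> v)) (at s)" for q s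
  proof -
    have "((\<lambda>s. q + s *\<^sub>R v) has_derivative (\<lambda>r. r *\<^sub>R v)) (at s)" by (auto intro!: derivative_eq_intros)
    from has_derivative_compose[OF this A[unfolded gderiv_def]]
    show ?thesis by (simp add: has_field_derivative_def inner_commute mult.commute[of _ "_ \<bullet> _"])
  qed
  have dA': "((\<lambda>t. A' (q + t *\<^sub>R w) \<bullet> v) has_real_derivative (A'' (q + t *\<^sub>R w) w \<bullet> v)) (at t)" for q t
  proof -
    have "((\<lambda>t. q + t *\<^sub>R w) has_derivative (\<lambda>r. r *\<^sub>R w)) (at t)" by (auto intro!: derivative_eq_intros)
    from has_derivative_inner_left[OF has_derivative_compose[OF this A'], of v]
    show ?thesis by (simp add: has_field_derivative_def blinfun.scaleR_right mult.commute[of _ "_ \<bullet> _"])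
  qed
  obtain s where s: "0 < s" "s < h"
    "(A (p + h *\<^sub>R w + h *\<^sub>R v) - A (p + h *\<^sub>R v)) - (A (p + h *\<^sub>R w + 0 *\<^sub>R v) - A (p + 0 *\<^sub>R v))
      = (h - 0) * (A' (p + h *\<^sub>R w + s *\<^sub>R v) \<bullet> v - A' (p + s *\<^sub>R v) \<bullet> v)"
    using MVT2[OF h, of "\<lambda>s. A (p + h *\<^sub>R w + s *\<^sub>R v) - A (p + s *\<^sub>R v)"
        "\<lambda>s. A' (p + h *\<^sub>R w + s *\<^sub>R v) \<bullet> v - A' (p + s *\<^sub>R v) \<bullet> v"]
      DERIV_diff[OF dA dA] by blast
  obtain t where t: "0 < t" "t < h"
    "A' (p + s *\<^sub>R v + h *\<^sub>R w) \<bullet> v - A' (p + s *\<^sub>R v + 0 *\<^sub>R w) \<bullet> v = (h - 0) * (A'' (p + s *\<^sub>R v + t *\<^sub>R w) w \<bullet> v)"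
    using MVT2[OF h, of "\<lambda>t. A' (p + s *\<^sub>R v + t *\<^sub>R w) \<bullet> v"
        "\<lambda>t. A'' (p + s *\<^sub>R v + t *\<^sub>R w) w \<bullet> v"] dA' by blast
  have "A (p + h *\<^sub>R v + h *\<^sub>R w) - A (p + h *\<^sub>R v) - A (p + h *\<^sub>R w) + A p
      = h * h * (A'' (p + s *\<^sub>R v + t *\<^sub>R w) w \<bullet> v)"
    using s(3) t(3) by (simp add: algebra_simps)
  then show ?thesis using s(1,2) t(1,2) by (intro exI[of _ s] exI[of _ t]) auto
qed

text \<open>The second difference is symmetric in the two directions. Evaluating it by two mean
  value theorems in either order and letting the step shrink gives both mixed derivatives, by
  continuity of \<open>A''\<close>. Symmetry is what allows the adjoint equation to be solved by
  minimisation.\<close>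

lemma hessian_symmetric:
  fixes A :: "'a::euclidean_space \<Rightarrow> real"
  assumes A: "\<And>p. GDERIV A p :> A' p" and A': "\<And>p. (A' has_derivative blinfun_apply (A'' p)) (at p)"
    and cont: "continuous_on UNIV A''"
  shows "A'' p v \<bullet> w = A'' p w \<bullet> v"
proof -
  define h where "h n = inverse (real (Suc n))" for n
  have h0: "h n > 0" for n by (simp add: h_def)
  have hlim: "h \<longlonglongrightarrow> 0" unfolding h_def by (rule LIMSEQ_inverse_real_of_nat)
  have lim: "(\<lambda>n. A'' (p + s n *\<^sub>R v + t n *\<^sub>R w) x \<bullet> y) \<longlonglongrightarrow> A'' p x \<bullet> y"
    if "\<And>n. s n \<in> {0..h n}" "\<And>n. t n \<in> {0..h n}" for s t x y v w
  proof -
    have "s \<longlonglongrightarrow> 0" "t \<longlonglongrightarrow> 0"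
      using that by (auto intro!: tendsto_sandwich[OF _ _ tendsto_const hlim])
    then have "(\<lambda>n. p + s n *\<^sub>R v + t n *\<^sub>R w) \<longlonglongrightarrow> p + 0 *\<^sub>R v + 0 *\<^sub>R w" by (intro tendsto_intros)
    then have "(\<lambda>n. A'' (p + s n *\<^sub>R v + t n *\<^sub>R w)) \<longlonglongrightarrow> A'' p"
      using cont by (intro isCont_tendsto_compose[of _ A'']) (auto simp: continuous_on_eq_continuous_at)
    then show ?thesis by (intro tendsto_intros)
  qed
  have "\<forall>n. \<exists>s t. s \<in> {0..h n} \<and> t \<in> {0..h n} \<and>
    A (p + h n *\<^sub>R v + h n *\<^sub>R w) - A (p + h n *\<^sub>R v) - A (p + h n *\<^sub>R w) + A p
      = h n * h n * (A'' (p + s *\<^sub>R v + t *\<^sub>R w) w \<bullet> v)"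
    using second_difference_eq[OF A A' h0] by blast
  then obtain s t where st: "\<And>n. s n \<in> {0..h n}" "\<And>n. t n \<in> {0..h n}"
    "\<And>n. A (p + h n *\<^sub>R v + h n *\<^sub>R w) - A (p + h n *\<^sub>R v) - A (p + h n *\<^sub>R w) + A p
      = h n * h n * (A'' (p + s n *\<^sub>R v + t n *\<^sub>R w) w \<bullet> v)" by metis
  have "\<forall>n. \<exists>s t. s \<in> {0..h n} \<and> t \<in> {0..h n} \<and>
    A (p + h n *\<^sub>R w + h n *\<^sub>R v) - A (p + h n *\<^sub>R w) - A (p + h n *\<^sub>R v) + A p
      = h n * h n * (A'' (p + s *\<^sub>R w + t *\<^sub>R v) v \<bullet> w)"
    using second_difference_eq[OF A A' h0] by blast
  then obtain s' t' where st': "\<And>n. s' n \<in> {0..h n}" "\<And>n. t' n \<in> {0..h n}"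
    "\<And>n. A (p + h n *\<^sub>R w + h n *\<^sub>R v) - A (p + h n *\<^sub>R w) - A (p + h n *\<^sub>R v) + A p
      = h n * h n * (A'' (p + s' n *\<^sub>R w + t' n *\<^sub>R v) v \<bullet> w)" by metis
  have "A'' (p + s' n *\<^sub>R w + t' n *\<^sub>R v) v \<bullet> w = A'' (p + s n *\<^sub>R v + t n *\<^sub>R w) w \<bullet> v" for n
  proof -
    have "h n * h n * (A'' (p + s' n *\<^sub>R w + t' n *\<^sub>R v) v \<bullet> w) = h n * h n * (A'' (p + s n *\<^sub>R v + t n *\<^sub>R w) w \<bullet> v)"
    proof -
      have "p + h n *\<^sub>R w + h n *\<^sub>R v = p + h n *\<^sub>R v + h n *\<^sub>R w" by simp
      then show ?thesis using st(3)[of n] st'(3)[of n] by (simp only:)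
    qed
    then show ?thesis using h0[of n] by simp
  qed
  then show ?thesis
    using lim[OF st'(1,2), of w v v w] lim[OF st(1,2), of v w w v] by (simp add: LIMSEQ_unique)
qed

subsection \<open>Averages over a cone\<close>

text \<open>Dominated convergence for the difference quotients, which the mean value inequality
  bounds by \<open>B * \<bar>f\<bar>\<close>.\<close>

lemma has_real_derivative_integral:
  fixes f :: "'a \<Rightarrow> real"
  assumes f: "integrable M f" and c0: "c0 \<in> {a<..<b}"
    and int: "\<And>c. c \<in> {a<..<b} \<Longrightarrow> integrable M (\<lambda>y. f y * m c y)"
    and d: "\<And>c y. c \<in> {a<..<b} \<Longrightarrow> ((\<lambda>c. m c y) has_real_derivative m' c y) (at c)"
    and B: "\<And>c y. c \<in> {a<..<b} \<Longrightarrow> \<bar>m' c y\<bar> \<le> B"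
    and meas: "m' c0 \<in> borel_measurable M"
  shows "((\<lambda>c. \<integral>y. f y * m c y \<partial>M) has_real_derivative (\<integral>y. f y * m' c0 y \<partial>M)) (at c0)"
proof -
  have "(\<lambda>n. ((\<integral>y. f y * m (c0 + X n) y \<partial>M) - (\<integral>y. f y * m c0 y \<partial>M)) / X n)
      \<longlonglongrightarrow> (\<integral>y. f y * m' c0 y \<partial>M)" if X: "\<forall>i. X i \<noteq> 0" "X \<longlonglongrightarrow> 0" for X :: "nat \<Rightarrow> real"
  proof -
  have "(\<lambda>n. c0 + X n) \<longlonglongrightarrow> c0 + 0" by (intro tendsto_intros X)
  then have "\<forall>\<^sub>F n in sequentially. c0 + X n \<in> {a<..<b}"
    using c0 by (intro topological_tendstoD) auto
  then obtain N where N: "\<And>n. n \<ge> N \<Longrightarrow> c0 + X n \<in> {a<..<b}" by (auto simp: eventually_sequentially)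
  \<comment> \<open>Dropping the first terms keeps every sample point in the interval where the
    derivative is bounded; \<open>LIMSEQ_offset\<close> undoes the shift at the end.\<close>
  define Y where "Y n = X (n + N)" for n
  have Y0: "Y n \<noteq> 0" and Yin: "c0 + Y n \<in> {a<..<b}" for n using X N by (auto simp: Y_def)
  have Ylim: "Y \<longlonglongrightarrow> 0" unfolding Y_def using X(2) by (rule LIMSEQ_ignore_initial_segment)
  have "(\<lambda>n. \<integral>y. f y * ((m (c0 + Y n) y - m c0 y) / Y n) \<partial>M) \<longlonglongrightarrow> (\<integral>y. f y * m' c0 y \<partial>M)"
  proof (rule integral_dominated_convergence)
    show "(\<lambda>y. f y * m' c0 y) \<in> borel_measurable M"
      by (rule borel_measurable_times[OF borel_measurable_integrable[OF f] meas])
    have "(\<lambda>y. (f y * m (c0 + Y n) y - f y * m c0 y) / Y n) \<in> borel_measurable M" for n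
      using int[OF Yin] int[OF c0] by (intro borel_measurable_divide borel_measurable_diff) auto
    then show "(\<lambda>y. f y * ((m (c0 + Y n) y - m c0 y) / Y n)) \<in> borel_measurable M" for n
      by (simp add: right_diff_distrib diff_divide_distrib)
    show "integrable M (\<lambda>y. B * \<bar>f y\<bar>)" using f by simp
    show "AE y in M. (\<lambda>n. f y * ((m (c0 + Y n) y - m c0 y) / Y n)) \<longlonglongrightarrow> f y * m' c0 y"
    proof (intro AE_I2 tendsto_mult tendsto_const)
      fix y
      have "((\<lambda>h. (m (c0 + h) y - m c0 y) / h) \<longlongrightarrow> m' c0 y) (at 0)"
        using d[OF c0] by (simp add: DERIV_def)
      then show "(\<lambda>n. (m (c0 + Y n) y - m c0 y) / Y n) \<longlonglongrightarrow> m' c0 y"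
        using Ylim Y0 by (auto simp: tendsto_at_iff_sequentially comp_def)
    qed
    show "AE y in M. norm (f y * ((m (c0 + Y n) y - m c0 y) / Y n)) \<le> B * \<bar>f y\<bar>" for n
    proof (intro AE_I2)
      fix y
      have "norm (m (c0 + Y n) y - m c0 y) \<le> B * norm (c0 + Y n - c0)"
        using d B c0 Yin by (intro field_differentiable_bound[of "{a<..<b}" _ "\<lambda>c. m' c y"])
          (auto intro: has_field_derivative_at_within)
      then have "\<bar>(m (c0 + Y n) y - m c0 y) / Y n\<bar> \<le> B"
        using Y0[of n] by (simp add: abs_divide field_simps)
      then have "\<bar>f y\<bar> * \<bar>(m (c0 + Y n) y - m c0 y) / Y n\<bar> \<le> \<bar>f y\<bar> * B"
        by (rule mult_left_mono) simp
      then show "norm (f y * ((m (c0 + Y n) y - m c0 y) / Y n)) \<le> B * \<bar>f y\<bar>"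
        by (simp add: abs_mult mult.commute)
    qed
  qed
  moreover have "(\<integral>y. f y * ((m (c0 + Y n) y - m c0 y) / Y n) \<partial>M)
      = ((\<integral>y. f y * m (c0 + Y n) y \<partial>M) - (\<integral>y. f y * m c0 y \<partial>M)) / Y n" for n
    using int[OF Yin] int[OF c0] by (simp add: right_diff_distrib)
  ultimately have "(\<lambda>n. ((\<integral>y. f y * m (c0 + X (n + N)) y \<partial>M) - (\<integral>y. f y * m c0 y \<partial>M)) / X (n + N))
      \<longlonglongrightarrow> (\<integral>y. f y * m' c0 y \<partial>M)" by (simp only: Y_def)
  then show ?thesis by (rule LIMSEQ_offset)
  qed
  then show ?thesis
    by (auto simp: DERIV_def tendsto_at_iff_sequentially comp_def)
qed

text \<open>Centred at \<open>e\<close> and not at the origin: after scaling by \<open>c\<close> and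
  moving to \<open>x\<close>, the bump occupies a ball of radius \<open>\<rho> / c\<close> around
  \<open>x + (1 / c) *\<^sub>R e\<close>, hence a piece of the cone with vertex \<open>x\<close> and
  axis \<open>e\<close>.\<close>

definition cone_bump :: "'a::euclidean_space \<Rightarrow> real \<Rightarrow> 'a \<Rightarrow> real" where
  "cone_bump e \<rho> w = smooth_step (\<rho>\<^sup>2 - (norm (w - e))\<^sup>2)"

lemma cone_bump_bounds: "0 \<le> cone_bump e \<rho> w" "cone_bump e \<rho> w \<le> 1"
  by (auto simp: cone_bump_def smooth_step_bounds)

lemma cone_bump_eq_0: "\<rho> > 0 \<Longrightarrow> w \<notin> ball e \<rho> \<Longrightarrow> cone_bump e \<rho> w = 0"
  unfolding cone_bump_def
  by (intro smooth_step_nonpos) (auto simp: dist_norm norm_minus_commute intro!: power_mono)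

lemma cone_bump_pos: "w \<in> ball e \<rho> \<Longrightarrow> cone_bump e \<rho> w > 0"
  unfolding cone_bump_def smooth_step_pos_iff
  by (auto simp: dist_norm norm_minus_commute intro!: power_strict_mono)

lemma C_k_cone_bump: "C_k k (cone_bump e \<rho>)"
  unfolding cone_bump_def[abs_def] by (intro C_k_smooth_step C_k_diff C_k_const C_k_norm_sq)

lemma cone_bump_test: "\<rho> > 0 \<Longrightarrow> cone_bump e \<rho> \<in> test_functions UNIV"
  by (rule test_functionsI[where K = "cball e \<rho>"]) (auto simp: C_k_cone_bump cone_bump_eq_0)

lemma cone_bump_continuous: "continuous_on UNIV (cone_bump e \<rho>)"
  using C_k_cone_bump[of 0 e \<rho>] by simp

lemma cone_bump_measurable [measurable]: "cone_bump e \<rho> \<in> borel_measurable borel"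
  using cone_bump_continuous by (rule borel_measurable_continuous_onI)

lemma cone_bump_has_derivative:
  "(cone_bump e \<rho> has_derivative frechet_derivative (cone_bump e \<rho>) (at w)) (at w)"
  by (rule C_k_SucD(1)[OF C_k_cone_bump[of "Suc 0"]])

lemma frechet_derivative_cone_bump_scaleR:
  "frechet_derivative (cone_bump e \<rho>) (at w) (c *\<^sub>R h) = c * frechet_derivative (cone_bump e \<rho>) (at w) h"
  using linear_cmul[OF has_derivative_linear[OF cone_bump_has_derivative]] by simp

text \<open>The divergence of \<open>w \<mapsto> \<eta> w *\<^sub>R w\<close> for the bump \<open>\<eta>\<close>.\<close>

definition cone_div :: "'a::euclidean_space \<Rightarrow> real \<Rightarrow> 'a \<Rightarrow> real" where
  "cone_div e \<rho> w = real DIM('a) * cone_bump e \<rho> w + frechet_derivative (cone_bump e \<rho>) (at w) w"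

lemma frechet_derivative_cone_bump_eq_sum:
  "frechet_derivative (cone_bump e \<rho>) (at w) h = (\<Sum>i\<in>Basis. (h \<bullet> i) * frechet_derivative (cone_bump e \<rho>) (at w) i)"
proof -
  have lin: "linear (frechet_derivative (cone_bump e \<rho>) (at w))"
    using has_derivative_linear[OF cone_bump_has_derivative] .
  have "frechet_derivative (cone_bump e \<rho>) (at w) h
      = frechet_derivative (cone_bump e \<rho>) (at w) (\<Sum>i\<in>Basis. (h \<bullet> i) *\<^sub>R i)"
    by (simp add: euclidean_representation)
  also have "\<dots> = (\<Sum>i\<in>Basis. (h \<bullet> i) * frechet_derivative (cone_bump e \<rho>) (at w) i)"
    by (simp add: linear_sum[OF lin] linear_cmul[OF lin])
  finally show ?thesis .
qed

lemma cone_div_continuous: fixes e :: "'a::euclidean_space" shows "continuous_on UNIV (cone_div e \<rho>)"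
proof -
  have "continuous_on UNIV (\<lambda>w. frechet_derivative (cone_bump e \<rho>) (at w) i)" if "i \<in> Basis" for i
    using C_k_SucD(2)[OF C_k_cone_bump[of "Suc 0"] that] by simp
  then have "continuous_on UNIV (\<lambda>w. real DIM('a) * cone_bump e \<rho> w
      + (\<Sum>i\<in>Basis. (w \<bullet> i) * frechet_derivative (cone_bump e \<rho>) (at w) i))"
    by (intro continuous_intros cone_bump_continuous)
  also have "(\<lambda>w. real DIM('a) * cone_bump e \<rho> w
      + (\<Sum>i\<in>Basis. (w \<bullet> i) * frechet_derivative (cone_bump e \<rho>) (at w) i)) = cone_div e \<rho>"
    by (simp add: fun_eq_iff cone_div_def frechet_derivative_cone_bump_eq_sum[symmetric])
  finally show ?thesis .
qed

lemma cone_div_measurable [measurable]: "cone_div e \<rho> \<in> borel_measurable borel"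
  using cone_div_continuous by (rule borel_measurable_continuous_onI)

lemma cone_div_bounded:
  assumes "\<rho> > 0"
  obtains B where "B > 0" "\<And>w. \<bar>cone_div e \<rho> w\<bar> \<le> B"
proof -
  have "cone_div e \<rho> w = 0" if w: "w \<notin> cball e \<rho>" for w
  proof -
    have "closure {w. cone_bump e \<rho> w \<noteq> 0} \<subseteq> cball e \<rho>"
      using cone_bump_eq_0[OF assms, of _ e] ball_subset_cball[of e \<rho>] by (intro closure_minimal) blast+
    then have "frechet_derivative (cone_bump e \<rho>) (at w) w = 0"
      using w by (intro test_functions_frechet_eq_0[OF cone_bump_test[OF assms]]) auto
    moreover have "cone_bump e \<rho> w = 0" using w by (intro cone_bump_eq_0[OF assms]) auto
    ultimately show ?thesis by (simp add: cone_div_def)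
  qed
  then show thesis
    using that by (rule continuous_compact_support_bounded[OF cone_div_continuous compact_cball])
qed

text \<open>The product rule yields \<open>d * c^(d-1) * bump + c^d * D bump z\<close>, and pulling
  out \<open>c^(d-1)\<close> leaves exactly the divergence of \<open>\<eta> w *\<^sub>R w\<close> at
  \<open>w = c *\<^sub>R z\<close>. So differentiating an average in the scale can be followed by an
  integration by parts.\<close>

lemma cone_bump_scaled_has_derivative:
  fixes z :: "'a::euclidean_space"
  shows "((\<lambda>c. c ^ DIM('a) * cone_bump e \<rho> (c *\<^sub>R z)) has_real_derivative
      c ^ (DIM('a) - 1) * cone_div e \<rho> (c *\<^sub>R z)) (at c)"
proof -
  have "((\<lambda>c. c *\<^sub>R z) has_derivative (\<lambda>r. r *\<^sub>R z)) (at c)" by (auto intro!: derivative_eq_intros)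
  note * = has_derivative_compose[OF this cone_bump_has_derivative[of e \<rho>]]
  have 1: "((\<lambda>c. cone_bump e \<rho> (c *\<^sub>R z)) has_real_derivative frechet_derivative (cone_bump e \<rho>) (at (c *\<^sub>R z)) z) (at c)"
    using * by (simp add: has_field_derivative_def frechet_derivative_cone_bump_scaleR mult_commute_abs)
  have 2: "((\<lambda>c. c ^ DIM('a)) has_real_derivative real DIM('a) * c ^ (DIM('a) - 1)) (at c)"
    by (auto intro!: derivative_eq_intros)
  have "c ^ DIM('a) = c ^ (DIM('a) - 1) * c"
    by (metis DIM_positive Suc_diff_1 power_Suc2)
  then show ?thesis
    using DERIV_mult[OF 2 1] by (simp add: cone_div_def frechet_derivative_cone_bump_scaleR algebra_simps)
qed

lemma C_k_cone_test: "C_k k (\<lambda>y. ((y - x) \<bullet> i) * cone_bump e \<rho> (c *\<^sub>R (y - x)))"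
  by (simp only: inner_diff_left)
    (intro C_k_mult C_k_diff C_k_inner C_k_const C_k_scale_shift[OF C_k_cone_bump])

lemma cone_test_frechet_derivative:
  fixes x y i :: "'a::euclidean_space"
  assumes "i \<in> Basis"
  shows "frechet_derivative (\<lambda>y. ((y - x) \<bullet> i) * cone_bump e \<rho> (c *\<^sub>R (y - x))) (at y) i
    = cone_bump e \<rho> (c *\<^sub>R (y - x))
      + ((c *\<^sub>R (y - x)) \<bullet> i) * frechet_derivative (cone_bump e \<rho>) (at (c *\<^sub>R (y - x))) i"
proof -
  have "((\<lambda>y. c *\<^sub>R (y - x)) has_derivative (\<lambda>h. c *\<^sub>R h)) (at y)" by (auto intro!: derivative_eq_intros)
  note 1 = has_derivative_compose[OF this cone_bump_has_derivative]
  have 2: "((\<lambda>y. (y - x) \<bullet> i) has_derivative (\<lambda>h. h \<bullet> i)) (at y)" by (auto intro!: derivative_eq_intros)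
  show ?thesis
    using assms by (subst frechet_derivative_at[OF has_derivative_mult[OF 2 1], symmetric])
      (simp add: frechet_derivative_cone_bump_scaleR inner_Basis)
qed

text \<open>The same function \<open>cone_div\<close> is the divergence in \<open>y\<close> of the
  field \<open>(y - x)\<close> times the bump. Its components are test functions, so the weak
  gradient can be inserted componentwise.\<close>

lemma cone_test_divergence:
  fixes x y :: "'a::euclidean_space"
  shows "(\<Sum>i\<in>Basis. frechet_derivative (\<lambda>y. ((y - x) \<bullet> i) * cone_bump e \<rho> (c *\<^sub>R (y - x))) (at y) i)
    = cone_div e \<rho> (c *\<^sub>R (y - x))"
  by (simp add: cone_test_frechet_derivative sum.distrib cone_div_def
      frechet_derivative_cone_bump_eq_sum[of _ _ "c *\<^sub>R (y - x)" "c *\<^sub>R (y - x)"])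

text \<open>Cauchy-Schwarz against the indicator of \<open>B\<close>.\<close>

lemma integral_abs_sq_le_measure:
  fixes u :: "'a::euclidean_space \<Rightarrow> real"
  assumes [measurable]: "u \<in> borel_measurable borel" "B \<in> sets borel" and u2: "integrable lborel (\<lambda>y. (u y)\<^sup>2)"
    and B: "emeasure lborel B < \<infinity>"
  shows "integrable lborel (\<lambda>y. indicator B y * \<bar>u y\<bar>)"
    and "(\<integral>y. indicator B y * \<bar>u y\<bar> \<partial>lborel)\<^sup>2 \<le> measure lborel B * (\<integral>y. indicator B y * (u y)\<^sup>2 \<partial>lborel)"
proof -
  have i1: "integrable lborel (indicat_real B)" using B by (simp add: integrable_indicator_iff)
  have i2: "integrable lborel (\<lambda>y. indicator B y * (u y)\<^sup>2)"
    using integrable_mult_indicator[OF _ u2, of B] by simp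
  have pt: "2 * (indicator B y * \<bar>u y\<bar>) \<le> t * indicator B y + indicator B y * (u y)\<^sup>2 / t" if "t > 0" for t y
  proof -
    have "0 \<le> (t - \<bar>u y\<bar>)\<^sup>2 / t" using that by simp
    also have "\<dots> = t - 2 * \<bar>u y\<bar> + (u y)\<^sup>2 / t" using that by (simp add: power2_diff field_simps power2_eq_square)
    finally show ?thesis by (auto simp: indicator_def)
  qed
  show i3: "integrable lborel (\<lambda>y. indicator B y * \<bar>u y\<bar>)"
  proof (rule Bochner_Integration.integrable_bound[OF Bochner_Integration.integrable_add[OF i1 i2]])
    show "AE y in lborel. norm (indicator B y * \<bar>u y\<bar>) \<le> norm (indicat_real B y + indicator B y * (u y)\<^sup>2)"
    proof (intro AE_I2)
      fix y
      have "0 \<le> indicator B y * \<bar>u y\<bar>" "0 \<le> indicat_real B y + indicator B y * (u y)\<^sup>2" by simp_all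
      then show "norm (indicator B y * \<bar>u y\<bar>) \<le> norm (indicat_real B y + indicator B y * (u y)\<^sup>2)"
        using pt[of 1 y] unfolding real_norm_def by linarith
    qed
  qed simp
  have "(\<integral>y. indicator B y * \<bar>u y\<bar> \<partial>lborel)
      \<le> sqrt (measure lborel B) * sqrt (\<integral>y. indicator B y * (u y)\<^sup>2 \<partial>lborel)"
  proof (rule le_mult_if_weighted)
    fix t :: real assume t: "t > 0"
    have "2 * (\<integral>y. indicator B y * \<bar>u y\<bar> \<partial>lborel) = (\<integral>y. 2 * (indicator B y * \<bar>u y\<bar>) \<partial>lborel)" by simp
    also have "\<dots> \<le> (\<integral>y. t * indicator B y + indicator B y * (u y)\<^sup>2 / t \<partial>lborel)"
      using i1 i2 i3 pt[OF t] by (intro integral_mono) auto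
    also have "\<dots> = t * measure lborel B + (\<integral>y. indicator B y * (u y)\<^sup>2 \<partial>lborel) / t"
      using i1 i2 by simp
    finally show "2 * (\<integral>y. indicator B y * \<bar>u y\<bar> \<partial>lborel)
      \<le> t * (sqrt (measure lborel B))\<^sup>2 + (sqrt (\<integral>y. indicator B y * (u y)\<^sup>2 \<partial>lborel))\<^sup>2 / t"
      by (simp add: integral_nonneg)
  qed (auto simp: integral_nonneg)
  then have "(\<integral>y. indicator B y * \<bar>u y\<bar> \<partial>lborel)\<^sup>2
      \<le> (sqrt (measure lborel B) * sqrt (\<integral>y. indicator B y * (u y)\<^sup>2 \<partial>lborel))\<^sup>2"
    by (intro power_mono) (auto simp: integral_nonneg)
  then show "(\<integral>y. indicator B y * \<bar>u y\<bar> \<partial>lborel)\<^sup>2 \<le> measure lborel B * (\<integral>y. indicator B y * (u y)\<^sup>2 \<partial>lborel)"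
    by (simp add: power_mult_distrib integral_nonneg)
qed

text \<open>The length scale is \<open>1 / c\<close>. All points of \<open>P\<close> share the axis
  \<open>e\<close>, the opening \<open>\<rho>\<close> and the largest admissible scale
  \<open>1 / c0\<close>, which makes the estimates on \<open>P\<close> uniform.\<close>

locale cone_patch =
  fixes \<Omega> P :: "'a::euclidean_space set" and e :: 'a and \<rho> c0 :: real
  assumes open_dom: "open \<Omega>" and bounded_dom: "bounded \<Omega>" and open_P: "open P" and P_sub: "P \<subseteq> \<Omega>"
    and norm_e: "norm e = 1" and \<rho>: "0 < \<rho>" "\<rho> \<le> 1" and c0: "0 < c0"
    and cone: "\<And>x c w. x \<in> P \<Longrightarrow> c0 \<le> c \<Longrightarrow> w \<in> cball e \<rho> \<Longrightarrow> x + (1 / c) *\<^sub>R w \<in> \<Omega>"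
begin

abbreviation bump :: "'a \<Rightarrow> real" where "bump \<equiv> cone_bump e \<rho>"

text \<open>The number \<open>2\<close> bounds \<open>norm e + \<rho>\<close>, so the support lies
  in a ball around the vertex \<open>x\<close> itself.\<close>

lemma bump_eq_0: "c > 0 \<Longrightarrow> y \<notin> cball x (2 / c) \<Longrightarrow> bump (c *\<^sub>R (y - x)) = 0"
proof (rule cone_bump_eq_0[OF \<rho>(1)])
  assume c: "c > 0" and y: "y \<notin> cball x (2 / c)"
  show "c *\<^sub>R (y - x) \<notin> ball e \<rho>"
  proof
    assume "c *\<^sub>R (y - x) \<in> ball e \<rho>"
    then have "norm (c *\<^sub>R (y - x)) \<le> 2"
      using norm_triangle_ineq2[of "c *\<^sub>R (y - x)" e] norm_e \<rho>(2) by (simp add: dist_norm norm_minus_commute)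
    then have "c * norm (y - x) \<le> 2" using c by simp
    then have "norm (y - x) \<le> 2 / c" using c by (simp add: field_simps)
    then show False using y by (simp add: dist_norm norm_minus_commute)
  qed
qed

lemma cone_test_function:
  assumes "x \<in> P" "c0 \<le> c"
  shows "(\<lambda>y. ((y - x) \<bullet> i) * bump (c *\<^sub>R (y - x))) \<in> test_functions \<Omega>"
proof (rule test_functionsI)
  have c: "c > 0" using assms c0 by simp
  show "C_k k (\<lambda>y. ((y - x) \<bullet> i) * bump (c *\<^sub>R (y - x)))" for k by (rule C_k_cone_test)
  show "compact ((\<lambda>w. x + (1 / c) *\<^sub>R w) ` cball e \<rho>)"
    by (intro compact_continuous_image continuous_intros) auto
  show "(\<lambda>w. x + (1 / c) *\<^sub>R w) ` cball e \<rho> \<subseteq> \<Omega>" using cone[OF assms] by blast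
  fix y assume y: "y \<notin> (\<lambda>w. x + (1 / c) *\<^sub>R w) ` cball e \<rho>"
  have "y = x + (1 / c) *\<^sub>R (c *\<^sub>R (y - x))" using c by simp
  then have "c *\<^sub>R (y - x) \<notin> cball e \<rho>" using y by blast
  then show "((y - x) \<bullet> i) * bump (c *\<^sub>R (y - x)) = 0"
    using cone_bump_eq_0[OF \<rho>(1), of "c *\<^sub>R (y - x)" e] ball_subset_cball by auto
qed

end

text \<open>Borel functions on the whole space make products measurable and Fubini applicable. The
  extension of \<open>f\<close> by zero is in general not weakly differentiable on the whole space,
  so \<open>weak\<close> is demanded only for test functions supported in \<Omega>.\<close>

locale weakly_differentiable_on_patch = cone_patch +
  fixes f :: "'a \<Rightarrow> real" and g :: "'a \<Rightarrow> 'a"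
  assumes f_meas [measurable]: "f \<in> borel_measurable borel" and g_meas [measurable]: "g \<in> borel_measurable borel"
    and f_outside: "\<And>x. x \<notin> \<Omega> \<Longrightarrow> f x = 0"
    and f_sq: "integrable lborel (\<lambda>x. (f x)\<^sup>2)" and g_sq: "integrable lborel (\<lambda>x. (norm (g x))\<^sup>2)"
    and weak: "\<And>\<phi> i. \<phi> \<in> test_functions \<Omega> \<Longrightarrow> i \<in> Basis \<Longrightarrow>
      (\<integral>x. f x * frechet_derivative \<phi> (at x) i \<partial>lborel) = - (\<integral>x. (g x \<bullet> i) * \<phi> x \<partial>lborel)"
begin

text \<open>The power of \<open>c\<close> makes the total mass of the kernel independent of
  \<open>c\<close>, but it is not normalised to one: the averages approach a fixed multiple of
  \<open>f\<close>.\<close>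

definition avg :: "real \<Rightarrow> 'a \<Rightarrow> real" where
  "avg c x = (\<integral>y. f y * (c ^ DIM('a) * bump (c *\<^sub>R (y - x))) \<partial>lborel)"

text \<open>The ball of radius \<open>2 / c\<close> contains the supports of the kernels for all
  scales between \<open>c\<close> and \<open>2 * c\<close>.\<close>

definition local_energy :: "real \<Rightarrow> 'a \<Rightarrow> real" where
  "local_energy c x = (\<integral>y. indicator (cball x (2 / c)) y * (norm (g y))\<^sup>2 \<partial>lborel)"

lemma measure_dom_finite: "emeasure lborel \<Omega> < \<infinity>"
  using bounded_dom by (rule emeasure_bounded_finite)

lemma dom_sets [measurable]: "\<Omega> \<in> sets borel" using open_dom by simp

lemma f_eq_indicator: "indicator \<Omega> y * \<bar>f y\<bar> = \<bar>f y\<bar>" "indicator \<Omega> y * (f y)\<^sup>2 = (f y)\<^sup>2"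
  using f_outside[of y] by (auto simp: indicator_def)

lemma f_integrable: "integrable lborel f"
  using integral_abs_sq_le_measure(1)[OF f_meas dom_sets f_sq measure_dom_finite]
  by (simp add: f_eq_indicator integrable_abs_iff)

lemma integral_abs_f_sq: "(\<integral>y. \<bar>f y\<bar> \<partial>lborel)\<^sup>2 \<le> measure lborel \<Omega> * (\<integral>y. (f y)\<^sup>2 \<partial>lborel)"
  using integral_abs_sq_le_measure(2)[OF f_meas dom_sets f_sq measure_dom_finite]
  by (simp add: f_eq_indicator)

lemma f_mult_integrable:
  assumes [measurable]: "h \<in> borel_measurable borel" and "\<And>y. \<bar>h y\<bar> \<le> B"
  shows "integrable lborel (\<lambda>y. f y * h y)"
proof (rule Bochner_Integration.integrable_bound)
  show "integrable lborel (\<lambda>y. B * f y)" using f_integrable by simp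
  have "\<bar>f y\<bar> * \<bar>h y\<bar> \<le> \<bar>f y\<bar> * \<bar>B\<bar>" for y using assms(2)[of y] by (intro mult_left_mono) auto
  then show "AE y in lborel. norm (f y * h y) \<le> norm (B * f y)" by (simp add: abs_mult mult.commute)
qed simp

lemma avg_bound:
  assumes "c > 0"
  shows "\<bar>avg c x\<bar> \<le> c ^ DIM('a) * (\<integral>y. \<bar>f y\<bar> \<partial>lborel)"
proof -
  have b: "\<bar>f y * (c ^ DIM('a) * bump (c *\<^sub>R (y - x)))\<bar> \<le> c ^ DIM('a) * \<bar>f y\<bar>" for y
    using cone_bump_bounds[of e \<rho> "c *\<^sub>R (y - x)"] assms
    by (auto simp: abs_mult mult.commute intro!: mult_left_mono mult_left_le)
  have i: "integrable lborel (\<lambda>y. f y * (c ^ DIM('a) * bump (c *\<^sub>R (y - x))))"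
    using assms cone_bump_bounds[of e \<rho>]
    by (intro f_mult_integrable[of _ "c ^ DIM('a)"]) (auto simp: abs_mult intro!: mult_left_le)
  have "\<bar>avg c x\<bar> \<le> (\<integral>y. c ^ DIM('a) * \<bar>f y\<bar> \<partial>lborel)"
    unfolding avg_def by (rule integral_abs_bound_integral) (use b i f_integrable in auto)
  then show ?thesis by simp
qed

lemma avg_bound_sq:
  assumes "c > 0"
  shows "(avg c x)\<^sup>2 \<le> (c ^ DIM('a))\<^sup>2 * (measure lborel \<Omega> * (\<integral>y. (f y)\<^sup>2 \<partial>lborel))"
proof -
  have "(avg c x)\<^sup>2 = \<bar>avg c x\<bar>\<^sup>2" by simp
  also have "\<dots> \<le> (c ^ DIM('a) * (\<integral>y. \<bar>f y\<bar> \<partial>lborel))\<^sup>2" using avg_bound[OF assms] by (intro power_mono) auto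
  also have "\<dots> \<le> (c ^ DIM('a))\<^sup>2 * (measure lborel \<Omega> * (\<integral>y. (f y)\<^sup>2 \<partial>lborel))"
    unfolding power_mult_distrib by (intro mult_left_mono integral_abs_f_sq) auto
  finally show ?thesis .
qed

text \<open>Differentiating under the integral sign gives a divergence tested with \<open>f\<close>.
  The field has compact support in \<Omega> by the cone condition, so the weak gradient replaces it
  without a boundary term.\<close>

lemma avg_has_derivative:
  assumes x: "x \<in> P" and c: "c0 \<le> c"
  shows "((\<lambda>c. avg c x) has_real_derivative
    - (c ^ (DIM('a) - 1) * (\<integral>y. (g y \<bullet> (y - x)) * bump (c *\<^sub>R (y - x)) \<partial>lborel))) (at c)"
proof -
  have cpos: "c > 0" using c c0 by simp
  obtain B where B: "B > 0" "\<And>w. \<bar>cone_div e \<rho> w\<bar> \<le> B" using cone_div_bounded[OF \<rho>(1)] by blast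
  have "((\<lambda>c. \<integral>y. f y * (c ^ DIM('a) * bump (c *\<^sub>R (y - x))) \<partial>lborel) has_real_derivative
      (\<integral>y. f y * (c ^ (DIM('a) - 1) * cone_div e \<rho> (c *\<^sub>R (y - x))) \<partial>lborel)) (at c)"
  proof (rule has_real_derivative_integral[OF f_integrable, of _ 0 "2 * c"])
    show "c \<in> {0<..<2 * c}" using cpos by simp
    show "integrable lborel (\<lambda>y. f y * (c' ^ DIM('a) * bump (c' *\<^sub>R (y - x))))" if "c' \<in> {0<..<2 * c}" for c'
      using that cone_bump_bounds[of e \<rho>]
      by (intro f_mult_integrable[of _ "c' ^ DIM('a)"]) (auto simp: abs_mult intro!: mult_left_le)
    show "((\<lambda>c. c ^ DIM('a) * bump (c *\<^sub>R (y - x))) has_real_derivative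
        c' ^ (DIM('a) - 1) * cone_div e \<rho> (c' *\<^sub>R (y - x))) (at c')" for c' y
      by (rule cone_bump_scaled_has_derivative)
    show "\<bar>c' ^ (DIM('a) - 1) * cone_div e \<rho> (c' *\<^sub>R (y - x))\<bar> \<le> (2 * c) ^ (DIM('a) - 1) * B" if "c' \<in> {0<..<2 * c}" for c' y
      unfolding abs_mult power_abs using that B(2) by (intro mult_mono power_mono) auto
    show "(\<lambda>y. c ^ (DIM('a) - 1) * cone_div e \<rho> (c *\<^sub>R (y - x))) \<in> borel_measurable lborel" by simp
  qed
  moreover have "(\<integral>y. f y * (c ^ (DIM('a) - 1) * cone_div e \<rho> (c *\<^sub>R (y - x))) \<partial>lborel)
      = - (c ^ (DIM('a) - 1) * (\<integral>y. (g y \<bullet> (y - x)) * bump (c *\<^sub>R (y - x)) \<partial>lborel))"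
  proof -
    let ?\<phi> = "\<lambda>i y. ((y - x) \<bullet> i) * bump (c *\<^sub>R (y - x))"
    note T = cone_test_function[OF x c]
    have fi: "integrable lborel (\<lambda>y. f y * frechet_derivative (?\<phi> i) (at y) i)" if "i \<in> Basis" for i
    proof -
      have cont: "continuous_on UNIV (\<lambda>y. frechet_derivative (?\<phi> i) (at y) i)"
        by (rule test_functions_frechet_continuous[OF T that])
      have K: "compact (closure {y. ?\<phi> i y \<noteq> 0})" using T[of i] by (simp add: test_functions_def)
      obtain B' where "\<And>y. \<bar>frechet_derivative (?\<phi> i) (at y) i\<bar> \<le> B'"
        using continuous_compact_support_bounded[OF cont K test_functions_frechet_eq_0[OF T]] by blast
      then show ?thesis using cont by (intro f_mult_integrable borel_measurable_continuous_onI)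
    qed
    have gi: "integrable lborel (\<lambda>y. (g y \<bullet> i) * ?\<phi> i y)" for i
    proof -
      let ?K = "cball x (2 / c)"
      have ng2: "integrable lborel (\<lambda>y. (norm (g y))\<^sup>2)" by (rule g_sq)
      have "integrable lborel (\<lambda>y. indicator ?K y * \<bar>norm (g y)\<bar>)"
        by (rule integral_abs_sq_le_measure(1)[OF _ _ ng2]) (auto intro!: emeasure_bounded_finite[unfolded infinity_ennreal_def])
      then have "integrable lborel (\<lambda>y. (norm i * (norm i * (2 / c))) * (indicator ?K y * \<bar>norm (g y)\<bar>))" by simp
      then show ?thesis
      proof (rule Bochner_Integration.integrable_bound)
        show "AE y in lborel. norm ((g y \<bullet> i) * ?\<phi> i y) \<le> norm ((norm i * (norm i * (2 / c))) * (indicator ?K y * \<bar>norm (g y)\<bar>))"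
        proof (intro AE_I2)
          fix y
          show "norm ((g y \<bullet> i) * ?\<phi> i y) \<le> norm ((norm i * (norm i * (2 / c))) * (indicator ?K y * \<bar>norm (g y)\<bar>))"
          proof (cases "y \<in> ?K")
            case True
            then have n: "norm (y - x) \<le> 2 / c" by (simp add: dist_norm norm_minus_commute)
            have "\<bar>(y - x) \<bullet> i\<bar> \<le> (2 / c) * norm i"
              using Cauchy_Schwarz_ineq2[of "y - x" i] n by (meson mult_right_mono norm_ge_zero order_trans)
            then have "\<bar>g y \<bullet> i\<bar> * (\<bar>(y - x) \<bullet> i\<bar> * \<bar>bump (c *\<^sub>R (y - x))\<bar>) \<le> (norm (g y) * norm i) * (((2 / c) * norm i) * 1)"
              using cpos cone_bump_bounds[of e \<rho> "c *\<^sub>R (y - x)"]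
              by (intro mult_mono Cauchy_Schwarz_ineq2) auto
            then show ?thesis using True cpos by (simp add: abs_mult mult_ac)
          next
            case False
            then show ?thesis using bump_eq_0[OF cpos] by simp
          qed
        qed
      qed simp
    qed
    have "(\<integral>y. f y * cone_div e \<rho> (c *\<^sub>R (y - x)) \<partial>lborel)
        = (\<integral>y. (\<Sum>i\<in>Basis. f y * frechet_derivative (?\<phi> i) (at y) i) \<partial>lborel)"
      by (simp only: cone_test_divergence[symmetric] sum_distrib_left)
    also have "\<dots> = (\<Sum>i\<in>Basis. \<integral>y. f y * frechet_derivative (?\<phi> i) (at y) i \<partial>lborel)"
      using fi by (rule Bochner_Integration.integral_sum)
    also have "\<dots> = (\<Sum>i\<in>Basis. - (\<integral>y. (g y \<bullet> i) * ?\<phi> i y \<partial>lborel))"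
      using weak[OF T] by (intro sum.cong) auto
    also have "\<dots> = - (\<integral>y. (\<Sum>i\<in>Basis. (g y \<bullet> i) * ?\<phi> i y) \<partial>lborel)"
      using gi by (simp add: sum_negf Bochner_Integration.integral_sum)
    also have "(\<lambda>y. \<Sum>i\<in>Basis. (g y \<bullet> i) * ?\<phi> i y) = (\<lambda>y. (g y \<bullet> (y - x)) * bump (c *\<^sub>R (y - x)))"
      by (subst (2) euclidean_inner) (simp add: sum_distrib_right mult.assoc)
    finally show ?thesis by (simp add: mult.left_commute[of "f _"])
  qed
  ultimately show ?thesis by (simp add: avg_def)
qed

text \<open>By the mean value theorem the difference is at most \<open>c * c^(d-1) * (2/c)\<close>
  times the integral of \<open>norm g\<close> over the ball, up to a factor from doubling
  \<open>c\<close>. Cauchy-Schwarz contributes the volume of order \<open>c^(-d)\<close>, which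
  leaves \<open>c^(d-2)\<close>.\<close>

lemma avg_diff_sq:
  assumes x: "x \<in> P" and c: "c0 \<le> c"
  shows "(avg (2 * c) x - avg c x)\<^sup>2 \<le> 8 ^ DIM('a) * unit_ball_vol (real DIM('a)) * (c ^ DIM('a) / c\<^sup>2) * local_energy c x"
proof -
  have cpos: "c > 0" using c c0 by simp
  let ?K = "cball x (2 / c)"
  define N where "N = (\<integral>y. indicator ?K y * \<bar>norm (g y)\<bar> \<partial>lborel)"
  have K: "emeasure lborel ?K < \<infinity>" by (rule emeasure_bounded_finite) simp
  note CS = integral_abs_sq_le_measure[OF _ _ g_sq K]
  have Ni: "integrable lborel (\<lambda>y. indicator ?K y * \<bar>norm (g y)\<bar>)" by (rule CS(1)) auto
  have N0: "N \<ge> 0" unfolding N_def by (intro Bochner_Integration.integral_nonneg) auto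
  \<comment> \<open>The intermediate scale exceeds \<open>c\<close>, so its kernel is supported in
    the larger ball belonging to \<open>c\<close>.\<close>
  obtain \<xi> where \<xi>: "c < \<xi>" "\<xi> < 2 * c"
    "avg (2 * c) x - avg c x = (2 * c - c) * - (\<xi> ^ (DIM('a) - 1) * (\<integral>y. (g y \<bullet> (y - x)) * bump (\<xi> *\<^sub>R (y - x)) \<partial>lborel))"
    using MVT2[of c "2 * c" "\<lambda>c. avg c x", OF _ avg_has_derivative[OF x]] c cpos by force
  have \<xi>0: "\<xi> > 0" using \<xi> cpos by simp
  have "\<bar>\<integral>y. (g y \<bullet> (y - x)) * bump (\<xi> *\<^sub>R (y - x)) \<partial>lborel\<bar> \<le> (\<integral>y. (2 / c) * (indicator ?K y * \<bar>norm (g y)\<bar>) \<partial>lborel)"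
  proof (rule integral_abs_bound_integral)
    show i: "integrable lborel (\<lambda>y. (2 / c) * (indicator ?K y * \<bar>norm (g y)\<bar>))" using Ni by simp
    show b: "\<bar>(g y \<bullet> (y - x)) * bump (\<xi> *\<^sub>R (y - x))\<bar> \<le> (2 / c) * (indicator ?K y * \<bar>norm (g y)\<bar>)" for y
    proof (cases "y \<in> cball x (2 / \<xi>)")
      case True
      moreover have "2 / \<xi> \<le> 2 / c" using \<xi> cpos by (intro divide_left_mono) auto
      ultimately have yK: "y \<in> ?K" and n: "norm (y - x) \<le> 2 / c" by (auto simp: dist_norm norm_minus_commute)
      have "\<bar>(g y \<bullet> (y - x))\<bar> * \<bar>bump (\<xi> *\<^sub>R (y - x))\<bar> \<le> (norm (g y) * (2 / c)) * 1"
        using n cone_bump_bounds[of e \<rho> "\<xi> *\<^sub>R (y - x)"] cpos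
        by (intro mult_mono order_trans[OF Cauchy_Schwarz_ineq2]) auto
      then show ?thesis using yK by (simp add: abs_mult mult.commute)
    next
      case False
      then show ?thesis using bump_eq_0[OF \<xi>0 False] cpos by simp
    qed
    show "integrable lborel (\<lambda>y. (g y \<bullet> (y - x)) * bump (\<xi> *\<^sub>R (y - x)))"
      by (rule Bochner_Integration.integrable_bound[OF i]) (use b cpos in \<open>auto simp: abs_mult\<close>)
  qed
  then have "\<bar>\<integral>y. (g y \<bullet> (y - x)) * bump (\<xi> *\<^sub>R (y - x)) \<partial>lborel\<bar> \<le> (2 / c) * N" by (simp add: N_def)
  moreover have "\<bar>\<xi> ^ (DIM('a) - 1)\<bar> \<le> (2 * c) ^ (DIM('a) - 1)" using \<xi> \<xi>0 power_mono[of \<xi> "2 * c" "DIM('a) - 1"] by simp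
  ultimately have "c * (\<bar>\<xi> ^ (DIM('a) - 1)\<bar> * \<bar>\<integral>y. (g y \<bullet> (y - x)) * bump (\<xi> *\<^sub>R (y - x)) \<partial>lborel\<bar>)
      \<le> c * ((2 * c) ^ (DIM('a) - 1) * ((2 / c) * N))"
    using cpos by (intro mult_left_mono[of _ _ c] mult_mono) (auto simp del: power_mult_distrib)
  then have "\<bar>avg (2 * c) x - avg c x\<bar> \<le> c * ((2 * c) ^ (DIM('a) - 1) * ((2 / c) * N))"
    unfolding \<xi>(3) using cpos by (simp add: abs_mult)
  also have "\<dots> = (2 * (2 * c) ^ (DIM('a) - 1)) * N" using cpos by (simp add: field_simps)
  finally have "\<bar>avg (2 * c) x - avg c x\<bar>\<^sup>2 \<le> ((2 * (2 * c) ^ (DIM('a) - 1)) * N)\<^sup>2" by (intro power_mono) auto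
  also have "\<dots> = (2 * (2 * c) ^ (DIM('a) - 1))\<^sup>2 * N\<^sup>2" by (rule power_mult_distrib)
  also have "\<dots> \<le> (2 * (2 * c) ^ (DIM('a) - 1))\<^sup>2 * (measure lborel ?K * (\<integral>y. indicator ?K y * (norm (g y))\<^sup>2 \<partial>lborel))"
    unfolding N_def by (intro mult_left_mono CS(2)) auto
  also have "\<dots> = (2 * (2 * c) ^ (DIM('a) - 1))\<^sup>2 * (unit_ball_vol (real DIM('a)) * (2 / c) ^ DIM('a)) * local_energy c x"
    using cpos by (simp add: content_cball local_energy_def)
  also have "(2 * (2 * c) ^ (DIM('a) - 1))\<^sup>2 * (unit_ball_vol (real DIM('a)) * (2 / c) ^ DIM('a)) = 8 ^ DIM('a) * unit_ball_vol (real DIM('a)) * (c ^ DIM('a) / c\<^sup>2)"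
  proof -
    have "(2 * (2 * c) ^ (DIM('a) - 1)) = 2 ^ DIM('a) * c ^ DIM('a) / c"
    proof -
      have "DIM('a) = Suc (DIM('a) - 1)" using DIM_positive[where 'a='a] by simp
      then have "2 ^ DIM('a) * c ^ DIM('a) = (2 * c) * (2 * c) ^ (DIM('a) - 1)"
        by (metis power_Suc power_mult_distrib)
      then show ?thesis using cpos by simp
    qed
    then have "(2 * (2 * c) ^ (DIM('a) - 1))\<^sup>2 * (2 / c) ^ DIM('a) = (2 ^ DIM('a) * c ^ DIM('a) / c)\<^sup>2 * (2 ^ DIM('a) / c ^ DIM('a))"
      by (simp add: power_divide)
    also have "\<dots> = (2 ^ DIM('a) * 2 ^ DIM('a) * 2 ^ DIM('a)) * (c ^ DIM('a) / c\<^sup>2)"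
      using cpos by (simp add: power2_eq_square)
    also have "(2 ^ DIM('a) * 2 ^ DIM('a) * 2 ^ DIM('a) :: real) = 8 ^ DIM('a)" by (simp flip: power_mult_distrib)
    finally show ?thesis by (simp add: mult_ac)
  qed
  finally show ?thesis by simp
qed

lemma avg_measurable [measurable]: "avg c \<in> borel_measurable borel"
proof -
  have [measurable]: "(\<lambda>p. f (snd p) * (c ^ DIM('a) * bump (c *\<^sub>R (snd p - fst p)))) \<in> borel_measurable (borel \<Otimes>\<^sub>M lborel)"
    by measurable
  show ?thesis unfolding avg_def[abs_def]
    by (rule lborel.borel_measurable_lebesgue_integral) (simp add: split_beta')
qed

lemma cball_pair_measurable: "(\<lambda>p. indicator (cball (fst p) r) (snd p) :: real) \<in> borel_measurable (borel \<Otimes>\<^sub>M lborel)"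
proof -
  have "(\<lambda>p. indicator {..r} (dist (fst p) (snd p)) :: real) \<in> borel_measurable (borel \<Otimes>\<^sub>M (lborel :: 'a measure))"
    by measurable
  then show ?thesis by (simp add: indicator_def)
qed

lemma local_energy_measurable [measurable]: "local_energy c \<in> borel_measurable borel"
proof -
  note cball_pair_measurable[of "2 / c", measurable]
  have [measurable]: "(\<lambda>p. indicator (cball (fst p) (2 / c)) (snd p) * (norm (g (snd p)))\<^sup>2) \<in> borel_measurable (borel \<Otimes>\<^sub>M lborel)"
    by measurable
  show ?thesis unfolding local_energy_def[abs_def]
    by (rule lborel.borel_measurable_lebesgue_integral) (simp add: split_beta')
qed

lemma local_energy_integrable: "integrable lborel (\<lambda>y. indicator (cball x r) y * (norm (g y))\<^sup>2)"
  using integrable_mult_indicator[OF _ g_sq, of "cball x r"] by simp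

lemma local_energy_bounds: "0 \<le> local_energy c x" "local_energy c x \<le> (\<integral>y. (norm (g y))\<^sup>2 \<partial>lborel)"
  unfolding local_energy_def
  by (simp, rule integral_mono[OF local_energy_integrable g_sq]) (simp add: indicator_def)

text \<open>Tonelli: a given \<open>y\<close> is counted by exactly those \<open>x\<close> in the
  ball of radius \<open>2 / c\<close> around \<open>y\<close>, so each unit of energy is multiplied
  by the volume of that ball.\<close>

lemma nn_integral_local_energy:
  assumes c: "c > 0"
  shows "(\<integral>\<^sup>+x. ennreal (local_energy c x) \<partial>lborel) = ennreal (unit_ball_vol (real DIM('a)) * (2 / c) ^ DIM('a) * (\<integral>y. (norm (g y))\<^sup>2 \<partial>lborel))"
proof -
  note cball_pair_measurable[of "2 / c", measurable]
  have m: "(\<lambda>(x, y). ennreal (indicator (cball x (2 / c)) y * (norm (g y))\<^sup>2)) \<in> borel_measurable (lborel \<Otimes>\<^sub>M lborel)"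
    unfolding split_beta' by measurable
  have "(\<integral>\<^sup>+x. ennreal (local_energy c x) \<partial>lborel)
      = (\<integral>\<^sup>+x. \<integral>\<^sup>+y. ennreal (indicator (cball x (2 / c)) y * (norm (g y))\<^sup>2) \<partial>lborel \<partial>lborel)"
    unfolding local_energy_def by (intro nn_integral_cong nn_integral_eq_integral[symmetric] local_energy_integrable) auto
  also have "\<dots> = (\<integral>\<^sup>+y. \<integral>\<^sup>+x. ennreal (indicator (cball x (2 / c)) y * (norm (g y))\<^sup>2) \<partial>lborel \<partial>lborel)"
    by (rule lborel_pair.Fubini'[symmetric]) (use m in \<open>simp add: split_beta'\<close>)
  also have "\<dots> = (\<integral>\<^sup>+y. ennreal (unit_ball_vol (real DIM('a)) * (2 / c) ^ DIM('a)) * ennreal ((norm (g y))\<^sup>2) \<partial>lborel)"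
  proof (rule nn_integral_cong)
    fix y
    have "ennreal (indicator (cball x (2 / c)) y * (norm (g y))\<^sup>2) = ennreal ((norm (g y))\<^sup>2) * indicator (cball y (2 / c)) x" for x
      by (auto simp: indicator_def dist_commute)
    then have "(\<integral>\<^sup>+x. ennreal (indicator (cball x (2 / c)) y * (norm (g y))\<^sup>2) \<partial>lborel)
      = ennreal ((norm (g y))\<^sup>2) * emeasure lborel (cball y (2 / c))" by (simp add: nn_integral_cmult_indicator)
    also have "emeasure lborel (cball y (2 / c)) = ennreal (unit_ball_vol (real DIM('a)) * (2 / c) ^ DIM('a))"
      using c by (simp add: emeasure_cball)
    finally show "(\<integral>\<^sup>+x. ennreal (indicator (cball x (2 / c)) y * (norm (g y))\<^sup>2) \<partial>lborel)
      = ennreal (unit_ball_vol (real DIM('a)) * (2 / c) ^ DIM('a)) * ennreal ((norm (g y))\<^sup>2)" by (simp add: mult.commute)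
  qed
  also have "\<dots> = ennreal (unit_ball_vol (real DIM('a)) * (2 / c) ^ DIM('a)) * ennreal (\<integral>y. (norm (g y))\<^sup>2 \<partial>lborel)"
    by (simp add: nn_integral_cmult nn_integral_eq_integral[OF g_sq])
  finally show ?thesis using c by (simp add: ennreal_mult unit_ball_vol_nonneg)
qed

end

section \<open>From dyadic averages to the weighted estimate\<close>

lemma lborel_integral_affine_euclidean:
  fixes h :: "'a::euclidean_space \<Rightarrow> real"
  assumes "s \<noteq> 0" and [measurable]: "h \<in> borel_measurable borel"
  shows "(\<integral>x. h x \<partial>lborel) = \<bar>s\<bar> ^ DIM('a) * (\<integral>x. h (t + s *\<^sub>R x) \<partial>lborel)"
proof -
  have "(\<integral>x. h x \<partial>lborel) = (\<integral>x. h x \<partial>density (distr lborel borel (\<lambda>x. t + s *\<^sub>R x)) (\<lambda>_. \<bar>s\<bar> ^ DIM('a)))"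
    by (subst lborel_affine[OF assms(1), of t]) simp
  also have "\<dots> = (\<integral>x. \<bar>s\<bar> ^ DIM('a) *\<^sub>R h x \<partial>distr lborel borel (\<lambda>x. t + s *\<^sub>R x))"
    by (rule integral_density) auto
  also have "\<dots> = (\<integral>x. \<bar>s\<bar> ^ DIM('a) *\<^sub>R h (t + s *\<^sub>R x) \<partial>lborel)"
    by (rule integral_distr) auto
  finally show ?thesis by simp
qed

text \<open>Cauchy-Schwarz with weights \<open>r^k\<close>: the square of a long sum is controlled
  by the sum of squares, uniformly in its length, if the squares decay slightly faster than
  \<open>r^k\<close>.\<close>

lemma sq_sum_le_geometric:
  fixes b :: "nat \<Rightarrow> real"
  assumes r: "0 < r" "r < 1"
  shows "(\<Sum>k<n. b k)\<^sup>2 \<le> 1 / (1 - r) * (\<Sum>k<n. (b k)\<^sup>2 / r ^ k)"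
proof -
  have "(\<Sum>k<n. sqrt (r ^ k) * (b k / sqrt (r ^ k)))\<^sup>2
      \<le> (\<Sum>k<n. (sqrt (r ^ k))\<^sup>2) * (\<Sum>k<n. (b k / sqrt (r ^ k))\<^sup>2)"
    by (rule Cauchy_Schwarz_ineq_sum)
  also have "\<dots> = (\<Sum>k<n. r ^ k) * (\<Sum>k<n. (b k)\<^sup>2 / r ^ k)" using r by (simp add: power_divide)
  also have "\<dots> \<le> 1 / (1 - r) * (\<Sum>k<n. (b k)\<^sup>2 / r ^ k)"
  proof (rule mult_right_mono)
    have "(\<Sum>k<n. r ^ k) \<le> (\<Sum>k. r ^ k)" using r by (intro sum_le_suminf summable_geometric) auto
    also have "\<dots> = 1 / (1 - r)" using r by (intro suminf_geometric) auto
    finally show "(\<Sum>k<n. r ^ k) \<le> 1 / (1 - r)" .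
  qed (use r in \<open>auto intro!: sum_nonneg\<close>)
  finally show ?thesis using r by simp
qed

context cone_patch
begin

definition mass :: real where "mass = (\<integral>w. bump w \<partial>lborel)"

lemma bump_integrable: "integrable lborel bump"
proof (rule Bochner_Integration.integrable_bound)
  show "integrable lborel (indicat_real (cball e \<rho>))"
    by (simp add: integrable_indicator_iff emeasure_bounded_finite[unfolded infinity_ennreal_def])
  show "AE w in lborel. norm (bump w) \<le> norm (indicat_real (cball e \<rho>) w)"
    using cone_bump_eq_0[OF \<rho>(1), of _ e] cone_bump_bounds[of e \<rho>] by (intro AE_I2) (force simp: indicator_def)
qed simp

lemma mass_pos: "mass > 0"
proof -
  have "mass \<noteq> 0"
  proof
    assume "mass = 0"
    then have "AE w in lborel. bump w = 0"
      using bump_integrable cone_bump_bounds[of e \<rho>] unfolding mass_def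
      by (subst (asm) integral_nonneg_eq_0_iff_AE) auto
    then have "AE w in lborel. w \<notin> ball e \<rho>"
      by eventually_elim (use cone_bump_pos[of _ e \<rho>] in force)
    then have "emeasure lborel (ball e \<rho>) = 0" by (subst (asm) AE_iff_measurable[of "ball e \<rho>"]) auto
    then show False using \<rho> by (simp add: emeasure_ball unit_ball_vol_pos less_imp_neq[OF unit_ball_vol_pos, symmetric])
  qed
  moreover have "mass \<ge> 0" unfolding mass_def by (intro Bochner_Integration.integral_nonneg) (simp add: cone_bump_bounds)
  ultimately show ?thesis by simp
qed

text \<open>The first summand comes from the coarsest average, the second from the series over
  dyadic scales. The factor \<open>A\<close> occurs twice, once from Cauchy-Schwarz with geometric
  weights and once from summing the series. Nothing depends on \<open>f\<close>, \<open>g\<close> or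
  the weight.\<close>

definition weight_const :: "real \<Rightarrow> real" where
  "weight_const q = (let V = unit_ball_vol (real DIM('a)); \<beta> = 2 - real DIM('a) / q; A = 1 / (1 - 2 powr (- \<beta> / 2))
    in 2 * (c0 ^ DIM('a))\<^sup>2 * measure lborel \<Omega> + 2 * A * (A * (8 ^ DIM('a) * V * (V * 2 ^ DIM('a) + 1) * c0 powr (- \<beta>))))"

end

context weakly_differentiable_on_patch
begin

abbreviation Ng :: real where "Ng \<equiv> \<integral>y. (norm (g y))\<^sup>2 \<partial>lborel"
abbreviation Nf :: real where "Nf \<equiv> \<integral>y. (f y)\<^sup>2 \<partial>lborel"

lemma Ng_nonneg: "0 \<le> Ng" and Nf_nonneg: "0 \<le> Nf"
  by (auto intro: Bochner_Integration.integral_nonneg)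

lemma avg_tendsto_weakly:
  assumes \<theta>: "\<theta> \<in> test_functions P" and C: "\<And>n. C n > 0" "filterlim C at_top sequentially"
  shows "(\<lambda>n. \<integral>x. avg (C n) x * \<theta> x \<partial>lborel) \<longlonglongrightarrow> mass * (\<integral>y. f y * \<theta> y \<partial>lborel)"
proof -
  have \<theta>c: "continuous_on UNIV \<theta>" using \<theta> by (rule test_functions_continuous)
  have [measurable]: "\<theta> \<in> borel_measurable borel" using \<theta>c by (rule borel_measurable_continuous_onI)
  have K: "compact (closure {x. \<theta> x \<noteq> 0})" using \<theta> by (simp add: test_functions_def)
  have \<theta>0: "\<theta> x = 0" if "x \<notin> closure {x. \<theta> x \<noteq> 0}" for x
    using that closure_subset[of "{x. \<theta> x \<noteq> 0}"] by auto
  obtain B where B: "B > 0" "\<And>x. \<bar>\<theta> x\<bar> \<le> B" using continuous_compact_support_bounded[OF \<theta>c K \<theta>0] by blast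
  have \<theta>int: "integrable lborel \<theta>"
  proof -
    have "integrable lborel (\<lambda>x. indicator (closure {x. \<theta> x \<noteq> 0}) x *\<^sub>R \<theta> x)"
      using K \<theta>c by (intro borel_integrable_compact) (auto intro: continuous_on_subset)
    moreover have "(\<lambda>x. indicator (closure {x. \<theta> x \<noteq> 0}) x *\<^sub>R \<theta> x) = \<theta>"
    proof (rule ext)
      fix x
      show "indicator (closure {x. \<theta> x \<noteq> 0}) x *\<^sub>R \<theta> x = \<theta> x"
        using \<theta>0[of x] by (cases "x \<in> closure {x. \<theta> x \<noteq> 0}") simp_all
    qed
    ultimately show ?thesis by simp
  qed
  \<comment> \<open>The transposed average of \<open>\<theta>\<close>; it looks backwards along the
    cone, hence the minus sign.\<close>
  define K where "K c y = (\<integral>w. bump w * \<theta> (y - (1 / c) *\<^sub>R w) \<partial>lborel)" for c y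
  have Kmeas [measurable]: "K c \<in> borel_measurable borel" for c
    unfolding K_def by (rule lborel.borel_measurable_lebesgue_integral) (simp add: split_beta')
  have bi: "integrable lborel (\<lambda>w. bump w * \<theta> (y - (1 / c) *\<^sub>R w))" for y c
    by (rule Bochner_Integration.integrable_bound[OF integrable_mult_left[OF bump_integrable, of B]])
      (use B cone_bump_bounds[of e \<rho>] in \<open>auto simp: abs_mult intro!: AE_I2 mult_left_mono\<close>)
  have Kbound: "\<bar>K c y\<bar> \<le> mass * B" for c y
  proof -
    have "\<bar>K c y\<bar> \<le> (\<integral>w. bump w * B \<partial>lborel)"
      unfolding K_def
      by (rule integral_abs_bound_integral[OF bi])
        (use B cone_bump_bounds[of e \<rho>] bump_integrable in \<open>auto simp: abs_mult intro!: mult_left_mono\<close>)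
    then show ?thesis by (simp add: mass_def)
  qed
  have swap: "(\<integral>x. avg c x * \<theta> x \<partial>lborel) = (\<integral>y. f y * K c y \<partial>lborel)" if c: "c > 0" for c
  proof -
    let ?h = "\<lambda>x y. f y * (c ^ DIM('a) * bump (c *\<^sub>R (y - x))) * \<theta> x"
    have prod: "integrable (lborel \<Otimes>\<^sub>M lborel) (\<lambda>(x, y). \<theta> x * f y)"
    proof (rule lborel_pair.Fubini_integrable)
      show "(\<lambda>(x, y). \<theta> x * f y) \<in> borel_measurable (lborel \<Otimes>\<^sub>M lborel)" by measurable
      show "integrable lborel (\<lambda>x. \<integral>y. norm (case (x, y) of (x, y) \<Rightarrow> \<theta> x * f y) \<partial>lborel)"
        using \<theta>int by (simp add: abs_mult)
      show "AE x in lborel. integrable lborel (\<lambda>y. case (x, y) of (x, y) \<Rightarrow> \<theta> x * f y)"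
        using f_integrable by simp
    qed
    have hi: "integrable (lborel \<Otimes>\<^sub>M lborel) (\<lambda>(x, y). ?h x y)"
    proof (rule Bochner_Integration.integrable_bound[OF integrable_mult_right[OF prod, of "c ^ DIM('a)"]])
      show "(\<lambda>(x, y). ?h x y) \<in> borel_measurable (lborel \<Otimes>\<^sub>M lborel)" by measurable
      have "\<bar>f y\<bar> * (c ^ DIM('a) * bump (c *\<^sub>R (y - x))) * \<bar>\<theta> x\<bar> \<le> \<bar>f y\<bar> * (c ^ DIM('a) * 1) * \<bar>\<theta> x\<bar>" for x y
        using c cone_bump_bounds[of e \<rho>] by (intro mult_right_mono mult_left_mono) auto
      then show "AE p in lborel \<Otimes>\<^sub>M lborel. norm (case p of (x, y) \<Rightarrow> ?h x y) \<le> norm (c ^ DIM('a) * (case p of (x, y) \<Rightarrow> \<theta> x * f y))"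
        using c cone_bump_bounds(1)[of e \<rho>] by (intro AE_I2) (auto simp: abs_mult mult_ac split: prod.split)
    qed
    have "(\<integral>x. avg c x * \<theta> x \<partial>lborel) = (\<integral>x. \<integral>y. ?h x y \<partial>lborel \<partial>lborel)"
      by (simp add: avg_def)
    also have "\<dots> = (\<integral>y. \<integral>x. ?h x y \<partial>lborel \<partial>lborel)"
      by (rule lborel_pair.Fubini_integral[symmetric, OF hi])
    also have "\<dots> = (\<integral>y. f y * K c y \<partial>lborel)"
    proof (rule Bochner_Integration.integral_cong[OF refl])
      fix y
      \<comment> \<open>The substitution is \<open>x = y - (1 / c) *\<^sub>R w\<close>; its Jacobian
        \<open>c^(-d)\<close> cancels the normalising power of the kernel.\<close>
      have "(\<integral>x. bump (c *\<^sub>R (y - x)) * \<theta> x \<partial>lborel)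
          = \<bar>- (1 / c)\<bar> ^ DIM('a) * (\<integral>w. bump (c *\<^sub>R (y - (y + (- (1 / c)) *\<^sub>R w))) * \<theta> (y + (- (1 / c)) *\<^sub>R w) \<partial>lborel)"
        using c by (intro lborel_integral_affine_euclidean[where h = "\<lambda>x. bump (c *\<^sub>R (y - x)) * \<theta> x"]) auto
      also have "\<dots> = (1 / c) ^ DIM('a) * K c y" using c by (simp add: K_def)
      finally have "c ^ DIM('a) * (\<integral>x. bump (c *\<^sub>R (y - x)) * \<theta> x \<partial>lborel) = K c y"
        using c by (simp add: power_divide)
      moreover have "(\<integral>x. ?h x y \<partial>lborel) = (\<integral>x. (f y * c ^ DIM('a)) * (bump (c *\<^sub>R (y - x)) * \<theta> x) \<partial>lborel)"
        by (simp only: mult.assoc)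
      ultimately show "(\<integral>x. ?h x y \<partial>lborel) = f y * K c y" by simp
    qed
    finally show ?thesis .
  qed
  have inv: "(\<lambda>n. 1 / C n) \<longlonglongrightarrow> 0"
    using tendsto_inverse_0_at_top[OF C(2)] by (simp add: inverse_eq_divide)
  have Klim: "(\<lambda>n. K (C n) y) \<longlonglongrightarrow> mass * \<theta> y" for y
  proof -
    have "(\<lambda>n. K (C n) y) \<longlonglongrightarrow> (\<integral>w. bump w * \<theta> y \<partial>lborel)"
      unfolding K_def
    proof (rule integral_dominated_convergence[where w = "\<lambda>w. bump w * B"])
      show "AE w in lborel. (\<lambda>n. bump w * \<theta> (y - (1 / C n) *\<^sub>R w)) \<longlonglongrightarrow> bump w * \<theta> y"
      proof (intro AE_I2 tendsto_mult tendsto_const)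
        fix w
        have "(\<lambda>n. y - (1 / C n) *\<^sub>R w) \<longlonglongrightarrow> y - 0 *\<^sub>R w" by (intro tendsto_intros inv)
        then show "(\<lambda>n. \<theta> (y - (1 / C n) *\<^sub>R w)) \<longlonglongrightarrow> \<theta> y"
          using \<theta>c by (intro isCont_tendsto_compose[of _ \<theta>]) (auto simp: continuous_on_eq_continuous_at)
      qed
      show "AE w in lborel. norm (bump w * \<theta> (y - (1 / C n) *\<^sub>R w)) \<le> bump w * B" for n
        using B cone_bump_bounds[of e \<rho>] by (auto simp: abs_mult intro!: AE_I2 mult_left_mono)
    qed (use bump_integrable in auto)
    then show ?thesis by (simp add: mass_def)
  qed
  have "(\<lambda>n. \<integral>y. f y * K (C n) y \<partial>lborel) \<longlonglongrightarrow> (\<integral>y. f y * (mass * \<theta> y) \<partial>lborel)"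
  proof (rule integral_dominated_convergence[where w = "\<lambda>y. \<bar>f y\<bar> * (mass * B)"])
    show "AE y in lborel. (\<lambda>n. f y * K (C n) y) \<longlonglongrightarrow> f y * (mass * \<theta> y)"
      by (intro AE_I2 tendsto_mult tendsto_const Klim)
    show "AE y in lborel. norm (f y * K (C n) y) \<le> \<bar>f y\<bar> * (mass * B)" for n
      using Kbound by (auto simp: abs_mult intro!: AE_I2 mult_left_mono)
  qed (use f_integrable in auto)
  also have "(\<integral>y. f y * (mass * \<theta> y) \<partial>lborel) = mass * (\<integral>y. f y * \<theta> y \<partial>lborel)"
    by (simp add: mult.left_commute[of _ mass])
  finally show ?thesis using C(1) by (simp add: swap)
qed

text \<open>The height \<open>M = c^(d/q)\<close> balances two regimes. Where
  \<open>w \<le> M\<close>, the local energy integrates to a multiple of \<open>c^(-d) * Ng\<close>.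
  Where \<open>w > M\<close>, one has \<open>w \<le> w^q * M^(1-q)\<close> and the local energy is
  at most \<open>Ng\<close>. Since \<open>M^q = c^d\<close>, both parts carry the same power
  \<open>M * c^(-d)\<close>.\<close>

lemma nn_integral_weight_local_energy:
  assumes [measurable]: "w \<in> borel_measurable borel" and w: "\<And>x. w x \<ge> 1"
    and W: "(\<integral>\<^sup>+x. indicator P x * ennreal (w x powr q) \<partial>lborel) \<le> ennreal W" "W \<ge> 0"
    and q: "q > 1" and c: "c > 0"
  shows "(\<integral>\<^sup>+x. indicator P x * ennreal (w x * local_energy c x) \<partial>lborel)
    \<le> ennreal (c powr (DIM('a) / q) / c ^ DIM('a) * (unit_ball_vol (real DIM('a)) * 2 ^ DIM('a) + W) * Ng)"
proof -
  have [measurable]: "P \<in> sets borel" using open_P by simp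
  define M where "M = c powr (DIM('a) / q)"
  have M: "M > 0" using c by (simp add: M_def)
  have pt: "w x * local_energy c x \<le> M * local_energy c x + w x powr q * (M powr (1 - q) * Ng)" for x
  proof (cases "w x \<le> M")
    case True
    then have "w x * local_energy c x \<le> M * local_energy c x" using local_energy_bounds by (intro mult_right_mono) auto
    moreover have "0 \<le> w x powr q * (M powr (1 - q) * Ng)" using Ng_nonneg by (intro mult_nonneg_nonneg) auto
    ultimately show ?thesis by linarith
  next
    case False
    have "w x = w x powr q * w x powr (1 - q)" using w[of x] by (simp flip: powr_add)
    also have "\<dots> \<le> w x powr q * M powr (1 - q)"
      using False M q by (intro mult_left_mono powr_mono2') auto
    finally have "w x * local_energy c x \<le> (w x powr q * M powr (1 - q)) * Ng"
      using local_energy_bounds by (intro mult_mono) auto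
    moreover have "0 \<le> M * local_energy c x" using M local_energy_bounds by simp
    ultimately show ?thesis unfolding mult.assoc by linarith
  qed
  have "(\<integral>\<^sup>+x. indicator P x * ennreal (w x * local_energy c x) \<partial>lborel)
      \<le> (\<integral>\<^sup>+x. ennreal M * ennreal (local_energy c x) + ennreal (M powr (1 - q) * Ng) * (indicator P x * ennreal (w x powr q)) \<partial>lborel)"
  proof (rule nn_integral_mono)
    fix x
    show "indicator P x * ennreal (w x * local_energy c x)
      \<le> ennreal M * ennreal (local_energy c x) + ennreal (M powr (1 - q) * Ng) * (indicator P x * ennreal (w x powr q))"
    proof (cases "x \<in> P")
      case True
      have "ennreal (w x * local_energy c x) \<le> ennreal (M * local_energy c x + w x powr q * (M powr (1 - q) * Ng))"
        by (rule ennreal_leI[OF pt])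
      also have "\<dots> = ennreal M * ennreal (local_energy c x) + ennreal (M powr (1 - q) * Ng) * ennreal (w x powr q)"
        using M local_energy_bounds Ng_nonneg by (simp add: ennreal_plus ennreal_mult mult.commute)
      finally show ?thesis using True by simp
    qed simp
  qed
  also have "\<dots> = ennreal M * ennreal (unit_ball_vol (real DIM('a)) * (2 / c) ^ DIM('a) * Ng)
      + ennreal (M powr (1 - q) * Ng) * (\<integral>\<^sup>+x. indicator P x * ennreal (w x powr q) \<partial>lborel)"
    by (simp add: nn_integral_add nn_integral_cmult nn_integral_local_energy[OF c])
  also have "\<dots> \<le> ennreal M * ennreal (unit_ball_vol (real DIM('a)) * (2 / c) ^ DIM('a) * Ng)
      + ennreal (M powr (1 - q) * Ng) * ennreal W"
    by (intro add_left_mono mult_left_mono W) auto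
  also have "\<dots> = ennreal (M * (unit_ball_vol (real DIM('a)) * (2 / c) ^ DIM('a) * Ng) + M powr (1 - q) * Ng * W)"
    using M W(2) Ng_nonneg c by (simp add: ennreal_plus ennreal_mult unit_ball_vol_nonneg)
  also have "M powr (1 - q) = M / c ^ DIM('a)"
  proof -
    have "M powr (1 - q) = M / M powr q" using M by (simp add: powr_diff)
    also have "M powr q = c ^ DIM('a)" using c q by (simp add: M_def powr_powr powr_realpow)
    finally show ?thesis .
  qed
  also have "M * (unit_ball_vol (real DIM('a)) * (2 / c) ^ DIM('a) * Ng) + M / c ^ DIM('a) * Ng * W
      = M / c ^ DIM('a) * (unit_ball_vol (real DIM('a)) * 2 ^ DIM('a) + W) * Ng"
    by (simp add: power_divide algebra_simps)
  finally show ?thesis by (simp add: M_def)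
qed

text \<open>The powers \<open>c^(d-2)\<close> of the difference estimate and
  \<open>c^(d/q-d)\<close> of the weighted energy combine to a decay of order
  \<open>c^(-(2-d/q))\<close>.\<close>

lemma nn_integral_weight_diff:
  assumes [measurable]: "w \<in> borel_measurable borel" and w: "\<And>x. w x \<ge> 1"
    and W: "(\<integral>\<^sup>+x. indicator P x * ennreal (w x powr q) \<partial>lborel) \<le> ennreal W" "W \<ge> 0"
    and q: "q > 1" and c: "c0 \<le> c"
  shows "(\<integral>\<^sup>+x. indicator P x * ennreal (w x * (avg (2 * c) x - avg c x)\<^sup>2) \<partial>lborel)
    \<le> ennreal (8 ^ DIM('a) * unit_ball_vol (real DIM('a)) * (unit_ball_vol (real DIM('a)) * 2 ^ DIM('a) + 1)
        * ((1 + W) * Ng) * c powr (- (2 - DIM('a) / q)))"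
proof -
  have cpos: "c > 0" using c c0 by simp
  have [measurable]: "P \<in> sets borel" using open_P by simp
  let ?V = "unit_ball_vol (real DIM('a))"
  let ?k = "8 ^ DIM('a) * ?V * (c ^ DIM('a) / c\<^sup>2)"
  have V: "?V \<ge> 0" by (rule unit_ball_vol_nonneg) simp
  have "(\<integral>\<^sup>+x. indicator P x * ennreal (w x * (avg (2 * c) x - avg c x)\<^sup>2) \<partial>lborel)
      \<le> (\<integral>\<^sup>+x. ennreal ?k * (indicator P x * ennreal (w x * local_energy c x)) \<partial>lborel)"
  proof (rule nn_integral_mono)
    fix x
    show "indicator P x * ennreal (w x * (avg (2 * c) x - avg c x)\<^sup>2) \<le> ennreal ?k * (indicator P x * ennreal (w x * local_energy c x))"
    proof (cases "x \<in> P")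
      case True
      have "w x * (avg (2 * c) x - avg c x)\<^sup>2 \<le> w x * (?k * local_energy c x)"
        using w[of x] by (intro mult_left_mono avg_diff_sq True c) auto
      then have "ennreal (w x * (avg (2 * c) x - avg c x)\<^sup>2) \<le> ennreal (?k * (w x * local_energy c x))"
        by (intro ennreal_leI) (simp add: mult_ac)
      also have "\<dots> = ennreal ?k * ennreal (w x * local_energy c x)"
        using V cpos by (intro ennreal_mult') auto
      finally show ?thesis using True by simp
    qed simp
  qed
  also have "\<dots> = ennreal ?k * (\<integral>\<^sup>+x. indicator P x * ennreal (w x * local_energy c x) \<partial>lborel)"
    by (rule nn_integral_cmult) simp
  also have "\<dots> \<le> ennreal ?k * ennreal (c powr (DIM('a) / q) / c ^ DIM('a) * (?V * 2 ^ DIM('a) + W) * Ng)"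
    by (intro mult_left_mono nn_integral_weight_local_energy assms cpos) auto
  also have "\<dots> = ennreal (?k * (c powr (DIM('a) / q) / c ^ DIM('a) * (?V * 2 ^ DIM('a) + W) * Ng))"
    using V cpos by (intro ennreal_mult'[symmetric]) auto
  also have "\<dots> \<le> ennreal (8 ^ DIM('a) * ?V * (?V * 2 ^ DIM('a) + 1) * ((1 + W) * Ng) * c powr (- (2 - DIM('a) / q)))"
  proof (rule ennreal_leI)
    have p: "c powr (- (2 - DIM('a) / q)) = c powr (DIM('a) / q) / c\<^sup>2"
    proof -
      have "c powr (DIM('a) / q - 2) = c powr (DIM('a) / q) / c powr 2" by (rule powr_diff)
      then show ?thesis using cpos by (simp only: powr_numeral minus_diff_eq)
    qed
    have "?k * (c powr (DIM('a) / q) / c ^ DIM('a) * (?V * 2 ^ DIM('a) + W) * Ng)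
        = (8 ^ DIM('a) * ?V * c powr (- (2 - DIM('a) / q))) * ((?V * 2 ^ DIM('a) + W) * Ng)"
      unfolding p using cpos by simp
    also have "\<dots> \<le> (8 ^ DIM('a) * ?V * c powr (- (2 - DIM('a) / q))) * ((?V * 2 ^ DIM('a) + 1) * (1 + W) * Ng)"
    proof (intro mult_left_mono mult_right_mono Ng_nonneg)
      \<comment> \<open>The crude product bound isolates the dependence on the weight in the single
        factor \<open>1 + W\<close>.\<close>
      have "0 \<le> ?V * 2 ^ DIM('a) * W" using V W(2) by simp
      then show "?V * 2 ^ DIM('a) + W \<le> (?V * 2 ^ DIM('a) + 1) * (1 + W)" by (simp add: algebra_simps)
    qed (use V in auto)
    finally show "?k * (c powr (DIM('a) / q) / c ^ DIM('a) * (?V * 2 ^ DIM('a) + W) * Ng)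
      \<le> 8 ^ DIM('a) * ?V * (?V * 2 ^ DIM('a) + 1) * ((1 + W) * Ng) * c powr (- (2 - DIM('a) / q))"
      by (simp only: mult_ac)
  qed
  finally show ?thesis .
qed

end

lemma integrable_lebesgue_on_borel:
  fixes h :: "'a::euclidean_space \<Rightarrow> real"
  assumes S: "S \<in> sets borel" and h: "integrable lborel (\<lambda>x. indicator S x * h x)"
  shows "integrable (lebesgue_on S) h"
    and "(\<integral>x. h x \<partial>lebesgue_on S) = (\<integral>x. indicator S x * h x \<partial>lborel)"
proof -
  have m: "(\<lambda>x. indicator S x * h x) \<in> borel_measurable lborel" using h by simp
  have "integrable lebesgue (\<lambda>x. indicator S x *\<^sub>R h x)" using h m by (simp add: integrable_completion)
  then show "integrable (lebesgue_on S) h" using S by (simp add: integrable_restrict_space)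
  have "(\<integral>x. h x \<partial>lebesgue_on S) = (\<integral>x. indicator S x *\<^sub>R h x \<partial>lebesgue)"
    using S by (intro integral_restrict_space) auto
  also have "\<dots> = (\<integral>x. indicator S x * h x \<partial>lborel)" using m by (simp add: integral_completion)
  finally show "(\<integral>x. h x \<partial>lebesgue_on S) = (\<integral>x. indicator S x * h x \<partial>lborel)" .
qed

context weakly_differentiable_on_patch
begin

text \<open>Telescoping over \<open>c = c0 * 2^k\<close> bounds all averages at once by the majorant
  \<open>H\<close>, whose weighted integral is a convergent geometric series. The averages converge
  almost everywhere on \<open>P\<close>, and the weak limit shows that the pointwise limit is
  \<open>mass * f\<close>.\<close>

lemma nn_integral_weight_f:
  assumes w_meas [measurable]: "w \<in> borel_measurable borel" and w: "\<And>x. w x \<ge> 1"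
    and W: "(\<integral>\<^sup>+x. indicator P x * ennreal (w x powr q) \<partial>lborel) \<le> ennreal W" "W \<ge> 0"
    and q: "q > 1" "q > DIM('a) / 2"
  shows "(\<integral>\<^sup>+x. indicator P x * ennreal (w x * (mass * f x)\<^sup>2) \<partial>lborel)
    \<le> ennreal (weight_const q * (1 + W) * (Nf + Ng))"
proof -
  have Ps [measurable]: "P \<in> sets borel" using open_P by simp
  define V where "V = unit_ball_vol (real DIM('a))"
  define \<beta> where "\<beta> = 2 - real DIM('a) / q"
  \<comment> \<open>Half of the decay rate: \<open>r^2\<close> is \<open>2^(-\<beta>)\<close>, so
    one factor \<open>r^k\<close> pays for the Cauchy-Schwarz weights and the other makes the series
    converge.\<close>
  define r where "r = 2 powr (- \<beta> / 2)"
  define A where "A = 1 / (1 - r)"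
  define K where "K = 8 ^ DIM('a) * V * (V * 2 ^ DIM('a) + 1) * ((1 + W) * Ng)"
  have V: "V \<ge> 0" unfolding V_def by (rule unit_ball_vol_nonneg) simp
  have \<beta>: "\<beta> > 0" using q by (simp add: \<beta>_def field_simps)
  have r: "0 < r" "r < 1" using \<beta> by (auto simp: r_def powr_less_one)
  have A: "A > 0" using r by (simp add: A_def)
  have K: "K \<ge> 0" using V W(2) Ng_nonneg by (simp add: K_def)
  define C where "C k = c0 * 2 ^ k" for k :: nat
  have C: "C k > 0" "c0 \<le> C k" for k using c0 by (auto simp: C_def)
  have Clim: "filterlim C at_top sequentially"
  proof (rule filterlim_at_top_mono)
    show "filterlim (\<lambda>n. c0 * real n) at_top sequentially"
      by (rule filterlim_tendsto_pos_mult_at_top[OF tendsto_const c0 filterlim_real_sequentially])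
    show "\<forall>\<^sub>F n in sequentially. c0 * real n \<le> C n"
      using c0 of_nat_less_two_power[where 'a = real] by (auto simp: C_def less_imp_le)
  qed
  define D where "D k x = avg (C (Suc k)) x - avg (C k) x" for k x
  have [measurable]: "D k \<in> borel_measurable borel" for k unfolding D_def by measurable
  \<comment> \<open>A majorant of the squared averages at all scales; being defined in
    \<open>ennreal\<close>, it needs no convergence in advance.\<close>
  define H where "H x = ennreal (2 * (avg c0 x)\<^sup>2) + ennreal (2 * A) * (\<Sum>k. ennreal ((D k x)\<^sup>2 / r ^ k))" for x
  have [measurable]: "H \<in> borel_measurable borel" unfolding H_def by measurable
  have tele: "avg (C n) x = avg c0 x + (\<Sum>k<n. D k x)" for n x
    using sum_lessThan_telescope[of "\<lambda>k. avg (C k) x" n] by (simp add: D_def C_def)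
  have ptH: "ennreal ((avg (C n) x)\<^sup>2) \<le> H x" for n x
  proof -
    have "(a + b)\<^sup>2 \<le> 2 * a\<^sup>2 + 2 * b\<^sup>2" for a b :: real
      using sum_squares_bound[of a b] by (simp add: power2_sum)
    then have "(avg (C n) x)\<^sup>2 \<le> 2 * (avg c0 x)\<^sup>2 + 2 * (\<Sum>k<n. D k x)\<^sup>2" unfolding tele .
    also have "\<dots> \<le> 2 * (avg c0 x)\<^sup>2 + 2 * A * (\<Sum>k<n. (D k x)\<^sup>2 / r ^ k)"
      using sq_sum_le_geometric[OF r, of "\<lambda>k. D k x" n] by (simp add: A_def)
    finally have "ennreal ((avg (C n) x)\<^sup>2) \<le> ennreal (2 * (avg c0 x)\<^sup>2 + 2 * A * (\<Sum>k<n. (D k x)\<^sup>2 / r ^ k))"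
      by (rule ennreal_leI)
    also have "\<dots> = ennreal (2 * (avg c0 x)\<^sup>2) + ennreal (2 * A) * (\<Sum>k<n. ennreal ((D k x)\<^sup>2 / r ^ k))"
      using A r by (simp add: ennreal_plus ennreal_mult sum_nonneg)
    also have "\<dots> \<le> H x" unfolding H_def by (intro add_left_mono mult_left_mono sum_le_suminf) auto
    finally show ?thesis .
  qed
  have Cpow: "C k powr (- \<beta>) = c0 powr (- \<beta>) * (r ^ k * r ^ k)" for k
  proof -
    have "(2 ^ k) powr (- \<beta>) = (2 powr (- \<beta>)) ^ k" by (simp add: powr_powr powr_realpow[symmetric] mult.commute)
    also have "2 powr (- \<beta>) = r * r" by (simp add: r_def flip: powr_add)
    finally show ?thesis using c0 by (simp add: C_def powr_mult power_mult_distrib)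
  qed
  have D_int: "(\<integral>\<^sup>+x. indicator P x * ennreal (w x * ((D k x)\<^sup>2 / r ^ k)) \<partial>lborel) \<le> ennreal (K * c0 powr (- \<beta>) * r ^ k)" for k
  proof -
    have "(\<integral>\<^sup>+x. indicator P x * ennreal (w x * ((D k x)\<^sup>2 / r ^ k)) \<partial>lborel)
        = (\<integral>\<^sup>+x. ennreal (1 / r ^ k) * (indicator P x * ennreal (w x * (avg (2 * C k) x - avg (C k) x)\<^sup>2)) \<partial>lborel)"
    proof (rule nn_integral_cong)
      fix x
      have "ennreal (w x * ((D k x)\<^sup>2 / r ^ k)) = ennreal (1 / r ^ k * (w x * (avg (2 * C k) x - avg (C k) x)\<^sup>2))"
      proof -
        have "2 * C k = C (Suc k)" by (simp add: C_def)
        then show ?thesis by (simp add: D_def)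
      qed
      also have "\<dots> = ennreal (1 / r ^ k) * ennreal (w x * (avg (2 * C k) x - avg (C k) x)\<^sup>2)"
        using r by (intro ennreal_mult') auto
      finally show "indicator P x * ennreal (w x * ((D k x)\<^sup>2 / r ^ k))
          = ennreal (1 / r ^ k) * (indicator P x * ennreal (w x * (avg (2 * C k) x - avg (C k) x)\<^sup>2))"
        by (simp add: mult.left_commute)
    qed
    also have "\<dots> = ennreal (1 / r ^ k) * (\<integral>\<^sup>+x. indicator P x * ennreal (w x * (avg (2 * C k) x - avg (C k) x)\<^sup>2) \<partial>lborel)"
      by (rule nn_integral_cmult) simp
    also have "\<dots> \<le> ennreal (1 / r ^ k) * ennreal (K * C k powr (- \<beta>))"
      unfolding K_def V_def \<beta>_def
      by (intro mult_left_mono nn_integral_weight_diff assms C) auto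
    also have "\<dots> = ennreal (1 / r ^ k * (K * C k powr (- \<beta>)))"
      using r by (intro ennreal_mult'[symmetric]) auto
    also have "1 / r ^ k * (K * C k powr (- \<beta>)) = K * c0 powr (- \<beta>) * r ^ k"
      unfolding Cpow using r by simp
    finally show ?thesis .
  qed
  \<comment> \<open>The coarsest average is bounded uniformly in \<open>x\<close>, so here
    \<open>w \<le> w powr q\<close>, valid because \<open>w \<ge> 1\<close>, is enough.\<close>
  have avg0_int: "(\<integral>\<^sup>+x. indicator P x * ennreal (w x * (2 * (avg c0 x)\<^sup>2)) \<partial>lborel)
      \<le> ennreal (2 * (c0 ^ DIM('a))\<^sup>2 * measure lborel \<Omega> * Nf * W)"
  proof -
    define b where "b = 2 * ((c0 ^ DIM('a))\<^sup>2 * (measure lborel \<Omega> * Nf))"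
    have b: "b \<ge> 0" using Nf_nonneg by (simp add: b_def)
    have "(\<integral>\<^sup>+x. indicator P x * ennreal (w x * (2 * (avg c0 x)\<^sup>2)) \<partial>lborel)
        \<le> (\<integral>\<^sup>+x. ennreal b * (indicator P x * ennreal (w x powr q)) \<partial>lborel)"
    proof (rule nn_integral_mono)
      fix x
      have "w x \<le> w x powr q" using powr_mono[of 1 q "w x"] q w[of x] by simp
      then have "w x * (2 * (avg c0 x)\<^sup>2) \<le> w x powr q * b"
        using avg_bound_sq[OF c0, of x] w[of x] by (intro mult_mono) (auto simp: b_def)
      then have "ennreal (w x * (2 * (avg c0 x)\<^sup>2)) \<le> ennreal (b * w x powr q)"
        by (intro ennreal_leI) (simp add: mult.commute)
      also have "\<dots> = ennreal b * ennreal (w x powr q)" by (rule ennreal_mult'[OF b])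
      finally show "indicator P x * ennreal (w x * (2 * (avg c0 x)\<^sup>2)) \<le> ennreal b * (indicator P x * ennreal (w x powr q))"
        by (auto simp: indicator_def)
    qed
    also have "\<dots> = ennreal b * (\<integral>\<^sup>+x. indicator P x * ennreal (w x powr q) \<partial>lborel)"
      by (rule nn_integral_cmult) simp
    also have "\<dots> \<le> ennreal b * ennreal W" by (intro mult_left_mono W) auto
    also have "\<dots> = ennreal (b * W)" by (rule ennreal_mult'[OF b, symmetric])
    finally show ?thesis by (simp add: b_def mult_ac)
  qed
  have H_int: "(\<integral>\<^sup>+x. indicator P x * (ennreal (w x) * H x) \<partial>lborel) \<le> ennreal (weight_const q * (1 + W) * (Nf + Ng))"
  proof -
    have "(\<integral>\<^sup>+x. indicator P x * (ennreal (w x) * H x) \<partial>lborel)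
        = (\<integral>\<^sup>+x. indicator P x * ennreal (w x * (2 * (avg c0 x)\<^sup>2))
            + ennreal (2 * A) * (\<Sum>k. indicator P x * ennreal (w x * ((D k x)\<^sup>2 / r ^ k))) \<partial>lborel)"
    proof (rule nn_integral_cong)
      fix x
      have w0: "0 \<le> w x" using w[of x] by simp
      show "indicator P x * (ennreal (w x) * H x) = indicator P x * ennreal (w x * (2 * (avg c0 x)\<^sup>2))
            + ennreal (2 * A) * (\<Sum>k. indicator P x * ennreal (w x * ((D k x)\<^sup>2 / r ^ k)))"
        unfolding H_def ennreal_mult'[OF w0] ennreal_suminf_cmult
        by (simp only: distrib_left mult.assoc mult.left_commute)
    qed
    also have "\<dots> = (\<integral>\<^sup>+x. indicator P x * ennreal (w x * (2 * (avg c0 x)\<^sup>2)) \<partial>lborel)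
        + ennreal (2 * A) * (\<Sum>k. \<integral>\<^sup>+x. indicator P x * ennreal (w x * ((D k x)\<^sup>2 / r ^ k)) \<partial>lborel)"
    proof -
      define S where "S x = (\<Sum>k. indicator P x * ennreal (w x * ((D k x)\<^sup>2 / r ^ k)))" for x
      have [measurable]: "S \<in> borel_measurable borel" unfolding S_def by measurable
      have 1: "(\<integral>\<^sup>+x. indicator P x * ennreal (w x * (2 * (avg c0 x)\<^sup>2)) + ennreal (2 * A) * S x \<partial>lborel)
          = (\<integral>\<^sup>+x. indicator P x * ennreal (w x * (2 * (avg c0 x)\<^sup>2)) \<partial>lborel) + (\<integral>\<^sup>+x. ennreal (2 * A) * S x \<partial>lborel)"
        by (rule nn_integral_add) measurable
      have 2: "(\<integral>\<^sup>+x. ennreal (2 * A) * S x \<partial>lborel) = ennreal (2 * A) * (\<integral>\<^sup>+x. S x \<partial>lborel)"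
        by (rule nn_integral_cmult) measurable
      have 3: "(\<integral>\<^sup>+x. S x \<partial>lborel)
          = (\<Sum>k. \<integral>\<^sup>+x. indicator P x * ennreal (w x * ((D k x)\<^sup>2 / r ^ k)) \<partial>lborel)"
        unfolding S_def by (rule nn_integral_suminf) measurable
      show ?thesis using 1[unfolded 2 3] unfolding S_def .
    qed
    also have "\<dots> \<le> ennreal (2 * (c0 ^ DIM('a))\<^sup>2 * measure lborel \<Omega> * Nf * W)
        + ennreal (2 * A) * (\<Sum>k. ennreal (K * c0 powr (- \<beta>) * r ^ k))"
      by (intro add_mono mult_left_mono suminf_le avg0_int D_int summableI) auto
    also have "(\<Sum>k. ennreal (K * c0 powr (- \<beta>) * r ^ k)) = ennreal (\<Sum>k. K * c0 powr (- \<beta>) * r ^ k)"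
      using K r by (intro suminf_ennreal2 summable_mult summable_geometric) auto
    also have "(\<Sum>k. K * c0 powr (- \<beta>) * r ^ k) = K * c0 powr (- \<beta>) * A"
      using r by (simp add: suminf_mult suminf_geometric A_def)
    also have "ennreal (2 * (c0 ^ DIM('a))\<^sup>2 * measure lborel \<Omega> * Nf * W) + ennreal (2 * A) * ennreal (K * c0 powr (- \<beta>) * A)
        = ennreal (2 * (c0 ^ DIM('a))\<^sup>2 * measure lborel \<Omega> * Nf * W + 2 * A * (K * c0 powr (- \<beta>) * A))"
      using A K W(2) Nf_nonneg by (simp add: ennreal_plus ennreal_mult)
    also have "\<dots> \<le> ennreal (weight_const q * (1 + W) * (Nf + Ng))"
    proof (rule ennreal_leI)
      define a1 where "a1 = 2 * (c0 ^ DIM('a))\<^sup>2 * measure lborel \<Omega>"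
      define a2 where "a2 = 2 * A * (A * (8 ^ DIM('a) * V * (V * 2 ^ DIM('a) + 1) * c0 powr (- \<beta>)))"
      have a: "a1 \<ge> 0" "a2 \<ge> 0" using A V by (auto simp: a1_def a2_def)
      have wc: "weight_const q = a1 + a2"
        unfolding weight_const_def Let_def a1_def a2_def V_def A_def r_def \<beta>_def by (rule refl)
      have "2 * (c0 ^ DIM('a))\<^sup>2 * measure lborel \<Omega> * Nf * W + 2 * A * (K * c0 powr (- \<beta>) * A)
          = a1 * Nf * W + a2 * ((1 + W) * Ng)"
        by (simp add: a1_def a2_def K_def mult_ac)
      also have "\<dots> \<le> a1 * (Nf + Ng) * (1 + W) + a2 * ((1 + W) * (Nf + Ng))"
        using a W(2) Nf_nonneg Ng_nonneg by (intro add_mono mult_mono) (auto intro!: mult_nonneg_nonneg)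
      also have "\<dots> = weight_const q * (1 + W) * (Nf + Ng)" by (simp add: wc algebra_simps)
      finally show "2 * (c0 ^ DIM('a))\<^sup>2 * measure lborel \<Omega> * Nf * W + 2 * A * (K * c0 powr (- \<beta>) * A)
          \<le> weight_const q * (1 + W) * (Nf + Ng)" .
    qed
    finally show ?thesis .
  qed
  \<comment> \<open>Since \<open>w \<ge> 1\<close>, the unweighted integral is finite as well;
    finiteness of \<open>H\<close> almost everywhere yields the pointwise convergence of the
    averages.\<close>
  have H_int1: "(\<integral>\<^sup>+x. indicator P x * H x \<partial>lborel) < \<infinity>"
  proof -
    have "(\<integral>\<^sup>+x. indicator P x * H x \<partial>lborel) \<le> (\<integral>\<^sup>+x. indicator P x * (ennreal (w x) * H x) \<partial>lborel)"
    proof (intro nn_integral_mono mult_left_mono)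
      fix x
      have "1 * H x \<le> ennreal (w x) * H x" using w[of x] by (intro mult_right_mono) auto
      then show "H x \<le> ennreal (w x) * H x" by simp
    qed auto
    also have "\<dots> < \<infinity>" using H_int by (auto simp: less_top[symmetric] top_unique)
    finally show ?thesis .
  qed
  have H_fin: "AE x in lborel. x \<in> P \<longrightarrow> H x \<noteq> \<infinity>"
  proof -
    have "AE x in lborel. indicator P x * H x \<noteq> \<infinity>" using H_int1 by (intro nn_integral_PInf_AE) auto
    then show ?thesis by eventually_elim auto
  qed
  define Fs where "Fs x = lim (\<lambda>n. avg (C n) x)" for x
  have [measurable]: "Fs \<in> borel_measurable borel" unfolding Fs_def by (rule borel_measurable_lim_metric) simp
  have conv: "AE x in lborel. x \<in> P \<longrightarrow> (\<lambda>n. avg (C n) x) \<longlonglongrightarrow> Fs x"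
    using H_fin
  proof (eventually_elim, intro impI)
    fix x assume "x \<in> P \<longrightarrow> H x \<noteq> \<infinity>" "x \<in> P"
    then have "H x \<noteq> \<infinity>" by simp
    then have "ennreal (2 * A) * (\<Sum>k. ennreal ((D k x)\<^sup>2 / r ^ k)) \<noteq> \<infinity>" by (auto simp: H_def)
    then have "(\<Sum>k. ennreal ((D k x)\<^sup>2 / r ^ k)) \<noteq> \<infinity>" using A by (auto simp: ennreal_mult_eq_top_iff)
    then have sq: "summable (\<lambda>k. (D k x)\<^sup>2 / r ^ k)"
      unfolding infinity_ennreal_def by (rule summable_suminf_not_top[rotated]) (use r in simp)
    \<comment> \<open>Young's inequality with weight \<open>r^k\<close> deduces absolute summability
      from the weighted sum of squares.\<close>
    have "norm (D k x) \<le> r ^ k + (D k x)\<^sup>2 / r ^ k" for k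
    proof -
      have "2 * \<bar>D k x\<bar> * r ^ k \<le> \<bar>D k x\<bar>\<^sup>2 + (r ^ k)\<^sup>2" by (rule sum_squares_bound)
      then have "2 * \<bar>D k x\<bar> \<le> r ^ k + (D k x)\<^sup>2 / r ^ k"
        using r by (simp add: field_simps power2_eq_square)
      moreover have "\<bar>D k x\<bar> \<ge> 0" by simp
      ultimately show ?thesis unfolding real_norm_def by linarith
    qed
    then have "summable (\<lambda>k. D k x)"
      using r by (intro summable_comparison_test'[OF summable_add[OF summable_geometric sq]]) auto
    then have "convergent (\<lambda>n. avg c0 x + (\<Sum>k<n. D k x))"
      by (intro convergent_add convergent_const) (simp add: summable_iff_convergent)
    then show "(\<lambda>n. avg (C n) x) \<longlonglongrightarrow> Fs x" by (simp add: Fs_def tele convergent_LIMSEQ_iff)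
  qed
  have limH: "AE x in lborel. x \<in> P \<longrightarrow> ennreal ((Fs x)\<^sup>2) \<le> H x"
    using conv
  proof (eventually_elim, intro impI)
    fix x assume "x \<in> P \<longrightarrow> (\<lambda>n. avg (C n) x) \<longlonglongrightarrow> Fs x" "x \<in> P"
    then have "(\<lambda>n. ennreal ((avg (C n) x)\<^sup>2)) \<longlonglongrightarrow> ennreal ((Fs x)\<^sup>2)" by (intro tendsto_intros) auto
    then show "ennreal ((Fs x)\<^sup>2) \<le> H x"
      by (rule tendsto_upperbound) (use ptH in auto)
  qed
  \<comment> \<open>An integrable majorant for the averages themselves, obtained from
    \<open>\<bar>v\<bar> \<le> 1 + v\<^sup>2\<close>; the bounded patch makes the constant
    integrable.\<close>
  define G where "G x = indicator P x * (1 + enn2real (H x))" for x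
  have [measurable]: "G \<in> borel_measurable borel" unfolding G_def by measurable
  have Pfin: "emeasure lborel P < \<infinity>"
    using bounded_subset[OF bounded_dom P_sub] by (rule emeasure_bounded_finite)
  have G_int: "integrable lborel G"
  proof (rule integrableI_nonneg)
    have "(\<integral>\<^sup>+x. ennreal (G x) \<partial>lborel) \<le> (\<integral>\<^sup>+x. indicator P x + indicator P x * H x \<partial>lborel)"
      using H_fin
      by (intro nn_integral_mono_AE, eventually_elim)
        (auto simp: G_def indicator_def ennreal_plus ennreal_enn2real_if)
    also have "\<dots> = emeasure lborel P + (\<integral>\<^sup>+x. indicator P x * H x \<partial>lborel)"
      by (simp add: nn_integral_add)
    also have "\<dots> < \<infinity>" using Pfin H_int1 by simp
    finally show "(\<integral>\<^sup>+x. ennreal (G x) \<partial>lborel) < \<infinity>" .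
  qed (auto simp: G_def)
  have bound: "x \<in> P \<longrightarrow> \<bar>v\<bar> \<le> G x" if "ennreal (v\<^sup>2) \<le> H x" "x \<in> P \<longrightarrow> H x \<noteq> \<infinity>" for v x
  proof
    assume x: "x \<in> P"
    then have "ennreal (v\<^sup>2) \<le> ennreal (enn2real (H x))" using that by (simp add: ennreal_enn2real_if)
    then have "v\<^sup>2 \<le> enn2real (H x)" by simp
    moreover have "2 * \<bar>v\<bar> * 1 \<le> \<bar>v\<bar>\<^sup>2 + 1\<^sup>2" by (rule sum_squares_bound)
    then have "\<bar>v\<bar> \<le> 1 + v\<^sup>2" using zero_le_power2[of v] by simp
    ultimately show "\<bar>v\<bar> \<le> G x" using x by (simp add: G_def)
  qed
  have ident: "(\<integral>x. Fs x * \<theta> x \<partial>lborel) = mass * (\<integral>x. f x * \<theta> x \<partial>lborel)"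
    and \<theta>int: "integrable lborel (\<lambda>x. Fs x * \<theta> x)" "integrable lborel (\<lambda>x. f x * \<theta> x)"
    if \<theta>: "\<theta> \<in> test_functions P" for \<theta>
  proof -
    have \<theta>c: "continuous_on UNIV \<theta>" using \<theta> by (rule test_functions_continuous)
    have [measurable]: "\<theta> \<in> borel_measurable borel" using \<theta>c by (rule borel_measurable_continuous_onI)
    have Kc: "compact (closure {x. \<theta> x \<noteq> 0})" using \<theta> by (simp add: test_functions_def)
    have \<theta>0: "\<theta> x = 0" if "x \<notin> closure {x. \<theta> x \<noteq> 0}" for x
      using that closure_subset[of "{x. \<theta> x \<noteq> 0}"] by auto
    have \<theta>P: "\<theta> x = 0" if "x \<notin> P" for x
      using that \<theta> closure_subset[of "{x. \<theta> x \<noteq> 0}"] by (auto simp: test_functions_def)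
    obtain B where B: "B > 0" "\<And>x. \<bar>\<theta> x\<bar> \<le> B" using continuous_compact_support_bounded[OF \<theta>c Kc \<theta>0] by blast
    have dom: "AE x in lborel. norm (avg (C n) x * \<theta> x) \<le> G x * B" for n
      using H_fin
    proof eventually_elim
      fix x assume x: "x \<in> P \<longrightarrow> H x \<noteq> \<infinity>"
      show "norm (avg (C n) x * \<theta> x) \<le> G x * B"
      proof (cases "x \<in> P")
        case True
        then show ?thesis using bound[OF ptH x] B unfolding real_norm_def abs_mult by (intro mult_mono) (auto simp: G_def)
      qed (simp add: \<theta>P G_def)
    qed
    have domF: "AE x in lborel. norm (Fs x * \<theta> x) \<le> norm (G x * B)"
      using H_fin limH
    proof eventually_elim
      fix x assume x: "x \<in> P \<longrightarrow> H x \<noteq> \<infinity>" "x \<in> P \<longrightarrow> ennreal ((Fs x)\<^sup>2) \<le> H x"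
      show "norm (Fs x * \<theta> x) \<le> norm (G x * B)"
      proof (cases "x \<in> P")
        case True
        have "\<bar>Fs x\<bar> * \<bar>\<theta> x\<bar> \<le> G x * B"
          using bound[of "Fs x" x] x True B by (intro mult_mono) (auto simp: G_def)
        then show ?thesis unfolding real_norm_def abs_mult[of "Fs x"] by linarith
      qed (simp add: \<theta>P G_def)
    qed
    have "(\<lambda>n. \<integral>x. avg (C n) x * \<theta> x \<partial>lborel) \<longlonglongrightarrow> (\<integral>x. Fs x * \<theta> x \<partial>lborel)"
    proof (rule integral_dominated_convergence[OF _ _ _ _ dom])
      show "AE x in lborel. (\<lambda>n. avg (C n) x * \<theta> x) \<longlonglongrightarrow> Fs x * \<theta> x"
        using conv
      proof eventually_elim
        fix x assume x: "x \<in> P \<longrightarrow> (\<lambda>n. avg (C n) x) \<longlonglongrightarrow> Fs x"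
        show "(\<lambda>n. avg (C n) x * \<theta> x) \<longlonglongrightarrow> Fs x * \<theta> x"
          using x by (cases "x \<in> P") (auto simp: \<theta>P intro: tendsto_intros)
      qed
    qed (use G_int in auto)
    with avg_tendsto_weakly[OF \<theta> C(1) Clim] show "(\<integral>x. Fs x * \<theta> x \<partial>lborel) = mass * (\<integral>x. f x * \<theta> x \<partial>lborel)"
      by (rule LIMSEQ_unique[rotated])
    show "integrable lborel (\<lambda>x. Fs x * \<theta> x)"
      by (rule Bochner_Integration.integrable_bound[OF _ _ domF]) (use G_int in auto)
    show "integrable lborel (\<lambda>x. f x * \<theta> x)" using B(2) by (intro f_mult_integrable) auto
  qed
  \<comment> \<open>Both functions give the same integral against every test function on
    \<open>P\<close>, so the fundamental lemma identifies them.\<close>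
  have eq: "AE x in lebesgue_on P. Fs x - mass * f x = 0"
  proof (rule AE_eq_0_if_test_functions[OF open_P])
    have "integrable lborel (\<lambda>x. indicator P x * Fs x)"
    proof (rule Bochner_Integration.integrable_bound[OF G_int])
      show "AE x in lborel. norm (indicator P x * Fs x) \<le> norm (G x)"
        using H_fin limH
      proof eventually_elim
        fix x assume x: "x \<in> P \<longrightarrow> H x \<noteq> \<infinity>" "x \<in> P \<longrightarrow> ennreal ((Fs x)\<^sup>2) \<le> H x"
        show "norm (indicator P x * Fs x) \<le> norm (G x)"
          using bound[of "Fs x" x] x by (cases "x \<in> P") auto
      qed
    qed simp
    moreover have "integrable lborel (\<lambda>x. indicator P x * (mass * f x))"
      using integrable_mult_indicator[OF _ integrable_mult_right[OF f_integrable, of mass], of P] by simp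
    ultimately have "integrable lborel (\<lambda>x. indicator P x * (Fs x - mass * f x))"
      by (simp add: right_diff_distrib)
    then show "integrable (lebesgue_on P) (\<lambda>x. Fs x - mass * f x)" by (rule integrable_lebesgue_on_borel(1)[OF Ps])
    fix \<theta> assume \<theta>: "\<theta> \<in> test_functions P"
    have \<theta>P: "\<theta> x = 0" if "x \<notin> P" for x
      using that \<theta> closure_subset[of "{x. \<theta> x \<noteq> 0}"] by (auto simp: test_functions_def)
    then have cut: "(\<lambda>x. indicator P x * ((Fs x - mass * f x) * \<theta> x)) = (\<lambda>x. Fs x * \<theta> x - mass * (f x * \<theta> x))"
      by (auto simp: fun_eq_iff indicator_def algebra_simps)
    have i: "integrable lborel (\<lambda>x. Fs x * \<theta> x - mass * (f x * \<theta> x))" using \<theta>int[OF \<theta>] by simp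
    have "(\<integral>x. (Fs x - mass * f x) * \<theta> x \<partial>lebesgue_on P) = (\<integral>x. Fs x * \<theta> x - mass * (f x * \<theta> x) \<partial>lborel)"
      using integrable_lebesgue_on_borel(2)[OF Ps, of "\<lambda>x. (Fs x - mass * f x) * \<theta> x"] i by (simp only: cut)
    also have "\<dots> = 0" using \<theta>int[OF \<theta>] ident[OF \<theta>] by simp
    finally show "(\<integral>x. (Fs x - mass * f x) * \<theta> x \<partial>lebesgue_on P) = 0" .
  qed
  have "AE x in lborel. x \<in> P \<longrightarrow> Fs x = mass * f x"
  proof -
    have "AE x in lebesgue. x \<in> P \<longrightarrow> Fs x = mass * f x" using eq Ps by (simp add: AE_restrict_space_iff)
    then show ?thesis by (simp add: AE_completion_iff)
  qed
  with limH have "AE x in lborel. indicator P x * ennreal (w x * (mass * f x)\<^sup>2) \<le> indicator P x * (ennreal (w x) * H x)"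
  proof eventually_elim
    fix x assume x: "x \<in> P \<longrightarrow> Fs x = mass * f x" "x \<in> P \<longrightarrow> ennreal ((Fs x)\<^sup>2) \<le> H x"
    show "indicator P x * ennreal (w x * (mass * f x)\<^sup>2) \<le> indicator P x * (ennreal (w x) * H x)"
    proof (cases "x \<in> P")
      case True
      have "ennreal (w x * (mass * f x)\<^sup>2) = ennreal (w x) * ennreal ((mass * f x)\<^sup>2)"
        using w[of x] by (intro ennreal_mult') auto
      also have "\<dots> \<le> ennreal (w x) * H x" using x True by (intro mult_left_mono) auto
      finally show ?thesis using True by simp
    qed simp
  qed
  then have "(\<integral>\<^sup>+x. indicator P x * ennreal (w x * (mass * f x)\<^sup>2) \<partial>lborel)
      \<le> (\<integral>\<^sup>+x. indicator P x * (ennreal (w x) * H x) \<partial>lborel)" by (rule nn_integral_mono_AE)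
  also note H_int
  finally show ?thesis .
qed

end

subsection \<open>Multipliers on the Sobolev space H1 of a Lipschitz domain\<close>

text \<open>Elements of the function spaces are Lebesgue measurable on \<Omega> only. Borel
  representatives that vanish outside it give access to \<open>lborel\<close>, product measures and
  Fubini.\<close>

lemma ex_borel_representative_real:
  fixes \<phi> :: "'a::euclidean_space \<Rightarrow> real"
  assumes S: "S \<in> sets borel" and \<phi>: "\<phi> \<in> borel_measurable (lebesgue_on S)"
  shows "\<exists>f\<in>borel_measurable borel. (\<forall>x. x \<notin> S \<longrightarrow> f x = 0) \<and> (AE x in lebesgue_on S. f x = \<phi> x)"
proof -
  have SL: "S \<in> sets lebesgue" using S by simp
  have "(\<lambda>x. if x \<in> S then \<phi> x else 0) \<in> borel_measurable lebesgue"
    using \<phi> SL by (rule borel_measurable_if_I)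
  then obtain f' where f': "f' \<in> borel_measurable lborel" "AE x in lborel. (if x \<in> S then \<phi> x else 0) = f' x"
    using completion_ex_borel_measurable_real by blast
  have "AE x in lebesgue. (if x \<in> S then \<phi> x else 0) = f' x" using f'(2) by (rule AE_completion)
  then have "AE x in lebesgue_on S. indicator S x * f' x = \<phi> x"
    using SL by (simp add: AE_restrict_space_iff) (auto elim!: eventually_mono)
  moreover have "(\<lambda>x. indicator S x * f' x) \<in> borel_measurable borel" using f'(1) S by simp
  ultimately show ?thesis by (intro bexI[of _ "\<lambda>x. indicator S x * f' x"]) auto
qed

lemma ex_borel_representative:
  fixes g :: "'a::euclidean_space \<Rightarrow> 'b::euclidean_space"
  assumes S: "S \<in> sets borel" and g: "g \<in> borel_measurable (lebesgue_on S)"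
  shows "\<exists>f\<in>borel_measurable borel. (\<forall>x. x \<notin> S \<longrightarrow> f x = 0) \<and> (AE x in lebesgue_on S. f x = g x)"
proof -
  have "\<forall>i\<in>Basis. \<exists>f\<in>borel_measurable borel. (\<forall>x. x \<notin> S \<longrightarrow> f x = 0) \<and> (AE x in lebesgue_on S. f x = g x \<bullet> i)"
    using g by (intro ballI ex_borel_representative_real[OF S]) simp
  then have "\<exists>F. \<forall>i\<in>Basis. F i \<in> borel_measurable borel \<and> (\<forall>x. x \<notin> S \<longrightarrow> F i x = 0) \<and> (AE x in lebesgue_on S. F i x = g x \<bullet> i)"
    unfolding Bex_def by (rule bchoice)
  then obtain F where F: "\<And>i. i \<in> Basis \<Longrightarrow> F i \<in> borel_measurable borel"
    "\<And>i x. i \<in> Basis \<Longrightarrow> x \<notin> S \<Longrightarrow> F i x = 0" "\<And>i. i \<in> Basis \<Longrightarrow> AE x in lebesgue_on S. F i x = g x \<bullet> i"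
    by blast
  have "AE x in lebesgue_on S. \<forall>i\<in>Basis. F i x = g x \<bullet> i" using F(3) by (intro AE_finite_allI) auto
  then have "AE x in lebesgue_on S. (\<Sum>i\<in>Basis. F i x *\<^sub>R i) = g x"
    by eventually_elim (simp add: euclidean_representation)
  moreover have "(\<lambda>x. \<Sum>i\<in>Basis. F i x *\<^sub>R i) \<in> borel_measurable borel"
    using F(1) by (intro borel_measurable_sum borel_measurable_scaleR) auto
  ultimately show ?thesis using F(2) by (intro bexI[of _ "\<lambda>x. \<Sum>i\<in>Basis. F i x *\<^sub>R i"]) auto
qed

lemma borel_representative_integral:
  fixes h k :: "'a::euclidean_space \<Rightarrow> real"
  assumes S: "S \<in> sets borel" and h: "h \<in> borel_measurable borel" "\<And>x. x \<notin> S \<Longrightarrow> h x = 0"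
    and k: "k \<in> borel_measurable (lebesgue_on S)" "AE x in lebesgue_on S. h x = k x"
  shows "(\<integral>x. k x \<partial>lebesgue_on S) = (\<integral>x. h x \<partial>lborel)"
    and "integrable (lebesgue_on S) k \<longleftrightarrow> integrable lborel h"
proof -
  have SL: "S \<in> sets lebesgue" using S by simp
  have cut: "(\<lambda>x. indicator S x *\<^sub>R h x) = h" using h(2) by (auto simp: fun_eq_iff indicator_def)
  have hm: "h \<in> borel_measurable (lebesgue_on S)" using h(1) by (intro measurable_restrict_space1 measurable_completion) simp
  have "(\<integral>x. k x \<partial>lebesgue_on S) = (\<integral>x. h x \<partial>lebesgue_on S)"
    using k(2) by (intro integral_cong_AE k hm) auto
  also have "\<dots> = (\<integral>x. indicator S x *\<^sub>R h x \<partial>lebesgue)" using SL by (intro integral_restrict_space) auto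
  also have "\<dots> = (\<integral>x. h x \<partial>lborel)" unfolding cut using h(1) by (intro integral_completion) simp
  finally show "(\<integral>x. k x \<partial>lebesgue_on S) = (\<integral>x. h x \<partial>lborel)" .
  have "integrable (lebesgue_on S) k \<longleftrightarrow> integrable (lebesgue_on S) h"
    using k(2) by (intro integrable_cong_AE k hm) auto
  also have "\<dots> \<longleftrightarrow> integrable lebesgue (\<lambda>x. indicator S x *\<^sub>R h x)" using SL by (simp add: integrable_restrict_space)
  also have "\<dots> \<longleftrightarrow> integrable lborel h" unfolding cut using h(1) by (simp add: integrable_completion)
  finally show "integrable (lebesgue_on S) k \<longleftrightarrow> integrable lborel h" .
qed

section \<open>The uniform cone property\<close>

lemma norm_orthogonal_part_le:
  assumes "norm e = 1"
  shows "norm (u - (u \<bullet> e) *\<^sub>R e) \<le> norm u"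
proof (rule power2_le_imp_le)
  have "e \<bullet> e = 1" using assms by (simp add: norm_eq_1)
  then have "(norm (u - (u \<bullet> e) *\<^sub>R e))\<^sup>2 = (norm u)\<^sup>2 - (u \<bullet> e)\<^sup>2"
    unfolding power2_norm_eq_inner
    by (simp add: inner_diff_left inner_diff_right inner_commute power2_eq_square)
  then show "(norm (u - (u \<bullet> e) *\<^sub>R e))\<^sup>2 \<le> (norm u)\<^sup>2" by simp
qed simp

text \<open>Near a boundary point the graph function cannot rise as fast as a point moving inside a
  narrow cone around the direction \<open>e\<close>. At an interior point every direction works. The
  statement covers all of the closure so that compactness can be applied.\<close>

lemma lipschitz_domain_cone:
  fixes \<Omega> :: "'a::euclidean_space set"
  assumes dom: "lipschitz_domain \<Omega>" and z: "z \<in> closure \<Omega>"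
  shows "\<exists>e \<rho> r c0. norm e = 1 \<and> 0 < \<rho> \<and> \<rho> \<le> 1 \<and> 0 < r \<and> 0 < c0 \<and>
    (\<forall>x\<in>\<Omega> \<inter> ball z r. \<forall>c\<ge>c0. \<forall>w\<in>cball e \<rho>. x + (1 / c) *\<^sub>R w \<in> \<Omega>)"
proof -
  \<comment> \<open>A displacement by \<open>(1 / c) *\<^sub>R w\<close> has length at most
    \<open>2 / c\<close>, hence at most \<open>r\<close>, and stays in the doubled ball.\<close>
  have near: "x + (1 / c) *\<^sub>R w \<in> ball z (2 * r)"
    if "x \<in> ball z r" "2 / r \<le> c" "w \<in> cball e \<rho>" "norm e = 1" "\<rho> \<le> 1" "r > 0" for x c r \<rho> and w e :: 'a
  proof -
    have c: "c > 0" using that(2,6) by (meson divide_pos_pos less_le_trans zero_less_numeral)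
    have "norm w \<le> 2" using that(3-5) norm_triangle_ineq2[of w e] by (simp add: dist_norm norm_minus_commute)
    then have "norm w / c \<le> 2 / c" using c by (simp add: divide_right_mono)
    also have "2 / c \<le> r" using that(2,6) c by (simp add: field_simps)
    finally have "norm ((1 / c) *\<^sub>R w) \<le> r" using c by simp
    moreover have "dist z (x + (1 / c) *\<^sub>R w) \<le> dist z x + norm ((1 / c) *\<^sub>R w)"
      using dist_triangle[of z "x + (1 / c) *\<^sub>R w" x] by (simp add: dist_norm)
    ultimately show ?thesis using that(1) by simp
  qed
  show ?thesis
  proof (cases "z \<in> \<Omega>")
    case True
    have "open \<Omega>" using dom by (simp add: lipschitz_domain_def)
    then obtain R where R: "R > 0" "ball z R \<subseteq> \<Omega>" using True open_contains_ball by blast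
    obtain e :: 'a where e: "e \<in> Basis" using nonempty_Basis by blast
    show ?thesis
    proof (intro exI conjI ballI allI impI)
      show "norm e = 1" using e by simp
      show "0 < (1::real)" "(1::real) \<le> 1" "0 < R / 2" "0 < 2 / (R / 2)" using R by auto
      fix x c w assume "x \<in> \<Omega> \<inter> ball z (R / 2)" "2 / (R / 2) \<le> c" "w \<in> cball e 1"
      then show "x + (1 / c) *\<^sub>R w \<in> \<Omega>" using near[of x "R / 2" c w e 1] R e by auto
    qed
  next
    case False
    have "open \<Omega>" using dom by (simp add: lipschitz_domain_def)
    then have "z \<in> frontier \<Omega>" using z False by (simp add: frontier_def interior_open)
    then obtain e \<gamma> L V where V: "norm e = 1" "open V" "z \<in> V" "L-lipschitz_on {x. x \<bullet> e = 0} \<gamma>"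
        "\<Omega> \<inter> V = {x \<in> V. \<gamma> (x - (x \<bullet> e) *\<^sub>R e) < x \<bullet> e}"
      using dom unfolding lipschitz_domain_def by blast
    obtain R where R: "R > 0" "ball z R \<subseteq> V" using V(2,3) open_contains_ball by blast
    have L: "L \<ge> 0" using V(4) by (rule lipschitz_on_nonneg)
    \<comment> \<open>The opening solves \<open>L * \<rho> = 1 - \<rho>\<close>: the largest rise of
      the graph along the cone equals the smallest rise of the moving point. Strictness is inherited
      from the starting point.\<close>
    define \<rho> where "\<rho> = 1 / (1 + L)"
    have \<rho>: "0 < \<rho>" "\<rho> \<le> 1" "L * \<rho> \<le> 1 - \<rho>" using L by (auto simp: \<rho>_def field_simps)
    have ee: "e \<bullet> e = 1" using V(1) by (simp add: norm_eq_1)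
    define \<pi> where "\<pi> x = x - (x \<bullet> e) *\<^sub>R e" for x
    have \<pi>0: "\<pi> x \<in> {x. x \<bullet> e = 0}" for x by (simp add: \<pi>_def inner_diff_left ee)
    show ?thesis
    proof (intro exI conjI ballI allI impI)
      show "norm e = 1" "0 < \<rho>" "\<rho> \<le> 1" using V \<rho> by auto
      show "0 < R / 2" "0 < 2 / (R / 2)" using R by auto
      fix x c w assume x: "x \<in> \<Omega> \<inter> ball z (R / 2)" and c: "2 / (R / 2) \<le> c" and w: "w \<in> cball e \<rho>"
      let ?y = "x + (1 / c) *\<^sub>R w"
      have "0 < 2 / (R / 2)" using R by simp
      then have cpos: "c > 0" using c by linarith
      have yV: "?y \<in> V" using near[of x "R / 2" c w e \<rho>] x c w V(1) \<rho>(2) R by auto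
      have "x \<in> V" using x R by auto
      then have gx: "\<gamma> (\<pi> x) < x \<bullet> e" using x V(5) unfolding \<pi>_def by blast
      have nw: "norm (w - e) \<le> \<rho>" using w by (simp add: dist_norm norm_minus_commute)
      have "\<bar>(w - e) \<bullet> e\<bar> \<le> \<rho>" using Cauchy_Schwarz_ineq2[of "w - e" e] nw V(1) by simp
      then have we: "w \<bullet> e \<ge> 1 - \<rho>" using ee by (simp add: inner_diff_left)
      \<comment> \<open>Movement along \<open>e\<close> does not shift the base point of the graph,
        so only the deviation \<open>w - e\<close>, of size at most \<open>\<rho>\<close>,
        counts.\<close>
      have "\<pi> w = \<pi> (w - e)" by (simp add: \<pi>_def inner_diff_left ee algebra_simps)
      then have pw: "norm (\<pi> w) \<le> \<rho>" using norm_orthogonal_part_le[OF V(1), of "w - e", folded \<pi>_def] nw by simp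
      have py: "\<pi> ?y = \<pi> x + (1 / c) *\<^sub>R \<pi> w" by (simp add: \<pi>_def inner_add_left algebra_simps)
      have "dist (\<gamma> (\<pi> ?y)) (\<gamma> (\<pi> x)) \<le> L * dist (\<pi> ?y) (\<pi> x)"
        by (rule lipschitz_onD[OF V(4) \<pi>0 \<pi>0])
      then have "\<gamma> (\<pi> ?y) \<le> \<gamma> (\<pi> x) + L * (norm (\<pi> w) / c)"
        using cpos by (simp add: py dist_norm abs_le_iff)
      also have "L * (norm (\<pi> w) / c) \<le> L * (\<rho> / c)"
        using pw L cpos by (intro mult_left_mono divide_right_mono) auto
      also have "L * (\<rho> / c) \<le> (1 - \<rho>) / c" using \<rho>(3) cpos by (simp add: divide_right_mono)
      also have "(1 - \<rho>) / c \<le> (w \<bullet> e) / c" using we cpos by (simp add: divide_right_mono)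
      finally have "\<gamma> (\<pi> ?y) < x \<bullet> e + (w \<bullet> e) / c" using gx by linarith
      then have "\<gamma> (\<pi> ?y) < ?y \<bullet> e" by (simp add: inner_add_left)
      then show "?y \<in> \<Omega>" using yV V(5) unfolding \<pi>_def by blast
    qed
  qed
qed

text \<open>The representatives are chosen once and serve every patch, so the local estimates can be
  added for one and the same function.\<close>

lemma H1_weakly_differentiable_on_patch:
  assumes op: "open \<Omega>" and y: "y \<in> H1 \<Omega>"
  shows "\<exists>f g. (\<forall>P e \<rho> c0. cone_patch \<Omega> P e \<rho> c0 \<longrightarrow> weakly_differentiable_on_patch \<Omega> P e \<rho> c0 f g) \<and>
     f \<in> borel_measurable borel \<and> (AE x in lebesgue_on \<Omega>. f x = y x) \<and>
     (\<integral>x. (f x)\<^sup>2 \<partial>lborel) + (\<integral>x. (norm (g x))\<^sup>2 \<partial>lborel) = (norm_H1 \<Omega> y)\<^sup>2"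
proof -
  have S: "\<Omega> \<in> sets borel" using op by simp
  have SL: "\<Omega> \<in> sets lebesgue" using op by simp
  note ym = L2_measurable[OF H1_L2[OF y]] and gm = L2_measurable[OF wgrad_L2[OF y]]
  obtain f where f: "f \<in> borel_measurable borel" "\<And>x. x \<notin> \<Omega> \<Longrightarrow> f x = 0" "AE x in lebesgue_on \<Omega>. f x = y x"
    using ex_borel_representative[OF S ym] by blast
  obtain g where g: "g \<in> borel_measurable borel" "\<And>x. x \<notin> \<Omega> \<Longrightarrow> g x = 0" "AE x in lebesgue_on \<Omega>. g x = wgrad \<Omega> y x"
    using ex_borel_representative[OF S gm] by blast
  have f2: "AE x in lebesgue_on \<Omega>. (f x)\<^sup>2 = (norm (y x))\<^sup>2" using f(3) by eventually_elim simp
  have g2: "AE x in lebesgue_on \<Omega>. (norm (g x))\<^sup>2 = (norm (wgrad \<Omega> y x))\<^sup>2" using g(3) by eventually_elim simp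
  note If = borel_representative_integral[OF S _ _ _ f2] and Ig = borel_representative_integral[OF S _ _ _ g2]
  have fsq: "integrable lborel (\<lambda>x. (f x)\<^sup>2)"
    using L2_integrable_sq[OF H1_L2[OF y]] f ym by (subst If(2)[symmetric]) auto
  have gsq: "integrable lborel (\<lambda>x. (norm (g x))\<^sup>2)"
    using L2_integrable_sq[OF wgrad_L2[OF y]] g gm by (subst Ig(2)[symmetric]) auto
  have nf: "(norm_L2 \<Omega> y)\<^sup>2 = (\<integral>x. (f x)\<^sup>2 \<partial>lborel)"
    unfolding norm_L2_power2_integral using f ym by (intro If(1)) auto
  have ng: "(norm_L2 \<Omega> (wgrad \<Omega> y))\<^sup>2 = (\<integral>x. (norm (g x))\<^sup>2 \<partial>lborel)"
    unfolding norm_L2_power2_integral using g gm by (intro Ig(1)) auto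
  have weak: "(\<integral>x. f x * frechet_derivative \<phi> (at x) i \<partial>lborel) = - (\<integral>x. (g x \<bullet> i) * \<phi> x \<partial>lborel)"
    if \<phi>: "\<phi> \<in> test_functions \<Omega>" and i: "i \<in> Basis" for \<phi> i
  proof -
    have [measurable]: "\<phi> \<in> borel_measurable borel" "(\<lambda>x. frechet_derivative \<phi> (at x) i) \<in> borel_measurable borel"
      using test_functions_continuous[OF \<phi>] test_functions_frechet_continuous[OF \<phi> i]
      by (auto intro: borel_measurable_continuous_onI)
    note \<phi>L = test_functions_L2(1)[OF SL \<phi>] test_functions_L2(2)[OF SL \<phi> i]
    have "(\<integral>x. y x * frechet_derivative \<phi> (at x) i \<partial>lebesgue_on \<Omega>) = (\<integral>x. f x * frechet_derivative \<phi> (at x) i \<partial>lborel)"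
    proof (rule borel_representative_integral(1)[OF S])
      show "AE x in lebesgue_on \<Omega>. f x * frechet_derivative \<phi> (at x) i = y x * frechet_derivative \<phi> (at x) i"
        using f(3) by eventually_elim simp
      show "(\<lambda>x. y x * frechet_derivative \<phi> (at x) i) \<in> borel_measurable (lebesgue_on \<Omega>)"
        using ym L2_measurable[OF \<phi>L(2)] by (rule borel_measurable_times)
    qed (use f in auto)
    moreover have "(\<integral>x. (wgrad \<Omega> y x \<bullet> i) * \<phi> x \<partial>lebesgue_on \<Omega>) = (\<integral>x. (g x \<bullet> i) * \<phi> x \<partial>lborel)"
    proof (rule borel_representative_integral(1)[OF S])
      show "AE x in lebesgue_on \<Omega>. (g x \<bullet> i) * \<phi> x = (wgrad \<Omega> y x \<bullet> i) * \<phi> x"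
        using g(3) by eventually_elim simp
      show "(\<lambda>x. (wgrad \<Omega> y x \<bullet> i) * \<phi> x) \<in> borel_measurable (lebesgue_on \<Omega>)"
        using gm L2_measurable[OF \<phi>L(1)] by measurable
    qed (use g in auto)
    moreover have "(\<integral>x. y x * frechet_derivative \<phi> (at x) i \<partial>lebesgue_on \<Omega>) = - (\<integral>x. (wgrad \<Omega> y x \<bullet> i) * \<phi> x \<partial>lebesgue_on \<Omega>)"
      using weak_gradient_wgrad[OF y] \<phi> i by (simp add: weak_gradient_def)
    ultimately show ?thesis by simp
  qed
  have "weakly_differentiable_on_patch \<Omega> P e \<rho> c0 f g" if "cone_patch \<Omega> P e \<rho> c0" for P e \<rho> c0
    by (intro weakly_differentiable_on_patch.intro that weakly_differentiable_on_patch_axioms.intro f(1,2) g(1) fsq gsq weak)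
  then show ?thesis using f nf ng norm_H1_power2[OF op, of y] by (intro exI[of _ f] exI[of _ g]) auto
qed

lemma finite_cone_patches:
  assumes dom: "lipschitz_domain \<Omega>" "bounded \<Omega>"
  shows "\<exists>\<P>. finite \<P> \<and> (\<forall>(P, e, \<rho>, c0)\<in>\<P>. cone_patch \<Omega> P e \<rho> c0) \<and> \<Omega> \<subseteq> (\<Union>p\<in>\<P>. fst p)"
proof -
  have op: "open \<Omega>" using dom(1) by (simp add: lipschitz_domain_def)
  have "\<forall>z\<in>closure \<Omega>. \<exists>e \<rho> r c0. norm e = 1 \<and> 0 < \<rho> \<and> \<rho> \<le> 1 \<and> 0 < r \<and> 0 < c0 \<and>
    (\<forall>x\<in>\<Omega> \<inter> ball z r. \<forall>c\<ge>c0. \<forall>w\<in>cball e \<rho>. x + (1 / c) *\<^sub>R w \<in> \<Omega>)"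
    using lipschitz_domain_cone[OF dom(1)] by blast
  then obtain e \<rho> r c0 where E: "\<And>z. z \<in> closure \<Omega> \<Longrightarrow> norm (e z) = 1 \<and> 0 < \<rho> z \<and> \<rho> z \<le> 1 \<and> 0 < r z \<and> 0 < c0 z \<and>
    (\<forall>x\<in>\<Omega> \<inter> ball z (r z). \<forall>c\<ge>c0 z. \<forall>w\<in>cball (e z) (\<rho> z). x + (1 / c) *\<^sub>R w \<in> \<Omega>)"
    by metis
  have "compact (closure \<Omega>)" using dom(2) by (simp add: compact_closure)
  then obtain Z where Z: "Z \<subseteq> closure \<Omega>" "finite Z" "closure \<Omega> \<subseteq> (\<Union>z\<in>Z. ball z (r z))"
    by (rule compactE_image[of _ "closure \<Omega>" "\<lambda>z. ball z (r z)"]) (use E in auto)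
  let ?\<P> = "(\<lambda>z. (\<Omega> \<inter> ball z (r z), e z, \<rho> z, c0 z)) ` Z"
  have "cone_patch \<Omega> (\<Omega> \<inter> ball z (r z)) (e z) (\<rho> z) (c0 z)" if "z \<in> Z" for z
    using E[of z] that Z(1) op dom(2) by (intro cone_patch.intro) (auto simp: open_Int)
  then show ?thesis using Z closure_subset[of \<Omega>] by (intro exI[of _ ?\<P>]) auto
qed

text \<open>Normalising the \<open>L\<^sup>q\<close> size of \<open>v\<close> makes the constant
  \<open>W\<close> of the weighted estimate universal; general \<open>v\<close> follow by
  scaling.\<close>

lemma multiplier_estimate_normalized:
  fixes \<Omega> :: "'a::euclidean_space set"
  assumes dom: "lipschitz_domain \<Omega>" "bounded \<Omega>" and q: "q > 1" "q > DIM('a) / 2"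
  shows "\<exists>K\<ge>0. \<forall>v\<in>borel_measurable (lebesgue_on \<Omega>). \<forall>y\<in>H1 \<Omega>.
    (\<integral>\<^sup>+x. ennreal (\<bar>v x\<bar> powr q) \<partial>lebesgue_on \<Omega>) \<le> 1 \<longrightarrow>
    (\<integral>\<^sup>+x. ennreal (\<bar>v x\<bar> * (y x)\<^sup>2) \<partial>lebesgue_on \<Omega>) \<le> ennreal (K * (norm_H1 \<Omega> y)\<^sup>2)"
proof -
  have op: "open \<Omega>" using dom(1) by (simp add: lipschitz_domain_def)
  have S [measurable]: "\<Omega> \<in> sets borel" using op by simp
  have SL: "\<Omega> \<in> sets lebesgue" using op by simp
  obtain \<P> where \<P>: "finite \<P>" "\<And>P e \<rho> c0. (P, e, \<rho>, c0) \<in> \<P> \<Longrightarrow> cone_patch \<Omega> P e \<rho> c0"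
    "\<Omega> \<subseteq> (\<Union>p\<in>\<P>. fst p)" using finite_cone_patches[OF dom] by fastforce
  \<comment> \<open>Bounds the integral of \<open>w^q\<close> for the weight
    \<open>w = 1 + \<bar>v\<bar>\<close>, using
    \<open>(1 + a)^q \<le> 2^q * (1 + a^q)\<close>.\<close>
  define W where "W = 2 powr q * (measure lborel \<Omega> + 1)"
  have W0: "W \<ge> 0" by (simp add: W_def)
  \<comment> \<open>The absolute value makes nonnegativity of the constant evident without
    inspecting \<open>weight_const\<close>.\<close>
  define k where "k = (\<lambda>(P :: 'a set, e :: 'a, \<rho>, c0). \<bar>cone_patch.weight_const \<Omega> c0 q * (1 + W) / (cone_patch.mass e \<rho>)\<^sup>2\<bar>)"
  define K where "K = (\<Sum>p\<in>\<P>. k p)"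
  have k0: "k p \<ge> 0" for p by (auto simp: k_def split: prod.split)
  have "(\<integral>\<^sup>+x. ennreal (\<bar>v x\<bar> * (y x)\<^sup>2) \<partial>lebesgue_on \<Omega>) \<le> ennreal (K * (norm_H1 \<Omega> y)\<^sup>2)"
    if vm: "v \<in> borel_measurable (lebesgue_on \<Omega>)" and y: "y \<in> H1 \<Omega>"
      and v1: "(\<integral>\<^sup>+x. ennreal (\<bar>v x\<bar> powr q) \<partial>lebesgue_on \<Omega>) \<le> 1" for v y
  proof -
    obtain f g where wd: "\<And>P e \<rho> c0. cone_patch \<Omega> P e \<rho> c0 \<Longrightarrow> weakly_differentiable_on_patch \<Omega> P e \<rho> c0 f g"
      and fm [measurable]: "f \<in> borel_measurable borel" and fy: "AE x in lebesgue_on \<Omega>. f x = y x"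
      and nrm: "(\<integral>x. (f x)\<^sup>2 \<partial>lborel) + (\<integral>x. (norm (g x))\<^sup>2 \<partial>lborel) = (norm_H1 \<Omega> y)\<^sup>2"
      using H1_weakly_differentiable_on_patch[OF op y] by blast
    obtain v' where v': "v' \<in> borel_measurable borel" "AE x in lebesgue_on \<Omega>. v' x = v x"
      using ex_borel_representative[OF S vm] by blast
    note v'(1) [measurable]
    \<comment> \<open>Adding \<open>1\<close> provides the lower bound \<open>w \<ge> 1\<close> of
      the weighted estimate, and boundedness of \<Omega> keeps the cost finite.\<close>
    define w where "w x = 1 + \<bar>v' x\<bar>" for x
    have wm [measurable]: "w \<in> borel_measurable borel" unfolding w_def by measurable
    have w1: "w x \<ge> 1" for x by (simp add: w_def)
    have to_lborel: "(\<integral>\<^sup>+x. F x \<partial>lebesgue_on \<Omega>) = (\<integral>\<^sup>+x. indicator \<Omega> x * F x \<partial>lborel)" for F :: "'a \<Rightarrow> ennreal"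
      using SL by (simp add: nn_integral_restrict_space nn_integral_completion mult.commute)
    have "(\<integral>\<^sup>+x. ennreal (\<bar>v' x\<bar> powr q) \<partial>lebesgue_on \<Omega>) \<le> 1"
    proof -
      have "(\<integral>\<^sup>+x. ennreal (\<bar>v' x\<bar> powr q) \<partial>lebesgue_on \<Omega>) = (\<integral>\<^sup>+x. ennreal (\<bar>v x\<bar> powr q) \<partial>lebesgue_on \<Omega>)"
        using v'(2) by (intro nn_integral_cong_AE) (auto elim: eventually_mono)
      then show ?thesis using v1 by simp
    qed
    then have v'1: "(\<integral>\<^sup>+x. indicator \<Omega> x * ennreal (\<bar>v' x\<bar> powr q) \<partial>lborel) \<le> 1" by (simp add: to_lborel)
    have wq: "w x powr q \<le> 2 powr q * (1 + \<bar>v' x\<bar> powr q)" for x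
    proof -
      have "w x powr q \<le> (2 * max 1 \<bar>v' x\<bar>) powr q" using q by (intro powr_mono2) (auto simp: w_def)
      also have "\<dots> = 2 powr q * max 1 \<bar>v' x\<bar> powr q" by (simp add: powr_mult)
      also have "max 1 \<bar>v' x\<bar> powr q \<le> 1 + \<bar>v' x\<bar> powr q" by (simp add: max_def)
      finally show ?thesis by simp
    qed
    have Wb: "(\<integral>\<^sup>+x. indicator P x * ennreal (w x powr q) \<partial>lborel) \<le> ennreal W" if P: "P \<subseteq> \<Omega>" for P
    proof -
      have "(\<integral>\<^sup>+x. indicator P x * ennreal (w x powr q) \<partial>lborel)
          \<le> (\<integral>\<^sup>+x. ennreal (2 powr q) * (indicator \<Omega> x + indicator \<Omega> x * ennreal (\<bar>v' x\<bar> powr q)) \<partial>lborel)"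
      proof (rule nn_integral_mono)
        fix x
        have "ennreal (w x powr q) \<le> ennreal (2 powr q) * (1 + ennreal (\<bar>v' x\<bar> powr q))"
          using ennreal_leI[OF wq[of x]] by (simp add: ennreal_mult)
        then show "indicator P x * ennreal (w x powr q) \<le> ennreal (2 powr q) * (indicator \<Omega> x + indicator \<Omega> x * ennreal (\<bar>v' x\<bar> powr q))"
          using P by (auto simp: indicator_def)
      qed
      also have "\<dots> = ennreal (2 powr q) * (emeasure lborel \<Omega> + (\<integral>\<^sup>+x. indicator \<Omega> x * ennreal (\<bar>v' x\<bar> powr q) \<partial>lborel))"
        by (simp add: nn_integral_cmult nn_integral_add)
      also have "\<dots> \<le> ennreal (2 powr q) * (ennreal (measure lborel \<Omega>) + 1)"
        using v'1 emeasure_bounded_finite[OF dom(2)]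
        by (intro mult_left_mono add_mono) (auto simp: emeasure_eq_ennreal_measure)
      also have "\<dots> = ennreal W" by (simp add: W_def ennreal_mult ennreal_plus)
      finally show ?thesis .
    qed
    have local_energy: "(\<integral>\<^sup>+x. indicator P x * ennreal (w x * (f x)\<^sup>2) \<partial>lborel) \<le> ennreal (k (P, e, \<rho>, c0) * (norm_H1 \<Omega> y)\<^sup>2)"
      if p: "(P, e, \<rho>, c0) \<in> \<P>" for P e \<rho> c0
    proof -
      interpret weakly_differentiable_on_patch \<Omega> P e \<rho> c0 f g using \<P>(2)[OF p] by (rule wd)
      have [measurable]: "P \<in> sets borel" using open_P by simp
      have "(\<integral>\<^sup>+x. indicator P x * ennreal (w x * (f x)\<^sup>2) \<partial>lborel)
          = (\<integral>\<^sup>+x. ennreal (1 / mass\<^sup>2) * (indicator P x * ennreal (w x * (mass * f x)\<^sup>2)) \<partial>lborel)"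
      proof (rule nn_integral_cong)
        fix x
        have "w x * (f x)\<^sup>2 = 1 / mass\<^sup>2 * (w x * (mass * f x)\<^sup>2)"
          using mass_pos by (simp add: power_mult_distrib)
        then have "ennreal (w x * (f x)\<^sup>2) = ennreal (1 / mass\<^sup>2) * ennreal (w x * (mass * f x)\<^sup>2)"
          by (simp only:) (rule ennreal_mult', simp)
        then show "indicator P x * ennreal (w x * (f x)\<^sup>2) = ennreal (1 / mass\<^sup>2) * (indicator P x * ennreal (w x * (mass * f x)\<^sup>2))"
          by (simp only: mult.left_commute)
      qed
      also have "\<dots> = ennreal (1 / mass\<^sup>2) * (\<integral>\<^sup>+x. indicator P x * ennreal (w x * (mass * f x)\<^sup>2) \<partial>lborel)"
        by (rule nn_integral_cmult) measurable
      also have "\<dots> \<le> ennreal (1 / mass\<^sup>2) * ennreal (weight_const q * (1 + W) * (Nf + Ng))"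
        by (intro mult_left_mono nn_integral_weight_f wm w1 Wb P_sub W0 q) auto
      also have "\<dots> = ennreal (1 / mass\<^sup>2 * (weight_const q * (1 + W) * (Nf + Ng)))"
        by (rule ennreal_mult'[symmetric]) simp
      also have "\<dots> \<le> ennreal (k (P, e, \<rho>, c0) * (norm_H1 \<Omega> y)\<^sup>2)"
      proof (rule ennreal_leI)
        have "1 / mass\<^sup>2 * (weight_const q * (1 + W) * (Nf + Ng)) = (weight_const q * (1 + W) / mass\<^sup>2) * (norm_H1 \<Omega> y)\<^sup>2"
          by (simp add: nrm)
        also have "\<dots> \<le> \<bar>weight_const q * (1 + W) / mass\<^sup>2\<bar> * (norm_H1 \<Omega> y)\<^sup>2"
          by (intro mult_right_mono abs_ge_self) auto
        finally show "1 / mass\<^sup>2 * (weight_const q * (1 + W) * (Nf + Ng)) \<le> k (P, e, \<rho>, c0) * (norm_H1 \<Omega> y)\<^sup>2"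
          by (simp add: k_def)
      qed
      finally show ?thesis .
    qed
    have "(\<integral>\<^sup>+x. ennreal (\<bar>v x\<bar> * (y x)\<^sup>2) \<partial>lebesgue_on \<Omega>) \<le> (\<integral>\<^sup>+x. ennreal (w x * (f x)\<^sup>2) \<partial>lebesgue_on \<Omega>)"
      using v'(2) fy
      by (intro nn_integral_mono_AE, eventually_elim) (auto simp: w_def intro!: ennreal_leI mult_right_mono)
    also have "\<dots> = (\<integral>\<^sup>+x. indicator \<Omega> x * ennreal (w x * (f x)\<^sup>2) \<partial>lborel)" by (rule to_lborel)
    \<comment> \<open>Patches may overlap; for a nonnegative integrand this only enlarges the sum,
      so no partition of unity is required.\<close>
    also have "\<dots> \<le> (\<integral>\<^sup>+x. (\<Sum>p\<in>\<P>. indicator (fst p) x * ennreal (w x * (f x)\<^sup>2)) \<partial>lborel)"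
    proof (rule nn_integral_mono)
      fix x
      show "indicator \<Omega> x * ennreal (w x * (f x)\<^sup>2) \<le> (\<Sum>p\<in>\<P>. indicator (fst p) x * ennreal (w x * (f x)\<^sup>2))"
      proof (cases "x \<in> \<Omega>")
        case True
        then obtain p where "p \<in> \<P>" "x \<in> fst p" using \<P>(3) by blast
        then show ?thesis
          using \<P>(1) True member_le_sum[of p \<P> "\<lambda>p. indicator (fst p) x * ennreal (w x * (f x)\<^sup>2)"] by simp
      qed simp
    qed
    also have "\<dots> = (\<Sum>p\<in>\<P>. \<integral>\<^sup>+x. indicator (fst p) x * ennreal (w x * (f x)\<^sup>2) \<partial>lborel)"
    proof (rule nn_integral_sum)
      fix p assume p: "p \<in> \<P>"
      obtain P e \<rho> c0 where pp: "p = (P, e, \<rho>, c0)" by (cases p) auto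
      then have "open P" using \<P>(2) p cone_patch.open_P by blast
      then have [measurable]: "fst p \<in> sets borel" by (simp add: pp)
      show "(\<lambda>x. indicator (fst p) x * ennreal (w x * (f x)\<^sup>2)) \<in> borel_measurable lborel" by measurable
    qed
    also have "\<dots> \<le> (\<Sum>p\<in>\<P>. ennreal (k p * (norm_H1 \<Omega> y)\<^sup>2))"
      using local_energy by (intro sum_mono) (auto split: prod.split)
    also have "\<dots> = ennreal (K * (norm_H1 \<Omega> y)\<^sup>2)"
      using k0 by (simp add: K_def sum_distrib_right)
    finally show ?thesis .
  qed
  moreover have "K \<ge> 0" unfolding K_def using k0 by (intro sum_nonneg) auto
  ultimately show ?thesis by blast
qed

subsection \<open>One time step: the adjoint equation\<close>

lemma Lq_multiplier_quadratic:
  fixes \<Omega> :: "'a::euclidean_space set"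
  assumes dom: "lipschitz_domain \<Omega>" "bounded \<Omega>" and q: "q > max (real DIM('a) / 2) 1"
  shows "\<exists>K\<ge>0. \<forall>v\<in>Lq q \<Omega>. \<forall>y\<in>H1 \<Omega>. integrable (lebesgue_on \<Omega>) (\<lambda>x. \<bar>v x\<bar> * (y x)\<^sup>2) \<and>
    (\<integral>x. \<bar>v x\<bar> * (y x)\<^sup>2 \<partial>lebesgue_on \<Omega>) \<le> K * norm_Lq q \<Omega> v * (norm_H1 \<Omega> y)\<^sup>2"
proof -
  have q': "q > 1" "q > DIM('a) / 2" using q by auto
  obtain K where K: "K \<ge> 0" and est: "\<And>v y. v \<in> borel_measurable (lebesgue_on \<Omega>) \<Longrightarrow> y \<in> H1 \<Omega> \<Longrightarrow>
    (\<integral>\<^sup>+x. ennreal (\<bar>v x\<bar> powr q) \<partial>lebesgue_on \<Omega>) \<le> 1 \<Longrightarrow>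
    (\<integral>\<^sup>+x. ennreal (\<bar>v x\<bar> * (y x)\<^sup>2) \<partial>lebesgue_on \<Omega>) \<le> ennreal (K * (norm_H1 \<Omega> y)\<^sup>2)"
    using multiplier_estimate_normalized[OF dom q'] by blast
  have "integrable (lebesgue_on \<Omega>) (\<lambda>x. \<bar>v x\<bar> * (y x)\<^sup>2) \<and>
    (\<integral>x. \<bar>v x\<bar> * (y x)\<^sup>2 \<partial>lebesgue_on \<Omega>) \<le> K * norm_Lq q \<Omega> v * (norm_H1 \<Omega> y)\<^sup>2"
    if v: "v \<in> Lq q \<Omega>" and y: "y \<in> H1 \<Omega>" for v y
  proof -
    have vm [measurable]: "v \<in> borel_measurable (lebesgue_on \<Omega>)"
      and vi: "integrable (lebesgue_on \<Omega>) (\<lambda>x. \<bar>v x\<bar> powr q)" using v by (auto simp: Lq_def)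
    note ym [measurable] = L2_measurable[OF H1_L2[OF y]]
    define I where "I = (\<integral>x. \<bar>v x\<bar> powr q \<partial>lebesgue_on \<Omega>)"
    define m where "m = norm_Lq q \<Omega> v"
    have I0: "I \<ge> 0" unfolding I_def by (intro Bochner_Integration.integral_nonneg) auto
    have m: "m = I powr (1 / q)" by (simp add: m_def I_def norm_Lq_def)
    have m0: "m \<ge> 0" by (simp add: m)
    have nn: "(\<integral>\<^sup>+x. ennreal (\<bar>v x\<bar> * (y x)\<^sup>2) \<partial>lebesgue_on \<Omega>) \<le> ennreal (K * m * (norm_H1 \<Omega> y)\<^sup>2)"
    \<comment> \<open>Scaling divides by the norm of \<open>v\<close>; if that is zero,
      \<open>v\<close> vanishes almost everywhere and the estimate is trivial.\<close>
    proof (cases "m = 0")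
      case True
      then have "I = 0" using I0 q' by (simp add: m)
      then have "AE x in lebesgue_on \<Omega>. \<bar>v x\<bar> powr q = 0"
        using vi unfolding I_def by (subst (asm) integral_nonneg_eq_0_iff_AE) auto
      then have "AE x in lebesgue_on \<Omega>. ennreal (\<bar>v x\<bar> * (y x)\<^sup>2) = 0" by eventually_elim simp
      then have "(\<integral>\<^sup>+x. ennreal (\<bar>v x\<bar> * (y x)\<^sup>2) \<partial>lebesgue_on \<Omega>) = 0"
        by (subst nn_integral_0_iff_AE) auto
      then show ?thesis by simp
    next
      case False
      then have mp: "m > 0" using m0 by simp
      have mq: "m powr q = I" using q' I0 by (simp add: m powr_powr)
      have "(\<integral>\<^sup>+x. ennreal (\<bar>v x / m\<bar> powr q) \<partial>lebesgue_on \<Omega>) = (\<integral>\<^sup>+x. ennreal (\<bar>v x\<bar> powr q / I) \<partial>lebesgue_on \<Omega>)"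
        using mp mq by (simp add: abs_divide powr_divide)
      also have "\<dots> = ennreal (\<integral>x. \<bar>v x\<bar> powr q / I \<partial>lebesgue_on \<Omega>)"
        using vi I0 by (intro nn_integral_eq_integral) auto
      also have "\<dots> \<le> 1" using I0 by (simp add: I_def[symmetric])
      finally have "(\<integral>\<^sup>+x. ennreal (\<bar>v x / m\<bar> * (y x)\<^sup>2) \<partial>lebesgue_on \<Omega>) \<le> ennreal (K * (norm_H1 \<Omega> y)\<^sup>2)"
        by (intro est y) simp_all
      then have "ennreal m * (\<integral>\<^sup>+x. ennreal (\<bar>v x / m\<bar> * (y x)\<^sup>2) \<partial>lebesgue_on \<Omega>)
          \<le> ennreal m * ennreal (K * (norm_H1 \<Omega> y)\<^sup>2)" by (rule mult_left_mono) simp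
      also have "\<dots> = ennreal (K * m * (norm_H1 \<Omega> y)\<^sup>2)"
        using m0 K by (simp add: ennreal_mult'[symmetric] mult_ac)
      also have "ennreal m * (\<integral>\<^sup>+x. ennreal (\<bar>v x / m\<bar> * (y x)\<^sup>2) \<partial>lebesgue_on \<Omega>)
          = (\<integral>\<^sup>+x. ennreal m * ennreal (\<bar>v x / m\<bar> * (y x)\<^sup>2) \<partial>lebesgue_on \<Omega>)"
        by (rule nn_integral_cmult[symmetric]) measurable
      also have "\<dots> = (\<integral>\<^sup>+x. ennreal (\<bar>v x\<bar> * (y x)\<^sup>2) \<partial>lebesgue_on \<Omega>)"
        using mp by (simp add: ennreal_mult'[symmetric] abs_divide)
      finally show ?thesis .
    qed
    have i: "integrable (lebesgue_on \<Omega>) (\<lambda>x. \<bar>v x\<bar> * (y x)\<^sup>2)"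
      using le_less_trans[OF nn] by (intro integrableI_nonneg) auto
    moreover have "(\<integral>x. \<bar>v x\<bar> * (y x)\<^sup>2 \<partial>lebesgue_on \<Omega>) \<le> K * m * (norm_H1 \<Omega> y)\<^sup>2"
    proof -
      have "ennreal (\<integral>x. \<bar>v x\<bar> * (y x)\<^sup>2 \<partial>lebesgue_on \<Omega>) \<le> ennreal (K * m * (norm_H1 \<Omega> y)\<^sup>2)"
        using nn nn_integral_eq_integral[OF i] by simp
      then show ?thesis using K m0 by (subst (asm) ennreal_le_iff) auto
    qed
    ultimately show ?thesis by (simp add: m_def)
  qed
  then show ?thesis using K by blast
qed

lemma norm_Lq_nonneg: "0 \<le> norm_Lq q \<Omega> v"
  by (simp add: norm_Lq_def)

text \<open>Cauchy-Schwarz for the measure with density \<open>\<bar>v\<bar>\<close> reduces the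
  bilinear bound to the quadratic one.\<close>

lemma Lq_multiplier:
  fixes \<Omega> :: "'a::euclidean_space set"
  assumes dom: "lipschitz_domain \<Omega>" "bounded \<Omega>" and q: "q > max (real DIM('a) / 2) 1"
  shows "\<exists>K\<ge>0. \<forall>v\<in>Lq q \<Omega>. \<forall>y\<in>H1 \<Omega>. \<forall>z\<in>H1 \<Omega>. integrable (lebesgue_on \<Omega>) (\<lambda>x. v x * y x * z x) \<and>
    (\<integral>x. \<bar>v x * y x * z x\<bar> \<partial>lebesgue_on \<Omega>) \<le> K * norm_Lq q \<Omega> v * norm_H1 \<Omega> y * norm_H1 \<Omega> z"
proof -
  have op: "open \<Omega>" using dom(1) by (simp add: lipschitz_domain_def)
  obtain K where K: "K \<ge> 0" and est: "\<And>v y. v \<in> Lq q \<Omega> \<Longrightarrow> y \<in> H1 \<Omega> \<Longrightarrow>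
    integrable (lebesgue_on \<Omega>) (\<lambda>x. \<bar>v x\<bar> * (y x)\<^sup>2) \<and>
    (\<integral>x. \<bar>v x\<bar> * (y x)\<^sup>2 \<partial>lebesgue_on \<Omega>) \<le> K * norm_Lq q \<Omega> v * (norm_H1 \<Omega> y)\<^sup>2"
    using Lq_multiplier_quadratic[OF assms] by blast
  have "integrable (lebesgue_on \<Omega>) (\<lambda>x. v x * y x * z x) \<and>
    (\<integral>x. \<bar>v x * y x * z x\<bar> \<partial>lebesgue_on \<Omega>) \<le> K * norm_Lq q \<Omega> v * norm_H1 \<Omega> y * norm_H1 \<Omega> z"
    if v: "v \<in> Lq q \<Omega>" and y: "y \<in> H1 \<Omega>" and z: "z \<in> H1 \<Omega>" for v y z
  proof -
    let ?M = "lebesgue_on \<Omega>"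
    have [measurable]: "v \<in> borel_measurable ?M" using v by (auto simp: Lq_def)
    note [measurable] = L2_measurable[OF H1_L2[OF y]] L2_measurable[OF H1_L2[OF z]]
    have iy: "integrable ?M (\<lambda>x. \<bar>v x\<bar> * (y x)\<^sup>2)" and iz: "integrable ?M (\<lambda>x. \<bar>v x\<bar> * (z x)\<^sup>2)"
      using est v y z by auto
    have pt: "2 * \<bar>v x * y x * z x\<bar> \<le> t * (\<bar>v x\<bar> * (y x)\<^sup>2) + (\<bar>v x\<bar> * (z x)\<^sup>2) / t" if t: "t > 0" for t x
    proof -
      have "0 \<le> (t * \<bar>y x\<bar> - \<bar>z x\<bar>)\<^sup>2 / t" using t by simp
      also have "\<dots> = t * (y x)\<^sup>2 + (z x)\<^sup>2 / t - 2 * (\<bar>y x\<bar> * \<bar>z x\<bar>)"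
        using t by (simp add: power2_diff power_mult_distrib field_simps) (simp add: power2_eq_square field_simps)
      finally have "\<bar>v x\<bar> * (2 * (\<bar>y x\<bar> * \<bar>z x\<bar>)) \<le> \<bar>v x\<bar> * (t * (y x)\<^sup>2 + (z x)\<^sup>2 / t)"
        by (intro mult_left_mono) auto
      then show ?thesis by (simp add: abs_mult distrib_left mult_ac)
    qed
    have i: "integrable ?M (\<lambda>x. v x * y x * z x)"
    proof (rule Bochner_Integration.integrable_bound[OF Bochner_Integration.integrable_add[OF iy iz]])
      show "AE x in ?M. norm (v x * y x * z x) \<le> norm (\<bar>v x\<bar> * (y x)\<^sup>2 + \<bar>v x\<bar> * (z x)\<^sup>2)"
      proof (intro AE_I2)
        fix x
        have "0 \<le> \<bar>v x * y x * z x\<bar>" "0 \<le> \<bar>v x\<bar> * (y x)\<^sup>2 + \<bar>v x\<bar> * (z x)\<^sup>2" by simp_all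
        then show "norm (v x * y x * z x) \<le> norm (\<bar>v x\<bar> * (y x)\<^sup>2 + \<bar>v x\<bar> * (z x)\<^sup>2)"
          using pt[of 1 x] unfolding real_norm_def by linarith
      qed
    qed measurable
    have m0: "0 \<le> K * norm_Lq q \<Omega> v" using K norm_Lq_nonneg by (rule mult_nonneg_nonneg)
    have "(\<integral>x. \<bar>v x * y x * z x\<bar> \<partial>?M)
        \<le> (sqrt (K * norm_Lq q \<Omega> v) * norm_H1 \<Omega> y) * (sqrt (K * norm_Lq q \<Omega> v) * norm_H1 \<Omega> z)"
    proof (rule le_mult_if_weighted)
      fix t :: real assume t: "t > 0"
      have "2 * (\<integral>x. \<bar>v x * y x * z x\<bar> \<partial>?M) = (\<integral>x. 2 * \<bar>v x * y x * z x\<bar> \<partial>?M)" by simp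
      also have "\<dots> \<le> (\<integral>x. t * (\<bar>v x\<bar> * (y x)\<^sup>2) + (\<bar>v x\<bar> * (z x)\<^sup>2) / t \<partial>?M)"
        using iy iz i by (intro integral_mono pt[OF t]) auto
      also have "\<dots> = t * (\<integral>x. \<bar>v x\<bar> * (y x)\<^sup>2 \<partial>?M) + (\<integral>x. \<bar>v x\<bar> * (z x)\<^sup>2 \<partial>?M) / t"
        using iy iz by simp
      also have "\<dots> \<le> t * (K * norm_Lq q \<Omega> v * (norm_H1 \<Omega> y)\<^sup>2) + (K * norm_Lq q \<Omega> v * (norm_H1 \<Omega> z)\<^sup>2) / t"
        using est[OF v y] est[OF v z] t by (intro add_mono mult_left_mono divide_right_mono) auto
      finally show "2 * (\<integral>x. \<bar>v x * y x * z x\<bar> \<partial>?M)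
        \<le> t * (sqrt (K * norm_Lq q \<Omega> v) * norm_H1 \<Omega> y)\<^sup>2 + (sqrt (K * norm_Lq q \<Omega> v) * norm_H1 \<Omega> z)\<^sup>2 / t"
        using m0 by (simp add: power_mult_distrib)
    qed (use m0 op in \<open>auto intro!: mult_nonneg_nonneg\<close>)
    also have "\<dots> = (sqrt (K * norm_Lq q \<Omega> v) * sqrt (K * norm_Lq q \<Omega> v)) * norm_H1 \<Omega> y * norm_H1 \<Omega> z"
      by (simp only: mult_ac)
    also have "sqrt (K * norm_Lq q \<Omega> v) * sqrt (K * norm_Lq q \<Omega> v) = K * norm_Lq q \<Omega> v"
      using m0 by simp
    finally show ?thesis using i by simp
  qed
  then show ?thesis using K by blast
qed

section \<open>Monotonicity inequalities and derivatives\<close>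

lemma deriv_ge_if_difference_ge:
  fixes h :: "real \<Rightarrow> real"
  assumes "(h has_real_derivative h') (at x)" and "\<And>z. (h z - h x) * (z - x) \<ge> c * (z - x)\<^sup>2"
  shows "h' \<ge> c"
proof (rule tendsto_lowerbound)
  show "((\<lambda>t. (h (x + t) - h x) / t) \<longlongrightarrow> h') (at 0)" using assms(1) by (simp add: DERIV_def)
  have "c \<le> (h (x + t) - h x) / t" if "t \<noteq> 0" for t
  proof -
    have "c * t\<^sup>2 \<le> ((h (x + t) - h x) / t) * t\<^sup>2"
      using assms(2)[of "x + t"] that by (simp add: power2_eq_square)
    then show ?thesis by (rule mult_right_le_imp_le) (use that in simp)
  qed
  then show "\<forall>\<^sub>F t in at 0. c \<le> (h (x + t) - h x) / t" by (auto simp: eventually_at_filter)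
qed simp

text \<open>The second derivatives of the approximations need not converge. The mean value theorem
  converts their lower bound into a one-sided Lipschitz inequality for the first derivatives, and
  this passes to the limit.\<close>

lemma semiconvex_limit:
  assumes "assumption_A_psi \<psi> \<psi>' C\<^sub>\<psi>"
  shows "(\<psi>' a - \<psi>' b) * (a - b) \<ge> - C\<^sub>\<psi> * (a - b)\<^sup>2"
proof -
  have "\<exists>(f :: nat \<Rightarrow> real \<Rightarrow> real) f' f''. (\<forall>n. is_C1_with (f n) (f' n) \<and> is_C1_with (f' n) (f'' n)) \<and>
      (\<forall>K. compact K \<longrightarrow> uniform_limit K f \<psi> sequentially \<and> uniform_limit K f' \<psi>' sequentially) \<and>
      (\<forall>n x. f'' n x \<ge> - C\<^sub>\<psi>)"
    using assms unfolding assumption_A_psi_def by (elim conjE exE) (intro exI conjI, assumption+)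
  then obtain f :: "nat \<Rightarrow> real \<Rightarrow> real" and f' f'' where
    F: "\<forall>n. is_C1_with (f n) (f' n) \<and> is_C1_with (f' n) (f'' n)"
    "\<forall>K. compact K \<longrightarrow> uniform_limit K f \<psi> sequentially \<and> uniform_limit K f' \<psi>' sequentially"
    "\<forall>n x. f'' n x \<ge> - C\<^sub>\<psi>" by (elim exE conjE)
  have f: "is_C1_with (f' n) (f'' n)" "compact K \<Longrightarrow> uniform_limit K f' \<psi>' sequentially" "f'' n x \<ge> - C\<^sub>\<psi>" for n K x
    using F by simp_all
  have lim: "(\<lambda>n. f' n x) \<longlonglongrightarrow> \<psi>' x" for x
    using tendsto_uniform_limitI[OF f(2)[of "{x}"]] by simp
  have pt: "- C\<^sub>\<psi> * (a - b)\<^sup>2 \<le> (f' n a - f' n b) * (a - b)" for n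
  proof -
    have mvt: "- C\<^sub>\<psi> * (r - s) \<le> f' n r - f' n s" if sr: "s < r" for r s
    proof -
      have "\<And>x. (f' n has_real_derivative f'' n x) (at x)" using f(1)[of n] by (simp add: is_C1_with_def)
      then obtain z where z: "f' n r - f' n s = (r - s) * f'' n z" using MVT2[OF sr, of "f' n" "f'' n"] by blast
      have "(r - s) * (- C\<^sub>\<psi>) \<le> (r - s) * f'' n z" using f(3)[where n = n and x = z] sr by (intro mult_left_mono) auto
      then show ?thesis using z by (simp add: mult.commute)
    qed
    consider "a = b" | "b < a" | "a < b" by linarith
    then show ?thesis
    proof cases
      case 2
      then have "(- C\<^sub>\<psi> * (a - b)) * (a - b) \<le> (f' n a - f' n b) * (a - b)" by (intro mult_right_mono mvt) auto
      then show ?thesis by (simp add: power2_eq_square mult.assoc)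
    next
      case 3
      then have "(- C\<^sub>\<psi> * (b - a)) * (b - a) \<le> (f' n b - f' n a) * (b - a)" by (intro mult_right_mono mvt) auto
      also have "(f' n b - f' n a) * (b - a) = (f' n a - f' n b) * (a - b)" by (simp add: algebra_simps)
      also have "(- C\<^sub>\<psi> * (b - a)) * (b - a) = - C\<^sub>\<psi> * (a - b)\<^sup>2" by (simp add: power2_eq_square algebra_simps)
      finally show ?thesis .
    qed simp
  qed
  have "(\<lambda>n. (f' n a - f' n b) * (a - b)) \<longlonglongrightarrow> (\<psi>' a - \<psi>' b) * (a - b)" by (intro tendsto_intros lim)
  then show ?thesis by (rule tendsto_lowerbound) (use pt in auto)
qed

text \<open>Restricting to the line through \<open>p\<close> in direction \<open>v\<close> reduces
  the claim to the scalar case.\<close>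

lemma strongly_monotone_derivative:
  fixes A' :: "'a::euclidean_space \<Rightarrow> 'a"
  assumes d: "(A' has_derivative blinfun_apply D) (at p)" and m: "\<And>p q. (A' p - A' q) \<bullet> (p - q) \<ge> c * (norm (p - q))\<^sup>2"
  shows "D v \<bullet> v \<ge> c * (norm v)\<^sup>2"
proof -
  have "((\<lambda>t. p + t *\<^sub>R v) has_derivative (\<lambda>r. r *\<^sub>R v)) (at 0)" by (auto intro!: derivative_eq_intros)
  from has_derivative_inner_left[OF has_derivative_compose[OF this, of A' "blinfun_apply D"], of v] d
  have "((\<lambda>t. A' (p + t *\<^sub>R v) \<bullet> v) has_real_derivative D v \<bullet> v) (at 0)"
    by (simp add: has_field_derivative_def blinfun.scaleR_right mult_commute_abs)
  then show ?thesis
  proof (rule deriv_ge_if_difference_ge)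
    fix z :: real
    show "c * (norm v)\<^sup>2 * (z - 0)\<^sup>2 \<le> (A' (p + z *\<^sub>R v) \<bullet> v - A' (p + 0 *\<^sub>R v) \<bullet> v) * (z - 0)"
      using m[where p = "p + z *\<^sub>R v" and q = p] by (simp add: inner_diff_left power_mult_distrib mult_ac)
  qed
qed

text \<open>The regularity of the boundary is absorbed into \<open>multiplier\<close>; the analysis
  of the time steps uses of the domain only that it is open and bounded.\<close>

locale semilinear_operator =
  fixes \<Omega> :: "'a::euclidean_space set" and \<epsilon> C\<^sub>\<psi> C\<^sub>A M q Kq :: real
    and A :: "'a \<Rightarrow> real" and A' :: "'a \<Rightarrow> 'a" and A'' :: "'a \<Rightarrow> 'a \<Rightarrow>\<^sub>L 'a"
    and \<psi>' \<psi>'' :: "real \<Rightarrow> real"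
  assumes open_dom: "open \<Omega>" and bounded_dom: "bounded \<Omega>" and \<epsilon>: "\<epsilon> > 0"
    and A_grad: "\<And>p. GDERIV A p :> A' p"
    and A'_cont: "continuous_on UNIV A'"
    and A'_mono: "\<And>p q. (A' p - A' q) \<bullet> (p - q) \<ge> C\<^sub>A * (norm (p - q))\<^sup>2" and C\<^sub>A: "C\<^sub>A > 0"
    and A'_growth: "\<exists>C. \<forall>p. norm (A' p) \<le> C * norm p"
    and A'_deriv: "\<And>p. (A' has_derivative blinfun_apply (A'' p)) (at p)"
    and A''_cont: "continuous_on UNIV A''" and A''_bound: "\<And>p. norm (A'' p) \<le> M"
    and \<psi>'_mono: "\<And>a b. (\<psi>' a - \<psi>' b) * (a - b) \<ge> - C\<^sub>\<psi> * (a - b)\<^sup>2"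
    and \<psi>'_deriv: "\<And>x. (\<psi>' has_real_derivative \<psi>'' x) (at x)" and \<psi>''_cont: "continuous_on UNIV \<psi>''"
    and nemytskii: "nemytskii_H1_Lq_continuous \<Omega> q \<psi>''" and q: "q > 1"
    and Kq: "Kq \<ge> 0"
    and multiplier: "\<And>v y z. v \<in> Lq q \<Omega> \<Longrightarrow> y \<in> H1 \<Omega> \<Longrightarrow> z \<in> H1 \<Omega> \<Longrightarrow>
      integrable (lebesgue_on \<Omega>) (\<lambda>x. v x * y x * z x) \<and>
      (\<integral>x. \<bar>v x * y x * z x\<bar> \<partial>lebesgue_on \<Omega>) \<le> Kq * norm_Lq q \<Omega> v * norm_H1 \<Omega> y * norm_H1 \<Omega> z"
begin

lemma M_nonneg: "M \<ge> 0"
  using order_trans[OF norm_ge_zero A''_bound] .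

lemma A''_coercive: "A'' p v \<bullet> v \<ge> C\<^sub>A * (norm v)\<^sup>2"
  by (rule strongly_monotone_derivative[OF A'_deriv A'_mono])

lemma \<psi>''_ge: "\<psi>'' x \<ge> - C\<^sub>\<psi>"
  by (rule deriv_ge_if_difference_ge[OF \<psi>'_deriv]) (rule \<psi>'_mono)

lemma A''_apply_le: "norm (A'' p v) \<le> M * norm v"
  using order_trans[OF norm_blinfun mult_right_mono[OF A''_bound norm_ge_zero]] .

lemma A''_measurable:
  assumes [measurable]: "g \<in> borel_measurable (lebesgue_on \<Omega>)" "h \<in> borel_measurable (lebesgue_on \<Omega>)"
  shows "(\<lambda>x. A'' (g x) (h x)) \<in> borel_measurable (lebesgue_on \<Omega>)"
proof -
  have "continuous_on UNIV (\<lambda>p. A'' (fst p) (snd p))"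
    by (intro continuous_intros continuous_on_compose2[OF A''_cont]) auto
  then show ?thesis using borel_measurable_continuous_Pair[OF assms, of "\<lambda>p v. A'' p v"]
    by (simp add: split_beta')
qed

lemma A''_L2:
  assumes "y \<in> H1 \<Omega>" "\<phi> \<in> H1 \<Omega>"
  shows "(\<lambda>x. A'' (wgrad \<Omega> y x) (wgrad \<Omega> \<phi> x)) \<in> L2 \<Omega>"
  by (rule L2_bound[where K = M, OF wgrad_L2[OF assms(2)] A''_measurable[OF assms[THEN wgrad_L2, THEN L2_measurable]]])
    (simp add: A''_apply_le)

lemma \<psi>''_Lq: "y \<in> H1 \<Omega> \<Longrightarrow> (\<lambda>x. \<psi>'' (y x)) \<in> Lq q \<Omega>"
  using nemytskii by (simp add: nemytskii_H1_Lq_continuous_def)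

text \<open>This gives the \<psi>'' pairing in the adjoint equation a meaning for all
  \<open>H1\<close> functions.\<close>

lemma \<psi>''_integrable:
  "y \<in> H1 \<Omega> \<Longrightarrow> \<phi> \<in> H1 \<Omega> \<Longrightarrow> p \<in> H1 \<Omega> \<Longrightarrow> integrable (lebesgue_on \<Omega>) (\<lambda>x. \<psi>'' (y x) * \<phi> x * p x)"
  using multiplier[OF \<psi>''_Lq] by blast

text \<open>The test function is the left argument and the unknown the right one, as in the adjoint
  equation.\<close>

definition adj_form :: "('a \<Rightarrow> real) \<Rightarrow> real \<Rightarrow> ('a \<Rightarrow> real) \<Rightarrow> ('a \<Rightarrow> real) \<Rightarrow> real" where
  "adj_form y \<tau> \<phi> p = inner_L2 \<Omega> (\<lambda>x. \<epsilon> *\<^sub>R blinfun_apply (A'' (wgrad \<Omega> y x)) (wgrad \<Omega> \<phi> x)) (wgrad \<Omega> p)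
     + inner_L2 \<Omega> (\<lambda>x. 1 / \<epsilon> * \<psi>'' (y x) * \<phi> x + \<epsilon> / \<tau> * \<phi> x) p"

lemma adj_form_eq:
  assumes "y \<in> H1 \<Omega>" "\<phi> \<in> H1 \<Omega>" "p \<in> H1 \<Omega>"
  shows "adj_form y \<tau> \<phi> p = \<epsilon> * inner_L2 \<Omega> (\<lambda>x. A'' (wgrad \<Omega> y x) (wgrad \<Omega> \<phi> x)) (wgrad \<Omega> p)
    + 1 / \<epsilon> * (\<integral>x. \<psi>'' (y x) * \<phi> x * p x \<partial>lebesgue_on \<Omega>) + \<epsilon> / \<tau> * inner_L2 \<Omega> \<phi> p"
proof -
  note i = \<psi>''_integrable[OF assms]
  note j = L2_mult_integrable[OF H1_L2[OF assms(2)] H1_L2[OF assms(3)]]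
  have "inner_L2 \<Omega> (\<lambda>x. 1 / \<epsilon> * \<psi>'' (y x) * \<phi> x + \<epsilon> / \<tau> * \<phi> x) p
      = (\<integral>x. 1 / \<epsilon> * (\<psi>'' (y x) * \<phi> x * p x) + \<epsilon> / \<tau> * (\<phi> x * p x) \<partial>lebesgue_on \<Omega>)"
    unfolding inner_L2_def by (intro Bochner_Integration.integral_cong) (auto simp: algebra_simps)
  also have "\<dots> = 1 / \<epsilon> * (\<integral>x. \<psi>'' (y x) * \<phi> x * p x \<partial>lebesgue_on \<Omega>) + \<epsilon> / \<tau> * inner_L2 \<Omega> \<phi> p"
    using i j by (simp add: inner_L2_def)
  finally show ?thesis by (simp add: adj_form_def inner_L2_scaleR_left)
qed

lemma adj_form_add:
  assumes y: "y \<in> H1 \<Omega>" and f: "f \<in> H1 \<Omega>" and g: "g \<in> H1 \<Omega>" and p: "p \<in> H1 \<Omega>"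
  shows "adj_form y \<tau> (\<lambda>x. f x + g x) p = adj_form y \<tau> f p + adj_form y \<tau> g p"
proof -
  note fg = H1_add[OF open_dom f g]
  have "inner_L2 \<Omega> (\<lambda>x. A'' (wgrad \<Omega> y x) (wgrad \<Omega> (\<lambda>x. f x + g x) x)) (wgrad \<Omega> p)
      = inner_L2 \<Omega> (\<lambda>x. A'' (wgrad \<Omega> y x) (wgrad \<Omega> f x) + A'' (wgrad \<Omega> y x) (wgrad \<Omega> g x)) (wgrad \<Omega> p)"
  proof (rule inner_L2_cong_AE)
    show "AE x in lebesgue_on \<Omega>. A'' (wgrad \<Omega> y x) (wgrad \<Omega> (\<lambda>x. f x + g x) x)
        = A'' (wgrad \<Omega> y x) (wgrad \<Omega> f x) + A'' (wgrad \<Omega> y x) (wgrad \<Omega> g x)"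
      using wgrad_add[OF open_dom f g] by eventually_elim (simp add: blinfun.add_right)
  qed (auto intro!: A''_L2 L2_add wgrad_L2 y f g p fg)
  moreover have "(\<integral>x. \<psi>'' (y x) * (f x + g x) * p x \<partial>lebesgue_on \<Omega>)
      = (\<integral>x. \<psi>'' (y x) * f x * p x \<partial>lebesgue_on \<Omega>) + (\<integral>x. \<psi>'' (y x) * g x * p x \<partial>lebesgue_on \<Omega>)"
    using \<psi>''_integrable[OF y f p] \<psi>''_integrable[OF y g p] by (simp add: distrib_left distrib_right)
  ultimately show ?thesis
    by (simp add: adj_form_eq y f g p fg inner_L2_add_left A''_L2 wgrad_L2 H1_L2 distrib_left)
qed

lemma adj_form_mult_left:
  assumes y: "y \<in> H1 \<Omega>" and f: "f \<in> H1 \<Omega>" and p: "p \<in> H1 \<Omega>"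
  shows "adj_form y \<tau> (\<lambda>x. c * f x) p = c * adj_form y \<tau> f p"
proof -
  note cf = H1_mult_left[OF f, of c]
  have "inner_L2 \<Omega> (\<lambda>x. A'' (wgrad \<Omega> y x) (wgrad \<Omega> (\<lambda>x. c * f x) x)) (wgrad \<Omega> p)
      = inner_L2 \<Omega> (\<lambda>x. c *\<^sub>R A'' (wgrad \<Omega> y x) (wgrad \<Omega> f x)) (wgrad \<Omega> p)"
  proof (rule inner_L2_cong_AE)
    show "AE x in lebesgue_on \<Omega>. A'' (wgrad \<Omega> y x) (wgrad \<Omega> (\<lambda>x. c * f x) x) = c *\<^sub>R A'' (wgrad \<Omega> y x) (wgrad \<Omega> f x)"
      using wgrad_mult_left[OF open_dom f, of c] by eventually_elim (simp add: blinfun.scaleR_right)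
  qed (auto intro!: A''_L2 L2_scaleR wgrad_L2 y f p cf)
  moreover have "(\<lambda>x. \<psi>'' (y x) * (c * f x) * p x) = (\<lambda>x. c * (\<psi>'' (y x) * f x * p x))" by (simp add: mult_ac)
  ultimately show ?thesis
    by (simp add: adj_form_eq y f p cf inner_L2_scaleR_left inner_L2_mult_left distrib_left)
qed

text \<open>The zero order terms are symmetric as they stand; the leading term is so by symmetry of
  the Hessian.\<close>

lemma adj_form_sym:
  assumes y: "y \<in> H1 \<Omega>" and f: "f \<in> H1 \<Omega>" and p: "p \<in> H1 \<Omega>"
  shows "adj_form y \<tau> f p = adj_form y \<tau> p f"
proof -
  have "inner_L2 \<Omega> (\<lambda>x. A'' (wgrad \<Omega> y x) (wgrad \<Omega> f x)) (wgrad \<Omega> p)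
      = inner_L2 \<Omega> (\<lambda>x. A'' (wgrad \<Omega> y x) (wgrad \<Omega> p x)) (wgrad \<Omega> f)"
    unfolding inner_L2_def by (subst hessian_symmetric[OF A_grad A'_deriv A''_cont]) (rule refl)
  then show ?thesis
    by (simp add: adj_form_eq[OF y f p] adj_form_eq[OF y p f] inner_L2_commute[of \<Omega> f p] mult_ac)
qed

text \<open>The first entry controls the gradient, the second the function itself. For positive
  \<open>\<tau>\<close>, the second entry is positive exactly when
  \<open>\<tau> * C\<^sub>\<psi> < \<epsilon>\<^sup>2\<close>, which is the time step
  restriction.\<close>

definition coercivity :: "real \<Rightarrow> real" where "coercivity \<tau> = min (\<epsilon> * C\<^sub>A) (\<epsilon> / \<tau> - C\<^sub>\<psi> / \<epsilon>)"

text \<open>Strong monotonicity bounds \<open>A''\<close> below by \<open>C\<^sub>A\<close>,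
  semiconvexity bounds \<psi>'' below by \<open>- C\<^sub>\<psi>\<close>, and the discrete time
  derivative compensates the negative part.\<close>

lemma adj_form_coercive:
  assumes y: "y \<in> H1 \<Omega>" and f: "f \<in> H1 \<Omega>"
  shows "coercivity \<tau> * (norm_H1 \<Omega> f)\<^sup>2 \<le> adj_form y \<tau> f f"
proof -
  have 1: "C\<^sub>A * (norm_L2 \<Omega> (wgrad \<Omega> f))\<^sup>2 \<le> inner_L2 \<Omega> (\<lambda>x. A'' (wgrad \<Omega> y x) (wgrad \<Omega> f x)) (wgrad \<Omega> f)"
    unfolding norm_L2_power2_integral inner_L2_def integral_mult_right_zero[symmetric]
    by (intro integral_mono A''_coercive integrable_mult_right L2_integrable_sq L2_inner_integrable A''_L2 wgrad_L2 y f)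
  have 2: "- C\<^sub>\<psi> * (norm_L2 \<Omega> f)\<^sup>2 \<le> (\<integral>x. \<psi>'' (y x) * f x * f x \<partial>lebesgue_on \<Omega>)"
    unfolding norm_L2_power2_integral integral_mult_right_zero[symmetric]
  proof (intro integral_mono integrable_mult_right L2_integrable_sq H1_L2 f \<psi>''_integrable y)
    fix x
    have "- C\<^sub>\<psi> * (f x * f x) \<le> \<psi>'' (y x) * (f x * f x)" by (intro mult_right_mono \<psi>''_ge) auto
    then show "- C\<^sub>\<psi> * (norm (f x))\<^sup>2 \<le> \<psi>'' (y x) * f x * f x" by (simp add: power2_eq_square mult.assoc)
  qed
  have "coercivity \<tau> * (norm_H1 \<Omega> f)\<^sup>2 = coercivity \<tau> * (norm_L2 \<Omega> (wgrad \<Omega> f))\<^sup>2 + coercivity \<tau> * (norm_L2 \<Omega> f)\<^sup>2"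
    by (simp add: norm_H1_power2[OF open_dom] distrib_left)
  also have "\<dots> \<le> (\<epsilon> * C\<^sub>A) * (norm_L2 \<Omega> (wgrad \<Omega> f))\<^sup>2 + (\<epsilon> / \<tau> - C\<^sub>\<psi> / \<epsilon>) * (norm_L2 \<Omega> f)\<^sup>2"
    by (intro add_mono mult_right_mono) (auto simp: coercivity_def)
  also have "\<dots> = \<epsilon> * (C\<^sub>A * (norm_L2 \<Omega> (wgrad \<Omega> f))\<^sup>2) + 1 / \<epsilon> * (- C\<^sub>\<psi> * (norm_L2 \<Omega> f)\<^sup>2) + \<epsilon> / \<tau> * inner_L2 \<Omega> f f"
    by (simp add: norm_L2_power2 algebra_simps)
  also have "\<dots> \<le> adj_form y \<tau> f f"
    unfolding adj_form_eq[OF y f f] using \<epsilon> by (intro add_mono order_refl mult_left_mono 1 2) auto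
  finally show ?thesis .
qed

text \<open>Together with coercivity this makes the form an equivalent squared norm on
  \<open>H1\<close>, so completeness of \<open>H1\<close> carries over to it.\<close>

lemma adj_form_bounded:
  assumes y: "y \<in> H1 \<Omega>" and \<tau>: "\<tau> > 0"
  shows "\<exists>\<beta>\<ge>0. \<forall>f\<in>H1 \<Omega>. adj_form y \<tau> f f \<le> \<beta> * (norm_H1 \<Omega> f)\<^sup>2"
proof -
  define \<beta> where "\<beta> = \<epsilon> * M + 1 / \<epsilon> * (Kq * norm_Lq q \<Omega> (\<lambda>x. \<psi>'' (y x))) + \<epsilon> / \<tau>"
  have "adj_form y \<tau> f f \<le> \<beta> * (norm_H1 \<Omega> f)\<^sup>2" if f: "f \<in> H1 \<Omega>" for f
  proof -
    have 1: "inner_L2 \<Omega> (\<lambda>x. A'' (wgrad \<Omega> y x) (wgrad \<Omega> f x)) (wgrad \<Omega> f) \<le> M * (norm_H1 \<Omega> f)\<^sup>2"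
    proof -
      have "inner_L2 \<Omega> (\<lambda>x. A'' (wgrad \<Omega> y x) (wgrad \<Omega> f x)) (wgrad \<Omega> f) \<le> M * (norm_L2 \<Omega> (wgrad \<Omega> f))\<^sup>2"
        unfolding norm_L2_power2_integral inner_L2_def integral_mult_right_zero[symmetric]
      proof (intro integral_mono integrable_mult_right L2_integrable_sq L2_inner_integrable A''_L2 wgrad_L2 y f)
        fix x
        have "A'' (wgrad \<Omega> y x) (wgrad \<Omega> f x) \<bullet> wgrad \<Omega> f x \<le> norm (A'' (wgrad \<Omega> y x) (wgrad \<Omega> f x)) * norm (wgrad \<Omega> f x)"
          by (rule norm_cauchy_schwarz)
        also have "\<dots> \<le> (M * norm (wgrad \<Omega> f x)) * norm (wgrad \<Omega> f x)" by (intro mult_right_mono A''_apply_le) auto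
        finally show "A'' (wgrad \<Omega> y x) (wgrad \<Omega> f x) \<bullet> wgrad \<Omega> f x \<le> M * (norm (wgrad \<Omega> f x))\<^sup>2"
          by (simp add: power2_eq_square mult.assoc)
      qed
      also have "\<dots> \<le> M * (norm_H1 \<Omega> f)\<^sup>2" using norm_L2_wgrad_le_H1[OF open_dom] by (intro mult_left_mono power_mono M_nonneg) auto
      finally show ?thesis .
    qed
    have 2: "(\<integral>x. \<psi>'' (y x) * f x * f x \<partial>lebesgue_on \<Omega>) \<le> Kq * norm_Lq q \<Omega> (\<lambda>x. \<psi>'' (y x)) * (norm_H1 \<Omega> f)\<^sup>2"
    proof -
      have "(\<integral>x. \<psi>'' (y x) * f x * f x \<partial>lebesgue_on \<Omega>) \<le> (\<integral>x. \<bar>\<psi>'' (y x) * f x * f x\<bar> \<partial>lebesgue_on \<Omega>)"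
        using \<psi>''_integrable[OF y f f] by (intro integral_mono) auto
      also have "\<dots> \<le> Kq * norm_Lq q \<Omega> (\<lambda>x. \<psi>'' (y x)) * norm_H1 \<Omega> f * norm_H1 \<Omega> f"
        using multiplier[OF \<psi>''_Lq[OF y] f f] by simp
      finally show ?thesis by (simp add: power2_eq_square mult.assoc)
    qed
    have 3: "inner_L2 \<Omega> f f \<le> (norm_H1 \<Omega> f)\<^sup>2"
      using norm_L2_le_H1[OF open_dom] unfolding norm_L2_power2[symmetric] by (intro power_mono) auto
    have "adj_form y \<tau> f f \<le> \<epsilon> * (M * (norm_H1 \<Omega> f)\<^sup>2) + 1 / \<epsilon> * (Kq * norm_Lq q \<Omega> (\<lambda>x. \<psi>'' (y x)) * (norm_H1 \<Omega> f)\<^sup>2) + \<epsilon> / \<tau> * (norm_H1 \<Omega> f)\<^sup>2"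
      unfolding adj_form_eq[OF y f f] using \<epsilon> \<tau> by (intro add_mono mult_left_mono 1 2 3) auto
    also have "\<dots> = \<beta> * (norm_H1 \<Omega> f)\<^sup>2" by (simp add: \<beta>_def algebra_simps)
    finally show ?thesis .
  qed
  moreover have "\<beta> \<ge> 0" unfolding \<beta>_def using \<epsilon> \<tau> M_nonneg Kq norm_Lq_nonneg
    by (intro add_nonneg_nonneg mult_nonneg_nonneg) auto
  ultimately show ?thesis by blast
qed

text \<open>Coercivity makes the right-hand side bounded in the norm of the form and turns Cauchy
  sequences of the form into Cauchy sequences of \<open>H1\<close>; boundedness returns their limits
  to the form.\<close>

lemma adjoint_step_exists:
  assumes y: "y \<in> H1 \<Omega>" and \<tau>: "\<tau> > 0" and co: "coercivity \<tau> > 0" and r: "r \<in> L2 \<Omega>"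
  shows "\<exists>p\<in>H1 \<Omega>. \<forall>\<phi>\<in>H1 \<Omega>. adj_form y \<tau> \<phi> p = \<epsilon> / \<tau> * inner_L2 \<Omega> \<phi> r"
proof -
  obtain \<beta> where \<beta>: "\<beta> \<ge> 0" "\<And>f. f \<in> H1 \<Omega> \<Longrightarrow> adj_form y \<tau> f f \<le> \<beta> * (norm_H1 \<Omega> f)\<^sup>2"
    using adj_form_bounded[OF y \<tau>] by blast
  have H1_le: "norm_H1 \<Omega> f \<le> sqrt (adj_form y \<tau> f f) / sqrt (coercivity \<tau>)" if "f \<in> H1 \<Omega>" for f
  proof -
    have "(norm_H1 \<Omega> f)\<^sup>2 \<le> adj_form y \<tau> f f / coercivity \<tau>"
      using adj_form_coercive[OF y that, of \<tau>] co by (simp add: field_simps)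
    then have "sqrt ((norm_H1 \<Omega> f)\<^sup>2) \<le> sqrt (adj_form y \<tau> f f / coercivity \<tau>)" by (rule real_sqrt_le_mono)
    then show ?thesis using open_dom by (simp add: real_sqrt_divide)
  qed
  show ?thesis
  proof (rule symmetric_form_represents[where K = "\<epsilon> / \<tau> * norm_L2 \<Omega> r / sqrt (coercivity \<tau>)"])
    show "0 \<le> adj_form y \<tau> f f" if "f \<in> H1 \<Omega>" for f
      using adj_form_coercive[OF y that, of \<tau>] co by (meson less_imp_le mult_nonneg_nonneg order_trans zero_le_power2)
    show "\<epsilon> / \<tau> * inner_L2 \<Omega> f r \<le> \<epsilon> / \<tau> * norm_L2 \<Omega> r / sqrt (coercivity \<tau>) * sqrt (adj_form y \<tau> f f)" if f: "f \<in> H1 \<Omega>" for f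
    proof -
      have "inner_L2 \<Omega> f r \<le> norm_L2 \<Omega> f * norm_L2 \<Omega> r" using abs_inner_L2_le[OF H1_L2[OF f] r] by simp
      also have "\<dots> \<le> (sqrt (adj_form y \<tau> f f) / sqrt (coercivity \<tau>)) * norm_L2 \<Omega> r"
        using norm_L2_le_H1[OF open_dom, of f] H1_le[OF f] by (intro mult_right_mono) auto
      finally have "\<epsilon> / \<tau> * inner_L2 \<Omega> f r \<le> \<epsilon> / \<tau> * ((sqrt (adj_form y \<tau> f f) / sqrt (coercivity \<tau>)) * norm_L2 \<Omega> r)"
        using \<epsilon> \<tau> by (intro mult_left_mono) auto
      then show ?thesis by (simp add: mult_ac)
    qed
    fix f :: "nat \<Rightarrow> 'a \<Rightarrow> real" assume f: "\<And>n. f n \<in> H1 \<Omega>"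
      and c: "\<And>n k. n \<le> k \<Longrightarrow> adj_form y \<tau> (\<lambda>x. f k x - f n x) (\<lambda>x. f k x - f n x) \<le> (1/4)^n"
    \<comment> \<open>Discarding the first \<open>m\<close> terms gains the factor
      \<open>2^(-m)\<close>, which absorbs the coercivity constant and restores the exact geometric
      rate.\<close>
    obtain m where m: "1 / sqrt (coercivity \<tau>) < 2 ^ m" using real_arch_pow[of 2] by auto
    have cauchy: "norm_H1 \<Omega> (\<lambda>x. f (k + m) x - f (n + m) x) \<le> (1/2)^n" if "n \<le> k" for n k
    proof -
      have "norm_H1 \<Omega> (\<lambda>x. f (k + m) x - f (n + m) x)
          \<le> sqrt (adj_form y \<tau> (\<lambda>x. f (k + m) x - f (n + m) x) (\<lambda>x. f (k + m) x - f (n + m) x)) / sqrt (coercivity \<tau>)"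
        by (intro H1_le H1_diff[OF open_dom] f)
      also have "\<dots> \<le> sqrt ((1/4)^(n + m)) / sqrt (coercivity \<tau>)"
        using c[of "n + m" "k + m"] that co by (intro divide_right_mono real_sqrt_le_mono) auto
      also have "sqrt ((1/4)^(n + m)) = (1/2)^(n + m)" by (simp add: real_sqrt_power real_sqrt_divide)
      also have "(1/2)^(n + m) / sqrt (coercivity \<tau>) = (1/2)^(n + m) * (1 / sqrt (coercivity \<tau>))" by simp
      also have "\<dots> \<le> (1/2)^(n + m) * 2 ^ m" using m by (intro mult_left_mono) auto
      also have "\<dots> = (1/2)^n" by (simp add: power_add power_divide)
      finally show ?thesis .
    qed
    obtain g where g: "g \<in> H1 \<Omega>" "\<And>n. norm_H1 \<Omega> (\<lambda>x. g x - f (n + m) x) \<le> 2 * (1/2)^n"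
      using H1_fast_Cauchy_convergent[OF open_dom, of "\<lambda>n. f (n + m)", OF f cauchy] by blast
    have "(\<lambda>n. adj_form y \<tau> (\<lambda>x. g x - f (n + m) x) (\<lambda>x. g x - f (n + m) x)) \<longlonglongrightarrow> 0"
    proof (rule tendsto_sandwich)
      have d: "(\<lambda>x. g x - f (n + m) x) \<in> H1 \<Omega>" for n by (intro H1_diff[OF open_dom] g f)
      show "\<forall>\<^sub>F n in sequentially. 0 \<le> adj_form y \<tau> (\<lambda>x. g x - f (n + m) x) (\<lambda>x. g x - f (n + m) x)"
        using adj_form_coercive[OF y d, of \<tau>] co
        by (intro always_eventually allI) (meson less_imp_le mult_nonneg_nonneg order_trans zero_le_power2)
      show "\<forall>\<^sub>F n in sequentially. adj_form y \<tau> (\<lambda>x. g x - f (n + m) x) (\<lambda>x. g x - f (n + m) x) \<le> \<beta> * (2 * (1/2)^n)\<^sup>2"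
        using \<beta>(2)[OF d] g(2) open_dom
        by (intro always_eventually allI order_trans[OF \<beta>(2)[OF d]] mult_left_mono power_mono \<beta>(1)) auto
      have "(\<lambda>n. \<beta> * (2 * (1/2::real)^n)\<^sup>2) \<longlonglongrightarrow> \<beta> * (2 * 0)\<^sup>2"
        by (intro tendsto_intros LIMSEQ_power_zero) auto
      then show "(\<lambda>n. \<beta> * (2 * (1/2::real)^n)\<^sup>2) \<longlonglongrightarrow> 0" by simp
    qed simp
    then have "(\<lambda>n. adj_form y \<tau> (\<lambda>x. g x - f n x) (\<lambda>x. g x - f n x)) \<longlonglongrightarrow> 0" by (rule LIMSEQ_offset)
    then show "\<exists>g\<in>H1 \<Omega>. (\<lambda>n. adj_form y \<tau> (\<lambda>x. g x - f n x) (\<lambda>x. g x - f n x)) \<longlonglongrightarrow> 0" using g(1) by blast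
  qed (use y r in \<open>auto simp: H1_add[OF open_dom] H1_mult_left adj_form_add adj_form_mult_left adj_form_sym
      inner_L2_add_left inner_L2_mult_left H1_L2 distrib_left\<close>)
qed

text \<open>The two right-hand sides may differ on a null set, because in the backward recursion the
  previous adjoint value is itself unique only almost everywhere.\<close>

lemma adjoint_step_unique:
  assumes y: "y \<in> H1 \<Omega>" and co: "coercivity \<tau> > 0"
    and p: "p \<in> H1 \<Omega>" "\<And>\<phi>. \<phi> \<in> H1 \<Omega> \<Longrightarrow> adj_form y \<tau> \<phi> p = \<epsilon> / \<tau> * inner_L2 \<Omega> \<phi> r"
    and p': "p' \<in> H1 \<Omega>" "\<And>\<phi>. \<phi> \<in> H1 \<Omega> \<Longrightarrow> adj_form y \<tau> \<phi> p' = \<epsilon> / \<tau> * inner_L2 \<Omega> \<phi> r'"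
    and r: "r \<in> L2 \<Omega>" "r' \<in> L2 \<Omega>" "AE x in lebesgue_on \<Omega>. r' x = r x"
  shows "AE x in lebesgue_on \<Omega>. p' x = p x"
proof -
  let ?d = "\<lambda>x. p' x + (-1) * p x"
  have mp: "(\<lambda>x. (-1) * p x) \<in> H1 \<Omega>" using p(1) by (rule H1_mult_left)
  have d: "?d \<in> H1 \<Omega>" using H1_add[OF open_dom p'(1) mp] .
  have "adj_form y \<tau> ?d ?d = adj_form y \<tau> p' ?d + (-1) * adj_form y \<tau> p ?d"
    by (simp only: adj_form_add[OF y p'(1) mp d] adj_form_mult_left[OF y p(1) d])
  also have "\<dots> = adj_form y \<tau> ?d p' + (-1) * adj_form y \<tau> ?d p"
    by (simp only: adj_form_sym[OF y p'(1) d] adj_form_sym[OF y p(1) d])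
  also have "\<dots> = \<epsilon> / \<tau> * inner_L2 \<Omega> ?d r' - \<epsilon> / \<tau> * inner_L2 \<Omega> ?d r" using p(2)[OF d] p'(2)[OF d] by simp
  also have "inner_L2 \<Omega> ?d r' = inner_L2 \<Omega> ?d r"
    using r by (intro inner_L2_cong_AE H1_L2[OF d]) auto
  finally have "adj_form y \<tau> ?d ?d = 0" by simp
  then have "coercivity \<tau> * (norm_H1 \<Omega> ?d)\<^sup>2 \<le> 0" using adj_form_coercive[OF y d, of \<tau>] by simp
  then have "norm_H1 \<Omega> ?d = 0" using co by (simp add: mult_le_0_iff)
  then have "norm_L2 \<Omega> ?d \<le> 0" using norm_L2_le_H1[OF open_dom, of ?d] by simp
  then have "norm_L2 \<Omega> ?d = 0" using norm_L2_nonneg by (rule antisym)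
  then have "AE x in lebesgue_on \<Omega>. ?d x = 0" by (rule norm_L2_eq_0_imp_AE[OF H1_L2[OF d]])
  then show ?thesis by eventually_elim simp
qed

end

subsection \<open>One time step: stability and linearisation\<close>

lemma Lq_diff:
  assumes q: "q > 0" and f: "f \<in> Lq q \<Omega>" and g: "g \<in> Lq q \<Omega>"
  shows "(\<lambda>x. f x - g x) \<in> Lq q \<Omega>"
proof -
  have [measurable]: "f \<in> borel_measurable (lebesgue_on \<Omega>)" "g \<in> borel_measurable (lebesgue_on \<Omega>)"
    using f g by (auto simp: Lq_def)
  have i: "integrable (lebesgue_on \<Omega>) (\<lambda>x. 2 powr q * (\<bar>f x\<bar> powr q + \<bar>g x\<bar> powr q))"
    using f g by (auto simp: Lq_def)
  have "\<bar>a - b\<bar> powr q \<le> 2 powr q * (\<bar>a\<bar> powr q + \<bar>b\<bar> powr q)" for a b :: real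
  proof -
    have "\<bar>a - b\<bar> powr q \<le> (2 * max \<bar>a\<bar> \<bar>b\<bar>) powr q" using q by (intro powr_mono2) auto
    also have "\<dots> = 2 powr q * max \<bar>a\<bar> \<bar>b\<bar> powr q" by (simp add: powr_mult)
    also have "max \<bar>a\<bar> \<bar>b\<bar> powr q \<le> \<bar>a\<bar> powr q + \<bar>b\<bar> powr q" by (simp add: max_def)
    finally show ?thesis by simp
  qed
  then have "integrable (lebesgue_on \<Omega>) (\<lambda>x. \<bar>f x - g x\<bar> powr q)"
    by (intro Bochner_Integration.integrable_bound[OF i]) auto
  then show ?thesis by (simp add: Lq_def)
qed

text \<open>The integral form of the remainder, bounded by a nonnegative integral so that Tonelli
  can later exchange it with the space integral without further integrability.\<close>

lemma taylor_remainder_nn_integral: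
  fixes h h' :: "real \<Rightarrow> real"
  assumes d: "\<And>x. (h has_real_derivative h' x) (at x)" and c: "continuous_on UNIV h'"
  shows "ennreal \<bar>h b - h a - h' a * (b - a)\<bar>
    \<le> (\<integral>\<^sup>+s. indicator {0..1} s * ennreal \<bar>(h' (a + s * (b - a)) - h' a) * (b - a)\<bar> \<partial>lborel)"
proof -
  let ?F = "\<lambda>s. h (a + s * (b - a)) - h' a * (s * (b - a))"
  let ?f = "\<lambda>s. (h' (a + s * (b - a)) - h' a) * (b - a)"
  have "has_bochner_integral lborel (\<lambda>s. indicator {0..1} s *\<^sub>R ?f s) (?F 1 - ?F 0)"
  proof (rule has_bochner_integral_FTC_Icc)
    fix s :: real
    have "(?F has_real_derivative ?f s) (at s)"
      by (auto intro!: derivative_eq_intros DERIV_chain2[OF d] simp: algebra_simps)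
    then show "(?F has_vector_derivative ?f s) (at s within {0..1})"
      by (auto simp: has_real_derivative_iff_has_vector_derivative intro: has_vector_derivative_at_within)
    show "continuous_on {0..1} ?f"
      by (intro continuous_intros continuous_on_compose2[OF c]) auto
  qed simp
  then have i: "integrable lborel (\<lambda>s. indicator {0..1} s *\<^sub>R ?f s)"
    and e: "(\<integral>s. indicator {0..1} s *\<^sub>R ?f s \<partial>lborel) = h b - h a - h' a * (b - a)"
    by (auto simp: has_bochner_integral_iff)
  have "ennreal (norm (\<integral>s. indicator {0..1} s *\<^sub>R ?f s \<partial>lborel)) \<le> (\<integral>\<^sup>+s. ennreal (norm (indicator {0..1} s *\<^sub>R ?f s)) \<partial>lborel)"
    using i by (rule integral_norm_bound_ennreal)
  also have "\<dots> = (\<integral>\<^sup>+s. indicator {0..1} s * ennreal \<bar>?f s\<bar> \<partial>lborel)"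
    by (intro nn_integral_cong) (auto simp: indicator_def)
  finally show ?thesis unfolding e real_norm_def .
qed

lemma lipschitz_if_derivative_bounded:
  assumes "\<And>p. (f has_derivative blinfun_apply (D p)) (at p)" "\<And>p. norm (D p) \<le> M"
  shows "norm (f p - f r) \<le> M * norm (p - r)"
  by (rule differentiable_bound[of UNIV f "\<lambda>p. blinfun_apply (D p)"])
    (use assms in \<open>auto simp: norm_blinfun.rep_eq[symmetric]\<close>)

context semilinear_operator
begin

lemma A'_measurable:
  "g \<in> borel_measurable (lebesgue_on \<Omega>) \<Longrightarrow> (\<lambda>x. A' (g x)) \<in> borel_measurable (lebesgue_on \<Omega>)"
  using borel_measurable_continuous_onI[OF A'_cont] by (rule measurable_compose_rev)

lemma A'_L2: "g \<in> L2 \<Omega> \<Longrightarrow> (\<lambda>x. A' (g x)) \<in> L2 \<Omega>"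
proof -
  assume g: "g \<in> L2 \<Omega>"
  obtain C where "\<And>p. norm (A' p) \<le> C * norm p" using A'_growth by blast
  then show ?thesis by (intro L2_bound[where K = C, OF g A'_measurable[OF L2_measurable[OF g]]]) auto
qed

text \<open>The previous state \<open>z\<close> is an argument of its own, because perturbed
  trajectories also differ in it.\<close>

definition step_solution :: "('a \<Rightarrow> real) \<Rightarrow> ('a \<Rightarrow> real) \<Rightarrow> real \<Rightarrow> ('a \<Rightarrow> real) \<Rightarrow> bool" where
  "step_solution u z \<tau> y \<longleftrightarrow> y \<in> H1 \<Omega> \<and> (\<forall>\<phi>\<in>H1 \<Omega>.
    integrable (lebesgue_on \<Omega>) (\<lambda>x. \<psi>' (y x) * \<phi> x) \<and>
    \<epsilon> / \<tau> * inner_L2 \<Omega> y \<phi> + \<epsilon> * inner_L2 \<Omega> (\<lambda>x. A' (wgrad \<Omega> y x)) (wgrad \<Omega> \<phi>)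
      + 1 / \<epsilon> * inner_L2 \<Omega> (\<lambda>x. \<psi>' (y x)) \<phi>
    = inner_L2 \<Omega> u \<phi> + \<epsilon> / \<tau> * inner_L2 \<Omega> z \<phi>)"

text \<open>The difference of the two equations is tested with the difference of the solutions.
  Monotonicity and semiconvexity give the coercive lower bound, and one factor of the norm
  cancels.\<close>

lemma step_lipschitz:
  assumes s1: "step_solution u1 z1 \<tau> y1" and s2: "step_solution u2 z2 \<tau> y2"
    and L: "u1 \<in> L2 \<Omega>" "u2 \<in> L2 \<Omega>" "z1 \<in> L2 \<Omega>" "z2 \<in> L2 \<Omega>" and \<tau>: "\<tau> > 0" and co: "coercivity \<tau> > 0"
  shows "norm_H1 \<Omega> (\<lambda>x. y2 x - y1 x)
    \<le> (norm_L2 \<Omega> (\<lambda>x. u2 x - u1 x) + \<epsilon> / \<tau> * norm_L2 \<Omega> (\<lambda>x. z2 x - z1 x)) / coercivity \<tau>"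
proof -
  have y: "y1 \<in> H1 \<Omega>" "y2 \<in> H1 \<Omega>" using s1 s2 by (auto simp: step_solution_def)
  let ?d = "\<lambda>x. y2 x - y1 x"
  have d: "?d \<in> H1 \<Omega>" using y by (intro H1_diff[OF open_dom])
  have i: "integrable (lebesgue_on \<Omega>) (\<lambda>x. \<psi>' (y1 x) * ?d x)" "integrable (lebesgue_on \<Omega>) (\<lambda>x. \<psi>' (y2 x) * ?d x)"
    using s1 s2 d by (auto simp: step_solution_def)
  note e1 = s1[unfolded step_solution_def, THEN conjunct2, rule_format, OF d, THEN conjunct2]
  note e2 = s2[unfolded step_solution_def, THEN conjunct2, rule_format, OF d, THEN conjunct2]
  have 1: "C\<^sub>A * (norm_L2 \<Omega> (wgrad \<Omega> ?d))\<^sup>2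
      \<le> inner_L2 \<Omega> (\<lambda>x. A' (wgrad \<Omega> y2 x)) (wgrad \<Omega> ?d) - inner_L2 \<Omega> (\<lambda>x. A' (wgrad \<Omega> y1 x)) (wgrad \<Omega> ?d)"
  proof -
    have "C\<^sub>A * (norm_L2 \<Omega> (wgrad \<Omega> ?d))\<^sup>2 = (\<integral>x. C\<^sub>A * (norm (wgrad \<Omega> ?d x))\<^sup>2 \<partial>lebesgue_on \<Omega>)"
      by (simp add: norm_L2_power2_integral)
    also have "\<dots> \<le> (\<integral>x. (A' (wgrad \<Omega> y2 x) - A' (wgrad \<Omega> y1 x)) \<bullet> wgrad \<Omega> ?d x \<partial>lebesgue_on \<Omega>)"
    proof (rule integral_mono_AE)
      show "AE x in lebesgue_on \<Omega>. C\<^sub>A * (norm (wgrad \<Omega> ?d x))\<^sup>2 \<le> (A' (wgrad \<Omega> y2 x) - A' (wgrad \<Omega> y1 x)) \<bullet> wgrad \<Omega> ?d x"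
        using wgrad_diff[OF open_dom y(2,1)] by eventually_elim (simp add: A'_mono)
    qed (intro integrable_mult_right L2_integrable_sq L2_inner_integrable L2_diff A'_L2 wgrad_L2 y d)+
    also have "\<dots> = inner_L2 \<Omega> (\<lambda>x. A' (wgrad \<Omega> y2 x)) (wgrad \<Omega> ?d) - inner_L2 \<Omega> (\<lambda>x. A' (wgrad \<Omega> y1 x)) (wgrad \<Omega> ?d)"
      by (subst inner_L2_diff_left[symmetric]) (auto intro!: A'_L2 wgrad_L2 y d simp: inner_L2_def)
    finally show ?thesis .
  qed
  have 2: "- C\<^sub>\<psi> * (norm_L2 \<Omega> ?d)\<^sup>2 \<le> inner_L2 \<Omega> (\<lambda>x. \<psi>' (y2 x)) ?d - inner_L2 \<Omega> (\<lambda>x. \<psi>' (y1 x)) ?d"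
  proof -
    have "- C\<^sub>\<psi> * (norm_L2 \<Omega> ?d)\<^sup>2 = (\<integral>x. - C\<^sub>\<psi> * (norm (?d x))\<^sup>2 \<partial>lebesgue_on \<Omega>)"
      unfolding norm_L2_power2_integral by (rule integral_mult_right_zero[symmetric])
    also have "\<dots> \<le> (\<integral>x. \<psi>' (y2 x) * ?d x - \<psi>' (y1 x) * ?d x \<partial>lebesgue_on \<Omega>)"
    proof (rule integral_mono)
      show "integrable (lebesgue_on \<Omega>) (\<lambda>x. - C\<^sub>\<psi> * (norm (?d x))\<^sup>2)"
        by (intro integrable_mult_right L2_integrable_sq H1_L2 d)
      show "- C\<^sub>\<psi> * (norm (?d x))\<^sup>2 \<le> \<psi>' (y2 x) * ?d x - \<psi>' (y1 x) * ?d x" for x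
        using \<psi>'_mono[of "y2 x" "y1 x"] by (simp add: left_diff_distrib)
    qed (use i in \<open>intro Bochner_Integration.integrable_diff; simp\<close>)
    also have "\<dots> = inner_L2 \<Omega> (\<lambda>x. \<psi>' (y2 x)) ?d - inner_L2 \<Omega> (\<lambda>x. \<psi>' (y1 x)) ?d"
      using i by (simp add: inner_L2_def)
    finally show ?thesis .
  qed
  have 3: "inner_L2 \<Omega> y2 ?d - inner_L2 \<Omega> y1 ?d = (norm_L2 \<Omega> ?d)\<^sup>2"
    using y d by (simp add: norm_L2_power2 inner_L2_diff_left H1_L2)
  have "coercivity \<tau> * (norm_H1 \<Omega> ?d)\<^sup>2 = coercivity \<tau> * (norm_L2 \<Omega> (wgrad \<Omega> ?d))\<^sup>2 + coercivity \<tau> * (norm_L2 \<Omega> ?d)\<^sup>2"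
    by (simp add: norm_H1_power2[OF open_dom] distrib_left)
  also have "\<dots> \<le> (\<epsilon> * C\<^sub>A) * (norm_L2 \<Omega> (wgrad \<Omega> ?d))\<^sup>2 + (\<epsilon> / \<tau> - C\<^sub>\<psi> / \<epsilon>) * (norm_L2 \<Omega> ?d)\<^sup>2"
    by (intro add_mono mult_right_mono) (auto simp: coercivity_def)
  also have "\<dots> = \<epsilon> * (C\<^sub>A * (norm_L2 \<Omega> (wgrad \<Omega> ?d))\<^sup>2) + 1 / \<epsilon> * (- C\<^sub>\<psi> * (norm_L2 \<Omega> ?d)\<^sup>2) + \<epsilon> / \<tau> * (norm_L2 \<Omega> ?d)\<^sup>2"
    by (simp add: algebra_simps)
  also have "\<dots> \<le> \<epsilon> * (inner_L2 \<Omega> (\<lambda>x. A' (wgrad \<Omega> y2 x)) (wgrad \<Omega> ?d) - inner_L2 \<Omega> (\<lambda>x. A' (wgrad \<Omega> y1 x)) (wgrad \<Omega> ?d))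
      + 1 / \<epsilon> * (inner_L2 \<Omega> (\<lambda>x. \<psi>' (y2 x)) ?d - inner_L2 \<Omega> (\<lambda>x. \<psi>' (y1 x)) ?d)
      + \<epsilon> / \<tau> * (inner_L2 \<Omega> y2 ?d - inner_L2 \<Omega> y1 ?d)"
    unfolding 3 using \<epsilon> by (intro add_mono order_refl mult_left_mono 1 2) auto
  also have "\<dots> = (inner_L2 \<Omega> u2 ?d - inner_L2 \<Omega> u1 ?d) + \<epsilon> / \<tau> * (inner_L2 \<Omega> z2 ?d - inner_L2 \<Omega> z1 ?d)"
    using e1 e2 by (simp only: right_diff_distrib)
  also have "\<dots> = inner_L2 \<Omega> (\<lambda>x. u2 x - u1 x) ?d + \<epsilon> / \<tau> * inner_L2 \<Omega> (\<lambda>x. z2 x - z1 x) ?d"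
    using L H1_L2[OF d] by (simp add: inner_L2_diff_left)
  also have "\<dots> \<le> norm_L2 \<Omega> (\<lambda>x. u2 x - u1 x) * norm_H1 \<Omega> ?d + \<epsilon> / \<tau> * (norm_L2 \<Omega> (\<lambda>x. z2 x - z1 x) * norm_H1 \<Omega> ?d)"
  proof -
    have *: "inner_L2 \<Omega> v ?d \<le> norm_L2 \<Omega> v * norm_H1 \<Omega> ?d" if "v \<in> L2 \<Omega>" for v
    proof -
      have "inner_L2 \<Omega> v ?d \<le> norm_L2 \<Omega> v * norm_L2 \<Omega> ?d" using abs_inner_L2_le[OF that H1_L2[OF d]] by simp
      also have "\<dots> \<le> norm_L2 \<Omega> v * norm_H1 \<Omega> ?d" by (intro mult_left_mono norm_L2_le_H1 open_dom) simp
      finally show ?thesis .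
    qed
    show ?thesis using L \<epsilon> \<tau> by (intro add_mono mult_left_mono * L2_diff) auto
  qed
  finally have "coercivity \<tau> * norm_H1 \<Omega> ?d * norm_H1 \<Omega> ?d
      \<le> (norm_L2 \<Omega> (\<lambda>x. u2 x - u1 x) + \<epsilon> / \<tau> * norm_L2 \<Omega> (\<lambda>x. z2 x - z1 x)) * norm_H1 \<Omega> ?d"
    by (simp add: power2_eq_square distrib_right mult.assoc)
  moreover have "0 \<le> norm_L2 \<Omega> (\<lambda>x. u2 x - u1 x) + \<epsilon> / \<tau> * norm_L2 \<Omega> (\<lambda>x. z2 x - z1 x)"
    using \<epsilon> \<tau> by (intro add_nonneg_nonneg mult_nonneg_nonneg) auto
  ultimately have "coercivity \<tau> * norm_H1 \<Omega> ?d \<le> norm_L2 \<Omega> (\<lambda>x. u2 x - u1 x) + \<epsilon> / \<tau> * norm_L2 \<Omega> (\<lambda>x. z2 x - z1 x)"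
    using norm_H1_nonneg[OF open_dom, of ?d] by (cases "norm_H1 \<Omega> ?d = 0") (auto simp: mult_le_cancel_right)
  then show ?thesis using co by (simp add: field_simps)
qed

section \<open>Remainders of the linearisation\<close>

lemma A'_remainder_pointwise:
  "(\<lambda>n. norm (A' (p + h n) - A' p - A'' p (h n)) / norm (h n)) \<longlonglongrightarrow> 0" if "h \<longlonglongrightarrow> 0"
proof -
  let ?Q = "\<lambda>h. norm (A' (p + h) - A' p - A'' p h) / norm h"
  have "(?Q \<longlongrightarrow> 0) (at 0)" using A'_deriv[of p] by (simp add: has_derivative_at)
  \<comment> \<open>At increment zero the quotient is a division by zero with value
    \<open>0\<close>, which is the correct limit; so terms with \<open>h n = 0\<close> need no
    separate treatment.\<close>
  then have "isCont ?Q 0" by (simp add: isCont_def)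
  from isCont_tendsto_compose[OF this that] show ?thesis by simp
qed

lemma A'_remainder_le: "norm (A' (p + h) - A' p - A'' p h) \<le> 2 * M * norm h"
proof -
  have "norm (A' (p + h) - A' p) \<le> M * norm h"
    using lipschitz_if_derivative_bounded[OF A'_deriv A''_bound, of "p + h" p] by simp
  then show ?thesis using norm_triangle_ineq4[of "A' (p + h) - A' p" "A'' p h"] A''_apply_le[of p h] by simp
qed

text \<open>The superposition operator of \<open>A'\<close> is in general not differentiable on \<open>L\<^sup>2\<close>; tested against
  a fixed \<open>P\<close>, dominated convergence along a fast null sequence suffices.\<close>

lemma A'_remainder:
  assumes a: "a \<in> L2 \<Omega>" and P: "P \<in> L2 \<Omega>" and e: "e > 0"
  shows "\<exists>\<eta>>0. \<forall>h\<in>L2 \<Omega>. norm_L2 \<Omega> h < \<eta> \<longrightarrow>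
    (\<integral>x. norm (A' (a x + h x) - A' (a x) - A'' (a x) (h x)) * norm (P x) \<partial>lebesgue_on \<Omega>) \<le> e * norm_L2 \<Omega> h"
proof (rule ccontr)
  let ?R = "\<lambda>h x. norm (A' (a x + h x) - A' (a x) - A'' (a x) (h x))"
  assume neg: "\<not> ?thesis"
  \<comment> \<open>A failure at every radius is sampled at the radii \<open>(1/2)^n\<close>; this
    speed makes the increments tend to zero almost everywhere along the whole sequence.\<close>
  have "\<forall>n::nat. \<exists>h. h \<in> L2 \<Omega> \<and> norm_L2 \<Omega> h < (1/2)^n \<and> \<not> (\<integral>x. ?R h x * norm (P x) \<partial>lebesgue_on \<Omega>) \<le> e * norm_L2 \<Omega> h"
  proof
    fix n :: nat
    have "(0::real) < (1/2)^n" by simp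
    then show "\<exists>h. h \<in> L2 \<Omega> \<and> norm_L2 \<Omega> h < (1/2)^n \<and> \<not> (\<integral>x. ?R h x * norm (P x) \<partial>lebesgue_on \<Omega>) \<le> e * norm_L2 \<Omega> h"
      using neg by blast
  qed
  from choice[OF this] obtain h where hh: "\<forall>n::nat. h n \<in> L2 \<Omega> \<and> norm_L2 \<Omega> (h n) < (1/2)^n \<and>
    \<not> (\<integral>x. ?R (h n) x * norm (P x) \<partial>lebesgue_on \<Omega>) \<le> e * norm_L2 \<Omega> (h n)" ..
  have h: "\<And>n::nat. h n \<in> L2 \<Omega>" "\<And>n. norm_L2 \<Omega> (h n) < (1/2)^n"
    "\<And>n. \<not> (\<integral>x. ?R (h n) x * norm (P x) \<partial>lebesgue_on \<Omega>) \<le> e * norm_L2 \<Omega> (h n)" for n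
    using hh by blast+
  note [measurable] = L2_measurable[OF a] L2_measurable[OF P] L2_measurable[OF h(1)]
  have [measurable]: "(\<lambda>x. A' (a x + h n x)) \<in> borel_measurable (lebesgue_on \<Omega>)" "(\<lambda>x. A' (a x)) \<in> borel_measurable (lebesgue_on \<Omega>)"
    "(\<lambda>x. A'' (a x) (h n x)) \<in> borel_measurable (lebesgue_on \<Omega>)" for n
    by (intro A'_measurable A''_measurable; measurable)+
  \<comment> \<open>The remainder per unit of increment. It is bounded by \<open>2 * M\<close> and
    tends to zero almost everywhere, so its product with the fixed \<open>P\<close> tends to zero in
    \<open>L\<^sup>2\<close>; the increment then keeps its full norm in Cauchy-Schwarz.\<close>
  define k where "k n x = ?R (h n) x / norm (h n x)" for n x
  have [measurable]: "k n \<in> borel_measurable (lebesgue_on \<Omega>)" for n unfolding k_def by measurable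
  have k: "0 \<le> k n x" "k n x \<le> 2 * M" for n x
  proof -
    show "0 \<le> k n x" by (simp add: k_def)
    show "k n x \<le> 2 * M" using A'_remainder_le[of "a x" "h n x"] M_nonneg
      by (cases "h n x = 0") (auto simp: k_def field_simps)
  qed
  have Rk: "?R (h n) x = norm (h n x) * k n x" for n x
    by (cases "h n x = 0") (auto simp: k_def blinfun.zero_right)
  have lim: "AE x in lebesgue_on \<Omega>. (\<lambda>n. k n x) \<longlonglongrightarrow> 0"
    using L2_AE_tendsto_0[of h \<Omega>, OF h(1) less_imp_le[OF h(2)]]
    by eventually_elim (simp add: k_def A'_remainder_pointwise)
  have kP: "(\<lambda>x. k n x * norm (P x)) \<in> L2 \<Omega>" for n
    by (rule L2_bound[where K = "2 * M", OF P]) (use k in \<open>auto simp: abs_mult intro!: AE_I2 mult_right_mono\<close>)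
  have "(\<lambda>n. \<integral>x. (norm (k n x * norm (P x)))\<^sup>2 \<partial>lebesgue_on \<Omega>) \<longlonglongrightarrow> (\<integral>x. 0 \<partial>lebesgue_on \<Omega>)"
  proof (rule integral_dominated_convergence[where w = "\<lambda>x. (2 * M)\<^sup>2 * (norm (P x))\<^sup>2"])
    show "integrable (lebesgue_on \<Omega>) (\<lambda>x. (2 * M)\<^sup>2 * (norm (P x))\<^sup>2)" by (intro integrable_mult_right L2_integrable_sq P)
    show "AE x in lebesgue_on \<Omega>. (\<lambda>n. (norm (k n x * norm (P x)))\<^sup>2) \<longlonglongrightarrow> 0"
      using lim
    proof eventually_elim
      case (elim x)
      have "(\<lambda>n. (norm (k n x * norm (P x)))\<^sup>2) \<longlonglongrightarrow> (norm (0 * norm (P x)))\<^sup>2" by (intro tendsto_intros elim)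
      then show ?case by simp
    qed
    show "AE x in lebesgue_on \<Omega>. norm ((norm (k n x * norm (P x)))\<^sup>2) \<le> (2 * M)\<^sup>2 * (norm (P x))\<^sup>2" for n
    proof (intro AE_I2)
      fix x
      have "(k n x * norm (P x))\<^sup>2 \<le> (2 * M * norm (P x))\<^sup>2" using k by (intro power_mono mult_right_mono) auto
      then show "norm ((norm (k n x * norm (P x)))\<^sup>2) \<le> (2 * M)\<^sup>2 * (norm (P x))\<^sup>2" by (simp add: power_mult_distrib)
    qed
  qed measurable
  then have "(\<lambda>n. sqrt (\<integral>x. (norm (k n x * norm (P x)))\<^sup>2 \<partial>lebesgue_on \<Omega>)) \<longlonglongrightarrow> sqrt 0" by (intro tendsto_real_sqrt) simp
  then have "(\<lambda>n. norm_L2 \<Omega> (\<lambda>x. k n x * norm (P x))) \<longlonglongrightarrow> 0"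
    unfolding norm_L2_power2_integral[symmetric] by simp
  then have "\<forall>\<^sub>F n in sequentially. norm_L2 \<Omega> (\<lambda>x. k n x * norm (P x)) < e" using e by (intro order_tendstoD)
  then obtain n where n: "norm_L2 \<Omega> (\<lambda>x. k n x * norm (P x)) < e" by (auto simp: eventually_sequentially)
  have "(\<integral>x. ?R (h n) x * norm (P x) \<partial>lebesgue_on \<Omega>) = (\<integral>x. norm (h n x) * norm (k n x * norm (P x)) \<partial>lebesgue_on \<Omega>)"
    using k by (simp only: Rk) (simp add: abs_mult mult.assoc)
  also have "\<dots> \<le> norm_L2 \<Omega> (h n) * norm_L2 \<Omega> (\<lambda>x. k n x * norm (P x))"
    by (rule integral_norm_mult_le_L2[OF h(1) kP])
  also have "\<dots> \<le> norm_L2 \<Omega> (h n) * e" using n by (intro mult_left_mono) auto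
  finally show False using h(3)[of n] by (simp add: mult.commute)
qed

lemma A'_remainder_H1:
  assumes y: "y \<in> H1 \<Omega>" and p: "p \<in> H1 \<Omega>" and e: "e > 0"
  shows "\<exists>\<eta>>0. \<forall>z\<in>H1 \<Omega>. norm_H1 \<Omega> (\<lambda>x. z x - y x) < \<eta> \<longrightarrow>
    \<bar>inner_L2 \<Omega> (\<lambda>x. A' (wgrad \<Omega> z x)) (wgrad \<Omega> p) - inner_L2 \<Omega> (\<lambda>x. A' (wgrad \<Omega> y x)) (wgrad \<Omega> p)
      - inner_L2 \<Omega> (\<lambda>x. A'' (wgrad \<Omega> y x) (wgrad \<Omega> (\<lambda>x. z x - y x) x)) (wgrad \<Omega> p)\<bar>
    \<le> e * norm_H1 \<Omega> (\<lambda>x. z x - y x)"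
proof -
  obtain \<eta> where \<eta>: "\<eta> > 0" "\<And>h. h \<in> L2 \<Omega> \<Longrightarrow> norm_L2 \<Omega> h < \<eta> \<Longrightarrow>
    (\<integral>x. norm (A' (wgrad \<Omega> y x + h x) - A' (wgrad \<Omega> y x) - A'' (wgrad \<Omega> y x) (h x)) * norm (wgrad \<Omega> p x) \<partial>lebesgue_on \<Omega>)
      \<le> e * norm_L2 \<Omega> h"
    using A'_remainder[OF wgrad_L2[OF y] wgrad_L2[OF p] e] by blast
  show ?thesis
  proof (intro exI conjI ballI impI)
    fix z assume z: "z \<in> H1 \<Omega>" and small: "norm_H1 \<Omega> (\<lambda>x. z x - y x) < \<eta>"
    let ?d = "\<lambda>x. z x - y x"
    have d: "?d \<in> H1 \<Omega>" using z y by (intro H1_diff[OF open_dom])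
    note L = A'_L2[OF wgrad_L2[OF z]] A'_L2[OF wgrad_L2[OF y]] A''_L2[OF y d]
    have R: "(\<lambda>x. A' (wgrad \<Omega> z x) - A' (wgrad \<Omega> y x) - A'' (wgrad \<Omega> y x) (wgrad \<Omega> ?d x)) \<in> L2 \<Omega>"
      by (intro L2_diff L)
    have m: "(\<lambda>x. A' (wgrad \<Omega> y x + wgrad \<Omega> ?d x)) \<in> borel_measurable (lebesgue_on \<Omega>)"
      by (intro A'_measurable borel_measurable_add L2_measurable wgrad_L2 y d)
    have e0: "inner_L2 \<Omega> (\<lambda>x. A' (wgrad \<Omega> z x)) (wgrad \<Omega> p) - inner_L2 \<Omega> (\<lambda>x. A' (wgrad \<Omega> y x)) (wgrad \<Omega> p)
        - inner_L2 \<Omega> (\<lambda>x. A'' (wgrad \<Omega> y x) (wgrad \<Omega> ?d x)) (wgrad \<Omega> p)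
        = inner_L2 \<Omega> (\<lambda>x. A' (wgrad \<Omega> z x) - A' (wgrad \<Omega> y x) - A'' (wgrad \<Omega> y x) (wgrad \<Omega> ?d x)) (wgrad \<Omega> p)"
      using L wgrad_L2[OF p] by (simp add: inner_L2_diff_left L2_diff)
    note [measurable] = m L[THEN L2_measurable] L2_measurable[OF wgrad_L2[OF p]]
    have "\<bar>inner_L2 \<Omega> (\<lambda>x. A' (wgrad \<Omega> z x) - A' (wgrad \<Omega> y x) - A'' (wgrad \<Omega> y x) (wgrad \<Omega> ?d x)) (wgrad \<Omega> p)\<bar>
        \<le> (\<integral>x. norm (A' (wgrad \<Omega> z x) - A' (wgrad \<Omega> y x) - A'' (wgrad \<Omega> y x) (wgrad \<Omega> ?d x)) * norm (wgrad \<Omega> p x) \<partial>lebesgue_on \<Omega>)"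
      unfolding inner_L2_def
      by (rule integral_abs_bound_integral[OF L2_inner_integrable[OF R wgrad_L2[OF p]] L2_norm_mult_integrable[OF R wgrad_L2[OF p]]])
        (rule Cauchy_Schwarz_ineq2)
    also have "\<dots> = (\<integral>x. norm (A' (wgrad \<Omega> y x + wgrad \<Omega> ?d x) - A' (wgrad \<Omega> y x) - A'' (wgrad \<Omega> y x) (wgrad \<Omega> ?d x)) * norm (wgrad \<Omega> p x) \<partial>lebesgue_on \<Omega>)"
    proof (rule integral_cong_AE)
      show "AE x in lebesgue_on \<Omega>. norm (A' (wgrad \<Omega> z x) - A' (wgrad \<Omega> y x) - A'' (wgrad \<Omega> y x) (wgrad \<Omega> ?d x)) * norm (wgrad \<Omega> p x)
        = norm (A' (wgrad \<Omega> y x + wgrad \<Omega> ?d x) - A' (wgrad \<Omega> y x) - A'' (wgrad \<Omega> y x) (wgrad \<Omega> ?d x)) * norm (wgrad \<Omega> p x)"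
        using wgrad_diff[OF open_dom z y] by eventually_elim simp
    qed measurable
    also have "\<dots> \<le> e * norm_L2 \<Omega> (wgrad \<Omega> ?d)"
      using norm_L2_wgrad_le_H1[OF open_dom, of ?d] small by (intro \<eta>(2) wgrad_L2 d) simp
    also have "\<dots> \<le> e * norm_H1 \<Omega> ?d" using e by (intro mult_left_mono norm_L2_wgrad_le_H1[OF open_dom]) auto
    finally show "\<bar>inner_L2 \<Omega> (\<lambda>x. A' (wgrad \<Omega> z x)) (wgrad \<Omega> p) - inner_L2 \<Omega> (\<lambda>x. A' (wgrad \<Omega> y x)) (wgrad \<Omega> p)
      - inner_L2 \<Omega> (\<lambda>x. A'' (wgrad \<Omega> y x) (wgrad \<Omega> ?d x)) (wgrad \<Omega> p)\<bar> \<le> e * norm_H1 \<Omega> ?d" unfolding e0 .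
  qed (rule \<eta>(1))
qed

text \<open>On each point of the segment from \<open>y\<close> to \<open>z\<close> the change of
  \<psi>'' is small in \<open>L\<^sup>q\<close> by continuity of the superposition operator, the
  multiplier bound pairs it with \<open>z - y\<close> and \<open>p\<close>, and integrating over the
  segment gives the remainder. Integrability of the \<psi>' terms is supplied by the notion of
  solution.\<close>

lemma \<psi>'_remainder:
  assumes y: "y \<in> H1 \<Omega>" and p: "p \<in> H1 \<Omega>" and e: "e > 0"
  shows "\<exists>\<eta>>0. \<forall>z\<in>H1 \<Omega>. norm_H1 \<Omega> (\<lambda>x. z x - y x) < \<eta> \<longrightarrow>
    integrable (lebesgue_on \<Omega>) (\<lambda>x. \<psi>' (z x) * p x) \<longrightarrow> integrable (lebesgue_on \<Omega>) (\<lambda>x. \<psi>' (y x) * p x) \<longrightarrow>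
    \<bar>inner_L2 \<Omega> (\<lambda>x. \<psi>' (z x)) p - inner_L2 \<Omega> (\<lambda>x. \<psi>' (y x)) p
      - (\<integral>x. \<psi>'' (y x) * (z x - y x) * p x \<partial>lebesgue_on \<Omega>)\<bar> \<le> e * norm_H1 \<Omega> (\<lambda>x. z x - y x)"
proof -
  \<comment> \<open>Chosen so that the multiplier constant times the norm of \<open>p\<close> is
    compensated; the added \<open>1\<close> avoids division by zero.\<close>
  define e' where "e' = e / (Kq * norm_H1 \<Omega> p + 1)"
  have np: "0 \<le> Kq * norm_H1 \<Omega> p" using Kq norm_H1_nonneg[OF open_dom] by (rule mult_nonneg_nonneg)
  have e': "e' > 0" "Kq * e' * norm_H1 \<Omega> p \<le> e"
  proof -
    show "e' > 0" using e np by (simp add: e'_def)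
    have "(Kq * norm_H1 \<Omega> p) * e \<le> (Kq * norm_H1 \<Omega> p + 1) * e" using e by (intro mult_right_mono) auto
    then show "Kq * e' * norm_H1 \<Omega> p \<le> e" using np by (simp add: e'_def field_simps)
  qed
  obtain \<eta> where \<eta>: "\<eta> > 0" "\<And>z. z \<in> H1 \<Omega> \<Longrightarrow> norm_H1 \<Omega> (\<lambda>x. z x - y x) < \<eta> \<Longrightarrow>
      norm_Lq q \<Omega> (\<lambda>x. \<psi>'' (z x) - \<psi>'' (y x)) < e'"
    using nemytskii y e'(1) unfolding nemytskii_H1_Lq_continuous_def by meson
  have \<psi>''m [measurable]: "\<psi>'' \<in> borel_measurable borel" using \<psi>''_cont by (rule borel_measurable_continuous_onI)
  \<comment> \<open>Finite measure of \<Omega> makes the product with the segment variable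
    \<sigma>-finite, as Tonelli requires.\<close>
  have "\<Omega> \<in> lmeasurable" using bounded_dom open_dom by (rule lmeasurable_open)
  then interpret F: finite_measure "lebesgue_on \<Omega>" by (rule finite_measure_lebesgue_on)
  interpret pair_sigma_finite "lborel :: real measure" "lebesgue_on \<Omega>" ..
  show ?thesis
  proof (intro exI conjI ballI impI)
    fix z assume z: "z \<in> H1 \<Omega>" and small: "norm_H1 \<Omega> (\<lambda>x. z x - y x) < \<eta>"
      and iz: "integrable (lebesgue_on \<Omega>) (\<lambda>x. \<psi>' (z x) * p x)" and iy: "integrable (lebesgue_on \<Omega>) (\<lambda>x. \<psi>' (y x) * p x)"
    let ?d = "\<lambda>x. z x - y x"
    have d: "?d \<in> H1 \<Omega>" using z y by (intro H1_diff[OF open_dom])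
    note [measurable] = L2_measurable[OF H1_L2[OF z]] L2_measurable[OF H1_L2[OF y]] L2_measurable[OF H1_L2[OF p]]
    let ?R = "\<lambda>x. \<psi>' (z x) * p x - \<psi>' (y x) * p x - \<psi>'' (y x) * ?d x * p x"
    have Ri: "integrable (lebesgue_on \<Omega>) ?R" using iz iy \<psi>''_integrable[OF y d p] by simp
    define w where "w s x = \<psi>'' (y x + s * ?d x) - \<psi>'' (y x)" for s x
    \<comment> \<open>The intermediate point has distance
      \<open>\<bar>s\<bar> * norm_H1 \<Omega> ?d\<close> from \<open>y\<close>, so the radius
      \<open>\<eta>\<close> for the end point serves every \<open>s\<close> in the unit
      interval.\<close>
    have wint: "(\<integral>\<^sup>+x. ennreal \<bar>w s x * ?d x * p x\<bar> \<partial>lebesgue_on \<Omega>) \<le> ennreal (e * norm_H1 \<Omega> ?d)" if s: "s \<in> {0..1}" for s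
    proof -
      have zs: "(\<lambda>x. y x + s * ?d x) \<in> H1 \<Omega>" by (intro H1_add[OF open_dom] H1_mult_left y d)
      have wL: "w s \<in> Lq q \<Omega>" unfolding w_def using q by (intro Lq_diff \<psi>''_Lq zs y) auto
      have "norm_H1 \<Omega> (\<lambda>x. (y x + s * ?d x) - y x) = \<bar>s\<bar> * norm_H1 \<Omega> ?d"
        using norm_H1_mult_left[OF open_dom d, of s] by simp
      also have "\<dots> \<le> 1 * norm_H1 \<Omega> ?d" using s norm_H1_nonneg[OF open_dom] by (intro mult_right_mono) auto
      finally have "norm_Lq q \<Omega> (w s) < e'" unfolding w_def using small by (intro \<eta>(2) zs) simp
      then have "Kq * norm_Lq q \<Omega> (w s) * norm_H1 \<Omega> ?d * norm_H1 \<Omega> p \<le> Kq * e' * norm_H1 \<Omega> ?d * norm_H1 \<Omega> p"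
        using Kq norm_H1_nonneg[OF open_dom] by (intro mult_right_mono mult_left_mono) auto
      also have "\<dots> = (Kq * e' * norm_H1 \<Omega> p) * norm_H1 \<Omega> ?d" by (simp only: mult_ac)
      also have "\<dots> \<le> e * norm_H1 \<Omega> ?d" using e'(2) norm_H1_nonneg[OF open_dom] by (intro mult_right_mono) auto
      finally have b: "Kq * norm_Lq q \<Omega> (w s) * norm_H1 \<Omega> ?d * norm_H1 \<Omega> p \<le> e * norm_H1 \<Omega> ?d" .
      note mult = multiplier[OF wL d p]
      have "(\<integral>\<^sup>+x. ennreal \<bar>w s x * ?d x * p x\<bar> \<partial>lebesgue_on \<Omega>) = ennreal (\<integral>x. \<bar>w s x * ?d x * p x\<bar> \<partial>lebesgue_on \<Omega>)"
        using mult by (intro nn_integral_eq_integral) auto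
      also have "\<dots> \<le> ennreal (e * norm_H1 \<Omega> ?d)" using mult b by (intro ennreal_leI) linarith
      finally show ?thesis .
    qed
    have "(\<integral>\<^sup>+x. ennreal \<bar>?R x\<bar> \<partial>lebesgue_on \<Omega>)
        \<le> (\<integral>\<^sup>+x. \<integral>\<^sup>+s. indicator {0..1} s * ennreal \<bar>w s x * ?d x * p x\<bar> \<partial>lborel \<partial>lebesgue_on \<Omega>)"
    proof (rule nn_integral_mono)
      fix x
      have "?R x = (\<psi>' (z x) - \<psi>' (y x) - \<psi>'' (y x) * (z x - y x)) * p x" by (simp add: algebra_simps)
      then have "ennreal \<bar>?R x\<bar> = ennreal \<bar>\<psi>' (z x) - \<psi>' (y x) - \<psi>'' (y x) * (z x - y x)\<bar> * ennreal \<bar>p x\<bar>"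
        by (simp add: abs_mult ennreal_mult)
      also have "\<dots> \<le> (\<integral>\<^sup>+s. indicator {0..1} s * ennreal \<bar>(\<psi>'' (y x + s * (z x - y x)) - \<psi>'' (y x)) * (z x - y x)\<bar> \<partial>lborel) * ennreal \<bar>p x\<bar>"
        by (intro mult_right_mono taylor_remainder_nn_integral[OF \<psi>'_deriv \<psi>''_cont]) auto
      also have "\<dots> = (\<integral>\<^sup>+s. indicator {0..1} s * ennreal \<bar>(\<psi>'' (y x + s * (z x - y x)) - \<psi>'' (y x)) * (z x - y x)\<bar> * ennreal \<bar>p x\<bar> \<partial>lborel)"
        by (rule nn_integral_multc[symmetric]) measurable
      also have "\<dots> = (\<integral>\<^sup>+s. indicator {0..1} s * ennreal \<bar>w s x * ?d x * p x\<bar> \<partial>lborel)"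
        by (simp add: w_def abs_mult ennreal_mult mult.assoc)
      finally show "ennreal \<bar>?R x\<bar> \<le> (\<integral>\<^sup>+s. indicator {0..1} s * ennreal \<bar>w s x * ?d x * p x\<bar> \<partial>lborel)" .
    qed
    also have "\<dots> = (\<integral>\<^sup>+s. \<integral>\<^sup>+x. indicator {0..1} s * ennreal \<bar>w s x * ?d x * p x\<bar> \<partial>lebesgue_on \<Omega> \<partial>lborel)"
      unfolding w_def by (rule Fubini') measurable
    also have "\<dots> \<le> (\<integral>\<^sup>+s. ennreal (e * norm_H1 \<Omega> ?d) * indicator {0..1} s \<partial>(lborel :: real measure))"
    proof (rule nn_integral_mono)
      fix s :: real
      show "(\<integral>\<^sup>+x. indicator {0..1} s * ennreal \<bar>w s x * ?d x * p x\<bar> \<partial>lebesgue_on \<Omega>) \<le> ennreal (e * norm_H1 \<Omega> ?d) * indicator {0..1} s"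
        using wint[of s] by (cases "s \<in> {0..1}") auto
    qed
    also have "\<dots> = ennreal (e * norm_H1 \<Omega> ?d)" by (simp add: nn_integral_cmult_indicator)
    finally have nnR: "(\<integral>\<^sup>+x. ennreal \<bar>?R x\<bar> \<partial>lebesgue_on \<Omega>) \<le> ennreal (e * norm_H1 \<Omega> ?d)" .
    have "ennreal (norm (\<integral>x. ?R x \<partial>lebesgue_on \<Omega>)) \<le> (\<integral>\<^sup>+x. ennreal (norm (?R x)) \<partial>lebesgue_on \<Omega>)"
      using Ri by (rule integral_norm_bound_ennreal)
    then have "ennreal \<bar>\<integral>x. ?R x \<partial>lebesgue_on \<Omega>\<bar> \<le> ennreal (e * norm_H1 \<Omega> ?d)" using nnR by simp
    then have "\<bar>\<integral>x. ?R x \<partial>lebesgue_on \<Omega>\<bar> \<le> e * norm_H1 \<Omega> ?d"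
      using e norm_H1_nonneg[OF open_dom] by (subst (asm) ennreal_le_iff) auto
    moreover have "(\<integral>x. ?R x \<partial>lebesgue_on \<Omega>) = inner_L2 \<Omega> (\<lambda>x. \<psi>' (z x)) p - inner_L2 \<Omega> (\<lambda>x. \<psi>' (y x)) p
      - (\<integral>x. \<psi>'' (y x) * (z x - y x) * p x \<partial>lebesgue_on \<Omega>)"
      using iz iy \<psi>''_integrable[OF y d p] by (simp add: inner_L2_def)
    ultimately show "\<bar>inner_L2 \<Omega> (\<lambda>x. \<psi>' (z x)) p - inner_L2 \<Omega> (\<lambda>x. \<psi>' (y x)) p
      - (\<integral>x. \<psi>'' (y x) * (z x - y x) * p x \<partial>lebesgue_on \<Omega>)\<bar> \<le> e * norm_H1 \<Omega> ?d" by simp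
  qed (rule \<eta>(1))
qed

text \<open>The difference of two state equations is tested with \<open>p\<close>, and the adjoint
  equation is tested with \<open>y' - y\<close>. The linear parts cancel and only the two remainders
  survive. Multiplying by \<open>\<tau>\<close> makes the coefficients of the time differences
  independent of the step, which the later telescoping needs.\<close>

lemma step_remainder:
  assumes y: "step_solution u z \<tau> y" and L: "u \<in> L2 \<Omega>" "z \<in> L2 \<Omega>" "r \<in> L2 \<Omega>" and \<tau>: "\<tau> > 0"
    and p: "p \<in> H1 \<Omega>" "\<And>\<phi>. \<phi> \<in> H1 \<Omega> \<Longrightarrow> adj_form y \<tau> \<phi> p = \<epsilon> / \<tau> * inner_L2 \<Omega> \<phi> r" and e: "e > 0"
  shows "\<exists>\<eta>>0. \<forall>u' z' y'. step_solution u' z' \<tau> y' \<longrightarrow> u' \<in> L2 \<Omega> \<longrightarrow> z' \<in> L2 \<Omega> \<longrightarrow>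
    norm_H1 \<Omega> (\<lambda>x. y' x - y x) < \<eta> \<longrightarrow>
    \<bar>\<tau> * inner_L2 \<Omega> (\<lambda>x. u' x - u x) p + \<epsilon> * inner_L2 \<Omega> (\<lambda>x. z' x - z x) p - \<epsilon> * inner_L2 \<Omega> (\<lambda>x. y' x - y x) r\<bar>
      \<le> e * norm_H1 \<Omega> (\<lambda>x. y' x - y x)"
proof -
  have yH: "y \<in> H1 \<Omega>" using y by (simp add: step_solution_def)
  \<comment> \<open>The remainders enter with the factors \<open>\<tau> * \<epsilon>\<close> and
    \<open>\<tau> / \<epsilon>\<close>, so this share of each adds up to exactly
    \<open>e\<close>.\<close>
  define e1 where "e1 = e / (\<tau> * (\<epsilon> + 1 / \<epsilon>))"
  have pos: "\<tau> * (\<epsilon> + 1 / \<epsilon>) > 0" using \<tau> \<epsilon> by (intro mult_pos_pos add_pos_pos) auto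
  have e1: "e1 > 0" "\<tau> * (\<epsilon> * e1 + 1 / \<epsilon> * e1) = e"
  proof -
    show "e1 > 0" using e pos by (simp add: e1_def)
    have "\<tau> * (\<epsilon> * e1 + 1 / \<epsilon> * e1) = \<tau> * (\<epsilon> + 1 / \<epsilon>) * e1" by (simp add: algebra_simps)
    also have "\<dots> = e"
    proof -
      have "c * (e / c) = e" if "c > 0" for c using that by simp
      from this[OF pos] show ?thesis by (simp only: e1_def)
    qed
    finally show "\<tau> * (\<epsilon> * e1 + 1 / \<epsilon> * e1) = e" .
  qed
  obtain \<eta>1 where \<eta>1: "\<eta>1 > 0" "\<And>v. v \<in> H1 \<Omega> \<Longrightarrow> norm_H1 \<Omega> (\<lambda>x. v x - y x) < \<eta>1 \<Longrightarrow>
    \<bar>inner_L2 \<Omega> (\<lambda>x. A' (wgrad \<Omega> v x)) (wgrad \<Omega> p) - inner_L2 \<Omega> (\<lambda>x. A' (wgrad \<Omega> y x)) (wgrad \<Omega> p)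
      - inner_L2 \<Omega> (\<lambda>x. A'' (wgrad \<Omega> y x) (wgrad \<Omega> (\<lambda>x. v x - y x) x)) (wgrad \<Omega> p)\<bar>
    \<le> e1 * norm_H1 \<Omega> (\<lambda>x. v x - y x)"
    using A'_remainder_H1[OF yH p(1) e1(1)] by blast
  obtain \<eta>2 where \<eta>2: "\<eta>2 > 0" "\<And>v. v \<in> H1 \<Omega> \<Longrightarrow> norm_H1 \<Omega> (\<lambda>x. v x - y x) < \<eta>2 \<Longrightarrow>
    integrable (lebesgue_on \<Omega>) (\<lambda>x. \<psi>' (v x) * p x) \<Longrightarrow> integrable (lebesgue_on \<Omega>) (\<lambda>x. \<psi>' (y x) * p x) \<Longrightarrow>
    \<bar>inner_L2 \<Omega> (\<lambda>x. \<psi>' (v x)) p - inner_L2 \<Omega> (\<lambda>x. \<psi>' (y x)) p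
      - (\<integral>x. \<psi>'' (y x) * (v x - y x) * p x \<partial>lebesgue_on \<Omega>)\<bar> \<le> e1 * norm_H1 \<Omega> (\<lambda>x. v x - y x)"
    using \<psi>'_remainder[OF yH p(1) e1(1)] by blast
  show ?thesis
  proof (intro exI[of _ "min \<eta>1 \<eta>2"] conjI allI impI)
    show "min \<eta>1 \<eta>2 > 0" using \<eta>1(1) \<eta>2(1) by simp
    fix u' z' y' assume y': "step_solution u' z' \<tau> y'" and L': "u' \<in> L2 \<Omega>" "z' \<in> L2 \<Omega>"
      and small: "norm_H1 \<Omega> (\<lambda>x. y' x - y x) < min \<eta>1 \<eta>2"
    let ?d = "\<lambda>x. y' x - y x"
    have y'H: "y' \<in> H1 \<Omega>" using y' by (simp add: step_solution_def)
    have d: "?d \<in> H1 \<Omega>" using y'H yH by (intro H1_diff[OF open_dom])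
    note s = y[unfolded step_solution_def, THEN conjunct2, rule_format, OF p(1)]
    note s' = y'[unfolded step_solution_def, THEN conjunct2, rule_format, OF p(1)]
    define RA where "RA = inner_L2 \<Omega> (\<lambda>x. A' (wgrad \<Omega> y' x)) (wgrad \<Omega> p) - inner_L2 \<Omega> (\<lambda>x. A' (wgrad \<Omega> y x)) (wgrad \<Omega> p)
      - inner_L2 \<Omega> (\<lambda>x. A'' (wgrad \<Omega> y x) (wgrad \<Omega> ?d x)) (wgrad \<Omega> p)"
    define RP where "RP = inner_L2 \<Omega> (\<lambda>x. \<psi>' (y' x)) p - inner_L2 \<Omega> (\<lambda>x. \<psi>' (y x)) p
      - (\<integral>x. \<psi>'' (y x) * ?d x * p x \<partial>lebesgue_on \<Omega>)"
    have RA: "\<bar>RA\<bar> \<le> e1 * norm_H1 \<Omega> ?d" unfolding RA_def using small by (intro \<eta>1(2) y'H) auto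
    have RP: "\<bar>RP\<bar> \<le> e1 * norm_H1 \<Omega> ?d" unfolding RP_def using small s s' by (intro \<eta>2(2) y'H) auto
    have adj: "\<epsilon> * inner_L2 \<Omega> (\<lambda>x. A'' (wgrad \<Omega> y x) (wgrad \<Omega> ?d x)) (wgrad \<Omega> p)
      + 1 / \<epsilon> * (\<integral>x. \<psi>'' (y x) * ?d x * p x \<partial>lebesgue_on \<Omega>) + \<epsilon> / \<tau> * inner_L2 \<Omega> ?d p = \<epsilon> / \<tau> * inner_L2 \<Omega> ?d r"
      using p(2)[OF d] adj_form_eq[OF yH d p(1), of \<tau>] by simp
    have dp: "inner_L2 \<Omega> ?d p = inner_L2 \<Omega> y' p - inner_L2 \<Omega> y p"
      by (intro inner_L2_diff_left H1_L2 y'H yH p)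
    have up: "inner_L2 \<Omega> (\<lambda>x. u' x - u x) p = inner_L2 \<Omega> u' p - inner_L2 \<Omega> u p"
      by (intro inner_L2_diff_left H1_L2[OF p(1)] L L')
    have zp: "inner_L2 \<Omega> (\<lambda>x. z' x - z x) p = inner_L2 \<Omega> z' p - inner_L2 \<Omega> z p"
      by (intro inner_L2_diff_left H1_L2[OF p(1)] L L')
    have R: "\<epsilon> * RA + 1 / \<epsilon> * RP = inner_L2 \<Omega> (\<lambda>x. u' x - u x) p + \<epsilon> / \<tau> * inner_L2 \<Omega> (\<lambda>x. z' x - z x) p - \<epsilon> / \<tau> * inner_L2 \<Omega> ?d r"
      using s[THEN conjunct2] s'[THEN conjunct2] adj unfolding RA_def RP_def dp up zp right_diff_distrib by linarith
    have e0: "\<tau> * inner_L2 \<Omega> (\<lambda>x. u' x - u x) p + \<epsilon> * inner_L2 \<Omega> (\<lambda>x. z' x - z x) p - \<epsilon> * inner_L2 \<Omega> ?d r = \<tau> * (\<epsilon> * RA + 1 / \<epsilon> * RP)"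
      unfolding R using \<tau> by (simp add: algebra_simps)
    have "\<bar>\<tau> * (\<epsilon> * RA + 1 / \<epsilon> * RP)\<bar> \<le> \<tau> * (\<epsilon> * \<bar>RA\<bar> + 1 / \<epsilon> * \<bar>RP\<bar>)"
    proof -
      have "\<bar>\<epsilon> * RA + 1 / \<epsilon> * RP\<bar> \<le> \<epsilon> * \<bar>RA\<bar> + 1 / \<epsilon> * \<bar>RP\<bar>"
        using abs_triangle_ineq[of "\<epsilon> * RA" "1 / \<epsilon> * RP"] \<epsilon> by (simp add: abs_mult)
      then show ?thesis using \<tau> by (simp add: abs_mult)
    qed
    also have "\<dots> \<le> \<tau> * (\<epsilon> * (e1 * norm_H1 \<Omega> ?d) + 1 / \<epsilon> * (e1 * norm_H1 \<Omega> ?d))"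
      using \<tau> \<epsilon> by (intro mult_left_mono add_mono RA RP) auto
    also have "\<dots> = (\<tau> * (\<epsilon> * e1 + 1 / \<epsilon> * e1)) * norm_H1 \<Omega> ?d" by (simp add: algebra_simps)
    finally show "\<bar>\<tau> * inner_L2 \<Omega> (\<lambda>x. u' x - u x) p + \<epsilon> * inner_L2 \<Omega> (\<lambda>x. z' x - z x) p - \<epsilon> * inner_L2 \<Omega> ?d r\<bar>
      \<le> e * norm_H1 \<Omega> ?d" unfolding e0 e1(2) .
  qed
qed

end

subsection \<open>The whole trajectory\<close>

context semilinear_operator
begin

text \<open>Index \<open>0\<close> carries the initial value, which gives the first step the same
  form as all others.\<close>

definition trajectory :: "nat \<Rightarrow> (nat \<Rightarrow> real) \<Rightarrow> (nat \<Rightarrow> 'a \<Rightarrow> real) \<Rightarrow> (nat \<Rightarrow> 'a \<Rightarrow> real) \<Rightarrow> bool" where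
  "trajectory N \<tau> u y \<longleftrightarrow> y 0 \<in> L2 \<Omega> \<and>
    (\<forall>j\<in>{1..N}. u j \<in> L2 \<Omega> \<and> step_solution (u j) (y (j - 1)) (\<tau> j) (y j))"

lemma trajectory_L2: "trajectory N \<tau> u y \<Longrightarrow> j \<le> N \<Longrightarrow> y j \<in> L2 \<Omega>"
  by (cases "j = 0") (auto simp: trajectory_def step_solution_def intro: H1_L2)

lemma trajectory_H1: "trajectory N \<tau> u y \<Longrightarrow> j \<in> {1..N} \<Longrightarrow> y j \<in> H1 \<Omega>"
  by (auto simp: trajectory_def step_solution_def)

text \<open>One step passes on the error of the previous state with a fixed factor, so induction
  over finitely many steps gives one constant. It is found before the perturbation and is therefore
  uniform in it.\<close>

lemma trajectory_lipschitz:
  assumes \<tau>: "\<And>j. j \<in> {1..N} \<Longrightarrow> \<tau> j > 0 \<and> coercivity (\<tau> j) > 0" and y: "trajectory N \<tau> u y"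
  shows "\<exists>L\<ge>0. \<forall>u' y' D. trajectory N \<tau> u' y' \<longrightarrow> y' 0 = y 0 \<longrightarrow>
    (\<forall>j\<in>{1..N}. norm_L2 \<Omega> (\<lambda>x. u' j x - u j x) \<le> D) \<longrightarrow> D \<ge> 0 \<longrightarrow>
    (\<forall>j\<in>{1..N}. norm_H1 \<Omega> (\<lambda>x. y' j x - y j x) \<le> L * D)"
proof -
  have "n \<le> N \<Longrightarrow> \<exists>L\<ge>0. \<forall>u' y' D. trajectory N \<tau> u' y' \<longrightarrow> y' 0 = y 0 \<longrightarrow>
    (\<forall>j\<in>{1..N}. norm_L2 \<Omega> (\<lambda>x. u' j x - u j x) \<le> D) \<longrightarrow> D \<ge> 0 \<longrightarrow>
    (\<forall>j\<in>{1..n}. norm_H1 \<Omega> (\<lambda>x. y' j x - y j x) \<le> L * D)" for n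
  proof (induction n)
    case 0
    show ?case by (intro exI[of _ 0]) auto
  next
    case (Suc n)
    then obtain L where L: "L \<ge> 0" "\<And>u' y' D j. trajectory N \<tau> u' y' \<Longrightarrow> y' 0 = y 0 \<Longrightarrow>
      (\<forall>j\<in>{1..N}. norm_L2 \<Omega> (\<lambda>x. u' j x - u j x) \<le> D) \<Longrightarrow> D \<ge> 0 \<Longrightarrow> j \<in> {1..n} \<Longrightarrow>
      norm_H1 \<Omega> (\<lambda>x. y' j x - y j x) \<le> L * D" by auto
    have Sn: "Suc n \<in> {1..N}" using Suc.prems by simp
    note t = \<tau>[OF Sn]
    \<comment> \<open>The quotient is the bound for the new step when the previous error is
      \<open>L * D\<close>; the maximum retains the earlier steps.\<close>
    define L' where "L' = max L ((1 + \<epsilon> / \<tau> (Suc n) * L) / coercivity (\<tau> (Suc n)))"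
    show ?case
    proof (intro exI[of _ L'] conjI allI impI ballI)
      show "L' \<ge> 0" using L(1) by (simp add: L'_def)
      fix u' y' D j
      assume y': "trajectory N \<tau> u' y'" and y0: "y' 0 = y 0"
        and D: "\<forall>j\<in>{1..N}. norm_L2 \<Omega> (\<lambda>x. u' j x - u j x) \<le> D" "D \<ge> 0" and j: "j \<in> {1..Suc n}"
      show "norm_H1 \<Omega> (\<lambda>x. y' j x - y j x) \<le> L' * D"
      proof (cases "j = Suc n")
        case False
        then have "norm_H1 \<Omega> (\<lambda>x. y' j x - y j x) \<le> L * D" using j by (intro L(2)[OF y' y0 D]) auto
        also have "\<dots> \<le> L' * D" using D(2) by (intro mult_right_mono) (auto simp: L'_def)
        finally show ?thesis .
      next
        case True
        have prev: "norm_L2 \<Omega> (\<lambda>x. y' n x - y n x) \<le> L * D"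
        proof (cases "n = 0")
          case True
          then have "(\<lambda>x. y' n x - y n x) = (\<lambda>x. 0 * y n x)" using y0 by simp
          then have "norm_L2 \<Omega> (\<lambda>x. y' n x - y n x) = 0" by (simp only: norm_L2_mult_left)
          then show ?thesis using L(1) D(2) by simp
        next
          case False
          then have "norm_H1 \<Omega> (\<lambda>x. y' n x - y n x) \<le> L * D" by (intro L(2)[OF y' y0 D]) auto
          then show ?thesis using norm_L2_le_H1[OF open_dom] by (rule order_trans[rotated])
        qed
        have "norm_H1 \<Omega> (\<lambda>x. y' (Suc n) x - y (Suc n) x) \<le>
          (norm_L2 \<Omega> (\<lambda>x. u' (Suc n) x - u (Suc n) x) + \<epsilon> / \<tau> (Suc n) * norm_L2 \<Omega> (\<lambda>x. y' n x - y n x)) / coercivity (\<tau> (Suc n))"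
        proof -
          have "u (Suc n) \<in> L2 \<Omega> \<and> step_solution (u (Suc n)) (y n) (\<tau> (Suc n)) (y (Suc n))"
            "u' (Suc n) \<in> L2 \<Omega> \<and> step_solution (u' (Suc n)) (y' n) (\<tau> (Suc n)) (y' (Suc n))"
            using y y' Sn unfolding trajectory_def by (metis diff_Suc_1)+
          moreover have "y n \<in> L2 \<Omega>" "y' n \<in> L2 \<Omega>" using y y' Suc.prems by (auto intro: trajectory_L2)
          ultimately show ?thesis using t by (intro step_lipschitz) auto
        qed
        also have "\<dots> \<le> (D + \<epsilon> / \<tau> (Suc n) * (L * D)) / coercivity (\<tau> (Suc n))"
          using D(1) Sn t \<epsilon> prev by (intro divide_right_mono add_mono mult_left_mono) auto
        also have "\<dots> = (1 + \<epsilon> / \<tau> (Suc n) * L) / coercivity (\<tau> (Suc n)) * D" by (simp add: algebra_simps)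
        also have "\<dots> \<le> L' * D" using D(2) by (intro mult_right_mono) (auto simp: L'_def)
        finally show ?thesis using True by simp
      qed
    qed
  qed
  from this[of N] show ?thesis by simp
qed

text \<open>Summing the step identities telescopes the pairings of state differences with adjoint
  values. At the start they vanish because the initial values agree, and at the end the terminal
  value of the adjoint remains.\<close>

lemma discrete_duality:
  assumes \<tau>: "\<And>j. j \<in> {1..N} \<Longrightarrow> \<tau> j > 0 \<and> coercivity (\<tau> j) > 0" and y: "trajectory N \<tau> u y"
    and p: "\<And>j. j \<in> {1..N} \<Longrightarrow> p j \<in> H1 \<Omega>" "p (N + 1) \<in> L2 \<Omega>"
      "\<And>j \<phi>. j \<in> {1..N} \<Longrightarrow> \<phi> \<in> H1 \<Omega> \<Longrightarrow> adj_form (y j) (\<tau> j) \<phi> (p j) = \<epsilon> / \<tau> j * inner_L2 \<Omega> \<phi> (p (j + 1))"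
    and e: "e > 0"
  shows "\<exists>\<eta>>0. \<forall>u' y' D. trajectory N \<tau> u' y' \<longrightarrow> y' 0 = y 0 \<longrightarrow>
    (\<forall>j\<in>{1..N}. norm_L2 \<Omega> (\<lambda>x. u' j x - u j x) \<le> D) \<longrightarrow> D \<ge> 0 \<longrightarrow> D < \<eta> \<longrightarrow>
    \<bar>(\<Sum>j=1..N. \<tau> j * inner_L2 \<Omega> (\<lambda>x. u' j x - u j x) (p j)) - \<epsilon> * inner_L2 \<Omega> (\<lambda>x. y' N x - y N x) (p (N + 1))\<bar> \<le> e * D"
proof -
  obtain L where L: "L \<ge> 0" "\<And>u' y' D j. trajectory N \<tau> u' y' \<Longrightarrow> y' 0 = y 0 \<Longrightarrow>
      (\<forall>j\<in>{1..N}. norm_L2 \<Omega> (\<lambda>x. u' j x - u j x) \<le> D) \<Longrightarrow> D \<ge> 0 \<Longrightarrow> j \<in> {1..N} \<Longrightarrow>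
      norm_H1 \<Omega> (\<lambda>x. y' j x - y j x) \<le> L * D" using trajectory_lipschitz[OF \<tau> y] by auto
  \<comment> \<open>Each of the \<open>N\<close> steps contributes at most
    \<open>e1 * L * D\<close>; the \<open>1\<close> avoids division by zero.\<close>
  define e1 where "e1 = e / (real N * L + 1)"
  have NL: "real N * L \<ge> 0" using L(1) by simp
  have e1: "e1 > 0" "real N * L * e1 \<le> e"
  proof -
    show "e1 > 0" using e NL by (simp add: e1_def)
    have "real N * L * e \<le> (real N * L + 1) * e" using e by (intro mult_right_mono) auto
    then show "real N * L * e1 \<le> e" using NL by (simp add: e1_def field_simps)
  qed
  have pL: "p (j + 1) \<in> L2 \<Omega>" if "j \<in> {1..N}" for j
    using that p(1)[of "j + 1"] p(2) by (cases "j = N") (auto intro: H1_L2)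
  have "\<forall>j\<in>{1..N}. \<exists>\<eta>>0. \<forall>u' z' y'. step_solution u' z' (\<tau> j) y' \<longrightarrow> u' \<in> L2 \<Omega> \<longrightarrow> z' \<in> L2 \<Omega> \<longrightarrow>
    norm_H1 \<Omega> (\<lambda>x. y' x - y j x) < \<eta> \<longrightarrow>
    \<bar>\<tau> j * inner_L2 \<Omega> (\<lambda>x. u' x - u j x) (p j) + \<epsilon> * inner_L2 \<Omega> (\<lambda>x. z' x - y (j - 1) x) (p j)
      - \<epsilon> * inner_L2 \<Omega> (\<lambda>x. y' x - y j x) (p (j + 1))\<bar> \<le> e1 * norm_H1 \<Omega> (\<lambda>x. y' x - y j x)"
  proof
    fix j assume j: "j \<in> {1..N}"
    have s: "step_solution (u j) (y (j - 1)) (\<tau> j) (y j)" "u j \<in> L2 \<Omega>" "y (j - 1) \<in> L2 \<Omega>"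
      using y j trajectory_L2[OF y, of "j - 1"] by (auto simp: trajectory_def)
    show "\<exists>\<eta>>0. \<forall>u' z' y'. step_solution u' z' (\<tau> j) y' \<longrightarrow> u' \<in> L2 \<Omega> \<longrightarrow> z' \<in> L2 \<Omega> \<longrightarrow>
    norm_H1 \<Omega> (\<lambda>x. y' x - y j x) < \<eta> \<longrightarrow>
    \<bar>\<tau> j * inner_L2 \<Omega> (\<lambda>x. u' x - u j x) (p j) + \<epsilon> * inner_L2 \<Omega> (\<lambda>x. z' x - y (j - 1) x) (p j)
      - \<epsilon> * inner_L2 \<Omega> (\<lambda>x. y' x - y j x) (p (j + 1))\<bar> \<le> e1 * norm_H1 \<Omega> (\<lambda>x. y' x - y j x)"
      using step_remainder[OF s pL[OF j] _ p(1)[OF j] p(3)[OF j] e1(1)] \<tau>[OF j] by blast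
  qed
  from bchoice[OF this] obtain \<eta> where \<eta>: "\<forall>j\<in>{1..N}. \<eta> j > 0 \<and> (\<forall>u' z' y'. step_solution u' z' (\<tau> j) y' \<longrightarrow> u' \<in> L2 \<Omega> \<longrightarrow> z' \<in> L2 \<Omega> \<longrightarrow>
    norm_H1 \<Omega> (\<lambda>x. y' x - y j x) < \<eta> j \<longrightarrow>
    \<bar>\<tau> j * inner_L2 \<Omega> (\<lambda>x. u' x - u j x) (p j) + \<epsilon> * inner_L2 \<Omega> (\<lambda>x. z' x - y (j - 1) x) (p j)
      - \<epsilon> * inner_L2 \<Omega> (\<lambda>x. y' x - y j x) (p (j + 1))\<bar> \<le> e1 * norm_H1 \<Omega> (\<lambda>x. y' x - y j x))" ..
  \<comment> \<open>One radius for all steps; the inserted \<open>1\<close> keeps the minimum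
    defined for \<open>N = 0\<close>.\<close>
  define m where "m = Min (insert 1 (\<eta> ` {1..N}))"
  have m: "m > 0" "\<And>j. j \<in> {1..N} \<Longrightarrow> m \<le> \<eta> j"
  proof -
    show "m > 0" unfolding m_def using \<eta> by (subst Min_gr_iff) auto
    show "m \<le> \<eta> j" if "j \<in> {1..N}" for j unfolding m_def by (rule Min_le) (use that in auto)
  qed
  show ?thesis
  proof (intro exI[of _ "m / (L + 1)"] conjI allI impI)
    show "m / (L + 1) > 0" using m(1) L(1) by simp
    fix u' y' D assume y': "trajectory N \<tau> u' y'" and y0: "y' 0 = y 0"
      and D: "\<forall>j\<in>{1..N}. norm_L2 \<Omega> (\<lambda>x. u' j x - u j x) \<le> D" "D \<ge> 0" "D < m / (L + 1)"
    define a where "a j = \<tau> j * inner_L2 \<Omega> (\<lambda>x. u' j x - u j x) (p j)" for j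
    \<comment> \<open>The state difference at step \<open>j\<close> is paired with the adjoint value
      of the next index. Hence \<open>b (j - 1)\<close> contains \<open>p j\<close>, the element
      with which step \<open>j\<close> is tested, and the sum telescopes.\<close>
    define b where "b j = \<epsilon> * inner_L2 \<Omega> (\<lambda>x. y' j x - y j x) (p (j + 1))" for j
    have LD: "L * D < m"
    proof -
      have "(L + 1) * D < m" using D(3) L(1) by (simp add: field_simps)
      then show ?thesis using D(2) by (simp add: distrib_right)
    qed
    have st: "\<bar>a j + b (j - 1) - b j\<bar> \<le> e1 * (L * D)" if j: "j \<in> {1..N}" for j
    proof -
      have n: "norm_H1 \<Omega> (\<lambda>x. y' j x - y j x) \<le> L * D" by (rule L(2)[OF y' y0 D(1,2) j])
      have s: "step_solution (u' j) (y' (j - 1)) (\<tau> j) (y' j)" "u' j \<in> L2 \<Omega>" "y' (j - 1) \<in> L2 \<Omega>"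
        using y' j trajectory_L2[OF y', of "j - 1"] by (auto simp: trajectory_def)
      have "norm_H1 \<Omega> (\<lambda>x. y' j x - y j x) < \<eta> j" using n LD m(2)[OF j] by linarith
      then have "\<bar>\<tau> j * inner_L2 \<Omega> (\<lambda>x. u' j x - u j x) (p j) + \<epsilon> * inner_L2 \<Omega> (\<lambda>x. y' (j - 1) x - y (j - 1) x) (p j)
        - \<epsilon> * inner_L2 \<Omega> (\<lambda>x. y' j x - y j x) (p (j + 1))\<bar> \<le> e1 * norm_H1 \<Omega> (\<lambda>x. y' j x - y j x)"
        using \<eta> j s by blast
      also have "\<dots> \<le> e1 * (L * D)" using n e1(1) by (intro mult_left_mono) auto
      finally show ?thesis using j by (simp add: a_def b_def)
    qed
    have b0: "b 0 = 0" using y0 by (simp add: b_def inner_L2_def)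
    have tele: "(\<Sum>j=1..n. a j + b (j - 1) - b j) = (\<Sum>j=1..n. a j) - b n" for n
      by (induction n) (simp_all add: b0)
    have "\<bar>(\<Sum>j=1..N. a j) - b N\<bar> \<le> (\<Sum>j=1..N. \<bar>a j + b (j - 1) - b j\<bar>)"
      unfolding tele[symmetric] by (rule sum_abs)
    also have "\<dots> \<le> (\<Sum>j=1..N. e1 * (L * D))" by (intro sum_mono st)
    also have "\<dots> = real N * L * e1 * D" by simp
    also have "\<dots> \<le> e * D" using e1(2) D(2) by (intro mult_right_mono) auto
    finally show "\<bar>(\<Sum>j=1..N. \<tau> j * inner_L2 \<Omega> (\<lambda>x. u' j x - u j x) (p j))
      - \<epsilon> * inner_L2 \<Omega> (\<lambda>x. y' N x - y N x) (p (N + 1))\<bar> \<le> e * D" by (simp add: a_def b_def)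
  qed
qed

text \<open>The adjoint equation runs backwards from the terminal value, and each step only requires
  the later value to lie in \<open>L\<^sup>2\<close>.\<close>

lemma discrete_adjoint_exists:
  fixes N :: nat and y :: "nat \<Rightarrow> 'a \<Rightarrow> real" and \<tau> :: "nat \<Rightarrow> real"
  assumes \<tau>: "\<And>j. j \<in> {1..N} \<Longrightarrow> \<tau> j > 0 \<and> coercivity (\<tau> j) > 0" and y: "\<And>j. j \<in> {1..N} \<Longrightarrow> y j \<in> H1 \<Omega>" and r: "r \<in> L2 \<Omega>"
  shows "\<exists>p. p (N + 1) = r \<and> (\<forall>j\<in>{1..N}. p j \<in> H1 \<Omega> \<and>
    (\<forall>\<phi>\<in>H1 \<Omega>. adj_form (y j) (\<tau> j) \<phi> (p j) = \<epsilon> / \<tau> j * inner_L2 \<Omega> \<phi> (p (j + 1))))"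
proof -
  define P where "P j pn q \<longleftrightarrow> q \<in> H1 \<Omega> \<and> (\<forall>\<phi>\<in>H1 \<Omega>. adj_form (y j) (\<tau> j) \<phi> q = \<epsilon> / \<tau> j * inner_L2 \<Omega> \<phi> pn)" for j pn q
  \<comment> \<open>Recursion in reversed time: \<open>b n\<close> is the adjoint value of index
    \<open>N + 1 - n\<close>, so \<open>b 0\<close> is the terminal datum.\<close>
  define b where "b = rec_nat r (\<lambda>n pn. SOME q. P (N - n) pn q)"
  have b0: "b 0 = r" and bS: "b (Suc n) = (SOME q. P (N - n) (b n) q)" for n by (simp_all add: b_def)
  have step: "P (N - n) (b n) (b (Suc n))" if "n < N" "b n \<in> L2 \<Omega>" for n
  proof -
    have j: "N - n \<in> {1..N}" using that by auto
    then have "\<exists>q. P (N - n) (b n) q"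
      using adjoint_step_exists[OF y[OF j] _ _ that(2)] \<tau>[OF j] unfolding P_def by blast
    then show ?thesis unfolding bS by (rule someI_ex)
  qed
  have bL: "n \<le> N \<Longrightarrow> b n \<in> L2 \<Omega>" for n
  proof (induction n)
    case (Suc n)
    then show ?case using step[of n] by (auto simp: P_def intro: H1_L2)
  qed (simp add: b0 r)
  show ?thesis
  proof (intro exI[of _ "\<lambda>j. b (N + 1 - j)"] conjI ballI)
    fix j assume j: "j \<in> {1..N}"
    then have "P (N - (N - j)) (b (N - j)) (b (Suc (N - j)))" by (intro step bL) auto
    moreover have "N - (N - j) = j" "Suc (N - j) = N + 1 - j" "N - j = N + 1 - (j + 1)" using j by auto
    ultimately have Pj: "P j (b (N + 1 - (j + 1))) (b (N + 1 - j))" by metis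
    show "b (N + 1 - j) \<in> H1 \<Omega>" using Pj by (simp add: P_def)
    fix \<phi> assume "\<phi> \<in> H1 \<Omega>"
    then show "adj_form (y j) (\<tau> j) \<phi> (b (N + 1 - j)) = \<epsilon> / \<tau> j * inner_L2 \<Omega> \<phi> (b (N + 1 - (j + 1)))"
      using Pj by (simp add: P_def)
  qed (simp add: b0)
qed

lemma discrete_adjoint_unique:
  fixes N :: nat and y p p' :: "nat \<Rightarrow> 'a \<Rightarrow> real" and \<tau> :: "nat \<Rightarrow> real"
  assumes \<tau>: "\<And>j. j \<in> {1..N} \<Longrightarrow> \<tau> j > 0 \<and> coercivity (\<tau> j) > 0" and y: "\<And>j. j \<in> {1..N} \<Longrightarrow> y j \<in> H1 \<Omega>" and r: "r \<in> L2 \<Omega>"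
    and p: "p (N + 1) = r" "\<And>j. j \<in> {1..N} \<Longrightarrow> p j \<in> H1 \<Omega>"
      "\<And>j \<phi>. j \<in> {1..N} \<Longrightarrow> \<phi> \<in> H1 \<Omega> \<Longrightarrow> adj_form (y j) (\<tau> j) \<phi> (p j) = \<epsilon> / \<tau> j * inner_L2 \<Omega> \<phi> (p (j + 1))"
    and p': "p' (N + 1) = r" "\<And>j. j \<in> {1..N} \<Longrightarrow> p' j \<in> H1 \<Omega>"
      "\<And>j \<phi>. j \<in> {1..N} \<Longrightarrow> \<phi> \<in> H1 \<Omega> \<Longrightarrow> adj_form (y j) (\<tau> j) \<phi> (p' j) = \<epsilon> / \<tau> j * inner_L2 \<Omega> \<phi> (p' (j + 1))"
    and j: "j \<in> {1..N}"
  shows "AE x in lebesgue_on \<Omega>. p' j x = p j x"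
proof -
  have "n \<le> N \<Longrightarrow> p (N + 1 - n) \<in> L2 \<Omega> \<and> p' (N + 1 - n) \<in> L2 \<Omega> \<and> (AE x in lebesgue_on \<Omega>. p' (N + 1 - n) x = p (N + 1 - n) x)" for n
  proof (induction n)
    case 0
    then show ?case using p(1) p'(1) r by simp
  next
    case (Suc n)
    then have k: "N - n \<in> {1..N}" and s: "N + 1 - Suc n = N - n" "N + 1 - n = N - n + 1" by auto
    have "AE x in lebesgue_on \<Omega>. p' (N - n) x = p (N - n) x"
      using Suc \<tau>[OF k] unfolding s
      by (intro adjoint_step_unique[OF y[OF k] _ p(2)[OF k] p(3)[OF k] p'(2)[OF k] p'(3)[OF k]]) auto
    then show ?case using p(2)[OF k] p'(2)[OF k] unfolding s by (auto intro: H1_L2)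
  qed
  moreover have "N + 1 - (N + 1 - j) = j" "N + 1 - j \<le> N" using j by auto
  ultimately show ?thesis by metis
qed

end

section \<open>The time grid and piecewise constant functions\<close>

lemma time_grid_mono:
  assumes "time_grid N T t" "i \<le> j" "j \<le> N"
  shows "t i \<le> t j"
  using assms(2,3)
proof (induction j rule: dec_induct)
  case (step n)
  then have "Suc n \<in> {1..N}" by simp
  then have "t (Suc n - 1) < t (Suc n)" using assms(1) unfolding time_grid_def by blast
  then show ?case using step by simp
qed simp

lemma time_grid_cell:
  assumes g: "time_grid N T t" and s: "0 < s" "s \<le> T"
  shows "\<exists>j\<in>{1..N}. s \<in> {t (j - 1)<..t j}"
proof -
  define j where "j = (LEAST j. s \<le> t j)"
  have tN: "s \<le> t N" and t0: "t 0 = 0" using g s by (auto simp: time_grid_def)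
  have j: "s \<le> t j" unfolding j_def using tN by (rule LeastI)
  have jN: "j \<le> N" unfolding j_def using tN by (rule Least_le)
  have j0: "j \<noteq> 0" using j t0 s(1) by (cases "j = 0") auto
  have "\<not> s \<le> t (j - 1)" using not_less_Least[of "j - 1" "\<lambda>j. s \<le> t j"] j0 by (simp add: j_def)
  then show ?thesis using j jN j0 by (intro bexI[of _ j]) auto
qed

lemma time_grid_cell_unique:
  assumes g: "time_grid N T t" and j: "j \<in> {1..N}" "s \<in> {t (j - 1)<..t j}" and k: "k \<in> {1..N}" "s \<in> {t (k - 1)<..t k}"
  shows "k = j"
proof (rule ccontr)
  assume "k \<noteq> j"
  then consider "k < j" | "j < k" by linarith
  then show False
  proof cases
    case 1
    then have "t k \<le> t (j - 1)" using j k by (intro time_grid_mono[OF g]) auto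
    then show False using j k by auto
  next
    case 2
    then have "t j \<le> t (k - 1)" using j k by (intro time_grid_mono[OF g]) auto
    then show False using j k by auto
  qed
qed

lemma pw_const_of_eq:
  assumes g: "time_grid N T t" and j: "j \<in> {1..N}" "s \<in> {t (j - 1)<..t j}"
  shows "pw_const_of N t p (s, x) = p j x"
proof -
  have "(\<Sum>k=1..N. indicator {t (k - 1)<..t k} s * p k x) = (\<Sum>k=1..N. if k = j then p k x else 0)"
  proof (rule sum.cong[OF refl])
    fix k assume k: "k \<in> {1..N}"
    show "indicator {t (k - 1)<..t k} s * p k x = (if k = j then p k x else 0)"
    proof (cases "k = j")
      case False
      then have "s \<notin> {t (k - 1)<..t k}" using time_grid_cell_unique[OF g j k] by blast
      then show ?thesis using False by (simp only: indicator_simps) simp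
    qed (use j(2) in \<open>simp only: indicator_simps, simp\<close>)
  qed
  then show ?thesis using j(1) by (simp add: pw_const_of_def)
qed

lemma time_grid_endpoint:
  assumes "time_grid N T t" "j \<in> {1..N}"
  shows "t j \<in> {t (j - 1)<..t j}" "tau t j > 0"
  using assms by (auto simp: time_grid_def tau_def)

lemma val_pw_const_of:
  assumes "time_grid N T t" "j \<in> {1..N}"
  shows "val t (pw_const_of N t p) j = p j"
  unfolding val_def by (rule ext) (rule pw_const_of_eq[OF assms time_grid_endpoint(1)[OF assms]])

lemma pw_const_of_mem:
  assumes "time_grid N T t" "\<And>j. j \<in> {1..N} \<Longrightarrow> p j \<in> X"
  shows "pw_const_of N t p \<in> pw_const N t \<Omega> X"
  unfolding pw_const_def
proof (intro CollectI ballI conjI)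
  fix j assume j: "j \<in> {1..N}"
  show "val t (pw_const_of N t p) j \<in> X" unfolding val_pw_const_of[OF assms(1) j] using assms(2) j by blast
  fix s x assume "s \<in> {t (j - 1)<..t j}"
  then show "pw_const_of N t p (s, x) = val t (pw_const_of N t p) j x"
    unfolding val_pw_const_of[OF assms(1) j] by (rule pw_const_of_eq[OF assms(1) j])
qed

lemma val_add: "val t (\<lambda>z. u z + v z) j = (\<lambda>x. val t u j x + val t v j x)"
  by (simp add: val_def)

lemma val_mult_left: "val t (\<lambda>z. c * u z) j = (\<lambda>x. c * val t u j x)"
  by (simp add: val_def)

lemma pw_const_add:
  assumes "u \<in> pw_const N t \<Omega> (L2 \<Omega>)" "v \<in> pw_const N t \<Omega> (L2 \<Omega>)"
  shows "(\<lambda>z. u z + v z) \<in> pw_const N t \<Omega> (L2 \<Omega>)"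
  unfolding pw_const_def
proof (intro CollectI ballI conjI)
  fix j assume j: "j \<in> {1..N}"
  show "val t (\<lambda>z. u z + v z) j \<in> L2 \<Omega>" unfolding val_add using assms j by (intro L2_add) (auto simp: pw_const_def)
  fix s x assume "s \<in> {t (j - 1)<..t j}" "x \<in> \<Omega>"
  then show "u (s, x) + v (s, x) = val t (\<lambda>z. u z + v z) j x" using assms j unfolding val_add pw_const_def by auto
qed

lemma pw_const_mult_left:
  assumes "u \<in> pw_const N t \<Omega> (L2 \<Omega>)"
  shows "(\<lambda>z. c * u z) \<in> pw_const N t \<Omega> (L2 \<Omega>)"
  unfolding pw_const_def
proof (intro CollectI ballI conjI)
  fix j assume j: "j \<in> {1..N}"
  show "val t (\<lambda>z. c * u z) j \<in> L2 \<Omega>" unfolding val_mult_left using assms j by (intro L2_mult_left) (auto simp: pw_const_def)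
  fix s x assume "s \<in> {t (j - 1)<..t j}" "x \<in> \<Omega>"
  then show "c * u (s, x) = val t (\<lambda>z. c * u z) j x" using assms j unfolding val_mult_left pw_const_def by auto
qed

text \<open>Lebesgue measure on the product is the completion of the product, not the product of the
  completions. Fubini is therefore applied to a Borel representative over \<open>lborel\<close>, and
  the result is carried back along null sets.\<close>

lemma slab_integral:
  fixes h :: "'a::euclidean_space \<Rightarrow> real"
  assumes S: "S \<in> sets borel" and h: "integrable (lebesgue_on S) h" and ab: "a \<le> b"
  shows "integrable lebesgue (\<lambda>z :: real \<times> 'a. indicator {a<..b} (fst z) * (indicator S (snd z) * h (snd z)))"
    and "(\<integral>z. indicator {a<..b} (fst z) * (indicator S (snd z) * h (snd z)) \<partial>(lebesgue :: (real \<times> 'a) measure))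
      = (b - a) * (\<integral>x. h x \<partial>lebesgue_on S)"
proof -
  have hm: "h \<in> borel_measurable (lebesgue_on S)" using h by simp
  obtain k where k: "k \<in> borel_measurable borel" "\<And>x. x \<notin> S \<Longrightarrow> k x = 0" "AE x in lebesgue_on S. k x = h x"
    using ex_borel_representative[OF S hm] by blast
  note rep = borel_representative_integral[OF S k(1,2) hm k(3)]
  have ki: "integrable lborel k" using rep(2) h by simp
  note k(1) [measurable]
  let ?G = "\<lambda>z :: real \<times> 'a. indicator {a<..b} (fst z) * k (snd z)"
  let ?F = "\<lambda>z :: real \<times> 'a. indicator {a<..b} (fst z) * (indicator S (snd z) * h (snd z))"
  have Gp: "integrable (lborel \<Otimes>\<^sub>M lborel) ?G"
  proof (rule lborel_pair.Fubini_integrable)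
    show "?G \<in> borel_measurable (lborel \<Otimes>\<^sub>M lborel)" by measurable
    have "integrable lborel (\<lambda>s. indicator {a<..b} s * (\<integral>x. \<bar>k x\<bar> \<partial>lborel))"
      by (intro integrable_mult_left) (simp add: integrable_indicator_iff ab)
    then show "integrable lborel (\<lambda>s. \<integral>x. norm (?G (s, x)) \<partial>lborel)" by (simp add: abs_mult)
    show "AE s in lborel. integrable lborel (\<lambda>x. ?G (s, x))" using ki by simp
  qed
  have "(\<integral>z. ?G z \<partial>(lborel \<Otimes>\<^sub>M lborel)) = (\<integral>s. \<integral>x. ?G (s, x) \<partial>lborel \<partial>lborel)"
    using lborel_pair.integral_fst'[OF Gp] by simp
  also have "\<dots> = (b - a) * (\<integral>x. k x \<partial>lborel)" using ab by simp
  finally have GI: "(\<integral>z. ?G z \<partial>lborel) = (b - a) * (\<integral>x. k x \<partial>lborel)" unfolding lborel_prod .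
  have Gi: "integrable lborel ?G" using Gp unfolding lborel_prod .
  have Gm: "?G \<in> borel_measurable lborel" using Gi by simp
  have ae: "AE z in lebesgue. ?G z = ?F z"
  proof -
    have "AE x in lebesgue. x \<in> S \<longrightarrow> k x = h x" using k(3) S by (simp add: AE_restrict_space_iff)
    then have "AE x in lborel. x \<in> S \<longrightarrow> k x = h x" by (simp add: AE_completion_iff)
    then obtain N where N: "N \<in> null_sets lborel" "{x. \<not> (x \<in> S \<longrightarrow> k x = h x)} \<subseteq> N"
      by (auto simp: eventually_ae_filter)
    \<comment> \<open>The representative may differ from \<open>h\<close> on a spatial null set; its
      cylinder over all times is null as well.\<close>
    have "UNIV \<times> N \<in> null_sets (lborel \<Otimes>\<^sub>M lborel :: (real \<times> 'a) measure)"
      using N(1) by (intro lborel.times_in_null_sets2) auto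
    then have "(UNIV :: real set) \<times> N \<in> null_sets lborel" unfolding lborel_prod .
    then have "AE z in lborel. ?G z = ?F z"
    proof (rule AE_I')
      show "{z \<in> space lborel. ?G z \<noteq> ?F z} \<subseteq> UNIV \<times> N"
      proof
        fix z assume "z \<in> {z \<in> space lborel. ?G z \<noteq> ?F z}"
        then have ne: "?G z \<noteq> ?F z" by simp
        then have "snd z \<in> S" using k(2)[of "snd z"] by (cases "snd z \<in> S") auto
        then have "k (snd z) \<noteq> h (snd z)" using ne by auto
        then show "z \<in> UNIV \<times> N" using N(2) \<open>snd z \<in> S\<close> by (cases z) auto
      qed
    qed
    then show ?thesis by (rule AE_completion)
  qed
  have Gl: "integrable lebesgue ?G" using Gi Gm by (simp add: integrable_completion)
  have Fm: "?F \<in> borel_measurable lebesgue" using borel_measurable_AE[OF borel_measurable_integrable[OF Gl] ae] .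
  show "integrable lebesgue ?F" using Gl Fm ae by (rule integrable_cong_AE_imp)
  have "(\<integral>z. ?F z \<partial>lebesgue) = (\<integral>z. ?G z \<partial>lebesgue)"
    using ae by (intro integral_cong_AE Fm borel_measurable_integrable[OF Gl]) (auto elim: eventually_mono)
  also have "\<dots> = (\<integral>z. ?G z \<partial>lborel)" using Gm by (rule integral_completion)
  finally show "(\<integral>z. ?F z \<partial>lebesgue) = (b - a) * (\<integral>x. h x \<partial>lebesgue_on S)" using GI rep(1) by simp
qed

text \<open>Reduces the norm of \<open>L\<^sup>2(Q)\<close> to a weighted sum over the time steps,
  which is the form in which duality is available.\<close>

lemma inner_L2_pw_const:
  fixes \<Omega> :: "'a::euclidean_space set"
  assumes op: "open \<Omega>" and g: "time_grid N T t"
    and F: "F \<in> pw_const N t \<Omega> (L2 \<Omega>)" and G: "G \<in> pw_const N t \<Omega> (L2 \<Omega>)"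
  shows "inner_L2 ({0..T} \<times> \<Omega>) F G = (\<Sum>j=1..N. tau t j * inner_L2 \<Omega> (val t F j) (val t G j))"
proof -
  have S: "\<Omega> \<in> sets borel" using op by simp
  let ?h = "\<lambda>j x. val t F j x * val t G j x"
  let ?H = "\<lambda>j z. indicator {t (j - 1)<..t j} (fst z) * (indicator \<Omega> (snd z) * ?h j (snd z))"
  let ?Q = "{0..T} \<times> \<Omega>"
  have hi: "integrable (lebesgue_on \<Omega>) (?h j)" if "j \<in> {1..N}" for j
    using F G that by (intro L2_mult_integrable) (auto simp: pw_const_def)
  have tj: "t (j - 1) \<le> t j" if "j \<in> {1..N}" for j using time_grid_endpoint(1)[OF g that] by simp
  note slab = slab_integral[OF S hi tj]
  have Hi: "integrable lebesgue (\<lambda>z. \<Sum>j=1..N. ?H j z)"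
    using slab(1) by (intro Bochner_Integration.integrable_sum) auto
  have "{0..T} \<times> \<Omega> \<in> sets (borel :: (real \<times> 'a) measure)"
    using S by (intro borel_Times) auto
  then have Q: "?Q \<in> sets lebesgue" by simp
  \<comment> \<open>Time \<open>0\<close> belongs to \<open>Q\<close> but to no cell, and members of
    the space are arbitrary there. The identity is therefore pointwise for all other times, and the
    exceptional slice is null.\<close>
  have pt: "(\<Sum>j=1..N. ?H j z) = indicator ?Q z *\<^sub>R (F z \<bullet> G z)" if "fst z \<noteq> 0" for z
  proof -
    obtain s x where z: "z = (s, x)" by (cases z)
    have H: "(\<Sum>j=1..N. ?H j z) = pw_const_of N t (\<lambda>j x. indicator \<Omega> x * ?h j x) (s, x)"
      by (simp add: pw_const_of_def z)
    show ?thesis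
    proof (cases "\<exists>j\<in>{1..N}. s \<in> {t (j - 1)<..t j}")
      case True
      then obtain j where j: "j \<in> {1..N}" "s \<in> {t (j - 1)<..t j}" by blast
      have "t 0 \<le> t (j - 1)" "t j \<le> t N" using j(1) by (auto intro!: time_grid_mono[OF g])
      then have sT: "s \<in> {0..T}" using j(2) g by (auto simp: time_grid_def)
      have FG: "x \<in> \<Omega> \<Longrightarrow> F (s, x) = val t F j x" "x \<in> \<Omega> \<Longrightarrow> G (s, x) = val t G j x"
        using F G j unfolding pw_const_def by auto
      show ?thesis unfolding H unfolding pw_const_of_eq[OF g j] z using sT FG by (auto simp: indicator_def)
    next
      case False
      then have sT: "s \<notin> {0..T}" using time_grid_cell[OF g, of s] that z by force
      have "(\<Sum>j=1..N. ?H j z) = 0" using False by (intro sum.neutral) (auto simp: z indicator_def)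
      moreover have "indicator ?Q z = (0 :: real)" using sT by (auto simp: z indicator_def)
      ultimately show ?thesis by (simp only:) simp
    qed
  qed
  have ae: "AE z in lebesgue. (\<Sum>j=1..N. ?H j z) = indicator ?Q z *\<^sub>R (F z \<bullet> G z)"
  proof -
    have "{0} \<times> UNIV \<in> null_sets (lborel \<Otimes>\<^sub>M lborel :: (real \<times> 'a) measure)"
      by (intro lborel.times_in_null_sets1) auto
    then have "({0} :: real set) \<times> (UNIV :: 'a set) \<in> null_sets lborel" unfolding lborel_prod .
    then have "AE z in lborel. (\<Sum>j=1..N. ?H j z) = indicator ?Q z *\<^sub>R (F z \<bullet> G z)"
    proof (rule AE_I')
      show "{z \<in> space lborel. (\<Sum>j=1..N. ?H j z) \<noteq> indicator ?Q z *\<^sub>R (F z \<bullet> G z)} \<subseteq> {0} \<times> UNIV"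
      proof
        fix z assume "z \<in> {z \<in> space lborel. (\<Sum>j=1..N. ?H j z) \<noteq> indicator ?Q z *\<^sub>R (F z \<bullet> G z)}"
        then have "(\<Sum>j=1..N. ?H j z) \<noteq> indicator ?Q z *\<^sub>R (F z \<bullet> G z)" by blast
        then have "fst z = 0" using pt by blast
        then show "z \<in> {0} \<times> UNIV" by (cases z) simp
      qed
    qed
    then show ?thesis by (rule AE_completion)
  qed
  have "inner_L2 ?Q F G = (\<integral>z. indicator ?Q z *\<^sub>R (F z \<bullet> G z) \<partial>lebesgue)"
    unfolding inner_L2_def using Q by (intro integral_restrict_space) auto
  also have "\<dots> = (\<integral>z. (\<Sum>j=1..N. ?H j z) \<partial>lebesgue)"
  proof (rule integral_cong_AE)
    show "(\<lambda>z. indicator ?Q z *\<^sub>R (F z \<bullet> G z)) \<in> borel_measurable lebesgue"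
      by (rule borel_measurable_AE[OF borel_measurable_integrable[OF Hi] ae])
    show "AE z in lebesgue. indicator ?Q z *\<^sub>R (F z \<bullet> G z) = (\<Sum>j=1..N. ?H j z)"
      using ae by eventually_elim (rule sym)
  qed (rule borel_measurable_integrable[OF Hi])
  also have "\<dots> = (\<Sum>j=1..N. \<integral>z. ?H j z \<partial>lebesgue)"
    using slab(1) by (intro Bochner_Integration.integral_sum) auto
  also have "\<dots> = (\<Sum>j=1..N. tau t j * inner_L2 \<Omega> (val t F j) (val t G j))"
    using slab(2) by (intro sum.cong) (auto simp: tau_def inner_L2_def)
  finally show ?thesis .
qed

text \<open>The control-to-state map enters as any selection \<open>S\<close> of solutions.
  Uniqueness of the adjoint is stated almost everywhere and for the indices \<open>1\<close> to
  \<open>N\<close>, which is all that \<open>adjoint_solution\<close> determines.\<close>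

theorem corollary2p5:
  fixes \<Omega> :: "'a::euclidean_space set"
    and T \<epsilon> lam C\<^sub>\<psi> :: real
    and N :: nat and t :: "nat \<Rightarrow> real"
    and A :: "'a \<Rightarrow> real" and A' :: "'a \<Rightarrow> 'a" and A'' :: "'a \<Rightarrow> 'a \<Rightarrow>\<^sub>L 'a"
    and \<psi> \<psi>' \<psi>'' :: "real \<Rightarrow> real"
    and y\<^sub>0 y\<^sub>\<Omega> :: "'a \<Rightarrow> real"
    and S :: "(real \<times> 'a \<Rightarrow> real) \<Rightarrow> (real \<times> 'a \<Rightarrow> real)"
    and u :: "real \<times> 'a \<Rightarrow> real"
  assumes domain: "lipschitz_domain \<Omega>" "bounded \<Omega>"
    and params: "T > 0" "\<epsilon> > 0" "lam > 0"
    and target: "y\<^sub>\<Omega> \<in> L2 \<Omega>"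
    and grid: "time_grid N T t"
    and A_i: "assumption_A_grad A A'"
    and A_ii: "assumption_A_psi \<psi> \<psi>' C\<^sub>\<psi>"
    and A_iii: "y\<^sub>0 \<in> H1 \<Omega>" "integrable (lebesgue_on \<Omega>) (\<lambda>x. \<psi> (y\<^sub>0 x))"
    and A_iv: "C\<^sub>\<psi> > 0 \<Longrightarrow> Max (tau t ` {1..N}) < \<epsilon>\<^sup>2 / C\<^sub>\<psi>"
    and B_A: "assumption_B_hessian A' A''"
    and B_psi: "assumption_B_psi \<Omega> \<psi>' \<psi>''"
    and S: "\<And>w. w \<in> pw_const N t \<Omega> (L2 \<Omega>) \<Longrightarrow> state_solution \<Omega> N t \<epsilon> A' \<psi>' y\<^sub>0 w (S w)"
    and u: "u \<in> pw_const N t \<Omega> (L2 \<Omega>)"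
  shows "\<exists>p. adjoint_solution \<Omega> N t \<epsilon> A'' \<psi>'' y\<^sub>\<Omega> (S u) p \<and>
           (\<forall>p'. adjoint_solution \<Omega> N t \<epsilon> A'' \<psi>'' y\<^sub>\<Omega> (S u) p' \<longrightarrow>
              (\<forall>j\<in>{1..N}. AE x in lebesgue_on \<Omega>. p' j x = p j x)) \<and>
           has_L2_gradient ({0..T} \<times> \<Omega>) (pw_const N t \<Omega> (L2 \<Omega>))
             (reduced_cost \<Omega> N t \<epsilon> lam y\<^sub>\<Omega> S)
             (\<lambda>z. 1 / \<epsilon> * (lam * u z + pw_const_of N t p z)) u"
proof -
  let ?V = "pw_const N t \<Omega> (L2 \<Omega>)"
  let ?Q = "{0..T} \<times> \<Omega>"
  have op: "open \<Omega>" using domain(1) by (simp add: lipschitz_domain_def)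
  obtain C\<^sub>A where C\<^sub>A: "C\<^sub>A > 0" "\<And>p q. (A' p - A' q) \<bullet> (p - q) \<ge> C\<^sub>A * (norm (p - q))\<^sup>2"
    using A_i unfolding assumption_A_grad_def by blast
  obtain M where M: "\<And>p. norm (A'' p) \<le> M"
    using B_A unfolding assumption_B_hessian_def bounded_iff by auto
  obtain q where q: "q > max (real DIM('a) / 2) 1" "nemytskii_H1_Lq_continuous \<Omega> q \<psi>''"
    using B_psi unfolding assumption_B_psi_def by blast
  obtain Kq where Kq: "Kq \<ge> 0" "\<And>v y z. v \<in> Lq q \<Omega> \<Longrightarrow> y \<in> H1 \<Omega> \<Longrightarrow> z \<in> H1 \<Omega> \<Longrightarrow>
      integrable (lebesgue_on \<Omega>) (\<lambda>x. v x * y x * z x) \<and>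
      (\<integral>x. \<bar>v x * y x * z x\<bar> \<partial>lebesgue_on \<Omega>) \<le> Kq * norm_Lq q \<Omega> v * norm_H1 \<Omega> y * norm_H1 \<Omega> z"
    using Lq_multiplier[OF domain q(1)] by blast
  \<comment> \<open>The geometry of the domain has been spent on \<open>Kq\<close>; semiconvexity of
    \<psi> enters through the limit inequality for \<psi>'.\<close>
  interpret semilinear_operator \<Omega> \<epsilon> C\<^sub>\<psi> C\<^sub>A M q Kq A A' A'' \<psi>' \<psi>''
    using A_i B_A B_psi semiconvex_limit[OF A_ii] q(1)
    by unfold_locales
      (simp_all add: assumption_A_grad_def assumption_B_hessian_def assumption_B_psi_def is_C1_with_def op params
        domain(2) C\<^sub>A M q(2) Kq)
  \<comment> \<open>Positive \<open>T\<close> excludes the empty grid, so the final state is the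
    result of a step and not the initial value.\<close>
  have N: "N \<ge> 1" using grid params(1) by (cases "N = 0") (auto simp: time_grid_def)
  have \<tau>: "tau t j > 0 \<and> coercivity (tau t j) > 0" if j: "j \<in> {1..N}" for j
  proof -
    have tp: "tau t j > 0" by (rule time_grid_endpoint(2)[OF grid j])
    have C0: "C\<^sub>\<psi> \<ge> 0" using A_ii by (simp add: assumption_A_psi_def)
    \<comment> \<open>This is the time step restriction rewritten as positivity of the zero order
      coefficient; for vanishing semiconvexity constant it holds for every step size.\<close>
    have "\<epsilon> / tau t j - C\<^sub>\<psi> / \<epsilon> > 0"
    proof (cases "C\<^sub>\<psi> = 0")
      case False
      then have "C\<^sub>\<psi> > 0" using C0 by simp
      moreover have "tau t j \<le> Max (tau t ` {1..N})" using j by (intro Max_ge) auto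
      ultimately have "tau t j < \<epsilon>\<^sup>2 / C\<^sub>\<psi>" using A_iv by simp
      then have "tau t j * C\<^sub>\<psi> < \<epsilon> * \<epsilon>" using \<open>C\<^sub>\<psi> > 0\<close> by (simp add: field_simps power2_eq_square)
      then show ?thesis using tp params(2) by (simp add: field_simps)
    qed (use tp params in simp)
    then show ?thesis using tp params(2) C\<^sub>A(1) by (simp add: coercivity_def)
  qed
  define y where "y w j = (if j = 0 then y\<^sub>0 else val t (S w) j)" for w j
  have traj: "trajectory N (tau t) (val t w) (y w)" if w: "w \<in> ?V" for w
    unfolding trajectory_def
  proof (intro conjI ballI)
    show "y w 0 \<in> L2 \<Omega>" using A_iii(1) by (simp add: y_def H1_L2)
    fix j assume j: "j \<in> {1..N}"
    show "val t w j \<in> L2 \<Omega>" using w j by (simp add: pw_const_def)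
    have eq: "y w (j - 1) = (if j = 1 then y\<^sub>0 else val t (S w) (j - 1))" "y w j = val t (S w) j"
      using j by (auto simp: y_def)
    have "val t (S w) j \<in> H1 \<Omega>" using S[OF w] j by (auto simp: state_solution_def pw_const_def)
    then show "step_solution (val t w j) (y w (j - 1)) (tau t j) (y w j)"
      unfolding step_solution_def eq
      using S[OF w, unfolded state_solution_def, THEN conjunct2, THEN bspec, OF j] by (rule conjI)
  qed
  have yH: "y w j \<in> H1 \<Omega>" if "w \<in> ?V" "j \<in> {1..N}" for w j using trajectory_H1[OF traj] that .
  have yN: "y w N = val t (S w) N" for w using N by (simp add: y_def)
  let ?r = "\<lambda>x. val t (S u) N x - y\<^sub>\<Omega> x"
  have yNL: "val t (S w) N \<in> L2 \<Omega>" if "w \<in> ?V" for w using trajectory_L2[OF traj[OF that], of N] by (simp add: yN)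
  have r: "?r \<in> L2 \<Omega>" using yNL[OF u] target by (rule L2_diff)
  \<comment> \<open>The integrability demanded by \<open>adjoint_solution\<close> holds
    automatically by the multiplier bound, so only the equations remain.\<close>
  have adj: "adjoint_solution \<Omega> N t \<epsilon> A'' \<psi>'' y\<^sub>\<Omega> (S u) p \<longleftrightarrow>
      p (N + 1) = ?r \<and> (\<forall>j\<in>{1..N}. p j \<in> H1 \<Omega> \<and>
        (\<forall>\<phi>\<in>H1 \<Omega>. adj_form (y u j) (tau t j) \<phi> (p j) = \<epsilon> / tau t j * inner_L2 \<Omega> \<phi> (p (j + 1))))" for p
  proof -
    have "y u j = val t (S u) j" if "j \<in> {1..N}" for j using that by (simp add: y_def)
    then show ?thesis unfolding adjoint_solution_def adj_form_def using \<psi>''_integrable yH[OF u] by auto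
  qed
  obtain p where p: "p (N + 1) = ?r" "\<And>j. j \<in> {1..N} \<Longrightarrow> p j \<in> H1 \<Omega>"
    "\<And>j \<phi>. j \<in> {1..N} \<Longrightarrow> \<phi> \<in> H1 \<Omega> \<Longrightarrow> adj_form (y u j) (tau t j) \<phi> (p j) = \<epsilon> / tau t j * inner_L2 \<Omega> \<phi> (p (j + 1))"
    using discrete_adjoint_exists[of N "tau t" "y u", OF \<tau> yH[OF u] r] by blast
  have p_adj: "adjoint_solution \<Omega> N t \<epsilon> A'' \<psi>'' y\<^sub>\<Omega> (S u) p" unfolding adj using p by blast
  have uniq: "AE x in lebesgue_on \<Omega>. p' j x = p j x"
    if "adjoint_solution \<Omega> N t \<epsilon> A'' \<psi>'' y\<^sub>\<Omega> (S u) p'" "j \<in> {1..N}" for p' j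
    using that unfolding adj by (intro discrete_adjoint_unique[where N = N and \<tau> = "tau t" and y = "y u", OF \<tau> yH[OF u] r p]) auto
  let ?g = "\<lambda>z. 1 / \<epsilon> * (lam * u z + pw_const_of N t p z)"
  let ?J = "reduced_cost \<Omega> N t \<epsilon> lam y\<^sub>\<Omega> S"
  have pL: "p j \<in> L2 \<Omega>" if "j \<in> {1..N}" for j using p(2)[OF that] by (rule H1_L2)
  have gV: "?g \<in> ?V"
    by (intro pw_const_mult_left pw_const_add u pw_const_of_mem[OF grid] pL)
  have vL: "val t v j \<in> L2 \<Omega>" if "v \<in> ?V" "j \<in> {1..N}" for v j using that by (simp add: pw_const_def)
  have val_g: "val t ?g j = (\<lambda>x. 1 / \<epsilon> * (lam * val t u j x + p j x))" if "j \<in> {1..N}" for j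
    unfolding val_mult_left val_add val_pw_const_of[OF grid that] ..
  note inner_Q = inner_L2_pw_const[OF op grid]
  have normQ: "(norm_L2 ?Q v)\<^sup>2 = (\<Sum>j=1..N. tau t j * (norm_L2 \<Omega> (val t v j))\<^sup>2)" if "v \<in> ?V" for v
    unfolding norm_L2_power2 by (rule inner_Q[OF that that])
  have inner_g: "inner_L2 ?Q ?g v = (\<Sum>j=1..N. tau t j * (1 / \<epsilon> * (lam * inner_L2 \<Omega> (val t u j) (val t v j) + inner_L2 \<Omega> (val t v j) (p j))))"
    if v: "v \<in> ?V" for v
    unfolding inner_Q[OF gV v]
  proof (rule sum.cong[OF refl])
    fix j assume j: "j \<in> {1..N}"
    have "inner_L2 \<Omega> (val t ?g j) (val t v j) = 1 / \<epsilon> * (lam * inner_L2 \<Omega> (val t u j) (val t v j) + inner_L2 \<Omega> (p j) (val t v j))"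
      unfolding val_g[OF j] inner_L2_mult_left
      by (subst inner_L2_add_left) (auto intro!: L2_mult_left vL u v pL j simp: inner_L2_mult_left)
    then show "tau t j * inner_L2 \<Omega> (val t ?g j) (val t v j)
      = tau t j * (1 / \<epsilon> * (lam * inner_L2 \<Omega> (val t u j) (val t v j) + inner_L2 \<Omega> (val t v j) (p j)))"
      by (simp add: inner_L2_commute[of \<Omega> "p j" "val t v j"])
  qed
  \<comment> \<open>A single time slice costs \<open>1 / sqrt (tau t j)\<close> in terms of the norm
    on \<open>Q\<close>; the sum over \<open>j\<close> dominates all these factors at once.\<close>
  define k where "k = (\<Sum>j=1..N. 1 / sqrt (tau t j))"
  have k: "k \<ge> 0" unfolding k_def using \<tau> by (intro sum_nonneg) (simp add: less_imp_le)
  have val_le: "norm_L2 \<Omega> (val t v j) \<le> k * norm_L2 ?Q v" if v: "v \<in> ?V" and j: "j \<in> {1..N}" for v j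
  proof -
    have tp: "tau t j > 0" using \<tau>[OF j] by simp
    have "tau t j * (norm_L2 \<Omega> (val t v j))\<^sup>2 \<le> (norm_L2 ?Q v)\<^sup>2"
      unfolding normQ[OF v]
    proof (rule member_le_sum)
      show "0 \<le> tau t i * (norm_L2 \<Omega> (val t v i))\<^sup>2" if "i \<in> {1..N} - {j}" for i
        using \<tau>[of i] that by (simp add: less_imp_le)
    qed (use j in auto)
    then have "sqrt (tau t j * (norm_L2 \<Omega> (val t v j))\<^sup>2) \<le> sqrt ((norm_L2 ?Q v)\<^sup>2)" by (rule real_sqrt_le_mono)
    then have "sqrt (tau t j) * norm_L2 \<Omega> (val t v j) \<le> norm_L2 ?Q v" by (simp add: real_sqrt_mult)
    then have "norm_L2 \<Omega> (val t v j) \<le> 1 / sqrt (tau t j) * norm_L2 ?Q v" using tp by (simp add: field_simps)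
    also have "\<dots> \<le> k * norm_L2 ?Q v"
      unfolding k_def using \<tau> j
      by (intro mult_right_mono member_le_sum[of j "{1..N}" "\<lambda>j. 1 / sqrt (tau t j)"]) (auto intro!: less_imp_le)
    finally show ?thesis .
  qed
  have grad: "has_L2_gradient ?Q ?V ?J ?g u"
    unfolding has_L2_gradient_def has_L2_frechet_derivative_def
  proof (intro conjI gV ballI allI impI)
    show "inner_L2 ?Q ?g (\<lambda>z. v z + w z) = inner_L2 ?Q ?g v + inner_L2 ?Q ?g w" if v: "v \<in> ?V" and w: "w \<in> ?V" for v w
      unfolding inner_Q[OF gV pw_const_add[OF v w]] inner_Q[OF gV v] inner_Q[OF gV w] sum.distrib[symmetric]
    proof (rule sum.cong[OF refl])
      fix j assume j: "j \<in> {1..N}"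
      show "tau t j * inner_L2 \<Omega> (val t ?g j) (val t (\<lambda>z. v z + w z) j)
        = tau t j * inner_L2 \<Omega> (val t ?g j) (val t v j) + tau t j * inner_L2 \<Omega> (val t ?g j) (val t w j)"
        unfolding val_add[of t v w] using vL[OF gV j] vL[OF v j] vL[OF w j] by (simp add: inner_L2_add_right distrib_left)
    qed
    show "inner_L2 ?Q ?g (\<lambda>z. c * v z) = c * inner_L2 ?Q ?g v" for c v by (rule inner_L2_mult_right)
    show "\<exists>K. \<forall>v\<in>?V. \<bar>inner_L2 ?Q ?g v\<bar> \<le> K * norm_L2 ?Q v"
    proof (intro exI ballI)
      fix v assume v: "v \<in> ?V"
      have "\<bar>inner_L2 ?Q ?g v\<bar> \<le> (\<Sum>j=1..N. \<bar>tau t j * inner_L2 \<Omega> (val t ?g j) (val t v j)\<bar>)"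
        unfolding inner_Q[OF gV v] by (rule sum_abs)
      also have "\<dots> \<le> (\<Sum>j=1..N. tau t j * norm_L2 \<Omega> (val t ?g j) * k * norm_L2 ?Q v)"
      proof (rule sum_mono)
        fix j assume j: "j \<in> {1..N}"
        have "\<bar>inner_L2 \<Omega> (val t ?g j) (val t v j)\<bar> \<le> norm_L2 \<Omega> (val t ?g j) * norm_L2 \<Omega> (val t v j)"
          by (intro abs_inner_L2_le vL gV v j)
        also have "\<dots> \<le> norm_L2 \<Omega> (val t ?g j) * (k * norm_L2 ?Q v)" by (intro mult_left_mono val_le v j) simp
        finally have "tau t j * \<bar>inner_L2 \<Omega> (val t ?g j) (val t v j)\<bar> \<le> tau t j * (norm_L2 \<Omega> (val t ?g j) * (k * norm_L2 ?Q v))"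
          using \<tau>[OF j] by (intro mult_left_mono) auto
        then show "\<bar>tau t j * inner_L2 \<Omega> (val t ?g j) (val t v j)\<bar> \<le> tau t j * norm_L2 \<Omega> (val t ?g j) * k * norm_L2 ?Q v"
          using \<tau>[OF j] by (simp add: abs_mult mult.assoc)
      qed
      finally show "\<bar>inner_L2 ?Q ?g v\<bar> \<le> (\<Sum>j=1..N. tau t j * norm_L2 \<Omega> (val t ?g j) * k) * norm_L2 ?Q v"
        by (simp only: sum_distrib_right)
    qed
    fix e :: real assume e: "e > 0"
    \<comment> \<open>The duality error is divided by \<open>\<epsilon>\<close> and measured in
      \<open>D = k * norm_L2 ?Q v\<close>; this choice lets it use up half of
      \<open>e\<close>.\<close>
    define e1 where "e1 = \<epsilon> * e / (2 * (k + 1))"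
    have e1: "e1 > 0" "1 / \<epsilon> * (e1 * k) \<le> e / 2"
    proof -
      show "e1 > 0" using e k params(2) by (simp add: e1_def)
      have "1 / \<epsilon> * (e1 * k) = e / 2 * (k / (k + 1))" using params(2) k by (simp add: e1_def)
      also have "\<dots> \<le> e / 2 * 1" using k e by (intro mult_left_mono) auto
      finally show "1 / \<epsilon> * (e1 * k) \<le> e / 2" by simp
    qed
    have pN: "p (N + 1) \<in> L2 \<Omega>" using p(1) r by simp
    obtain \<eta> where \<eta>: "\<eta> > 0" "\<And>u' y' D. trajectory N (tau t) u' y' \<Longrightarrow> y' 0 = y u 0 \<Longrightarrow>
      (\<forall>j\<in>{1..N}. norm_L2 \<Omega> (\<lambda>x. u' j x - val t u j x) \<le> D) \<Longrightarrow> D \<ge> 0 \<Longrightarrow> D < \<eta> \<Longrightarrow>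
      \<bar>(\<Sum>j=1..N. tau t j * inner_L2 \<Omega> (\<lambda>x. u' j x - val t u j x) (p j)) - \<epsilon> * inner_L2 \<Omega> (\<lambda>x. y' N x - y u N x) (p (N + 1))\<bar> \<le> e1 * D"
      using discrete_duality[where N = N and \<tau> = "tau t", OF \<tau> traj[OF u] p(2) pN p(3) e1(1)] by auto
    obtain L where L: "L \<ge> 0" "\<And>u' y' D j. trajectory N (tau t) u' y' \<Longrightarrow> y' 0 = y u 0 \<Longrightarrow>
      (\<forall>j\<in>{1..N}. norm_L2 \<Omega> (\<lambda>x. u' j x - val t u j x) \<le> D) \<Longrightarrow> D \<ge> 0 \<Longrightarrow> j \<in> {1..N} \<Longrightarrow>
      norm_H1 \<Omega> (\<lambda>x. y' j x - y u j x) \<le> L * D" using trajectory_lipschitz[where N = N and \<tau> = "tau t", OF \<tau> traj[OF u]] by auto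
    \<comment> \<open>The coefficient of the second order part of the cost: the final state differs
      by at most \<open>L * k\<close> times the size of \<open>v\<close>, and the control term is
      exactly quadratic.\<close>
    define c where "c = 1 / 2 * (L * k)\<^sup>2 + lam / (2 * \<epsilon>)"
    have c: "c \<ge> 0" using params by (simp add: c_def)
    \<comment> \<open>The first bound makes the duality estimate applicable, the second keeps the
      quadratic part below the other half of \<open>e\<close>.\<close>
    define \<delta> where "\<delta> = min (\<eta> / (k + 1)) (e / (2 * (c + 1)))"
    show "\<exists>\<delta>>0. \<forall>v\<in>?V. norm_L2 ?Q v < \<delta> \<longrightarrow> \<bar>?J (\<lambda>z. u z + v z) - ?J u - inner_L2 ?Q ?g v\<bar> \<le> e * norm_L2 ?Q v"
    proof (intro exI[of _ \<delta>] conjI ballI impI)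
      show "\<delta> > 0" using \<eta>(1) k c e by (simp add: \<delta>_def)
      fix v assume v: "v \<in> ?V" and small: "norm_L2 ?Q v < \<delta>"
      let ?w = "\<lambda>z. u z + v z"
      let ?n = "norm_L2 ?Q v"
      have w: "?w \<in> ?V" using u v by (rule pw_const_add)
      have dv: "(\<lambda>x. val t ?w j x - val t u j x) = val t v j" for j by (simp add: val_add)
      define D where "D = k * ?n"
      have D: "D \<ge> 0" using k by (simp add: D_def)
      have D\<eta>: "D < \<eta>"
      proof -
        have "(k + 1) * ?n < \<eta>" using small k by (simp add: \<delta>_def field_simps)
        moreover have "D \<le> (k + 1) * ?n" by (simp add: D_def distrib_right)
        ultimately show ?thesis by simp
      qed
      have y0: "y ?w 0 = y u 0" by (simp add: y_def)
      have ctrl: "\<forall>j\<in>{1..N}. norm_L2 \<Omega> (\<lambda>x. val t ?w j x - val t u j x) \<le> D"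
        unfolding dv D_def using val_le[OF v] by blast
      let ?d = "\<lambda>x. val t (S ?w) N x - val t (S u) N x"
      have dL: "?d \<in> L2 \<Omega>" using yNL[OF w] yNL[OF u] by (rule L2_diff)
      have dual: "\<bar>(\<Sum>j=1..N. tau t j * inner_L2 \<Omega> (val t v j) (p j)) - \<epsilon> * inner_L2 \<Omega> ?d ?r\<bar> \<le> e1 * D"
        using \<eta>(2)[OF traj[OF w] y0 ctrl D D\<eta>] unfolding dv yN p(1) .
      have dn: "norm_L2 \<Omega> ?d \<le> L * D"
        using order_trans[OF norm_L2_le_H1[OF op] L(2)[OF traj[OF w] y0 ctrl D, of N]] N unfolding yN by simp
      have J1: "(norm_L2 \<Omega> (\<lambda>x. val t (S ?w) N x - y\<^sub>\<Omega> x))\<^sup>2 = (norm_L2 \<Omega> ?r)\<^sup>2 + 2 * inner_L2 \<Omega> ?d ?r + (norm_L2 \<Omega> ?d)\<^sup>2"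
      proof -
        have "(\<lambda>x. val t (S ?w) N x - y\<^sub>\<Omega> x) = (\<lambda>x. ?r x + ?d x)" by auto
        then show ?thesis using r dL
          by (simp only: norm_L2_power2 inner_L2_add_left inner_L2_add_right L2_add) (simp add: inner_L2_commute[of \<Omega> ?r ?d])
      qed
      have J2: "(\<Sum>j=1..N. tau t j * (norm_L2 \<Omega> (val t ?w j))\<^sup>2)
          = (\<Sum>j=1..N. tau t j * (norm_L2 \<Omega> (val t u j))\<^sup>2) + 2 * (\<Sum>j=1..N. tau t j * inner_L2 \<Omega> (val t u j) (val t v j)) + ?n\<^sup>2"
        unfolding normQ[OF v] sum_distrib_left sum.distrib[symmetric]
      proof (rule sum.cong[OF refl])
        fix j assume j: "j \<in> {1..N}"
        have "(norm_L2 \<Omega> (val t ?w j))\<^sup>2 = (norm_L2 \<Omega> (val t u j))\<^sup>2 + 2 * inner_L2 \<Omega> (val t u j) (val t v j) + (norm_L2 \<Omega> (val t v j))\<^sup>2"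
          unfolding val_add[of t u v] norm_L2_power2 using vL[OF u j] vL[OF v j]
          by (simp add: inner_L2_add_left inner_L2_add_right L2_add inner_L2_commute[of \<Omega> "val t v j" "val t u j"])
        then show "tau t j * (norm_L2 \<Omega> (val t ?w j))\<^sup>2 = tau t j * (norm_L2 \<Omega> (val t u j))\<^sup>2
            + 2 * (tau t j * inner_L2 \<Omega> (val t u j) (val t v j)) + tau t j * (norm_L2 \<Omega> (val t v j))\<^sup>2"
          by (simp add: algebra_simps)
      qed
      define X where "X = (\<Sum>j=1..N. tau t j * inner_L2 \<Omega> (val t u j) (val t v j))"
      define Y where "Y = (\<Sum>j=1..N. tau t j * inner_L2 \<Omega> (val t v j) (p j))"
      have gv: "inner_L2 ?Q ?g v = lam / \<epsilon> * X + 1 / \<epsilon> * Y"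
        unfolding inner_g[OF v] X_def Y_def sum_distrib_left sum.distrib[symmetric]
        by (rule sum.cong[OF refl]) (simp add: algebra_simps)
      have "?J ?w - ?J u = inner_L2 \<Omega> ?d ?r + 1 / 2 * (norm_L2 \<Omega> ?d)\<^sup>2 + lam / (2 * \<epsilon>) * (2 * X + ?n\<^sup>2)"
        unfolding reduced_cost_def J1 J2 X_def by (simp add: algebra_simps)
      also have "lam / (2 * \<epsilon>) * (2 * X + ?n\<^sup>2) = lam / \<epsilon> * X + lam / (2 * \<epsilon>) * ?n\<^sup>2"
        using params(2) by (simp add: field_simps)
      finally have J: "?J ?w - ?J u
          = inner_L2 \<Omega> ?d ?r + 1 / 2 * (norm_L2 \<Omega> ?d)\<^sup>2 + (lam / \<epsilon> * X + lam / (2 * \<epsilon>) * ?n\<^sup>2)" .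
      \<comment> \<open>The terminal term is the only place where the state enters. Duality replaces
        its pairing with the residual by \<open>Y / \<epsilon>\<close>, which is the origin of the
        factor in front of the adjoint in the gradient.\<close>
      have "- (1 / \<epsilon>) * (Y - \<epsilon> * inner_L2 \<Omega> ?d ?r) = inner_L2 \<Omega> ?d ?r - 1 / \<epsilon> * Y"
        using params(2) by (simp add: field_simps)
      then have "?J ?w - ?J u - inner_L2 ?Q ?g v
          = - (1 / \<epsilon>) * (Y - \<epsilon> * inner_L2 \<Omega> ?d ?r) + (1 / 2 * (norm_L2 \<Omega> ?d)\<^sup>2 + lam / (2 * \<epsilon>) * ?n\<^sup>2)"
        unfolding gv J by linarith
      then have "\<bar>?J ?w - ?J u - inner_L2 ?Q ?g v\<bar>
          \<le> \<bar>- (1 / \<epsilon>) * (Y - \<epsilon> * inner_L2 \<Omega> ?d ?r)\<bar> + \<bar>1 / 2 * (norm_L2 \<Omega> ?d)\<^sup>2 + lam / (2 * \<epsilon>) * ?n\<^sup>2\<bar>"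
        by (simp only: abs_triangle_ineq)
      also have "\<bar>- (1 / \<epsilon>) * (Y - \<epsilon> * inner_L2 \<Omega> ?d ?r)\<bar> = 1 / \<epsilon> * \<bar>Y - \<epsilon> * inner_L2 \<Omega> ?d ?r\<bar>"
        using params(2) by (simp add: abs_mult)
      also have "\<dots> \<le> 1 / \<epsilon> * (e1 * D)" using dual params(2) unfolding Y_def by (intro mult_left_mono) auto
      also have "\<dots> = (1 / \<epsilon> * (e1 * k)) * ?n" by (simp add: D_def)
      also have "\<dots> \<le> e / 2 * ?n" using e1(2) by (intro mult_right_mono) auto
      also have "\<bar>1 / 2 * (norm_L2 \<Omega> ?d)\<^sup>2 + lam / (2 * \<epsilon>) * ?n\<^sup>2\<bar> = 1 / 2 * (norm_L2 \<Omega> ?d)\<^sup>2 + lam / (2 * \<epsilon>) * ?n\<^sup>2"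
        using params by (intro abs_of_nonneg add_nonneg_nonneg mult_nonneg_nonneg) auto
      also have "\<dots> \<le> 1 / 2 * (L * D)\<^sup>2 + lam / (2 * \<epsilon>) * ?n\<^sup>2"
        using dn by (intro add_right_mono mult_left_mono power_mono) auto
      also have "\<dots> = c * ?n * ?n" by (simp add: c_def D_def power2_eq_square algebra_simps)
      also have "\<dots> \<le> e / 2 * ?n"
      proof (intro mult_right_mono)
        have "(c + 1) * ?n < e / 2" using small c by (simp add: \<delta>_def field_simps)
        moreover have "c * ?n \<le> (c + 1) * ?n" by (intro mult_right_mono) auto
        ultimately show "c * ?n \<le> e / 2" by simp
      qed simp
      finally show "\<bar>?J ?w - ?J u - inner_L2 ?Q ?g v\<bar> \<le> e * ?n" by (simp add: field_simps)
    qed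
  qed
  show ?thesis using p_adj uniq grad by blast
qed

end
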